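(* Let $K$ be a field, let $n$ be an integer with $2n \ge 4$, and let $\Omega_1, \Omega_2$ be cyclic, strictly hyperbolic conjugacy classes of $\mathrm{Sp}(2n, K)$. Write $\Omega_1\Omega_2 = \{M_1M_2 : M_1\in\Omega_1, M_2\in\Omega_2\}$. (1) If $K = \mathrm{GF}(3)$, or $2n \ge 6$, or both $\Omega_1$ and $\Omega_2$ are triangularizable, then $\Omega_1 \Omega_2$ contains all nonscalar elements of $\mathrm{Sp}(2n, K)$. (2) If $2n = 4$, then $\Omega_1 \Omega_2$ contains all elements $M$ of $\mathrm{Sp}(2n, K)$ with $M^2 \ne \mathrm{I}_4$.
   Context: $\mathrm{Sp}(2n,K)$ is the group of all $P\in \mathrm{GL}(2n,K)$ with $PGP' = G$, where $P'$ is the transpose of $P$ and $G = \begin{pmatrix} 0 & \mathrm{I}_n\\ -\mathrm{I}_n & 0\end{pmatrix}$. A matrix is cyclic if its minimal polynomial equals its characteristic polynomial; a conjugacy class is cyclic if its elements are. A conjugacy class of $\mathrm{Sp}(2n,K)$ is called strictly hyperbolic if the minimal polynomial of its elements is of the form $q(x)q^*(x)$, where $q\in K[x]$ is a monic polynomial with $q(0)\neq 0$ that is prime to its reciprocal $q^*(x) = q(0)^{-1}x^{\deg q}q(x^{-1})$. A class is triangularizable if its elements are similar over $K$ to a triangular matrix (i.e. their characteristic polynomial splits over $K$). *)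

theory Defs
  imports "Jordan_Normal_Form.Char_Poly"
begin

section \<open>Minimal polynomials and cyclic matrices\<close>

definition poly_mat :: "'a::comm_ring_1 poly \<Rightarrow> 'a mat \<Rightarrow> 'a mat" where
  "poly_mat p A = mat (dim_row A) (dim_row A)
     (\<lambda>(i, j). \<Sum>k\<le>degree p. coeff p k * (A ^\<^sub>m k) $$ (i, j))"

definition is_min_poly :: "'a::field mat \<Rightarrow> 'a poly \<Rightarrow> bool" where
  "is_min_poly A p \<longleftrightarrow>
     lead_coeff p = 1 \<and> poly_mat p A = 0\<^sub>m (dim_row A) (dim_row A) \<and>
     (\<forall>r. r \<noteq> 0 \<longrightarrow> poly_mat r A = 0\<^sub>m (dim_row A) (dim_row A) \<longrightarrow> degree p \<le> degree r)"

definition min_poly :: "'a::field mat \<Rightarrow> 'a poly" where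
  "min_poly A = (THE p. is_min_poly A p)"

lemma poly_mat_eq_0_iff:
  assumes "degree p \<le> N"
  shows "poly_mat p A = 0\<^sub>m (dim_row A) (dim_row A) \<longleftrightarrow>
    (\<forall>i<dim_row A. \<forall>j<dim_row A. (\<Sum>k\<le>N. coeff p k * (A ^\<^sub>m k) $$ (i, j)) = 0)"
proof -
  have "(\<Sum>k\<le>degree p. coeff p k * (A ^\<^sub>m k) $$ (i, j)) =
        (\<Sum>k\<le>N. coeff p k * (A ^\<^sub>m k) $$ (i, j))" for i j
    by (rule sum.mono_neutral_left) (use assms in \<open>auto simp: coeff_eq_0\<close>)
  then show ?thesis by (auto simp: poly_mat_def mat_eq_iff)
qed

lemma annihilating_poly_exists:
  fixes A :: "'a::field mat"
  shows "\<exists>p. p \<noteq> 0 \<and> poly_mat p A = 0\<^sub>m (dim_row A) (dim_row A)"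
proof -
  define n where "n = dim_row A"
  define N where "N = n * n"
  define B where "B = mat (Suc N) (Suc N)
    (\<lambda>(r, k). if r = N then 0 else (A ^\<^sub>m k) $$ (r div n, r mod n))"
  have B: "B \<in> carrier_mat (Suc N) (Suc N)" by (simp add: B_def)
  have "B = mat\<^sub>r (Suc N) (Suc N) (\<lambda>r. if r = N then 0\<^sub>v (Suc N) else row B r)"
    by (rule eq_matI) (auto simp: B_def)
  moreover have "row B \<in> {0..<Suc N} \<rightarrow> carrier_vec (Suc N)"
    using B by auto
  ultimately have "det B = 0" by (metis det_row_0 lessI)
  then obtain v where v: "v \<in> carrier_vec (Suc N)" "v \<noteq> 0\<^sub>v (Suc N)"
      "B *\<^sub>v v = 0\<^sub>v (Suc N)"
    using det_0_iff_vec_prod_zero_field[OF B] by blast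
  define p where "p = (\<Sum>k\<le>N. monom (v $ k) k)"
  have c: "coeff p k = (if k \<le> N then v $ k else 0)" for k
    by (simp add: p_def coeff_sum)
  have "p \<noteq> 0"
  proof
    assume "p = 0"
    then have "v $ k = 0" if "k \<le> N" for k using c[of k] that by simp
    then show False using v by (auto simp: less_Suc_eq_le)
  qed
  moreover have "degree p \<le> N" by (rule degree_le) (simp add: c)
  moreover have "(\<Sum>k\<le>N. coeff p k * (A ^\<^sub>m k) $$ (i, j)) = 0" if ij: "i < n" "j < n" for i j
  proof -
    let ?r = "i * n + j"
    have "?r < Suc i * n" using ij by simp
    also have "\<dots> \<le> N" unfolding N_def using ij by (intro mult_right_mono) auto
    finally have r: "?r < N" .
    have "(B *\<^sub>v v) $ ?r = (\<Sum>k\<le>N. (A ^\<^sub>m k) $$ (i, j) * v $ k)"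
      using r v(1) ij by (auto simp: B_def scalar_prod_def atLeast0LessThan
          lessThan_Suc_atMost intro!: sum.cong)
    then show ?thesis using v r by (simp add: c mult.commute)
  qed
  ultimately show ?thesis using poly_mat_eq_0_iff[of p N A] by (auto simp: n_def)
qed

lemma is_min_poly_min_poly: "is_min_poly A (min_poly A)"
proof -
  let ?Z = "\<lambda>p. poly_mat p A = 0\<^sub>m (dim_row A) (dim_row A)"
  have smult: "?Z (Polynomial.smult c p)" if "?Z p" for c p
  proof -
    have "(\<Sum>k\<le>degree p. c * coeff p k * (A ^\<^sub>m k) $$ (i, j)) = 0"
      if "i < dim_row A" "j < dim_row A" for i j
      using \<open>?Z p\<close> that poly_mat_eq_0_iff[of p "degree p" A]
      by (simp add: mult.assoc flip: sum_distrib_left)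
    then show ?thesis by (simp add: poly_mat_eq_0_iff[of _ "degree p"] degree_smult_le)
  qed
  have diff: "?Z (p - q)" if "?Z p" "?Z q" for p q
    using that
    by (simp add: poly_mat_eq_0_iff[of _ "max (degree p) (degree q)"] degree_diff_le_max
        left_diff_distrib sum_subtractf)
  define d where "d = (LEAST d. \<exists>p. p \<noteq> 0 \<and> ?Z p \<and> degree p = d)"
  have "\<exists>d p. p \<noteq> 0 \<and> ?Z p \<and> degree p = d"
    using annihilating_poly_exists[of A] by blast
  then have "\<exists>p. p \<noteq> 0 \<and> ?Z p \<and> degree p = d" unfolding d_def by (rule LeastI_ex)
  then obtain p where p: "p \<noteq> 0" "?Z p" "degree p = d" by blast
  have le: "d \<le> degree r" if "r \<noteq> 0" "?Z r" for r
    unfolding d_def using that by (intro Least_le) blast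
  have "is_min_poly A (Polynomial.smult (inverse (lead_coeff p)) p)"
    using p le smult leading_coeff_neq_0[of p] unfolding is_min_poly_def by auto
  moreover have "q = r" if "is_min_poly A q" "is_min_poly A r" for q r
  proof (rule ccontr)
    assume "q \<noteq> r"
    have deg: "degree q = degree r"
      using that unfolding is_min_poly_def by (metis leading_coeff_0_iff order_antisym zero_neq_one)
    have "?Z (q - r)" using that by (intro diff) (simp_all add: is_min_poly_def)
    then have "degree q \<le> degree (q - r)"
      using that \<open>q \<noteq> r\<close> unfolding is_min_poly_def by simp
    moreover have "degree (q - r) \<le> degree q" using deg by (simp add: degree_diff_le)
    ultimately have "lead_coeff (q - r) = 0"
      using that deg by (simp add: is_min_poly_def)
    with \<open>q \<noteq> r\<close> show False
      by (metis leading_coeff_0_iff right_minus_eq)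
  qed
  ultimately show ?thesis unfolding min_poly_def by (blast intro: theI2)
qed

definition cyclic_mat :: "'a::field mat \<Rightarrow> bool" where
  "cyclic_mat A \<longleftrightarrow> min_poly A = char_poly A"

section \<open>The symplectic group and its conjugacy classes\<close>

definition symplectic_form :: "nat \<Rightarrow> 'a::field mat" where
  "symplectic_form n =
     four_block_mat (0\<^sub>m n n) (1\<^sub>m n) (- 1\<^sub>m n) (0\<^sub>m n n)"

text \<open>The parameter is half the dimension: \<open>Sp n\<close> consists of \<open>2n \<times> 2n\<close> matrices.\<close>

definition Sp :: "nat \<Rightarrow> 'a::field mat set" where
  "Sp n = {P \<in> carrier_mat (2 * n) (2 * n). invertible_mat P \<and>
     P * symplectic_form n * transpose_mat P = symplectic_form n}"

text \<open>\<open>similar_mat_wit N M P Q\<close> says that \<open>N = P * M * Q\<close> with \<open>Q\<close> the inverse of \<open>P\<close>;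
  the conjugating matrix \<open>P\<close> is required to be symplectic.\<close>

definition Sp_conj_class :: "nat \<Rightarrow> 'a::field mat \<Rightarrow> 'a mat set" where
  "Sp_conj_class n M = {N. \<exists>P\<in>Sp n. \<exists>Q. similar_mat_wit N M P Q}"

definition is_Sp_conj_class :: "nat \<Rightarrow> 'a::field mat set \<Rightarrow> bool" where
  "is_Sp_conj_class n \<Omega> \<longleftrightarrow> (\<exists>M\<in>Sp n. \<Omega> = Sp_conj_class n M)"

definition cyclic_class :: "'a::field mat set \<Rightarrow> bool" where
  "cyclic_class \<Omega> \<longleftrightarrow> (\<forall>M\<in>\<Omega>. cyclic_mat M)"

text \<open>For \<open>q(0) \<noteq> 0\<close>, \<open>reflect_poly q\<close> is \<open>x ^ degree q * q(1/x)\<close>.\<close>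

definition reciprocal_poly :: "'a::field poly \<Rightarrow> 'a poly" where
  "reciprocal_poly q = Polynomial.smult (inverse (poly q 0)) (reflect_poly q)"

definition strictly_hyperbolic_class :: "'a::field mat set \<Rightarrow> bool" where
  "strictly_hyperbolic_class \<Omega> \<longleftrightarrow>
     (\<exists>q. lead_coeff q = 1 \<and> poly q 0 \<noteq> 0 \<and> coprime q (reciprocal_poly q) \<and>
        (\<forall>M\<in>\<Omega>. min_poly M = q * reciprocal_poly q))"

definition triangularizable_class :: "'a::field mat set \<Rightarrow> bool" where
  "triangularizable_class \<Omega> \<longleftrightarrow>
     (\<forall>M\<in>\<Omega>. \<exists>T. (upper_triangular T \<or> upper_triangular (transpose_mat T)) \<and> similar_mat M T)"

definition scalar_mat :: "nat \<Rightarrow> 'a::field mat \<Rightarrow> bool" where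
  "scalar_mat m M \<longleftrightarrow> (\<exists>c. M = c \<cdot>\<^sub>m 1\<^sub>m m)"

definition class_product :: "'a::field mat set \<Rightarrow> 'a mat set \<Rightarrow> 'a mat set" where
  "class_product \<Omega>\<^sub>1 \<Omega>\<^sub>2 = {M\<^sub>1 * M\<^sub>2 | M\<^sub>1 M\<^sub>2. M\<^sub>1 \<in> \<Omega>\<^sub>1 \<and> M\<^sub>2 \<in> \<Omega>\<^sub>2}"

end

theory Submission
  imports Defs
begin

text \<open>
  Let \<open>q, q'\<close> be the polynomials of the two classes and \<open>\<omega>\<close> the symplectic form. If a symplectic
  basis turns \<open>M\<close> into \<open>(A, B; C, D)\<close> with \<open>A = X Y\<close>, where \<open>X\<close> and \<open>Y\<close> are cyclic
  with polynomials \<open>q\<close> and \<open>q'\<close>, then a block LU factorization writes \<open>M\<close> as a product of two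
  cyclic symplectic matrices with polynomials \<open>q q\<^sup>*\<close> and \<open>q' q'\<^sup>*\<close>; a cyclic strictly hyperbolic
  matrix is determined by its polynomial up to symplectic conjugacy, so the factors lie in the classes.

  The basis may be changed by adding \<open>S C\<close> to \<open>A\<close> for symmetric \<open>S\<close> and by congruences of \<open>C\<close>.
  Moreover every \<open>A\<close> of determinant \<open>q(0) q'(0)\<close> becomes such a product \<open>X Y\<close> after multiplication
  with some \<open>(I, F; 0, I)\<close>. This settles the case that \<open>C\<close> is singular but nonzero, and the case that \<open>C\<close> is
  triangular and invertible if the field has an element \<open>x\<close> with \<open>x \<noteq> 0, \<delta>\<close> and \<open>x\<^sup>2 \<noteq> \<delta> = q(0) q'(0)\<close>.

  The corner \<open>C\<close> is the Gram matrix of \<open>c(x, y) = \<omega>(x, M y)\<close> on a Lagrangian subspace. If \<open>c\<close> is not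
  alternating, an isotropic vector in a suitable complement produces a singular \<open>C\<close>, and otherwise
  orthogonalization produces a triangular one. If \<open>c\<close> is alternating, \<open>M\<close> is an involution with an eigenvector
  that yields a singular \<open>C\<close> as soon as \<open>n \<ge> 3\<close>. What remains are \<open>2 \<times> 2\<close> corners over \<open>GF(3)\<close>
  or with split polynomials, where \<open>X\<close> and \<open>Y\<close> are written down.
\<close>

section \<open>Polynomials in a matrix\<close>

text \<open>Since det X and det Y are q(0) and q'(0) up to the same sign, det A = delta is forced,
  and the corner must leave room to reach it. If C is singular and nonzero, A is fixed on ker C, but
  its determinant can be rescaled outside, and adding A F, where F maps a complement into ker C,
  keeps A^T C symmetric because C F = 0. These F are exactly those that the factorization X Y asks
  for. If C is invertible, A runs through S C and the factor 1 + F has to be absorbed by a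
  conjugation instead; this needs an eigenvalue of A different from all others. The diagonal
  (delta/x, x, 1, ..., 1) has determinant delta, and the conditions on x say that delta/x is neither
  x nor 1. Without such an x every nonzero element of K has square 1, and for n = 2 strict
  hyperbolicity then leaves only GF(3). An invertible alternating 2 x 2 corner admits only A of
  trace 0, so X Y must have trace 0. This is the obstruction behind the hypotheses for 2n = 4: roots
  in K allow triangular X and Y, and over GF(3) the possible polynomials can be listed.\<close>

lemma mult_carrier_square [simp]:
  "A \<in> carrier_mat n n \<Longrightarrow> B \<in> carrier_mat n n \<Longrightarrow> A * B \<in> carrier_mat n n"
  by (rule mult_carrier_mat)

lemma mult_cancel_inverse:
  fixes A B X :: "'a::field mat"
  assumes "A \<in> carrier_mat n n" "B \<in> carrier_mat n n" "X \<in> carrier_mat n k" "B * A = 1\<^sub>m n"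
  shows "B * (A * X) = X"
  using assms assoc_mult_mat[OF assms(2,1,3)] left_mult_one_mat[OF assms(3)] by simp


lemma pow_mat_Suc_left:
  assumes "A \<in> carrier_mat n n"
  shows "A ^\<^sub>m Suc k = A * A ^\<^sub>m k"
proof (induction k)
  case 0
  then show ?case using assms by simp
next
  case (Suc k)
  have "A ^\<^sub>m Suc (Suc k) = (A * A ^\<^sub>m k) * A" using Suc by simp
  also have "\<dots> = A * A ^\<^sub>m Suc k"
    using assms by (simp add: assoc_mult_mat[of _ n n _ n _ n])
  finally show ?case .
qed

lemma poly_mat_dim [simp]:
  "dim_row (poly_mat p A) = dim_row A" "dim_col (poly_mat p A) = dim_row A"
  by (simp_all add: poly_mat_def)

lemma poly_mat_carrier [simp]:
  "A \<in> carrier_mat n n \<Longrightarrow> poly_mat p A \<in> carrier_mat n n"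
  by (auto simp: poly_mat_def)

lemma poly_mat_index:
  assumes "A \<in> carrier_mat n n" "degree p \<le> N" "i < n" "j < n"
  shows "poly_mat p A $$ (i, j) = (\<Sum>k\<le>N. coeff p k * (A ^\<^sub>m k) $$ (i, j))"
proof -
  have "(\<Sum>k\<le>degree p. coeff p k * (A ^\<^sub>m k) $$ (i, j)) =
        (\<Sum>k\<le>N. coeff p k * (A ^\<^sub>m k) $$ (i, j))"
    by (rule sum.mono_neutral_left) (use assms in \<open>auto simp: coeff_eq_0\<close>)
  then show ?thesis using assms by (simp add: poly_mat_def)
qed

lemma poly_mat_0 [simp]: "A \<in> carrier_mat n n \<Longrightarrow> poly_mat 0 A = 0\<^sub>m n n"
  by (rule eq_matI) (auto simp: poly_mat_def)

lemma poly_mat_pCons: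
  assumes A: "A \<in> carrier_mat n n"
  shows "poly_mat (pCons a p) A = a \<cdot>\<^sub>m 1\<^sub>m n + A * poly_mat p A"
proof (rule eq_matI)
  fix i j assume "i < dim_row (a \<cdot>\<^sub>m 1\<^sub>m n + A * poly_mat p A)" "j < dim_col (a \<cdot>\<^sub>m 1\<^sub>m n + A * poly_mat p A)"
  then have ij: "i < n" "j < n" using A by auto
  have "(A * poly_mat p A) $$ (i, j) = (\<Sum>l<n. A $$ (i, l) * poly_mat p A $$ (l, j))"
    using A ij by (simp add: scalar_prod_def atLeast0LessThan)
  also have "\<dots> = (\<Sum>l<n. \<Sum>k\<le>degree p. coeff p k * (A $$ (i, l) * (A ^\<^sub>m k) $$ (l, j)))"
    using A ij by (intro sum.cong refl)
      (auto simp: poly_mat_index[OF A order.refl] sum_distrib_left mult_ac)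
  also have "\<dots> = (\<Sum>k\<le>degree p. coeff p k * (\<Sum>l<n. A $$ (i, l) * (A ^\<^sub>m k) $$ (l, j)))"
    by (subst sum.swap) (simp add: sum_distrib_left)
  also have "\<dots> = (\<Sum>k\<le>degree p. coeff p k * (A ^\<^sub>m Suc k) $$ (i, j))"
    unfolding pow_mat_Suc_left[OF A]
    using A ij by (intro sum.cong refl) (simp add: scalar_prod_def atLeast0LessThan del: pow_mat.simps)
  finally have 1: "(A * poly_mat p A) $$ (i, j) = (\<Sum>k\<le>degree p. coeff p k * (A ^\<^sub>m Suc k) $$ (i, j))" .
  have "poly_mat (pCons a p) A $$ (i, j)
      = (\<Sum>k\<le>Suc (degree p). coeff (pCons a p) k * (A ^\<^sub>m k) $$ (i, j))"
    by (rule poly_mat_index[OF A]) (use ij in \<open>auto simp: degree_pCons_le\<close>)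
  also have "\<dots> = a * (1\<^sub>m n) $$ (i, j) + (\<Sum>k\<le>degree p. coeff p k * (A ^\<^sub>m Suc k) $$ (i, j))"
    unfolding sum.atMost_Suc_shift using A by simp
  finally show "poly_mat (pCons a p) A $$ (i, j) = (a \<cdot>\<^sub>m 1\<^sub>m n + A * poly_mat p A) $$ (i, j)"
    using 1 ij A by simp
qed (use A in auto)

lemma poly_mat_add:
  assumes A: "A \<in> carrier_mat n n"
  shows "poly_mat (p + q) A = poly_mat p A + poly_mat q A"
  by (rule eq_matI)
    (use A in \<open>auto simp: poly_mat_index[OF A, of _ "max (degree p) (degree q)"] degree_add_le_max
      algebra_simps sum.distrib\<close>)

lemma poly_mat_smult:
  assumes A: "A \<in> carrier_mat n n"
  shows "poly_mat (Polynomial.smult c p) A = c \<cdot>\<^sub>m poly_mat p A"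
  by (rule eq_matI)
    (use A in \<open>auto simp: poly_mat_index[OF A, of _ "degree p"] degree_smult_le
      sum_distrib_left mult_ac\<close>)

lemma poly_mat_mult:
  assumes A: "A \<in> carrier_mat n n"
  shows "poly_mat (p * q) A = poly_mat p A * poly_mat q A"
proof (induction p)
  case 0
  then show ?case using A by simp
next
  case (pCons a p)
  have "poly_mat (pCons a p * q) A = poly_mat (Polynomial.smult a q + pCons 0 (p * q)) A" by simp
  also have "\<dots> = a \<cdot>\<^sub>m poly_mat q A + A * (poly_mat p A * poly_mat q A)"
    using A pCons.IH by (simp add: poly_mat_add poly_mat_smult poly_mat_pCons)
      (rule arg_cong2[of _ _ _ _ "(+)"], auto intro!: eq_matI)
  also have "\<dots> = poly_mat (pCons a p) A * poly_mat q A"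
    using A by (simp add: poly_mat_pCons add_mult_distrib_mat[of _ n n _ _ n]
        assoc_mult_mat[of _ n n _ n _ n] mult_smult_assoc_mat[of _ n n _ n])
  finally show ?case .
qed

lemma poly_mat_1 [simp]: "A \<in> carrier_mat n n \<Longrightarrow> poly_mat 1 A = 1\<^sub>m n"
  unfolding one_pCons by (subst poly_mat_pCons) (auto intro!: eq_matI)

lemma poly_mat_X [simp]: "A \<in> carrier_mat n n \<Longrightarrow> poly_mat [:0, 1:] A = A"
  by (simp add: poly_mat_pCons[of _ n]) (auto intro!: eq_matI)

lemma poly_mat_commute:
  "A \<in> carrier_mat n n \<Longrightarrow> poly_mat p A * poly_mat q A = poly_mat q A * poly_mat p A"
  by (metis poly_mat_mult mult.commute)

lemma poly_mat_commute_self: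
  "A \<in> carrier_mat n n \<Longrightarrow> poly_mat p A * A = A * poly_mat p A"
  using poly_mat_commute[of A n p "[:0, 1:]"] by simp

lemma poly_mat_similar:
  fixes A P Q :: "'a::field mat"
  assumes A: "A \<in> carrier_mat n n" and P: "P \<in> carrier_mat n n" and Q: "Q \<in> carrier_mat n n"
    and QP: "Q * P = 1\<^sub>m n"
  shows "poly_mat p (P * A * Q) = P * poly_mat p A * Q"
proof -
  have PQ: "P * Q = 1\<^sub>m n" using mat_mult_left_right_inverse[OF Q P QP] .
  have QPX: "Q * (P * X) = X" if "X \<in> carrier_mat n n" for X
    using mult_cancel_inverse[OF P Q that QP] .
  show ?thesis
  proof (induction p)
    case 0
    then show ?case using A P Q by simp
  next
    case (pCons a p)
    have "P * A * Q \<in> carrier_mat n n" "A * Q \<in> carrier_mat n n" "poly_mat p A * Q \<in> carrier_mat n n"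
      using A P Q by auto
    then show ?case using A P Q
      unfolding poly_mat_pCons[OF A] poly_mat_pCons[OF mult_carrier_mat[OF mult_carrier_mat[OF P A] Q]] pCons.IH
      by (simp add: add_mult_distrib_mat[of _ n n _ _ n] PQ
          mult_add_distrib_mat[of _ n n _ n] mult_smult_assoc_mat[of _ n n _ n] mult_smult_distrib[of _ n n _ n]
          assoc_mult_mat[of _ n n _ n _ n] QPX)
  qed
qed

lemma poly_mat_transpose:
  assumes A: "A \<in> carrier_mat n n"
  shows "poly_mat p (transpose_mat A) = transpose_mat (poly_mat p A)"
proof (induction p)
  case 0
  then show ?case using A by simp
next
  case (pCons a p)
  have "transpose_mat (poly_mat (pCons a p) A) = transpose_mat (a \<cdot>\<^sub>m 1\<^sub>m n + poly_mat p A * A)"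
    using A by (simp add: poly_mat_pCons poly_mat_commute_self)
  also have "\<dots> = a \<cdot>\<^sub>m 1\<^sub>m n + transpose_mat A * transpose_mat (poly_mat p A)"
    using A by (subst transpose_add[of _ n n]) (auto simp: transpose_mult[of _ n n])
  finally show ?case using A pCons.IH by (simp add: poly_mat_pCons[of _ n])
qed

text \<open>Annihilating polynomials are read off from the diagonal blocks, so the lower left block
  \<open>V\<close> stays existential.\<close>

lemma poly_mat_block_lower:
  assumes X: "X \<in> carrier_mat n n" and Z: "Z \<in> carrier_mat m n" and W: "W \<in> carrier_mat m m"
  shows "\<exists>V\<in>carrier_mat m n. poly_mat p (four_block_mat X (0\<^sub>m n m) Z W)
    = four_block_mat (poly_mat p X) (0\<^sub>m n m) V (poly_mat p W)"
proof (induction p)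
  case 0
  then show ?case using assms
    by (intro bexI[of _ "0\<^sub>m m n"]) (auto simp: poly_mat_0[of _ "n + m"])
next
  case (pCons a p)
  then obtain V where V: "V \<in> carrier_mat m n" and e: "poly_mat p (four_block_mat X (0\<^sub>m n m) Z W)
    = four_block_mat (poly_mat p X) (0\<^sub>m n m) V (poly_mat p W)" by blast
  have N: "four_block_mat X (0\<^sub>m n m) Z W \<in> carrier_mat (n + m) (n + m)" using X W by auto
  show ?case
  proof
    show "Z * poly_mat p X + W * V \<in> carrier_mat m n" using assms V by auto
    have "a \<cdot>\<^sub>m 1\<^sub>m (n + m) = four_block_mat (a \<cdot>\<^sub>m 1\<^sub>m n) (0\<^sub>m n m) (0\<^sub>m m n) (a \<cdot>\<^sub>m 1\<^sub>m m)"
      by (auto intro!: eq_matI)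
    then show "poly_mat (pCons a p) (four_block_mat X (0\<^sub>m n m) Z W) =
      four_block_mat (poly_mat (pCons a p) X) (0\<^sub>m n m) (Z * poly_mat p X + W * V) (poly_mat (pCons a p) W)"
      unfolding poly_mat_pCons[OF N] poly_mat_pCons[OF X] poly_mat_pCons[OF W] e
      using assms V
      by (simp add: mult_four_block_mat[of _ n n _ m _ m _ _ n _ m] add_four_block_mat[of _ n n _ m _ m])
  qed
qed

lemma poly_mat_block_diag:
  assumes X: "X \<in> carrier_mat n n" and W: "W \<in> carrier_mat m m"
  shows "poly_mat p (four_block_mat X (0\<^sub>m n m) (0\<^sub>m m n) W)
    = four_block_mat (poly_mat p X) (0\<^sub>m n m) (0\<^sub>m m n) (poly_mat p W)"
proof (induction p)
  case 0
  then show ?case using assms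
    by (auto simp: poly_mat_0[of _ "n + m"])
next
  case (pCons a p)
  have N: "four_block_mat X (0\<^sub>m n m) (0\<^sub>m m n) W \<in> carrier_mat (n + m) (n + m)" using X W by auto
  have "a \<cdot>\<^sub>m 1\<^sub>m (n + m) = four_block_mat (a \<cdot>\<^sub>m 1\<^sub>m n) (0\<^sub>m n m) (0\<^sub>m m n) (a \<cdot>\<^sub>m 1\<^sub>m m)"
    by (auto intro!: eq_matI)
  then show ?case
    unfolding poly_mat_pCons[OF N] poly_mat_pCons[OF X] poly_mat_pCons[OF W] pCons.IH
    using assms
    by (simp add: mult_four_block_mat[of _ n n _ m _ m _ _ n _ m] add_four_block_mat[of _ n n _ m _ m])
qed

text \<open>The zero polynomial is excluded because \<open>pCons a 0\<close> has degree 0 and not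
  \<open>Suc (degree 0)\<close>.\<close>

lemma reflect_poly_pCons_nonzero:
  assumes "p \<noteq> 0"
  shows "reflect_poly (pCons a p) = reflect_poly p + monom a (Suc (degree p))"
proof (rule poly_eqI)
  fix k
  show "coeff (reflect_poly (pCons a p)) k = coeff (reflect_poly p + monom a (Suc (degree p))) k"
    using assms by (auto simp: coeff_reflect_poly Suc_diff_le coeff_pCons split: nat.split)
qed

lemma poly_mat_monom:
  assumes A: "A \<in> carrier_mat n n"
  shows "poly_mat (monom a k) A = a \<cdot>\<^sub>m A ^\<^sub>m k"
proof -
  have "(\<Sum>l\<le>k. coeff (monom a k) l * (A ^\<^sub>m l) $$ (i, j)) = a * (A ^\<^sub>m k) $$ (i, j)" for i j
    by (subst sum.remove[of _ k]) auto
  then have *: "poly_mat (monom a k) A $$ (i, j) = a * (A ^\<^sub>m k) $$ (i, j)" if "i < n" "j < n" for i j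
    using poly_mat_index[OF A degree_monom_le that, of a k] by simp
  have "A ^\<^sub>m k \<in> carrier_mat n n" using A by (rule pow_carrier_mat)
  then show ?thesis
    by (intro eq_matI) (use A in \<open>auto simp: * simp del: pow_mat_dim\<close>)
qed

lemma pow_mat_inverse:
  fixes A B :: "'a::field mat"
  assumes A: "A \<in> carrier_mat n n" and B: "B \<in> carrier_mat n n" and BA: "B * A = 1\<^sub>m n"
  shows "B ^\<^sub>m k * A ^\<^sub>m k = 1\<^sub>m n"
proof (induction k)
  case 0
  then show ?case using A B by simp
next
  case (Suc k)
  have "B ^\<^sub>m Suc k * A ^\<^sub>m Suc k = B ^\<^sub>m k * (B * (A * A ^\<^sub>m k))"
    unfolding pow_mat_Suc_left[OF A] using A B by (simp add: assoc_mult_mat[of _ n n _ n _ n])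
  also have "B * (A * A ^\<^sub>m k) = A ^\<^sub>m k"
    by (rule mult_cancel_inverse[OF A B _ BA]) (use A in auto)
  finally show ?case using Suc by simp
qed

text \<open>The matrix form of x^d r(1/x) = p(x), where r is the reflection of p and d its degree.
  It carries annihilators of a matrix over to its inverse and computes adjoints for the symplectic
  form.\<close>

lemma poly_mat_reflect:
  fixes A B :: "'a::field mat"
  assumes A: "A \<in> carrier_mat n n" and B: "B \<in> carrier_mat n n" and BA: "B * A = 1\<^sub>m n"
  shows "poly_mat (reflect_poly p) B * A ^\<^sub>m degree p = poly_mat p A"
proof (induction p)
  case 0
  then show ?case using A B by simp
next
  case (pCons a p)
  show ?case
  proof (cases "p = 0")
    case True
    then show ?thesis using A B by (simp add: poly_mat_pCons[of _ n])
  next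
    case False
    let ?d = "degree p"
    have "poly_mat (reflect_poly (pCons a p)) B * A ^\<^sub>m degree (pCons a p)
      = (poly_mat (reflect_poly p) B + a \<cdot>\<^sub>m B ^\<^sub>m Suc ?d) * A ^\<^sub>m Suc ?d"
      using False B by (simp add: reflect_poly_pCons_nonzero poly_mat_add poly_mat_monom)
    also have "\<dots> = poly_mat (reflect_poly p) B * A ^\<^sub>m Suc ?d + a \<cdot>\<^sub>m (B ^\<^sub>m Suc ?d * A ^\<^sub>m Suc ?d)"
      using A B
      by (subst add_mult_distrib_mat[of _ n n _ _ n])
        (simp_all add: mult_smult_assoc_mat[of _ n n _ n] pow_carrier_mat del: pow_mat.simps assoc_mult_mat)
    also have "poly_mat (reflect_poly p) B * A ^\<^sub>m Suc ?d = poly_mat p A * A"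
      using A B pow_carrier_mat[OF A, of ?d] poly_mat_carrier[OF B]
      by (simp add: assoc_mult_mat[of _ n n _ n _ n, symmetric] pCons.IH del: assoc_mult_mat)
    also have "\<dots> = A * poly_mat p A" using A by (simp add: poly_mat_commute_self)
    also have "B ^\<^sub>m Suc ?d * A ^\<^sub>m Suc ?d = 1\<^sub>m n" by (rule pow_mat_inverse[OF assms])
    finally show ?thesis using A by (simp add: poly_mat_pCons[of _ n] comm_add_mat[of _ n n])
  qed
qed

section \<open>Cyclic vectors and companion matrices\<close>

lemma mat_vec_index_sum:
  "M \<in> carrier_mat n m \<Longrightarrow> x \<in> carrier_vec m \<Longrightarrow> i < n \<Longrightarrow> (M *\<^sub>v x) $ i = (\<Sum>j<m. M $$ (i, j) * x $ j)"
  by (auto simp: scalar_prod_def atLeast0LessThan)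

lemma mat_mat_index_sum:
  "M \<in> carrier_mat n m \<Longrightarrow> N \<in> carrier_mat m k \<Longrightarrow> i < n \<Longrightarrow> l < k \<Longrightarrow>
    (M * N) $$ (i, l) = (\<Sum>j<m. M $$ (i, j) * N $$ (j, l))"
  by (auto simp: scalar_prod_def atLeast0LessThan)

lemma mat_mult_unit_vec:
  fixes M :: "'a::field mat"
  assumes "M \<in> carrier_mat n m" "k < m"
  shows "M *\<^sub>v unit_vec m k = col M k"
  using assms by (intro eq_vecI) auto

text \<open>Coprimality in Bezout form: evaluated at a matrix, the identity splits every vector into
  two components, and this is how it is applied below.\<close>

definition comaximal :: "'a::field poly \<Rightarrow> 'a poly \<Rightarrow> bool" where
  "comaximal a b \<longleftrightarrow> (\<exists>u v. u * a + v * b = 1)"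

lemma comaximal_sym: "comaximal a b \<Longrightarrow> comaximal b a"
  unfolding comaximal_def by (metis add.commute)

lemma comaximal_mult:
  assumes "comaximal a b" "comaximal a c"
  shows "comaximal a (b * c)"
proof -
  obtain u v s t where "u * a + v * b = 1" "s * a + t * c = 1"
    using assms unfolding comaximal_def by blast
  then have "(u * a + v * b) * (s * a + t * c) = 1" by simp
  then have "(u * a * s + u * t * c + v * b * s) * a + (v * t) * (b * c) = 1"
    by (simp add: algebra_simps)
  then show ?thesis unfolding comaximal_def by blast
qed

lemma comaximal_power: "comaximal a b \<Longrightarrow> comaximal (a ^ k) b"
proof (induction k)
  case 0
  have "1 * (a ^ 0) + 0 * b = 1" by simp
  then show ?case unfolding comaximal_def by blast
next
  case (Suc k)
  then show ?case using comaximal_mult[of b a "a ^ k"] comaximal_sym by auto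
qed

lemma comaximal_dvd_mult:
  assumes "comaximal a b" "a dvd r * b"
  shows "a dvd r"
proof -
  obtain u v where uv: "u * a + v * b = 1" using assms unfolding comaximal_def by blast
  have "r = a * (r * u) + v * (r * b)"
    using arg_cong[OF uv, of "\<lambda>z. r * z"] by (simp add: algebra_simps)
  then show ?thesis using assms(2) by (metis dvd_add dvd_triv_left dvd_mult)
qed

lemma comaximal_mult_dvd:
  assumes "comaximal a b" "a dvd r" "b dvd r"
  shows "a * b dvd r"
proof -
  obtain s where s: "r = s * a" using assms(2) by (metis dvd_def mult.commute)
  then have "b dvd s" using comaximal_dvd_mult[OF comaximal_sym[OF assms(1)], of s] assms(3) by simp
  then show ?thesis unfolding s by (simp add: mult.commute mult_dvd_mono)
qed

text \<open>A nonzero combination of least degree divides every other combination, since the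
  remainder is again a combination and has smaller degree.\<close>

lemma poly_bezout:
  fixes a b :: "'a::field poly"
  assumes "b \<noteq> 0"
  obtains g u v where "g = u * a + v * b" "g dvd a" "g dvd b"
proof -
  let ?P = "\<lambda>g. g \<noteq> 0 \<and> (\<exists>u v. g = u * a + v * b)"
  have "?P b" using assms by (intro conjI exI[of _ 0] exI[of _ 1]) auto
  then obtain g where g: "?P g" and min: "\<And>h. ?P h \<Longrightarrow> degree g \<le> degree h"
    using ex_has_least_nat[of ?P b degree] by blast
  then obtain u v where uv: "g = u * a + v * b" by blast
  have dv: "g dvd h" if h: "h = s * a + t * b" for h s t
  proof -
    have "h mod g = h - (h div g) * g" by (simp add: minus_div_mult_eq_mod)
    also have "\<dots> = (s - h div g * u) * a + (t - h div g * v) * b"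
    proof -
      have "(s - h div g * u) * a + (t - h div g * v) * b = (s * a + t * b) - h div g * (u * a + v * b)"
        by (simp add: algebra_simps)
      then show ?thesis by (simp flip: h uv)
    qed
    finally have "h mod g = (s - h div g * u) * a + (t - h div g * v) * b" .
    then have "?P (h mod g)" if "h mod g \<noteq> 0" using that by blast
    then have "h mod g = 0" using min[of "h mod g"] degree_mod_less[of g h] g by fastforce
    then show ?thesis by auto
  qed
  show ?thesis
    by (rule that[OF uv]) (rule dv[of _ 1 0], simp, rule dv[of _ 0 1], simp)
qed

lemma degree_0_comaximal:
  assumes "g = u * a + v * b" "g \<noteq> 0" "degree g = 0"
  shows "comaximal a b"
proof -
  obtain h where "g * h = 1" using assms(2,3) by (metis dvd_def is_unit_iff_degree)
  then have "(h * u) * a + (h * v) * b = 1" using assms(1) by (simp add: algebra_simps)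
  then show ?thesis unfolding comaximal_def by blast
qed

lemma coprime_comaximal:
  fixes a b :: "'a::field poly"
  assumes "coprime a b" "b \<noteq> 0"
  shows "comaximal a b"
proof -
  obtain g u v where g: "g = u * a + v * b" "g dvd a" "g dvd b" using poly_bezout[OF assms(2)] .
  then have "is_unit g" using assms(1) coprime_common_divisor by blast
  then show ?thesis using degree_0_comaximal[OF g(1)] by (metis is_unit_iff_degree not_is_unit_0)
qed

lemma poly_decompose_multiplicity:
  fixes p g :: "'a::field poly"
  assumes "degree p > 0" "g \<noteq> 0"
  shows "\<exists>k d. g = p ^ k * d \<and> \<not> p dvd d"
  using assms(2)
proof (induction "degree g" arbitrary: g rule: less_induct)
  case less
  show ?case
  proof (cases "p dvd g")
    case False
    then show ?thesis by (intro exI[of _ 0] exI[of _ g]) simp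
  next
    case True
    then obtain h where h: "g = p * h" by blast
    then have "h \<noteq> 0" "degree h < degree g" using less.prems assms(1) by (auto simp: degree_mult_eq)
    then obtain k d where "h = p ^ k * d" "\<not> p dvd d" using less.hyps by blast
    then show ?thesis using h by (intro exI[of _ "Suc k"] exI[of _ d]) (simp add: mult.assoc)
  qed
qed

context
  fixes A :: "'a::field mat" and n :: nat
  assumes A: "A \<in> carrier_mat n n"
begin

private abbreviation act where "act p x \<equiv> poly_mat p A *\<^sub>v x"

lemma act_mult: "x \<in> carrier_vec n \<Longrightarrow> act (p * q) x = act p (act q x)"
  using A by (simp add: poly_mat_mult assoc_mult_mat_vec[of _ n n _ n])

lemma act_add: "x \<in> carrier_vec n \<Longrightarrow> act (p + q) x = act p x + act q x"
  using A by (simp add: poly_mat_add add_mult_distrib_mat_vec[of _ n n])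

lemma act_1: "x \<in> carrier_vec n \<Longrightarrow> act 1 x = x"
  using A by simp

lemma act_zero: "act p (0\<^sub>v n) = 0\<^sub>v n"
  using poly_mat_carrier[OF A, of p] by (intro eq_vecI) (auto simp: scalar_prod_def)

lemma act_vec_add: "x \<in> carrier_vec n \<Longrightarrow> y \<in> carrier_vec n \<Longrightarrow> act p (x + y) = act p x + act p y"
  using poly_mat_carrier[OF A, of p] by (simp add: mult_add_distrib_mat_vec[of _ n n])

lemma act_carrier: "act p x \<in> carrier_vec n"
  using poly_mat_carrier[OF A, of p] A by (intro carrier_vecI) simp

text \<open>The annihilator of the kernel of \<open>p(A)\<close> is attained by a single vector. The induction
  splits off coprime factors; a polynomial without such a splitting behaves like a prime power,
  all of whose proper divisors divide one maximal proper divisor.\<close>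

lemma exists_vector_with_order:
  assumes "p \<noteq> 0"
    and "\<And>r. (\<And>x. x \<in> carrier_vec n \<Longrightarrow> act p x = 0\<^sub>v n \<Longrightarrow> act r x = 0\<^sub>v n) \<Longrightarrow> p dvd r"
  shows "\<exists>x\<in>carrier_vec n. act p x = 0\<^sub>v n \<and> (\<forall>r. act r x = 0\<^sub>v n \<longrightarrow> p dvd r)"
  using assms
proof (induction "degree p" arbitrary: p rule: less_induct)
  case less
  note p0 = less.prems(1) and exact = less.prems(2)
  show ?case
  proof (cases "\<exists>a b. p = a * b \<and> degree a > 0 \<and> degree b > 0 \<and> comaximal a b")
    case True
    then obtain a b where ab: "p = a * b" "degree a > 0" "degree b > 0" and co: "comaximal a b" by blast
    have co': "comaximal b a" using co by (rule comaximal_sym)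
    have half: "\<exists>x\<in>carrier_vec n. act a x = 0\<^sub>v n \<and> (\<forall>r. act r x = 0\<^sub>v n \<longrightarrow> a dvd r)"
      if ab: "p = a * b" "degree a > 0" "degree b > 0" and co: "comaximal a b" for a b
    proof (rule less.hyps)
      show "degree a < degree p" using ab p0 by (auto simp: degree_mult_eq)
      show "a \<noteq> 0" using ab by auto
    next
      fix r assume r: "\<And>x. x \<in> carrier_vec n \<Longrightarrow> act a x = 0\<^sub>v n \<Longrightarrow> act r x = 0\<^sub>v n"
      \<comment> \<open>The hypothesis on \<open>p\<close> applies to \<open>r * b\<close>:
        \<open>b(A)\<close> maps the kernel of \<open>p(A)\<close> into that of \<open>a(A)\<close>,
        which \<open>r(A)\<close> kills.\<close>
      have "p dvd r * b"
      proof (rule exact)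
        fix x assume x: "x \<in> carrier_vec n" "act p x = 0\<^sub>v n"
        then have "act a (act b x) = 0\<^sub>v n" using ab act_mult by simp
        then show "act (r * b) x = 0\<^sub>v n" using r[OF act_carrier] x act_mult by simp
      qed
      then show "a dvd r" using comaximal_dvd_mult[OF co] ab(1) by (metis dvd_mult_left)
    qed
    obtain x where x: "x \<in> carrier_vec n" "act a x = 0\<^sub>v n" "\<And>r. act r x = 0\<^sub>v n \<Longrightarrow> a dvd r"
      using half[OF ab co] by blast
    obtain y where y: "y \<in> carrier_vec n" "act b y = 0\<^sub>v n" "\<And>r. act r y = 0\<^sub>v n \<Longrightarrow> b dvd r"
      using half[of b a] ab co' by (auto simp: mult.commute)
    \<comment> \<open>Applying \<open>b\<close> removes the component \<open>y\<close>, so an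
      annihilator of the sum gives one of \<open>x\<close> alone.\<close>
    have *: "act (s * b) x = 0\<^sub>v n" if "act s (x + y) = 0\<^sub>v n" for s
    proof -
      have "act (b * s) (x + y) = 0\<^sub>v n" using that x y by (simp add: act_mult act_zero)
      then have "act (s * b) x + act (s * b) y = 0\<^sub>v n" using x y by (simp add: act_vec_add mult.commute)
      moreover have "act (s * b) y = 0\<^sub>v n" using y by (simp add: act_mult act_zero)
      ultimately show ?thesis using act_carrier by (metis right_zero_vec)
    qed
    have **: "act (s * a) y = 0\<^sub>v n" if "act s (x + y) = 0\<^sub>v n" for s
    proof -
      have "act (a * s) (x + y) = 0\<^sub>v n" using that x y by (simp add: act_mult act_zero)
      then have "act (s * a) x + act (s * a) y = 0\<^sub>v n" using x y by (simp add: act_vec_add mult.commute)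
      moreover have "act (s * a) x = 0\<^sub>v n" using x by (simp add: act_mult act_zero)
      ultimately show ?thesis using act_carrier by (metis left_zero_vec)
    qed
    show ?thesis
    proof (intro bexI conjI allI impI)
      show "x + y \<in> carrier_vec n" using x y by simp
      have "act (b * a) x = 0\<^sub>v n" "act (a * b) y = 0\<^sub>v n"
        using x y by (simp_all add: act_mult act_zero)
      then have "act p x = 0\<^sub>v n" "act p y = 0\<^sub>v n" using ab by (simp_all add: mult.commute)
      then show "act p (x + y) = 0\<^sub>v n" using x y by (simp add: act_vec_add)
      fix s assume "act s (x + y) = 0\<^sub>v n"
      then have "a dvd s * b" "b dvd s * a" using * ** x(3) y(3) by blast+
      then have "a dvd s" "b dvd s" using comaximal_dvd_mult[OF co] comaximal_dvd_mult[OF co'] by blast+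
      then show "p dvd s" using comaximal_mult_dvd[OF co] ab by blast
    qed
  next
    case prim: False
    show ?thesis
    proof (cases "degree p = 0")
      case True
      then have "p dvd r" for r using p0 by (meson dvd_trans is_unit_iff_degree one_dvd)
      then show ?thesis using act_zero by (intro bexI[of _ "0\<^sub>v n"]) auto
    next
      case False
      \<comment> \<open>A divisor of least positive degree plays the role of the prime: by
        \<open>alt\<close> it divides a nonzero polynomial or is comaximal to it.\<close>
      then obtain \<pi> where \<pi>: "\<pi> dvd p" "degree \<pi> > 0"
        and min: "\<And>d. d dvd p \<Longrightarrow> degree d > 0 \<Longrightarrow> degree \<pi> \<le> degree d"
        using ex_has_least_nat[of "\<lambda>d. d dvd p \<and> degree d > 0" p degree] by (metis dvd_refl gr0I)
      have alt: "\<pi> dvd e \<or> comaximal \<pi> e" if e0: "e \<noteq> 0" for e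
      proof -
        obtain g u v where g: "g = u * \<pi> + v * e" "g dvd \<pi>" "g dvd e" using poly_bezout[OF e0] .
        have "\<pi> \<noteq> 0" "g \<noteq> 0" using \<pi> g e0 by auto
        show ?thesis
        proof (cases "degree g = 0")
          case True
          then show ?thesis using degree_0_comaximal[OF g(1) \<open>g \<noteq> 0\<close>] by blast
        next
          case False
          obtain h where h: "\<pi> = g * h" using g by blast
          have "degree \<pi> \<le> degree g" using min False g(2) \<pi>(1) dvd_trans by blast
          moreover have "g \<noteq> 0" "h \<noteq> 0" using h \<open>\<pi> \<noteq> 0\<close> by auto
          ultimately have "degree h = 0" using h by (simp add: degree_mult_eq)
          then have "is_unit h" using \<open>h \<noteq> 0\<close> is_unit_iff_degree by blast
          then have "\<pi> dvd g" using h by (metis dvd_refl mult_unit_dvd_iff)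
          then show ?thesis using g dvd_trans by blast
        qed
      qed
      obtain p' where p': "p = \<pi> * p'" using \<pi> by blast
      have p'0: "p' \<noteq> 0" "\<pi> \<noteq> 0" using p0 p' by auto
      have "\<not> p dvd p'"
        using dvd_imp_degree_le[of p p'] p'0 p' \<pi>(2) by (auto simp: degree_mult_eq)
      \<comment> \<open>\<open>p'\<close> is the maximal proper divisor of \<open>p\<close>, so a
        vector of the kernel that \<open>p'(A)\<close> does not kill is killed by no proper
        divisor.\<close>
      then obtain x where x: "x \<in> carrier_vec n" "act p x = 0\<^sub>v n" "act p' x \<noteq> 0\<^sub>v n"
        using exact[of p'] by blast
      have "p dvd r" if r: "act r x = 0\<^sub>v n" for r
      proof -
        obtain g u v where g: "g = u * r + v * p" "g dvd r" "g dvd p" using poly_bezout[OF p0] .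
        have gx: "act g x = 0\<^sub>v n" using x r unfolding g(1) by (simp add: act_add act_mult act_zero)
        obtain e where e: "p = g * e" using g by blast
        have ge0: "g \<noteq> 0" "e \<noteq> 0" using e p0 by auto
        show ?thesis
        proof (cases "degree e = 0")
          case True
          then have "is_unit e" using ge0 is_unit_iff_degree by blast
          then have "p dvd g" using e by (metis dvd_refl mult_unit_dvd_iff)
          then show ?thesis using g dvd_trans by blast
        next
          case False
          \<comment> \<open>Otherwise \<open>p\<close> would split into the full power of
            \<open>\<pi>\<close> in \<open>g\<close> and a comaximal factor of positive degree,
            against \<open>prim\<close>.\<close>
          have "\<pi> dvd e"
          proof (rule ccontr)
            assume "\<not> \<pi> dvd e"
            then have ce: "comaximal \<pi> e" using alt ge0 by blast
            obtain k d where d: "g = \<pi> ^ k * d" "\<not> \<pi> dvd d"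
              using poly_decompose_multiplicity[OF \<pi>(2) ge0(1)] by blast
            have d0: "d \<noteq> 0" using d by auto
            then have "comaximal \<pi> d" using alt d by blast
            then have c: "comaximal \<pi> (d * e)" using ce by (rule comaximal_mult)
            have "k \<noteq> 0"
            proof
              assume "k = 0"
              then have "\<pi> dvd 1 * (d * e)" using \<pi>(1) e d by simp
              then have "\<pi> dvd 1" using comaximal_dvd_mult[OF c] by blast
              then show False using \<pi>(2) by (metis degree_1 dvd_imp_degree_le leD one_neq_zero)
            qed
            then have "degree (\<pi> ^ k) > 0" using \<pi>(2) p'0 by (simp add: degree_power_eq)
            moreover have "degree (d * e) > 0" using False d0 ge0 by (simp add: degree_mult_eq)
            moreover have "p = \<pi> ^ k * (d * e)" using e d by (simp add: mult.assoc)
            ultimately show False using prim comaximal_power[OF c] by blast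
          qed
          then obtain e' where e': "e = \<pi> * e'" by blast
          have "\<pi> * p' = \<pi> * (e' * g)" using e e' p' by (simp add: ac_simps)
          then have "p' = e' * g" using p'0 by simp
          then have "act p' x = 0\<^sub>v n" using x gx by (simp add: act_mult act_zero)
          then show ?thesis using x by simp
        qed
      qed
      then show ?thesis using x by blast
    qed
  qed
qed

end

text \<open>For monic \<open>p\<close>, the matrix \<open>X\<close> is cyclic with minimal polynomial \<open>p\<close>.\<close>

definition cyclic_for :: "'a::field poly \<Rightarrow> 'a mat \<Rightarrow> bool" where
  "cyclic_for p X \<longleftrightarrow> X \<in> carrier_mat (degree p) (degree p) \<and>
     poly_mat p X = 0\<^sub>m (degree p) (degree p) \<and>
     (\<forall>r. poly_mat r X = 0\<^sub>m (degree p) (degree p) \<longrightarrow> degree r < degree p \<longrightarrow> r = 0)"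

lemma cyclic_forD:
  assumes "cyclic_for p X" "degree p = n"
  shows "X \<in> carrier_mat n n" "poly_mat p X = 0\<^sub>m n n"
    "\<And>r. poly_mat r X = 0\<^sub>m n n \<Longrightarrow> degree r < n \<Longrightarrow> r = 0"
  using assms unfolding cyclic_for_def by auto

lemma cyclic_for_dvd:
  assumes X: "cyclic_for p X" and r: "poly_mat r X = 0\<^sub>m (degree p) (degree p)" and "degree p > 0"
  shows "p dvd r"
proof -
  let ?n = "degree p"
  note c = cyclic_forD[OF X refl]
  have "poly_mat r X = poly_mat (r div p * p + r mod p) X" by simp
  also have "\<dots> = poly_mat (r div p) X * poly_mat p X + poly_mat (r mod p) X"
    using c(1) by (simp only: poly_mat_add poly_mat_mult)
  also have "\<dots> = poly_mat (r mod p) X" using c(1,2) right_mult_zero_mat[OF poly_mat_carrier[OF c(1)]]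
      left_add_zero_mat[OF poly_mat_carrier[OF c(1)]] by simp
  finally have "poly_mat (r mod p) X = 0\<^sub>m ?n ?n" using r by simp
  moreover have "p \<noteq> 0" using assms(3) by auto
  ultimately have "r mod p = 0" using c(3)[of "r mod p"] degree_mod_less[of p r] by fastforce
  then show ?thesis by auto
qed

lemma cyclic_for_similar:
  assumes X: "cyclic_for p X" and n: "degree p = n"
    and P: "P \<in> carrier_mat n n" and Q: "Q \<in> carrier_mat n n" and QP: "Q * P = 1\<^sub>m n"
  shows "cyclic_for p (P * X * Q)"
proof -
  note c = cyclic_forD[OF X n]
  have sim: "poly_mat r (P * X * Q) = P * poly_mat r X * Q" for r
    by (rule poly_mat_similar[OF c(1) P Q QP])
  have "poly_mat r X = 0\<^sub>m n n" if "P * poly_mat r X * Q = 0\<^sub>m n n" for r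
  proof -
    have "Q * (P * poly_mat r X * Q) * P = (Q * P) * poly_mat r X * (Q * P)"
      using P Q poly_mat_carrier[OF c(1), of r] by (simp add: assoc_mult_mat[of _ n n _ n _ n])
    also have "\<dots> = poly_mat r X"
      unfolding QP using left_mult_one_mat[OF poly_mat_carrier[OF c(1), of r]]
        right_mult_one_mat[OF poly_mat_carrier[OF c(1), of r]] by simp
    finally show ?thesis using that P Q by simp
  qed
  then show ?thesis using c P Q n unfolding cyclic_for_def sim by auto
qed

lemma cyclic_for_transpose:
  assumes X: "cyclic_for p X"
  shows "cyclic_for p (transpose_mat X)"
proof -
  note c = cyclic_forD[OF X refl]
  have "transpose_mat (poly_mat r X) = 0\<^sub>m (degree p) (degree p) \<Longrightarrow> poly_mat r X = 0\<^sub>m (degree p) (degree p)" for r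
    by (metis transpose_transpose zero_transpose_mat)
  then show ?thesis using c unfolding cyclic_for_def poly_mat_transpose[OF c(1)] by auto
qed

section \<open>Companion matrices and similarity of cyclic matrices\<close>

definition companion :: "nat \<Rightarrow> (nat \<Rightarrow> 'a::field) \<Rightarrow> 'a mat" where
  "companion n c = mat n n (\<lambda>(i, j). if j = n - 1 then - c i else if i = Suc j then 1 else 0)"

lemma companion_carrier [simp]: "companion n c \<in> carrier_mat n n"
  by (simp add: companion_def)

lemma companion_dim [simp]: "dim_row (companion n c) = n" "dim_col (companion n c) = n"
  by (simp_all add: companion_def)

lemma poly_mat_vec_index:
  assumes A: "A \<in> carrier_mat n n" and x: "x \<in> carrier_vec n" and N: "degree p \<le> N" and i: "i < n"
  shows "(poly_mat p A *\<^sub>v x) $ i = (\<Sum>k\<le>N. coeff p k * (A ^\<^sub>m k *\<^sub>v x) $ i)"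
proof -
  have "(poly_mat p A *\<^sub>v x) $ i = (\<Sum>j<n. (\<Sum>k\<le>N. coeff p k * (A ^\<^sub>m k) $$ (i, j)) * x $ j)"
    using A x i by (simp add: scalar_prod_def atLeast0LessThan poly_mat_index[OF A N])
  also have "\<dots> = (\<Sum>k\<le>N. coeff p k * (\<Sum>j<n. (A ^\<^sub>m k) $$ (i, j) * x $ j))"
    by (simp add: sum_distrib_right sum_distrib_left mult.assoc) (rule sum.swap)
  also have "\<dots> = (\<Sum>k\<le>N. coeff p k * (A ^\<^sub>m k *\<^sub>v x) $ i)"
    using mat_vec_index_sum[OF pow_carrier_mat[OF A] x i] by simp
  finally show ?thesis .
qed

lemma companion_unit_vec:
  assumes "Suc k < n"
  shows "companion n c *\<^sub>v unit_vec n k = unit_vec n (Suc k)"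
proof -
  have "companion n c *\<^sub>v unit_vec n k = col (companion n c) k"
    by (rule mat_mult_unit_vec[OF companion_carrier]) (use assms in simp)
  also have "\<dots> = unit_vec n (Suc k)"
    using assms by (intro eq_vecI) (auto simp: companion_def unit_vec_def)
  finally show ?thesis .
qed

lemma companion_unit_vec_last:
  assumes "n > 0"
  shows "companion n c *\<^sub>v unit_vec n (n - 1) = vec n (\<lambda>i. - c i)"
proof -
  have "companion n c *\<^sub>v unit_vec n (n - 1) = col (companion n c) (n - 1)"
    by (rule mat_mult_unit_vec[OF companion_carrier]) (use assms in simp)
  also have "\<dots> = vec n (\<lambda>i. - c i)"
    using assms by (intro eq_vecI) (auto simp: companion_def)
  finally show ?thesis .
qed

lemma pow_mat_vec_Suc:
  assumes "A \<in> carrier_mat n n" "x \<in> carrier_vec n"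
  shows "A ^\<^sub>m Suc k *\<^sub>v x = A *\<^sub>v (A ^\<^sub>m k *\<^sub>v x)"
  unfolding pow_mat_Suc_left[OF assms(1)] using assms pow_carrier_mat[OF assms(1), of k]
  by (simp add: assoc_mult_mat_vec[of _ n n _ n])

lemma companion_pow_unit_vec:
  assumes "k < n"
  shows "companion n c ^\<^sub>m k *\<^sub>v unit_vec n 0 = unit_vec n k"
  using assms
proof (induction k)
  case 0
  then show ?case by (simp add: companion_def)
next
  case (Suc k)
  then show ?case by (simp add: pow_mat_vec_Suc[of _ n] companion_unit_vec del: pow_mat.simps)
qed

text \<open>The first unit vector \<open>e_0\<close> is cyclic: for degree below \<open>n\<close>
  the vector \<open>r(C) e_0\<close> lists the coefficients of \<open>r\<close>, which gives
  minimality. The last column makes \<open>p(C)\<close> kill \<open>e_0\<close>, hence also every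
  \<open>C^k e_0\<close>, and these are the unit vectors.\<close>

lemma cyclic_for_companion:
  assumes monic: "lead_coeff p = 1" and n: "degree p = n" and n0: "n > 0"
  shows "cyclic_for p (companion n (coeff p))"
proof -
  let ?C = "companion n (coeff p)" and ?e = "unit_vec n 0 :: 'a vec"
  note C = companion_carrier[of n "coeff p"]
  have eval: "(poly_mat r ?C *\<^sub>v ?e) $ i = coeff r i" if "degree r < n" "i < n" for r i
  proof -
    have "(poly_mat r ?C *\<^sub>v ?e) $ i = (\<Sum>k\<le>n - 1. coeff r k * (?C ^\<^sub>m k *\<^sub>v ?e) $ i)"
      using that by (intro poly_mat_vec_index[OF C]) auto
    also have "\<dots> = (\<Sum>k\<le>n - 1. coeff r k * (if k = i then 1 else 0))"
      using that by (intro sum.cong refl) (auto simp: companion_pow_unit_vec)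
    also have "\<dots> = coeff r i" using that by (subst sum.remove[of _ i]) (auto intro!: sum.neutral)
    finally show ?thesis .
  qed
  have min: "r = 0" if r: "poly_mat r ?C = 0\<^sub>m n n" "degree r < n" for r
  proof (rule poly_eqI)
    fix i
    show "coeff r i = coeff 0 i"
    proof (cases "i < n")
      case True
      then show ?thesis using eval[OF r(2) True] r(1) by simp
    next
      case False
      then show ?thesis using r(2) by (simp add: coeff_eq_0)
    qed
  qed
  have zero: "poly_mat p ?C *\<^sub>v ?e = 0\<^sub>v n"
  proof (rule eq_vecI)
    fix i assume "i < dim_vec (0\<^sub>v n :: 'a vec)"
    then have i: "i < n" by simp
    have last: "(?C ^\<^sub>m n *\<^sub>v ?e) $ i = - coeff p i"
    proof -
      have "?C ^\<^sub>m n *\<^sub>v ?e = ?C *\<^sub>v (?C ^\<^sub>m (n - 1) *\<^sub>v ?e)"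
        using pow_mat_vec_Suc[OF C, of ?e "n - 1"] n0 by simp
      also have "?C ^\<^sub>m (n - 1) *\<^sub>v ?e = unit_vec n (n - 1)" using n0 by (simp add: companion_pow_unit_vec)
      also have "?C *\<^sub>v unit_vec n (n - 1) = vec n (\<lambda>i. - coeff p i)" by (rule companion_unit_vec_last[OF n0])
      finally show ?thesis using i by simp
    qed
    have "{..n} = insert n {..n - 1}" using n0 by auto
    then have "(poly_mat p ?C *\<^sub>v ?e) $ i = coeff p n * (?C ^\<^sub>m n *\<^sub>v ?e) $ i
        + (\<Sum>k\<le>n - 1. coeff p k * (?C ^\<^sub>m k *\<^sub>v ?e) $ i)"
      using poly_mat_vec_index[OF C _ eq_refl[OF n] i, of ?e] n0 by simp
    also have "(\<Sum>k\<le>n - 1. coeff p k * (?C ^\<^sub>m k *\<^sub>v ?e) $ i) = (\<Sum>k\<le>n - 1. coeff p k * (if k = i then 1 else 0))"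
      using i by (intro sum.cong refl) (auto simp: companion_pow_unit_vec)
    also have "\<dots> = coeff p i" using i by (subst sum.remove[of _ i]) (auto intro!: sum.neutral)
    finally show "(poly_mat p ?C *\<^sub>v ?e) $ i = 0\<^sub>v n $ i" using i last monic n by simp
  qed (simp add: companion_def)
  have kill: "poly_mat p ?C *\<^sub>v unit_vec n k = 0\<^sub>v n" if "k < n" for k
  proof -
    have k: "poly_mat (monom 1 k) ?C = ?C ^\<^sub>m k"
      unfolding poly_mat_monom[OF C] by (rule eq_matI) auto
    have "poly_mat p ?C *\<^sub>v unit_vec n k = poly_mat p ?C *\<^sub>v (poly_mat (monom 1 k) ?C *\<^sub>v ?e)"
      unfolding k using that by (simp add: companion_pow_unit_vec)
    also have "\<dots> = poly_mat (monom 1 k) ?C *\<^sub>v (poly_mat p ?C *\<^sub>v ?e)"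
      by (metis act_mult[OF C] mult.commute unit_vec_carrier)
    also have "\<dots> = 0\<^sub>v n" unfolding zero by (rule act_zero[OF C])
    finally show ?thesis .
  qed
  have "poly_mat p ?C = 0\<^sub>m n n"
  proof (rule eq_matI)
    fix i j assume "i < dim_row (0\<^sub>m n n :: 'a mat)" "j < dim_col (0\<^sub>m n n :: 'a mat)"
    then have ij: "i < n" "j < n" by auto
    then show "poly_mat p ?C $$ (i, j) = 0\<^sub>m n n $$ (i, j)"
      using arg_cong[OF kill[OF ij(2)], of "\<lambda>v. v $ i"] poly_mat_carrier[OF C, of p]
      by (simp add: mat_mult_unit_vec[of _ n n] companion_def)
  qed (use C in \<open>auto simp: companion_def\<close>)
  then show ?thesis using min n unfolding cyclic_for_def by simp
qed

lemma det_nonzero_inverse: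
  fixes A :: "'a::field mat"
  assumes "A \<in> carrier_mat n n" "det A \<noteq> 0"
  obtains B where "B \<in> carrier_mat n n" "A * B = 1\<^sub>m n" "B * A = 1\<^sub>m n"
  using det_non_zero_imp_unit[OF assms] unfolding Units_def ring_mat_def by auto

lemma det_nonzero_if_injective:
  fixes A :: "'a::field mat"
  assumes "A \<in> carrier_mat n n" "\<And>x. x \<in> carrier_vec n \<Longrightarrow> A *\<^sub>v x = 0\<^sub>v n \<Longrightarrow> x = 0\<^sub>v n"
  shows "det A \<noteq> 0"
  using det_0_iff_vec_prod_zero_field[OF assms(1)] assms(2) by blast

lemma cyclic_for_similar_companion:
  assumes X: "cyclic_for p A" and n: "degree p = n" and n0: "n > 0" and monic: "lead_coeff p = 1"
  obtains V W where "V \<in> carrier_mat n n" "W \<in> carrier_mat n n" "V * W = 1\<^sub>m n" "W * V = 1\<^sub>m n"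
    "A = V * companion n (coeff p) * W"
proof -
  note c = cyclic_forD[OF X n]
  have "p \<noteq> 0" using n n0 by auto
  have "\<exists>x\<in>carrier_vec n. poly_mat p A *\<^sub>v x = 0\<^sub>v n \<and> (\<forall>r. poly_mat r A *\<^sub>v x = 0\<^sub>v n \<longrightarrow> p dvd r)"
  proof (rule exists_vector_with_order[OF c(1) \<open>p \<noteq> 0\<close>])
    fix r assume r: "\<And>x. x \<in> carrier_vec n \<Longrightarrow> poly_mat p A *\<^sub>v x = 0\<^sub>v n \<Longrightarrow> poly_mat r A *\<^sub>v x = 0\<^sub>v n"
    have "poly_mat r A = 0\<^sub>m n n"
    proof (rule eq_matI)
      fix i j assume "i < dim_row (0\<^sub>m n n :: 'a mat)" "j < dim_col (0\<^sub>m n n :: 'a mat)"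
      then have ij: "i < n" "j < n" by auto
      have "poly_mat r A *\<^sub>v unit_vec n j = 0\<^sub>v n" by (rule r) (use c(2) in \<open>auto intro!: eq_vecI\<close>)
      then have "col (poly_mat r A) j = 0\<^sub>v n"
        using ij poly_mat_carrier[OF c(1), of r] by (simp add: mat_mult_unit_vec)
      from arg_cong[OF this, of "\<lambda>v. v $ i"] show "poly_mat r A $$ (i, j) = 0\<^sub>m n n $$ (i, j)"
        using ij c(1) by simp
    qed (use c(1) in auto)
    then show "p dvd r" using cyclic_for_dvd[OF X] n n0 by simp
  qed
  then obtain x where x: "x \<in> carrier_vec n" "\<And>r. poly_mat r A *\<^sub>v x = 0\<^sub>v n \<Longrightarrow> p dvd r" by blast
  define V where "V = mat n n (\<lambda>(i, k). (A ^\<^sub>m k *\<^sub>v x) $ i)"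
  have V: "V \<in> carrier_mat n n" by (simp add: V_def)
  have powx: "A ^\<^sub>m k *\<^sub>v x \<in> carrier_vec n" for k
    by (rule mult_mat_vec_carrier[OF pow_carrier_mat[OF c(1)] x(1)])
  have "det V \<noteq> 0"
  proof (rule det_nonzero_if_injective[OF V])
    fix y assume y: "y \<in> carrier_vec n" "V *\<^sub>v y = 0\<^sub>v n"
    \<comment> \<open>A linear relation between the iterates is a polynomial of degree below
      \<open>n\<close> that kills \<open>x\<close>.\<close>
    define r where "r = (\<Sum>k<n. monom (y $ k) k)"
    have cr: "coeff r k = (if k < n then y $ k else 0)" for k
      by (simp add: r_def coeff_sum)
    have dr: "degree r \<le> n - 1" using n0 by (intro degree_le) (auto simp: cr)
    have "poly_mat r A *\<^sub>v x = V *\<^sub>v y"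
    proof (rule eq_vecI)
      fix i assume "i < dim_vec (V *\<^sub>v y)"
      then have i: "i < n" using V by simp
      have "(poly_mat r A *\<^sub>v x) $ i = (\<Sum>k\<le>n - 1. coeff r k * (A ^\<^sub>m k *\<^sub>v x) $ i)"
        by (rule poly_mat_vec_index[OF c(1) x(1) dr i])
      also have "\<dots> = (\<Sum>k<n. (A ^\<^sub>m k *\<^sub>v x) $ i * y $ k)"
        using n0 by (intro sum.cong) (auto simp: cr)
      also have "\<dots> = (V *\<^sub>v y) $ i"
        using i mat_vec_index_sum[OF V y(1) i] by (simp add: V_def)
      finally show "(poly_mat r A *\<^sub>v x) $ i = (V *\<^sub>v y) $ i" .
    qed (use V c(1) in simp)
    then have "p dvd r" using x y by simp
    then have "r = 0" using dvd_imp_degree_le[of p r] dr n n0 by fastforce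
    then have "y $ k = 0" if "k < n" for k using cr[of k] that by simp
    then show "y = 0\<^sub>v n" using y by auto
  qed
  then obtain W where W: "W \<in> carrier_mat n n" "V * W = 1\<^sub>m n" "W * V = 1\<^sub>m n"
    using det_nonzero_inverse[OF V] by blast
  have "A * V = V * companion n (coeff p)"
  proof (rule eq_matI)
    fix i k assume "i < dim_row (V * companion n (coeff p))" "k < dim_col (V * companion n (coeff p))"
    then have ik: "i < n" "k < n" using V by (auto simp: companion_def)
    have "col V k = A ^\<^sub>m k *\<^sub>v x"
      using ik carrier_vecD[OF powx[of k]]
      by (intro eq_vecI) (auto simp: V_def simp del: index_mult_mat_vec dim_mult_mat_vec)
    then have "(A * V) $$ (i, k) = (A *\<^sub>v (A ^\<^sub>m k *\<^sub>v x)) $ i"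
      using ik c(1) V by simp
    also have "\<dots> = (A ^\<^sub>m Suc k *\<^sub>v x) $ i" by (simp only: pow_mat_vec_Suc[OF c(1) x(1)])
    also have "\<dots> = (V * companion n (coeff p)) $$ (i, k)"
    proof (cases "k = n - 1")
      case True
      have s: "{..n} = insert n {..<n}" by auto
      have "poly_mat p A *\<^sub>v x = 0\<^sub>v n" using c(1,2) x by auto
      then have "(\<Sum>k\<le>n. coeff p k * (A ^\<^sub>m k *\<^sub>v x) $ i) = 0"
        using poly_mat_vec_index[OF c(1) x(1) eq_refl[OF n] ik(1)] ik by simp
      then have "(A ^\<^sub>m n *\<^sub>v x) $ i = - (\<Sum>k<n. coeff p k * (A ^\<^sub>m k *\<^sub>v x) $ i)"
        using monic n unfolding s by (simp add: eq_neg_iff_add_eq_0)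
      also have "\<dots> = (V * companion n (coeff p)) $$ (i, k)"
        using ik True by (simp add: V_def companion_def scalar_prod_def atLeast0LessThan sum_negf mult.commute)
      finally show ?thesis using True n0 by simp
    next
      case False
      then have "Suc k < n" using ik by simp
      have "(V * companion n (coeff p)) $$ (i, k) = (\<Sum>j<n. (A ^\<^sub>m j *\<^sub>v x) $ i * (if j = Suc k then 1 else 0))"
        using ik False by (simp add: V_def companion_def scalar_prod_def atLeast0LessThan)
      also have "\<dots> = (A ^\<^sub>m Suc k *\<^sub>v x) $ i"
        using \<open>Suc k < n\<close> by (subst sum.remove[of _ "Suc k"]) (auto intro!: sum.neutral simp del: pow_mat.simps)
      finally show ?thesis by simp
    qed
    finally show "(A * V) $$ (i, k) = (V * companion n (coeff p)) $$ (i, k)" .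
  qed (use V c(1) in \<open>auto simp: companion_def\<close>)
  then have "V * companion n (coeff p) * W = A * V * W" by simp
  also have "\<dots> = A" using V W c(1) by (simp add: assoc_mult_mat[of _ n n _ n _ n])
  finally show ?thesis using that V W by metis
qed

lemma cyclic_for_conjugate:
  assumes "cyclic_for p A" "cyclic_for p B" "degree p = n" "n > 0" "lead_coeff p = 1"
  obtains P Q where "P \<in> carrier_mat n n" "Q \<in> carrier_mat n n" "P * Q = 1\<^sub>m n" "Q * P = 1\<^sub>m n"
    "A = P * B * Q"
proof -
  let ?C = "companion n (coeff p)"
  obtain V W where V: "V \<in> carrier_mat n n" "W \<in> carrier_mat n n" "V * W = 1\<^sub>m n" "W * V = 1\<^sub>m n"
    "A = V * ?C * W"
    using cyclic_for_similar_companion assms by metis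
  obtain V' W' where V': "V' \<in> carrier_mat n n" "W' \<in> carrier_mat n n" "V' * W' = 1\<^sub>m n" "W' * V' = 1\<^sub>m n"
    "B = V' * ?C * W'"
    using cyclic_for_similar_companion assms by metis
  note C = companion_carrier[of n "coeff p"]
  have X: "W' * (V' * X) = X" "V' * (W' * X) = X" "W * (V * X) = X" "V * (W * X) = X" if "X \<in> carrier_mat n n" for X
    using V V' that by (auto intro: mult_cancel_inverse)
  have c: "?C * W \<in> carrier_mat n n" "W' * (V' * (?C * W)) \<in> carrier_mat n n" "V' * W \<in> carrier_mat n n"
    "V' * (?C * W') \<in> carrier_mat n n" "?C * W' \<in> carrier_mat n n"
    using V V' mult_carrier_mat[OF C V(2)] mult_carrier_mat[OF C V'(2)] by auto
  show ?thesis
  proof (rule that)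
    show "V * W' \<in> carrier_mat n n" "V' * W \<in> carrier_mat n n" using V V' by auto
    show "(V * W') * (V' * W) = 1\<^sub>m n" "(V' * W) * (V * W') = 1\<^sub>m n"
      using V V' X by (simp_all add: assoc_mult_mat[of _ n n _ n _ n])
    show "A = (V * W') * B * (V' * W)"
      unfolding V(5) V'(5) using V V' X C c by (simp add: assoc_mult_mat[of _ n n _ n _ n])
  qed
qed

section \<open>Factorizations into matrices with prescribed companion form\<close>

lemma upper_triangular_diag_nonzero:
  fixes A :: "'a::field mat"
  assumes "A \<in> carrier_mat n n" "upper_triangular A"
  shows "det A \<noteq> 0 \<longleftrightarrow> (\<forall>i<n. A $$ (i, i) \<noteq> 0)"
  using upper_triangular_imp_det_eq_0_iff[OF assms] assms(1) by (auto simp: diag_mat_def)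

lemma upper_triangular_mult:
  fixes A B :: "'a::field mat"
  assumes A: "A \<in> carrier_mat n n" "upper_triangular A" and B: "B \<in> carrier_mat n n" "upper_triangular B"
  shows "upper_triangular (A * B)"
proof
  fix i j assume ij: "j < i" "i < dim_row (A * B)"
  then have i: "i < n" using A by simp
  have "A $$ (i, k) * B $$ (k, j) = 0" if "k < n" for k
    using upper_triangularD[OF A(2), of k i] upper_triangularD[OF B(2), of j k] A B i ij that
    by (cases "k < i") auto
  then have "(\<Sum>k<n. A $$ (i, k) * B $$ (k, j)) = 0" by (intro sum.neutral) auto
  then show "(A * B) $$ (i, j) = 0"
    using mat_mat_index_sum[OF A(1) B(1) i, of j] ij i by simp
qed

lemma upper_triangular_inverse:
  fixes A B :: "'a::field mat"
  assumes A: "A \<in> carrier_mat n n" "upper_triangular A" and B: "B \<in> carrier_mat n n" and AB: "A * B = 1\<^sub>m n"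
  shows "upper_triangular B"
proof -
  have "det A * det B = 1" using det_mult[OF A(1) B] AB by simp
  then have d: "A $$ (i, i) \<noteq> 0" if "i < n" for i
    using upper_triangular_diag_nonzero[OF A] that by auto
  have "B $$ (i, j) = 0" if "j < i" "i < n" for i j
    using that
  proof (induction "n - i" arbitrary: i rule: less_induct)
    case less
    have "0 = (\<Sum>k<n. A $$ (i, k) * B $$ (k, j))"
      using mat_mat_index_sum[OF A(1) B less.prems(2), of j] less.prems AB by simp
    also have "\<dots> = A $$ (i, i) * B $$ (i, j) + (\<Sum>k\<in>{..<n} - {i}. A $$ (i, k) * B $$ (k, j))"
      using less.prems by (subst sum.remove[of _ i]) auto
    also have "(\<Sum>k\<in>{..<n} - {i}. A $$ (i, k) * B $$ (k, j)) = 0"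
    proof (rule sum.neutral, rule ballI)
      fix k assume k: "k \<in> {..<n} - {i}"
      show "A $$ (i, k) * B $$ (k, j) = 0"
      proof (cases "k < i")
        case True
        then show ?thesis using upper_triangularD[OF A(2) True] A less.prems by simp
      next
        case False
        then have "B $$ (k, j) = 0" using k less.prems by (intro less.hyps) auto
        then show ?thesis by simp
      qed
    qed
    finally show ?case using d[OF less.prems(2)] by simp
  qed
  then show ?thesis using B by auto
qed

lemma four_block_carrier_Suc:
  assumes "A \<in> carrier_mat 1 1" "D \<in> carrier_mat n n"
  shows "four_block_mat A B C D \<in> carrier_mat (Suc n) (Suc n)"
  using four_block_carrier_mat[OF assms] by simp

lemma mat_1_1_eq: "A \<in> carrier_mat 1 1 \<Longrightarrow> A = A $$ (0, 0) \<cdot>\<^sub>m 1\<^sub>m 1"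
  for A :: "'a::field mat"
  by (rule eq_matI) auto

text \<open>One elimination step: \<open>B\<close> is the Schur complement of the pivot, and its
  conjugating matrices are extended by a diagonal entry 1. The induction hypothesis appears as an
  assumption so that the step can be used both directly and after a pivot has been created.\<close>

lemma ldu_decomposition_if_pivot:
  fixes A :: "'a::field mat"
  assumes IH: "\<And>B :: 'a mat. B \<in> carrier_mat n n \<Longrightarrow> det B \<noteq> 0 \<Longrightarrow>
      \<exists>P Q L R. P \<in> carrier_mat n n \<and> Q \<in> carrier_mat n n \<and> L \<in> carrier_mat n n \<and> R \<in> carrier_mat n n \<and>
      P * Q = 1\<^sub>m n \<and> upper_triangular P \<and> upper_triangular Q \<and> upper_triangular R \<and>
      (\<forall>i<n. \<forall>j<n. i < j \<longrightarrow> L $$ (i, j) = 0) \<and> (\<forall>i<n. L $$ (i, i) = 1) \<and> P * B * Q = L * R"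
    and A: "A \<in> carrier_mat (Suc n) (Suc n)" "det A \<noteq> 0" "A $$ (0, 0) \<noteq> 0"
  shows "\<exists>P Q L R. P \<in> carrier_mat (Suc n) (Suc n) \<and> Q \<in> carrier_mat (Suc n) (Suc n) \<and>
    L \<in> carrier_mat (Suc n) (Suc n) \<and> R \<in> carrier_mat (Suc n) (Suc n) \<and>
    P * Q = 1\<^sub>m (Suc n) \<and> upper_triangular P \<and> upper_triangular Q \<and> upper_triangular R \<and>
    (\<forall>i<Suc n. \<forall>j<Suc n. i < j \<longrightarrow> L $$ (i, j) = 0) \<and> (\<forall>i<Suc n. L $$ (i, i) = 1) \<and> P * A * Q = L * R"
proof -
  obtain D \<rho> s E where sp: "split_block A 1 1 = (D, \<rho>, s, E)" by (cases "split_block A 1 1")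
  have c: "D \<in> carrier_mat 1 1" "\<rho> \<in> carrier_mat 1 n" "s \<in> carrier_mat n 1" "E \<in> carrier_mat n n"
    and Ab: "A = four_block_mat D \<rho> s E"
    using split_block[OF sp, of n n] A by auto
  define d where "d = A $$ (0, 0)"
  have D: "D = d \<cdot>\<^sub>m 1\<^sub>m 1" using mat_1_1_eq[OF c(1)] Ab c by (simp add: d_def)
  have d0: "d \<noteq> 0" using A by (simp add: d_def)
  define t where "t = inverse d \<cdot>\<^sub>m s"
  have t: "t \<in> carrier_mat n 1" and ts: "s = d \<cdot>\<^sub>m t" using c d0 by (auto simp: t_def intro!: eq_matI)
  define B where "B = E - t * \<rho>"
  have B: "B \<in> carrier_mat n n" using c t by (auto simp: B_def)
  have EB: "E = t * \<rho> + B" using c t by (auto simp: B_def intro!: eq_matI)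
  have fact: "four_block_mat (1\<^sub>m 1) (0\<^sub>m 1 n) t (1\<^sub>m n) * four_block_mat D \<rho> (0\<^sub>m n 1) B = A"
    unfolding Ab using c t B
    by (simp add: mult_four_block_mat[of _ 1 1 _ n _ n _ _ 1 _ n] D ts EB mult_smult_distrib[of _ n 1 _ 1])
  have "det A = det (four_block_mat (1\<^sub>m 1) (0\<^sub>m 1 n) t (1\<^sub>m n)) * det (four_block_mat D \<rho> (0\<^sub>m n 1) B)"
    unfolding fact[symmetric] by (rule det_mult[of _ "Suc n"]) (use c t B in \<open>auto intro!: four_block_carrier_Suc\<close>)
  also have "det (four_block_mat D \<rho> (0\<^sub>m n 1) B) = det D * det B"
    by (rule det_four_block_mat_lower_left_zero) (use c B in auto)
  finally have "det B \<noteq> 0" using A(2) by auto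
  then obtain P Q L R where ih: "P \<in> carrier_mat n n" "Q \<in> carrier_mat n n" "L \<in> carrier_mat n n" "R \<in> carrier_mat n n"
      "P * Q = 1\<^sub>m n" "upper_triangular P" "upper_triangular Q" "upper_triangular R"
      "\<forall>i<n. \<forall>j<n. i < j \<longrightarrow> L $$ (i, j) = 0" "\<forall>i<n. L $$ (i, i) = 1" "P * B * Q = L * R"
    using IH[OF B] by blast
  define P' where "P' = four_block_mat (1\<^sub>m 1) (0\<^sub>m 1 n) (0\<^sub>m n 1) P"
  define Q' where "Q' = four_block_mat (1\<^sub>m 1) (0\<^sub>m 1 n) (0\<^sub>m n 1) Q"
  define L' where "L' = four_block_mat (1\<^sub>m 1) (0\<^sub>m 1 n) (P * t) L"
  define R' where "R' = four_block_mat D (\<rho> * Q) (0\<^sub>m n 1) R"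
  have Pt: "P * t \<in> carrier_mat n 1" "\<rho> * Q \<in> carrier_mat 1 n" "P * s \<in> carrier_mat n 1" "P * E \<in> carrier_mat n n"
     "t * \<rho> \<in> carrier_mat n n" "t * (\<rho> * Q) \<in> carrier_mat n n"
    using ih t c by auto
  have PQ': "P' * Q' = 1\<^sub>m (Suc n)"
    unfolding P'_def Q'_def using ih by (simp add: mult_four_block_mat[of _ 1 1 _ n _ n _ _ 1 _ n])
  have PAQ: "P' * A * Q' = four_block_mat D (\<rho> * Q) (P * s) (P * E * Q)"
    unfolding P'_def Q'_def Ab using ih c Pt
    by (simp add: mult_four_block_mat[of _ 1 1 _ n _ n _ _ 1 _ n])
  have "P * E * Q = P * t * (\<rho> * Q) + L * R"
  proof -
    have "P * E * Q = P * (t * \<rho> + B) * Q" by (simp add: EB)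
    also have "\<dots> = P * (t * \<rho>) * Q + P * B * Q"
      using ih Pt B by (simp add: mult_add_distrib_mat[of _ n n _ n] add_mult_distrib_mat[of _ n n _ _ n])
    also have "P * (t * \<rho>) * Q = P * t * (\<rho> * Q)"
      using assoc_mult_mat[OF ih(1) Pt(5) ih(2)] assoc_mult_mat[OF t c(2) ih(2)] assoc_mult_mat[OF ih(1) t Pt(2)]
      by simp
    finally show ?thesis using ih by simp
  qed
  moreover have "P * s = P * t * D"
    using ih t by (simp add: ts D mult_smult_distrib[of _ n n _ 1] mult_smult_distrib[of _ n 1 _ 1])
  ultimately have eq: "P' * A * Q' = L' * R'"
    unfolding PAQ L'_def R'_def using ih c Pt
    by (simp add: mult_four_block_mat[of _ 1 1 _ n _ n _ _ 1 _ n])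
  show ?thesis
  proof (intro exI conjI)
    show "P' \<in> carrier_mat (Suc n) (Suc n)" "Q' \<in> carrier_mat (Suc n) (Suc n)"
      "L' \<in> carrier_mat (Suc n) (Suc n)" "R' \<in> carrier_mat (Suc n) (Suc n)"
      unfolding P'_def Q'_def L'_def R'_def using ih c by (auto intro!: four_block_carrier_Suc)
    show "upper_triangular P'" "upper_triangular Q'" "upper_triangular R'"
      unfolding P'_def Q'_def R'_def using ih(1,2,4,6-8) c(1)
      by (auto intro!: upper_triangular_four_block[of _ "Suc 0" _ n] simp: D)
    show "\<forall>i<Suc n. \<forall>j<Suc n. i < j \<longrightarrow> L' $$ (i, j) = 0"
      using ih Pt by (auto simp: L'_def)
    show "\<forall>i<Suc n. L' $$ (i, i) = 1"
      using ih Pt by (auto simp: L'_def)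
  qed (use eq PQ' in auto)
qed

text \<open>An invertible matrix need not have an LU factorization, but some conjugate by an upper
  triangular matrix does. Such conjugations preserve the shape \<open>upper_right_block\<close>, so
  they can be undone at the end of the factorization into cyclic matrices.\<close>

lemma ldu_decomposition:
  fixes A :: "'a::field mat"
  assumes "A \<in> carrier_mat n n" "det A \<noteq> 0"
  shows "\<exists>P Q L R. P \<in> carrier_mat n n \<and> Q \<in> carrier_mat n n \<and> L \<in> carrier_mat n n \<and> R \<in> carrier_mat n n \<and>
      P * Q = 1\<^sub>m n \<and> upper_triangular P \<and> upper_triangular Q \<and> upper_triangular R \<and>
      (\<forall>i<n. \<forall>j<n. i < j \<longrightarrow> L $$ (i, j) = 0) \<and> (\<forall>i<n. L $$ (i, i) = 1) \<and> P * A * Q = L * R"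
  using assms
proof (induction n arbitrary: A)
  case 0
  then show ?case by (intro exI[of _ "1\<^sub>m 0"]) auto
next
  case (Suc n)
  note A = Suc.prems
  show ?case
  proof (cases "A $$ (0, 0) = 0")
    case False
    then show ?thesis using ldu_decomposition_if_pivot[OF Suc.IH A] by blast
  next
    case True
    have "\<exists>j<Suc n. A $$ (j, 0) \<noteq> 0"
    proof (rule ccontr)
      assume "\<not> ?thesis"
      then have "det A = 0" using laplace_expansion_column[OF A(1), of 0] by simp
      then show False using A by simp
    qed
    then obtain j where j: "j < Suc n" "A $$ (j, 0) \<noteq> 0" by blast
    then have j0: "0 < j" using True by (cases j) auto
    \<comment> \<open>\<open>T t\<close> is the identity plus \<open>t\<close> in position (0, j).
      Conjugation by \<open>T 1\<close> adds row \<open>j\<close> to row 0 and then alters column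
      \<open>j\<close> only; since \<open>j > 0\<close>, the nonzero entry
      \<open>A $$ (j, 0)\<close> becomes the pivot.\<close>
    define T where "T t = mat (Suc n) (Suc n) (\<lambda>(i, k). (if i = k then 1 else 0) + (if i = 0 \<and> k = j then t else 0 :: 'a))" for t
    have T: "T t \<in> carrier_mat (Suc n) (Suc n)" for t by (simp add: T_def)
    have Tmult: "(T t * M) $$ (i, k) = M $$ (i, k) + (if i = 0 then t * M $$ (j, k) else 0)"
      if "M \<in> carrier_mat (Suc n) (Suc n)" "i < Suc n" "k < Suc n" for t M i k
    proof -
      have "(T t * M) $$ (i, k) = (\<Sum>l<Suc n. (if l = i then M $$ (l, k) else 0) + (if l = j then (if i = 0 then t * M $$ (l, k) else 0) else 0))"
        unfolding mat_mat_index_sum[OF T that] using that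
        by (intro sum.cong refl) (auto simp: T_def algebra_simps)
      also have "\<dots> = M $$ (i, k) + (if i = 0 then t * M $$ (j, k) else 0)"
        unfolding sum.distrib using that j by (simp add: sum.delta del: sum.lessThan_Suc)
      finally show ?thesis .
    qed
    have TT: "T 1 * T (- 1) = 1\<^sub>m (Suc n)"
    proof (rule eq_matI)
      fix i k assume "i < dim_row (1\<^sub>m (Suc n) :: 'a mat)" "k < dim_col (1\<^sub>m (Suc n) :: 'a mat)"
      then have ik: "i < Suc n" "k < Suc n" by auto
      show "(T 1 * T (- 1)) $$ (i, k) = 1\<^sub>m (Suc n) $$ (i, k)"
        unfolding Tmult[OF T ik] using ik j j0 by (auto simp: T_def)
    qed (simp_all add: T_def)
    have up: "upper_triangular (T t)" for t using j0 by (auto simp: T_def upper_triangular_def)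
    let ?A = "T 1 * A * T (- 1)"
    have A': "?A \<in> carrier_mat (Suc n) (Suc n)" using A T by (meson mult_carrier_mat)
    have "det (T 1) * det (T (- 1)) = 1" using TT det_mult[OF T T, of 1 "-1"] by simp
    then have "det ?A \<noteq> 0" using A det_mult[OF mult_carrier_mat[OF T A(1)] T, of 1 "-1"] det_mult[OF T A(1), of 1] by auto
    have "?A $$ (0, 0) = (\<Sum>l<Suc n. (T 1 * A) $$ (0, l) * T (- 1) $$ (l, 0))"
      by (rule mat_mat_index_sum[OF mult_carrier_mat[OF T A(1)] T]) auto
    also have "\<dots> = (\<Sum>l<Suc n. if l = 0 then (T 1 * A) $$ (0, l) else 0)"
      by (intro sum.cong refl) (use j0 in \<open>auto simp: T_def\<close>)
    also have "\<dots> = (T 1 * A) $$ (0, 0)" by (simp add: sum.delta del: sum.lessThan_Suc)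
    also have "\<dots> = A $$ (j, 0)" using Tmult[OF A(1), of 0 0 1] True by simp
    finally have "?A $$ (0, 0) \<noteq> 0" using j by simp
    then obtain P Q L R where pq: "P \<in> carrier_mat (Suc n) (Suc n)" "Q \<in> carrier_mat (Suc n) (Suc n)"
      "L \<in> carrier_mat (Suc n) (Suc n)" "R \<in> carrier_mat (Suc n) (Suc n)"
      "P * Q = 1\<^sub>m (Suc n)" "upper_triangular P" "upper_triangular Q" "upper_triangular R"
      "\<forall>i<Suc n. \<forall>j<Suc n. i < j \<longrightarrow> L $$ (i, j) = 0" "\<forall>i<Suc n. L $$ (i, i) = 1" "P * ?A * Q = L * R"
      using ldu_decomposition_if_pivot[OF Suc.IH A' \<open>det ?A \<noteq> 0\<close>] by blast
    have TX: "T 1 * (T (- 1) * X) = X" if "X \<in> carrier_mat (Suc n) (Suc n)" for X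
      using mult_cancel_inverse[OF T T that TT] .
    have "P * T 1 * (T (- 1) * Q) = 1\<^sub>m (Suc n)"
      by (simp only: assoc_mult_mat[of _ "Suc n" "Suc n" _ "Suc n" _ "Suc n"] mult_carrier_square pq T TX)
    moreover have "P * T 1 * A * (T (- 1) * Q) = L * R"
      unfolding pq(11)[symmetric]
      by (simp only: assoc_mult_mat[of _ "Suc n" "Suc n" _ "Suc n" _ "Suc n"] mult_carrier_square pq(1-4) T A(1))
    moreover have "P * T 1 \<in> carrier_mat (Suc n) (Suc n)" "T (- 1) * Q \<in> carrier_mat (Suc n) (Suc n)"
      using pq T by (meson mult_carrier_mat)+
    ultimately show ?thesis
      using upper_triangular_mult[OF pq(1,6) T up] upper_triangular_mult[OF T up pq(2,7)] pq(3,4,8-10)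
      by (intro exI[of _ "P * T 1"] exI[of _ "T (- 1) * Q"] exI[of _ L] exI[of _ R] conjI)
  qed
qed

section \<open>A unit lower triangular matrix times a shift\<close>

lemma det_companion:
  assumes "n > 0"
  shows "det (companion n c) = (- 1) ^ n * c 0"
proof -
  have "det (companion n c) = (\<Sum>j<n. companion n c $$ (0, j) * cofactor (companion n c) 0 j)"
    using laplace_expansion_row[OF companion_carrier assms] .
  also have "\<dots> = (\<Sum>j<n. if j = n - 1 then - c 0 * cofactor (companion n c) 0 j else 0)"
    using assms by (intro sum.cong refl) (auto simp: companion_def)
  also have "\<dots> = - c 0 * cofactor (companion n c) 0 (n - 1)"
    using assms by (simp add: sum.delta)
  also have "mat_delete (companion n c) 0 (n - 1) = 1\<^sub>m (n - 1)"
    by (rule eq_matI) (auto simp: mat_delete_def companion_def)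
  then have "cofactor (companion n c) 0 (n - 1) = (- 1) ^ (n - 1)"
    by (simp add: cofactor_def)
  finally show ?thesis using assms by (cases n) auto
qed

text \<open>Row \<open>i\<close> is \<open>e_0 (L K)^i\<close> for a matrix \<open>K\<close> that
  shifts in all rows but the last: multiply by \<open>L\<close>, then move every entry one place to
  the right. The sum stops at \<open>i\<close> because row \<open>i\<close> has no nonzero entry
  further right.\<close>

fun krylov_row :: "'a::field mat \<Rightarrow> nat \<Rightarrow> nat \<Rightarrow> 'a" where
  "krylov_row L 0 j = (if j = 0 then 1 else 0)"
| "krylov_row L (Suc i) 0 = 0"
| "krylov_row L (Suc i) (Suc j) = (\<Sum>k\<le>i. krylov_row L i k * L $$ (k, j))"

lemma krylov_row_unitriangular:
  assumes L: "\<And>i j. i < j \<Longrightarrow> j < n \<Longrightarrow> L $$ (i, j) = 0" "\<And>i. i < n \<Longrightarrow> L $$ (i, i) = 1"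
    and "i < n" "j < n"
  shows "(i < j \<longrightarrow> krylov_row L i j = 0) \<and> krylov_row L i i = 1"
  using assms(3,4)
proof (induction i arbitrary: j)
  case 0
  then show ?case by auto
next
  case (Suc i)
  have "krylov_row L (Suc i) j = 0" if "Suc i < j"
  proof (cases j)
    case (Suc j')
    have "krylov_row L i k * L $$ (k, j') = 0" if "k \<le> i" for k
      using L(1)[of k j'] that \<open>Suc i < j\<close> Suc Suc.prems by simp
    then have "(\<Sum>k\<le>i. krylov_row L i k * L $$ (k, j')) = 0" by (intro sum.neutral) auto
    then show ?thesis using Suc by simp
  qed (use that in simp)
  moreover have "(\<Sum>k\<le>i. krylov_row L i k * L $$ (k, i)) = krylov_row L i i * L $$ (i, i)"
    using L(1)[of _ i] Suc.prems by (subst sum.remove[of _ i]) (auto intro!: sum.neutral)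
  moreover have "krylov_row L i i = 1" using Suc.IH[of i] Suc.prems by simp
  ultimately show ?case using L(2)[of i] Suc.prems by simp
qed

text \<open>The rows of \<open>\<Psi>\<close> are the iterates of \<open>e\<^sub>0\<close> under \<open>L * K\<close>; apart from the last
  one they do not depend on the last row of \<open>K\<close>.\<close>

lemma lower_times_shift_companion:
  fixes L :: "'a::field mat"
  assumes Lc: "L \<in> carrier_mat n n" and n0: "n > 0"
    and L: "\<And>i j. i < j \<Longrightarrow> j < n \<Longrightarrow> L $$ (i, j) = 0" "\<And>i. i < n \<Longrightarrow> L $$ (i, i) = 1"
  shows "\<exists>K \<Psi> \<Phi>. K \<in> carrier_mat n n \<and> \<Psi> \<in> carrier_mat n n \<and> \<Phi> \<in> carrier_mat n n \<and>
    (\<forall>i<n - 1. \<forall>j<n. K $$ (i, j) = (if j = Suc i then 1 else 0)) \<and> \<Phi> * \<Psi> = 1\<^sub>m n \<and>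
    L * K = \<Phi> * transpose_mat (companion n c) * \<Psi>"
proof -
  define \<Psi> where "\<Psi> = mat n n (\<lambda>(i, j). krylov_row L i j)"
  have \<Psi>: "\<Psi> \<in> carrier_mat n n" by (simp add: \<Psi>_def)
  have tri: "\<Psi> $$ (i, j) = 0" if "i < j" "j < n" for i j
    using krylov_row_unitriangular[OF L, where i = i and j = j] that less_trans[OF that] by (simp add: \<Psi>_def)
  have "upper_triangular (transpose_mat \<Psi>)" using tri \<Psi> by auto
  moreover have "\<forall>i<n. transpose_mat \<Psi> $$ (i, i) \<noteq> 0"
    using krylov_row_unitriangular[OF L] by (auto simp: \<Psi>_def)
  ultimately have "det (transpose_mat \<Psi>) \<noteq> 0" using upper_triangular_diag_nonzero[of "transpose_mat \<Psi>" n] \<Psi> by simp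
  then have "det \<Psi> \<noteq> 0" using det_transpose[OF \<Psi>] by simp
  then obtain \<Phi> where \<Phi>: "\<Phi> \<in> carrier_mat n n" "\<Phi> * \<Psi> = 1\<^sub>m n" "\<Psi> * \<Phi> = 1\<^sub>m n"
    using det_nonzero_inverse[OF \<Psi>] by blast
  define B where "B = \<Psi> * L"
  have B: "B \<in> carrier_mat n n" using \<Psi> Lc by (simp add: B_def)
  have Bij: "B $$ (i, j) = (\<Sum>k\<le>i. krylov_row L i k * L $$ (k, j))" if "i < n" "j < n" for i j
  proof -
    have "B $$ (i, j) = (\<Sum>k<n. \<Psi> $$ (i, k) * L $$ (k, j))"
      unfolding B_def using mat_mat_index_sum[OF \<Psi> Lc that] .
    also have "\<dots> = (\<Sum>k\<le>i. \<Psi> $$ (i, k) * L $$ (k, j))"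
      by (rule sum.mono_neutral_right) (use that tri in auto)
    finally show ?thesis using that by (simp add: \<Psi>_def)
  qed
  have B0: "B $$ (i, j) = 0" if "i < j" "j < n" for i j
    using Bij[of i j] that L(1)[of _ j] by (auto intro!: sum.neutral)
  have B1: "B $$ (i, i) = 1" if "i < n" for i
  proof -
    have "B $$ (i, i) = krylov_row L i i * L $$ (i, i)"
      unfolding Bij[OF that that] using L(1)[of _ i] that by (subst sum.remove[of _ i]) (auto intro!: sum.neutral)
    then show ?thesis using krylov_row_unitriangular[OF L, where i = i and j = i] L(2)[of i] that by simp
  qed
  define C where "C = transpose_mat (companion n c)"
  have C: "C \<in> carrier_mat n n" by (simp add: C_def companion_def)
  \<comment> \<open>As \<open>B\<close> is unit lower triangular, the last row of
    \<open>B * K = C * \<Psi>\<close> can be solved for the last row of \<open>K\<close>. The other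
    rows of the equation are the recursion of \<open>krylov_row\<close>.\<close>
  define K where "K = mat n n (\<lambda>(i, j). if i = n - 1
    then (C * \<Psi>) $$ (n - 1, j) - (\<Sum>k<n - 1. B $$ (n - 1, k) * (if j = Suc k then 1 else 0))
    else if j = Suc i then 1 else 0)"
  have K: "K \<in> carrier_mat n n" by (simp add: K_def)
  have s: "{..<n} = insert (n - 1) {..<n - 1}" using n0 by auto
  have "B * K = C * \<Psi>"
  proof (rule eq_matI)
    fix i j assume "i < dim_row (C * \<Psi>)" "j < dim_col (C * \<Psi>)"
    then have ij: "i < n" "j < n" using C \<Psi> by auto
    have "(B * K) $$ (i, j) = B $$ (i, n - 1) * K $$ (n - 1, j) + (\<Sum>k<n - 1. B $$ (i, k) * K $$ (k, j))"
      unfolding mat_mat_index_sum[OF B K ij] s by simp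
    also have "(\<Sum>k<n - 1. B $$ (i, k) * K $$ (k, j)) = (\<Sum>k<n - 1. B $$ (i, k) * (if j = Suc k then 1 else 0))"
      using ij by (intro sum.cong refl) (auto simp: K_def)
    finally have e: "(B * K) $$ (i, j) = B $$ (i, n - 1) * K $$ (n - 1, j) + (\<Sum>k<n - 1. B $$ (i, k) * (if j = Suc k then 1 else 0))" .
    show "(B * K) $$ (i, j) = (C * \<Psi>) $$ (i, j)"
    proof (cases "i = n - 1")
      case True
      then show ?thesis unfolding e using ij B1[of "n - 1"] by (simp add: K_def)
    next
      case False
      have "(C * \<Psi>) $$ (i, j) = (\<Sum>k<n. C $$ (i, k) * \<Psi> $$ (k, j))"
        by (rule mat_mat_index_sum[OF C \<Psi> ij])
      also have "\<dots> = (\<Sum>k<n. if k = Suc i then \<Psi> $$ (k, j) else 0)"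
        using False ij by (intro sum.cong refl) (auto simp: C_def companion_def)
      also have "\<dots> = \<Psi> $$ (Suc i, j)" using False ij by (simp add: sum.delta)
      finally have r: "(C * \<Psi>) $$ (i, j) = \<Psi> $$ (Suc i, j)" .
      have "(\<Sum>k<n - 1. B $$ (i, k) * (if j = Suc k then 1 else 0)) = \<Psi> $$ (Suc i, j)"
      proof (cases j)
        case 0
        then show ?thesis using ij False by (simp add: \<Psi>_def)
      next
        case (Suc j')
        have "(\<Sum>k<n - 1. B $$ (i, k) * (if j = Suc k then 1 else 0)) = (\<Sum>k<n - 1. if k = j' then B $$ (i, k) else 0)"
          using Suc by (intro sum.cong refl) auto
        also have "\<dots> = B $$ (i, j')" using Suc ij by (simp add: sum.delta)
        also have "\<dots> = \<Psi> $$ (Suc i, j)" using Bij[of i j'] Suc ij False by (simp add: \<Psi>_def)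
        finally show ?thesis .
      qed
      moreover have "B $$ (i, n - 1) = 0" using B0[of i "n - 1"] False ij by simp
      ultimately show ?thesis unfolding e r by simp
    qed
  qed (use B K C \<Psi> in auto)
  then have "\<Phi> * (\<Psi> * (L * K)) = \<Phi> * (C * \<Psi>)"
    using \<Psi> Lc K unfolding B_def by (simp add: assoc_mult_mat[of _ n n _ n _ n])
  moreover have "\<Phi> * (\<Psi> * (L * K)) = L * K"
    by (rule mult_cancel_inverse[OF \<Psi> \<Phi>(1) _ \<Phi>(2)]) (use Lc K in auto)
  ultimately have "L * K = \<Phi> * C * \<Psi>" using \<Phi> C \<Psi> by (simp add: assoc_mult_mat[of _ n n _ n _ n])
  moreover have "\<forall>i<n - 1. \<forall>j<n. K $$ (i, j) = (if j = Suc i then 1 else 0)" by (auto simp: K_def)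
  ultimately show ?thesis using K \<Psi> \<Phi> unfolding C_def by blast
qed


section \<open>Prescribing the polynomial of a Hessenberg matrix\<close>

definition upper_right_block :: "nat \<Rightarrow> nat \<Rightarrow> 'a::zero mat \<Rightarrow> bool" where
  "upper_right_block n m F \<longleftrightarrow> F \<in> carrier_mat n n \<and>
     (\<forall>i<n. \<forall>j<n. \<not> (i < m \<and> m \<le> j) \<longrightarrow> F $$ (i, j) = 0)"

text \<open>Upper triangular matrices preserve the span of the first \<open>m\<close> unit vectors;
  the matrices in question vanish on this span and map everything into it.\<close>

lemma upper_right_block_conjugate:
  fixes F :: "'a::field mat"
  assumes F: "upper_right_block n m F" and P: "P \<in> carrier_mat n n" "upper_triangular P"
    and Q: "Q \<in> carrier_mat n n" "upper_triangular Q"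
  shows "upper_right_block n m (P * F * Q)"
proof -
  have Fc: "F \<in> carrier_mat n n" and F0: "\<And>i j. i < n \<Longrightarrow> j < n \<Longrightarrow> \<not> (i < m \<and> m \<le> j) \<Longrightarrow> F $$ (i, j) = 0"
    using F by (auto simp: upper_right_block_def)
  have PF: "P * F \<in> carrier_mat n n" using P Fc by auto
  have PF0: "(P * F) $$ (i, j) = 0" if "i < n" "j < n" "\<not> (i < m \<and> m \<le> j)" for i j
  proof -
    have "P $$ (i, k) * F $$ (k, j) = 0" if "k < n" for k
    proof (cases "k < i")
      case True
      then show ?thesis using upper_triangularD[OF P(2) True] P \<open>i < n\<close> by simp
    next
      case False
      then show ?thesis using F0[of k j] that \<open>j < n\<close> \<open>\<not> (i < m \<and> m \<le> j)\<close> by auto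
    qed
    then show ?thesis unfolding mat_mat_index_sum[OF P(1) Fc that(1,2)] by (intro sum.neutral) auto
  qed
  have "(P * F * Q) $$ (i, j) = 0" if "i < n" "j < n" "\<not> (i < m \<and> m \<le> j)" for i j
  proof -
    have "(P * F) $$ (i, k) * Q $$ (k, j) = 0" if "k < n" for k
    proof (cases "j < k")
      case True
      then show ?thesis using upper_triangularD[OF Q(2) True] Q that by simp
    next
      case False
      then show ?thesis using PF0[of i k] that \<open>i < n\<close> \<open>\<not> (i < m \<and> m \<le> j)\<close> by auto
    qed
    then show ?thesis unfolding mat_mat_index_sum[OF PF Q(1) that(1,2)] by (intro sum.neutral) auto
  qed
  then show ?thesis using PF Q unfolding upper_right_block_def by auto
qed

lemma companion_mult_index:
  assumes M: "M \<in> carrier_mat n k" and "i < n" "j < k"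
  shows "(companion n c * M) $$ (i, j) = (if i = 0 then 0 else M $$ (i - 1, j)) - c i * M $$ (n - 1, j)"
proof -
  have "(companion n c * M) $$ (i, j) = (\<Sum>l<n. (if l = n - 1 then - c i * M $$ (l, j) else 0) + (if l = i - 1 then (if i = 0 then 0 else M $$ (l, j)) else 0))"
    unfolding mat_mat_index_sum[OF companion_carrier assms] using assms
    by (intro sum.cong refl) (auto simp: companion_def)
  then show ?thesis unfolding sum.distrib using assms by (auto simp: sum.delta)
qed

text \<open>The power series quotient of the reversals of two monic polynomials of degree
  \<open>n\<close> with lower coefficients \<open>b\<close> and \<open>c\<close>: with
  \<open>c n = 1\<close> understood, the sum of a_i c_(n-k+i) over i \<le> k equals b_(n-k).\<close>

fun toeplitz_coeff :: "nat \<Rightarrow> (nat \<Rightarrow> 'a::field) \<Rightarrow> (nat \<Rightarrow> 'a) \<Rightarrow> nat \<Rightarrow> 'a" where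
  "toeplitz_coeff n b c k = (if k = 0 then 1
     else b (n - k) - (\<Sum>i<k. toeplitz_coeff n b c i * c (n - k + i)))"

declare toeplitz_coeff.simps [simp del]

text \<open>In the basis of iterates \<open>t\<^sup>i\<close> of a companion matrix with polynomial \<open>b\<close>, the basis
  \<open>1, t, \<dots>, t\<^sup>m, t\<^sup>m (t + a\<^sub>1), t\<^sup>m (t\<^sup>2 + a\<^sub>1 t + a\<^sub>2), \<dots>\<close> becomes the chain of a matrix that
  differs from the given one only in the admitted positions; the \<open>a\<^sub>i\<close> are chosen
  so as to make \<open>c\<close> its polynomial.\<close>

lemma companion_change_polynomial:
  fixes b c :: "nat \<Rightarrow> 'a::field"
  assumes m: "1 \<le> m" "m < n" and bc: "b 0 = c 0"
  shows "\<exists>W G. W \<in> carrier_mat n n \<and> upper_triangular W \<and> det W \<noteq> 0 \<and> G \<in> carrier_mat n n \<and>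
    (\<forall>i<n. \<forall>j<n. \<not> (i < m \<and> m \<le> j) \<longrightarrow> G $$ (i, j) = 0) \<and>
    W * companion n c = companion n b * W + companion n b * G"
proof -
  define a where "a = toeplitz_coeff n b c"
  have a0: "a 0 = 1" by (simp add: a_def toeplitz_coeff.simps)
  have a: "a (n - i) = b i - (\<Sum>k<n - i. a k * c (i + k))" if "i < n" for i
    unfolding a_def using that by (subst toeplitz_coeff.simps) simp
  define w where "w i j = (if i = j then 1 else if m \<le> i \<and> i \<le> j then a (j - i) else 0)" for i j
  define W where "W = mat n n (\<lambda>(i, j). w i j)"
  have W: "W \<in> carrier_mat n n" by (simp add: W_def)
  have up: "upper_triangular W" by (auto simp: W_def w_def)
  have dW: "det W \<noteq> 0" using upper_triangular_diag_nonzero[OF W up] by (simp add: W_def w_def)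
  define Z where "Z = W * companion n c - companion n b * W"
  have Z: "Z \<in> carrier_mat n n"
    unfolding Z_def by (rule minus_carrier_mat[OF mult_carrier_mat[OF companion_carrier W]])
  have Wc: "(W * companion n c) $$ (i, j) = (if j = n - 1 then - (\<Sum>k<n. w i k * c k) else w i (Suc j))"
    if "i < n" "j < n" for i j
  proof -
    have "(W * companion n c) $$ (i, j) = (\<Sum>k<n. w i k * companion n c $$ (k, j))"
      unfolding mat_mat_index_sum[OF W companion_carrier that] using that by (simp add: W_def)
    also have "\<dots> = (if j = n - 1 then - (\<Sum>k<n. w i k * c k) else (\<Sum>k<n. if k = Suc j then w i k else 0))"
    proof (cases "j = n - 1")
      case True
      then show ?thesis using that by (simp add: companion_def sum_negf)
    next
      case False
      then show ?thesis using that by (simp only: if_False) (rule sum.cong, auto simp: companion_def)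
    qed
    finally show ?thesis using that by (auto simp: sum.delta)
  qed
  have cW: "(companion n b * W) $$ (i, j) = (if i = 0 then 0 else w (i - 1) j) - b i * (if j = n - 1 then 1 else 0)"
    if "i < n" "j < n" for i j
    unfolding companion_mult_index[OF W that] using that by (auto simp: W_def w_def)
  have Zij: "Z $$ (i, j) = (if j = n - 1 then - (\<Sum>k<n. w i k * c k) + b i else w i (Suc j)) - (if i = 0 then 0 else w (i - 1) j)"
    if "i < n" "j < n" for i j
    using that W Wc[OF that] cW[OF that] by (simp add: Z_def del: index_mult_mat(1))
  \<comment> \<open>The choice of \<open>a\<close> settles the last column below row
    \<open>m\<close>. Position (0, n - 1) is out of its reach, and there \<open>b 0 = c 0\<close> is
    used.\<close>
  have Z0: "Z $$ (i, j) = 0" if ij: "i < n" "j < n" and out: "\<not> (1 \<le> i \<and> i \<le> m \<and> m \<le> j)" for i j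
  proof (cases "j = n - 1")
    case False
    then show ?thesis using m ij out unfolding Zij[OF ij] by (auto simp: w_def a0)
  next
    case True
    show ?thesis
    proof (cases "i = 0")
      case True
      have "(\<Sum>k<n. w 0 k * c k) = (\<Sum>k<n. if k = 0 then c 0 else 0)"
        using m by (intro sum.cong refl) (auto simp: w_def)
      also have "\<dots> = c 0" using m by (simp add: sum.delta)
      finally show ?thesis using \<open>j = n - 1\<close> True bc unfolding Zij[OF ij] by simp
    next
      case False
      then have im: "m < i" using out m \<open>j = n - 1\<close> by auto
      have "(\<Sum>k<n. w i k * c k) = (\<Sum>k\<in>{i..<n}. a (k - i) * c k)"
        using im by (intro sum.mono_neutral_cong_right) (auto simp: w_def a0)
      also have "\<dots> = (\<Sum>k<n - i. a k * c (i + k))"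
        by (rule sum.reindex_bij_witness[of _ "\<lambda>k. i + k" "\<lambda>k. k - i"]) auto
      finally have "(\<Sum>k<n. w i k * c k) = b i - a (n - i)" using a[OF ij(1)] by simp
      moreover have "w (i - 1) (n - 1) = a (n - i)" using im ij by (auto simp: w_def)
      ultimately show ?thesis using \<open>j = n - 1\<close> False unfolding Zij[OF ij] by simp
    qed
  qed
  \<comment> \<open>Row \<open>i\<close> of \<open>companion n b * G\<close> is row
    \<open>i - 1\<close> of \<open>G\<close> minus a multiple of row \<open>n - 1\<close>, which is
    zero as \<open>m < n\<close>. Hence \<open>G\<close> is \<open>Z\<close> moved up by one
    row.\<close>
  define G where "G = mat n n (\<lambda>(i, j). if i < m then Z $$ (Suc i, j) else 0)"
  have G: "G \<in> carrier_mat n n" by (simp add: G_def)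
  have "companion n b * G = Z"
  proof (rule eq_matI)
    fix i j assume "i < dim_row Z" "j < dim_col Z"
    then have ij: "i < n" "j < n" using Z by auto
    show "(companion n b * G) $$ (i, j) = Z $$ (i, j)"
    proof (cases "1 \<le> i \<and> i \<le> m")
      case True
      then show ?thesis unfolding companion_mult_index[OF G ij] using ij m by (auto simp: G_def)
    next
      case False
      then have "Z $$ (i, j) = 0" using Z0[OF ij] by blast
      then show ?thesis unfolding companion_mult_index[OF G ij] using ij m False by (auto simp: G_def)
    qed
  qed (use Z G in \<open>auto simp: companion_def\<close>)
  then have "W * companion n c = companion n b * W + companion n b * G"
    using W by (auto simp: Z_def companion_def intro!: eq_matI)
  moreover have "G $$ (i, j) = 0" if "i < n" "j < n" "\<not> (i < m \<and> m \<le> j)" for i j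
    using that m Z0[of "Suc i" j] by (auto simp: G_def)
  ultimately show ?thesis using W up dW G by blast
qed

text \<open>Nonzero subdiagonal entries make the first unit vector cyclic: each application of
  \<open>Y\<close> reaches exactly one coordinate further, so the matrix of iterates is triangular
  and invertible.\<close>

lemma hessenberg_krylov:
  fixes Y :: "'a::field mat"
  assumes Y: "Y \<in> carrier_mat n n"
    and H: "\<And>i j. i < n \<Longrightarrow> j < n \<Longrightarrow> Suc j < i \<Longrightarrow> Y $$ (i, j) = 0"
      "\<And>j. Suc j < n \<Longrightarrow> Y $$ (Suc j, j) \<noteq> 0"
    and n0: "0 < n"
  shows "\<exists>V b. V \<in> carrier_mat n n \<and> upper_triangular V \<and> det V \<noteq> 0 \<and> Y * V = V * companion n b"
proof -
  define V where "V = mat n n (\<lambda>(i, k). (Y ^\<^sub>m k) $$ (i, 0))"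
  have V: "V \<in> carrier_mat n n" by (simp add: V_def)
  have pow: "(Y ^\<^sub>m Suc k) $$ (i, 0) = (\<Sum>l<n. Y $$ (i, l) * (Y ^\<^sub>m k) $$ (l, 0))" if "i < n" for i k
    unfolding pow_mat_Suc_left[OF Y] using mat_mat_index_sum[OF Y pow_carrier_mat[OF Y] that n0] .
  have tri: "(\<forall>i<n. k < i \<longrightarrow> (Y ^\<^sub>m k) $$ (i, 0) = 0) \<and> (Y ^\<^sub>m k) $$ (k, 0) \<noteq> 0" if "k < n" for k
    using that
  proof (induction k)
    case 0
    then show ?case using Y n0 by auto
  next
    case (Suc k)
    have ih: "\<And>i. i < n \<Longrightarrow> k < i \<Longrightarrow> (Y ^\<^sub>m k) $$ (i, 0) = 0" "(Y ^\<^sub>m k) $$ (k, 0) \<noteq> 0"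
      using Suc by auto
    have z: "(Y ^\<^sub>m Suc k) $$ (i, 0) = 0" if i: "i < n" "Suc k < i" for i
    proof -
      have "Y $$ (i, l) * (Y ^\<^sub>m k) $$ (l, 0) = 0" if "l < n" for l
        using ih(1)[of l] H(1)[of i l] that i by (cases "k < l") auto
      then show ?thesis unfolding pow[OF i(1)] by (intro sum.neutral) auto
    qed
    have "Y $$ (Suc k, l) * (Y ^\<^sub>m k) $$ (l, 0) = 0" if "l < n" "l \<noteq> k" for l
      using ih(1)[of l] H(1)[of "Suc k" l] that Suc.prems by (cases "k < l") auto
    then have "(\<Sum>l\<in>{..<n} - {k}. Y $$ (Suc k, l) * (Y ^\<^sub>m k) $$ (l, 0)) = 0"
      by (intro sum.neutral ballI) blast
    then have "(Y ^\<^sub>m Suc k) $$ (Suc k, 0) = Y $$ (Suc k, k) * (Y ^\<^sub>m k) $$ (k, 0)"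
      unfolding pow[OF Suc.prems] using Suc.prems by (subst sum.remove[of _ k]) auto
    then show ?case using z ih(2) H(2)[OF Suc.prems] by (simp del: pow_mat.simps)
  qed
  have up: "upper_triangular V" using tri by (auto simp: V_def)
  have dV: "det V \<noteq> 0" using upper_triangular_diag_nonzero[OF V up] tri by (simp add: V_def)
  obtain V' where V': "V' \<in> carrier_mat n n" "V * V' = 1\<^sub>m n" "V' * V = 1\<^sub>m n"
    using det_nonzero_inverse[OF V dV] .
  define v where "v = V' *\<^sub>v (Y *\<^sub>v col V (n - 1))"
  define b where "b i = - v $ i" for i
  have v: "v \<in> carrier_vec n" using V V' Y by (auto simp: v_def)
  have Vv: "V *\<^sub>v v = Y *\<^sub>v col V (n - 1)"
  proof -
    have y: "Y *\<^sub>v col V (n - 1) \<in> carrier_vec n" using V Y by auto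
    have "V *\<^sub>v v = (V * V') *\<^sub>v (Y *\<^sub>v col V (n - 1))"
      unfolding v_def by (rule assoc_mult_mat_vec[OF V V'(1) y, symmetric])
    then show ?thesis using y V'(2) by simp
  qed
  have "Y * V = V * companion n b"
  proof (rule eq_matI)
    fix i k assume "i < dim_row (V * companion n b)" "k < dim_col (V * companion n b)"
    then have ik: "i < n" "k < n" using V by (auto simp: companion_def)
    show "(Y * V) $$ (i, k) = (V * companion n b) $$ (i, k)"
    proof (cases "k = n - 1")
      case True
      have "(V * companion n b) $$ (i, k) = (\<Sum>l<n. V $$ (i, l) * v $ l)"
        unfolding mat_mat_index_sum[OF V companion_carrier ik] using ik True
        by (intro sum.cong refl) (auto simp: companion_def b_def)
      also have "\<dots> = (V *\<^sub>v v) $ i" using mat_vec_index_sum[OF V v ik(1)] by simp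
      finally show ?thesis unfolding Vv using ik True Y V by simp
    next
      case False
      then have Sk: "Suc k < n" using ik by simp
      have "(V * companion n b) $$ (i, k) = (\<Sum>l<n. if l = Suc k then V $$ (i, l) else 0)"
        unfolding mat_mat_index_sum[OF V companion_carrier ik] using ik False
        by (intro sum.cong refl) (auto simp: companion_def)
      also have "\<dots> = (Y ^\<^sub>m Suc k) $$ (i, 0)" using Sk ik by (simp add: sum.delta V_def del: pow_mat.simps)
      also have "\<dots> = (Y * V) $$ (i, k)"
        unfolding pow[OF ik(1)] mat_mat_index_sum[OF Y V ik] using ik by (simp add: V_def)
      finally show ?thesis by simp
    qed
  qed (use V Y in \<open>auto simp: companion_def\<close>)
  then show ?thesis using V up dV by blast
qed

text \<open>With \<open>Y = V C_b V^(-1)\<close>, multiplication by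
  \<open>1 + V G W^(-1) V^(-1)\<close> gives \<open>V C_b (W + G) W^(-1) V^(-1)\<close>, and
  \<open>C_b (W + G) = W C_c\<close>. All conjugating matrices are upper triangular, so the
  correction keeps its shape. The equality of determinants provides
  \<open>b 0 = c 0\<close>.\<close>

lemma hessenberg_change_polynomial:
  fixes Y :: "'a::field mat"
  assumes Y: "Y \<in> carrier_mat n n"
    and H: "\<And>i j. i < n \<Longrightarrow> j < n \<Longrightarrow> Suc j < i \<Longrightarrow> Y $$ (i, j) = 0"
      "\<And>j. Suc j < n \<Longrightarrow> Y $$ (Suc j, j) \<noteq> 0"
    and m: "1 \<le> m" "m < n" and det: "det Y = det (companion n c)"
  shows "\<exists>F P Q. upper_right_block n m F \<and> P \<in> carrier_mat n n \<and> Q \<in> carrier_mat n n \<and> Q * P = 1\<^sub>m n \<and>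
    Y * (1\<^sub>m n + F) = P * companion n c * Q"
proof -
  have n0: "0 < n" using m by simp
  obtain V b where V: "V \<in> carrier_mat n n" "upper_triangular V" "det V \<noteq> 0" and YV: "Y * V = V * companion n b"
    using hessenberg_krylov[OF Y H n0] by blast
  have "det Y * det V = det V * det (companion n b)"
    using arg_cong[OF YV, of det] det_mult[OF Y V(1)] det_mult[OF V(1) companion_carrier] by simp
  then have "b 0 = c 0" using V(3) det n0 by (simp add: det_companion)
  then obtain W G where W: "W \<in> carrier_mat n n" "upper_triangular W" "det W \<noteq> 0" and G: "G \<in> carrier_mat n n"
    and G0: "\<forall>i<n. \<forall>j<n. \<not> (i < m \<and> m \<le> j) \<longrightarrow> G $$ (i, j) = 0"
    and WG: "W * companion n c = companion n b * W + companion n b * G"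
    using companion_change_polynomial[OF m, of b c] by (elim meta_impE exE conjE) (assumption | rule that)+
  obtain V' where V': "V' \<in> carrier_mat n n" "V * V' = 1\<^sub>m n" "V' * V = 1\<^sub>m n"
    using det_nonzero_inverse[OF V(1,3)] .
  obtain W' where W': "W' \<in> carrier_mat n n" "W * W' = 1\<^sub>m n" "W' * W = 1\<^sub>m n"
    using det_nonzero_inverse[OF W(1,3)] .
  note upV' = upper_triangular_inverse[OF V(1,2) V'(1,2)] and upW' = upper_triangular_inverse[OF W(1,2) W'(1,2)]
  let ?C = "companion n c" and ?B = "companion n b"
  have B: "?B \<in> carrier_mat n n" and C: "?C \<in> carrier_mat n n" by (rule companion_carrier)+
  define F where "F = V * G * (W' * V')"
  have WV': "W' * V' \<in> carrier_mat n n" "upper_triangular (W' * V')"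
    using upper_triangular_mult[OF W'(1) upW' V'(1) upV'] W' V' by auto
  have F: "upper_right_block n m F"
    unfolding F_def by (rule upper_right_block_conjugate[OF _ V(1,2) WV']) (use G G0 in \<open>auto simp: upper_right_block_def\<close>)
  have VG: "V * W \<in> carrier_mat n n" "V * G \<in> carrier_mat n n" "W + G \<in> carrier_mat n n" "V * (W + G) \<in> carrier_mat n n"
     "?B * (W + G) \<in> carrier_mat n n" "W * ?C \<in> carrier_mat n n"
    using V(1) W(1) G mult_carrier_mat[OF B] mult_carrier_mat[OF W(1) C] by auto
  have "1\<^sub>m n = (V * W) * (W' * V')"
    using mult_cancel_inverse[OF W'(1) W(1) V'(1) W'(2)] V(1) V' W(1) W'(1) WV'
    by (simp add: assoc_mult_mat[of _ n n _ n _ n])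
  then have "1\<^sub>m n + F = (V * W + V * G) * (W' * V')"
    unfolding F_def using VG WV' by (simp add: add_mult_distrib_mat[of _ n n _ _ n])
  also have "V * W + V * G = V * (W + G)" using V(1) W(1) G by (simp add: mult_add_distrib_mat[of _ n n _ n])
  finally have 1: "1\<^sub>m n + F = V * (W + G) * (W' * V')" .
  have "Y * (1\<^sub>m n + F) = (Y * V) * (W + G) * (W' * V')"
    unfolding 1 by (simp only: assoc_mult_mat[of _ n n _ n _ n] mult_carrier_square Y V(1) VG WV')
  also have "\<dots> = V * (?B * (W + G)) * (W' * V')"
    unfolding YV by (simp only: assoc_mult_mat[of _ n n _ n _ n] mult_carrier_square B V(1) VG WV')
  also have "?B * (W + G) = W * ?C" using WG B W(1) G by (simp add: mult_add_distrib_mat[of _ n n _ n])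
  also have "V * (W * ?C) * (W' * V') = (V * W) * ?C * (W' * V')"
    by (simp only: assoc_mult_mat[of _ n n _ n _ n] mult_carrier_square C V(1) W(1) VG WV')
  finally have "Y * (1\<^sub>m n + F) = (V * W) * ?C * (W' * V')" .
  moreover have "(W' * V') * (V * W) = 1\<^sub>m n"
    using mult_cancel_inverse[OF V(1) V'(1) W(1) V'(3)] V(1) V' W(1) W' VG
    by (simp add: assoc_mult_mat[of _ n n _ n _ n])
  ultimately show ?thesis using F VG WV' by blast
qed

text \<open>Only the block \<open>F\<close> of \<open>A\<close>-multiples of the first \<open>m\<close> columns has to be adjusted
  in order to make \<open>A\<close> a product of two cyclic matrices with given polynomials.\<close>

theorem cyclic_factorization:
  fixes A :: "'a::field mat"
  assumes A: "A \<in> carrier_mat n n" and m: "1 \<le> m" "m < n"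
    and p: "lead_coeff p = 1" "degree p = n" "coeff p 0 \<noteq> 0" and q: "lead_coeff q = 1" "degree q = n" "coeff q 0 \<noteq> 0"
    and det: "det A = coeff p 0 * coeff q 0"
  shows "\<exists>F X Y. upper_right_block n m F \<and> cyclic_for p X \<and> cyclic_for q Y \<and> A * (1\<^sub>m n + F) = X * Y"
proof -
  have n0: "0 < n" using m by simp
  have dA: "det A \<noteq> 0" using det p q by simp
  obtain P Q L R where ldu: "P \<in> carrier_mat n n" "Q \<in> carrier_mat n n" "L \<in> carrier_mat n n" "R \<in> carrier_mat n n"
      "P * Q = 1\<^sub>m n" "upper_triangular P" "upper_triangular Q" "upper_triangular R"
      "\<forall>i<n. \<forall>j<n. i < j \<longrightarrow> L $$ (i, j) = 0" "\<forall>i<n. L $$ (i, i) = 1" "P * A * Q = L * R"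
    using ldu_decomposition[OF A dA] by (elim exE conjE) (rule that)
  have QP: "Q * P = 1\<^sub>m n" by (rule mat_mult_left_right_inverse[OF ldu(1,2,5)])
  have "i < j \<Longrightarrow> j < n \<Longrightarrow> L $$ (i, j) = 0" "i < n \<Longrightarrow> L $$ (i, i) = 1" for i j using ldu(9,10) by auto
  then obtain K \<Psi> \<Phi> where K: "K \<in> carrier_mat n n" "\<Psi> \<in> carrier_mat n n" "\<Phi> \<in> carrier_mat n n"
    and Kr: "\<And>i j. i < n - 1 \<Longrightarrow> j < n \<Longrightarrow> K $$ (i, j) = (if j = Suc i then 1 else 0)"
    and \<Phi>: "\<Phi> * \<Psi> = 1\<^sub>m n" and LK: "L * K = \<Phi> * transpose_mat (companion n (coeff p)) * \<Psi>"
    using lower_times_shift_companion[OF ldu(3) n0, of "coeff p"] by metis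
  have \<Psi>: "\<Psi> * \<Phi> = 1\<^sub>m n" by (rule mat_mult_left_right_inverse[OF K(3,2) \<Phi>])
  \<comment> \<open>The product \<open>L * R\<close> is split by inserting \<open>K\<close>: the
    factor \<open>L * K\<close> has polynomial \<open>p\<close>, and \<open>Y\<close>, the inverse
    of \<open>K\<close> times \<open>R\<close>, is a Hessenberg matrix because \<open>K\<close>
    shifts in its first \<open>n - 1\<close> rows.\<close>
  define X where "X = L * K"
  have cp: "cyclic_for p X"
    unfolding X_def LK
    by (rule cyclic_for_similar[OF cyclic_for_transpose[OF cyclic_for_companion[OF p(1,2) n0]] p(2) K(3,2) \<Psi>])
  have "diag_mat L = map (\<lambda>_. 1) [0..<n]" using ldu(3,10) by (simp add: diag_mat_def)
  then have "det L = 1"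
    using det_lower_triangular[OF _ ldu(3)] ldu(9) by (simp add: map_replicate_const prod_list_replicate)
  have CC: "transpose_mat (companion n (coeff p)) \<in> carrier_mat n n" by (simp add: companion_def)
  have "det \<Phi> * det \<Psi> = 1" using det_mult[OF K(3,2)] \<Phi> by simp
  moreover have "det X = det \<Phi> * det (companion n (coeff p)) * det \<Psi>"
    unfolding X_def LK det_mult[OF mult_carrier_mat[OF K(3) CC] K(2)] det_mult[OF K(3) CC]
    by (simp add: det_transpose[OF companion_carrier])
  ultimately have "det X = (- 1) ^ n * coeff p 0" using det_companion[OF n0, of "coeff p"]
    by (simp add: mult.commute mult.left_commute)
  then have dK: "det K = (- 1) ^ n * coeff p 0" using det_mult[OF ldu(3) K(1)] \<open>det L = 1\<close> by (simp add: X_def)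
  then have "det K \<noteq> 0" using p by simp
  then obtain K' where K': "K' \<in> carrier_mat n n" "K * K' = 1\<^sub>m n" "K' * K = 1\<^sub>m n"
    using det_nonzero_inverse[OF K(1)] by blast
  define Y where "Y = K' * R"
  have Y: "Y \<in> carrier_mat n n" using K' ldu by (simp add: Y_def)
  have KY: "K * Y = R" unfolding Y_def by (rule mult_cancel_inverse[OF K'(1) K(1) ldu(4) K'(2)])
  have "det P * det Q = 1" using det_mult[OF ldu(1,2)] ldu(5) by simp
  moreover have "det P * det A * det Q = det R"
    using arg_cong[OF ldu(11), of det] det_mult[OF mult_carrier_mat[OF ldu(1) A] ldu(2)] det_mult[OF ldu(1) A]
      det_mult[OF ldu(3,4)] \<open>det L = 1\<close> by simp
  ultimately have dR: "det R = coeff p 0 * coeff q 0"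
    using det by (metis mult.assoc mult.commute mult_1)
  have row: "Y $$ (Suc i, j) = R $$ (i, j)" if "Suc i < n" "j < n" for i j
  proof -
    have "R $$ (i, j) = (\<Sum>k<n. K $$ (i, k) * Y $$ (k, j))"
      using mat_mat_index_sum[OF K(1) Y, of i j] KY that by simp
    also have "\<dots> = (\<Sum>k<n. if k = Suc i then Y $$ (k, j) else 0)"
      using that by (intro sum.cong refl) (auto simp: Kr)
    finally show ?thesis using that by (simp add: sum.delta)
  qed
  have Rd: "R $$ (i, i) \<noteq> 0" if "i < n" for i
    using upper_triangular_diag_nonzero[OF ldu(4,8)] dR p q that by simp
  have H: "Y $$ (i, j) = 0" if "i < n" "j < n" "Suc j < i" for i j
    using row[of "i - 1" j] that upper_triangularD[OF ldu(8), of j "i - 1"] ldu(4) by auto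
  have H': "Y $$ (Suc j, j) \<noteq> 0" if "Suc j < n" for j using row[OF that, of j] Rd[of j] that by simp
  \<comment> \<open>As \<open>det L = 1\<close>, the hypothesis on \<open>det A\<close> leaves for
    \<open>Y\<close> exactly the determinant of the companion matrix of \<open>q\<close>.\<close>
  have "det K * det Y = det R" using det_mult[OF K(1) Y] KY by simp
  then have "(- 1) ^ n * coeff p 0 * det Y = coeff p 0 * coeff q 0" using dK dR by simp
  then have "(- 1) ^ n * ((- 1) ^ n * det Y) = (- 1) ^ n * coeff q 0" using p by simp
  then have "det Y = det (companion n (coeff q))"
    using det_companion[OF n0, of "coeff q"] by (simp flip: mult.assoc power_mult_distrib)
  then obtain F V W where F: "upper_right_block n m F" and V: "V \<in> carrier_mat n n" "W \<in> carrier_mat n n" "W * V = 1\<^sub>m n"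
    and YF: "Y * (1\<^sub>m n + F) = V * companion n (coeff q) * W"
    using hessenberg_change_polynomial[OF Y H H' m, of "coeff q"] by blast
  have cq: "cyclic_for q (Y * (1\<^sub>m n + F))"
    unfolding YF by (rule cyclic_for_similar[OF cyclic_for_companion[OF q(1,2) n0] q(2) V])
  have Fc: "F \<in> carrier_mat n n" using F by (simp add: upper_right_block_def)
  have Xc: "X \<in> carrier_mat n n" using ldu K by (simp add: X_def)
  have F': "1\<^sub>m n + F \<in> carrier_mat n n" "Y * (1\<^sub>m n + F) \<in> carrier_mat n n" using Fc Y by auto
  have c: "Q * X * P \<in> carrier_mat n n" "Q * (Y * (1\<^sub>m n + F)) * P \<in> carrier_mat n n" "Q * F * P \<in> carrier_mat n n"
    "Q * F \<in> carrier_mat n n" "F * P \<in> carrier_mat n n" "P * A \<in> carrier_mat n n" "P + F * P \<in> carrier_mat n n" "R * P \<in> carrier_mat n n"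
    using ldu Xc F' Fc A by auto
  have cancel: "P * (Q * Z) = Z" "Q * (P * Z) = Z" if "Z \<in> carrier_mat n n" for Z
    using mult_cancel_inverse[OF ldu(2,1) that ldu(5)] mult_cancel_inverse[OF ldu(1,2) that QP] by auto
  have "(Q * X * P) * (Q * (Y * (1\<^sub>m n + F)) * P) = Q * (X * (Y * (1\<^sub>m n + F)) * P)"
    by (simp only: assoc_mult_mat[of _ n n _ n _ n] mult_carrier_square ldu(1-4) Xc F' cancel)
  also have "X * (Y * (1\<^sub>m n + F)) = L * (K * Y) * (1\<^sub>m n + F)"
    unfolding X_def by (simp only: assoc_mult_mat[of _ n n _ n _ n] mult_carrier_square ldu(1-4) K Y F')
  also have "\<dots> = P * A * Q * (1\<^sub>m n + F)" unfolding KY ldu(11) ..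
  also have "Q * (P * A * Q * (1\<^sub>m n + F) * P) = A * (Q * (1\<^sub>m n + F) * P)"
    by (simp only: assoc_mult_mat[of _ n n _ n _ n] mult_carrier_square ldu(1-4) A F' cancel)
  also have "Q * (1\<^sub>m n + F) * P = 1\<^sub>m n + Q * F * P"
    using ldu Fc c QP by (simp add: mult_add_distrib_mat[of _ n n _ n] add_mult_distrib_mat[of _ n n _ _ n])
  finally have "A * (1\<^sub>m n + Q * F * P) = (Q * X * P) * (Q * (Y * (1\<^sub>m n + F)) * P)" by simp
  moreover have "cyclic_for p (Q * X * P)" by (rule cyclic_for_similar[OF cp p(2) ldu(2,1,5)])
  moreover have "cyclic_for q (Q * (Y * (1\<^sub>m n + F)) * P)" by (rule cyclic_for_similar[OF cq q(2) ldu(2,1,5)])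
  moreover have "upper_right_block n m (Q * F * P)" by (rule upper_right_block_conjugate[OF F ldu(2,7) ldu(1,6)])
  ultimately show ?thesis by blast
qed

section \<open>The symplectic form and symplectic bases\<close>

lemma symplectic_form_carrier [simp]: "symplectic_form n \<in> carrier_mat (2 * n) (2 * n)"
proof -
  have "symplectic_form n \<in> carrier_mat (n + n) (n + n)"
    unfolding symplectic_form_def by (rule four_block_carrier_mat) auto
  then show ?thesis by (simp add: mult_2)
qed

lemma symplectic_form_dim [simp]:
  "dim_row (symplectic_form n) = 2 * n" "dim_col (symplectic_form n) = 2 * n"
  using symplectic_form_carrier[of n] by blast+

lemma symplectic_form_index:
  assumes "i < 2 * n" "j < 2 * n"
  shows "symplectic_form n $$ (i, j) = (if j = i + n then 1 else if i = j + n then - 1 else 0)"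
  using assms by (auto simp: symplectic_form_def)

lemma symplectic_form_mult_index:
  assumes X: "X \<in> carrier_mat (2 * n) k" and "i < 2 * n" "j < k"
  shows "(symplectic_form n * X) $$ (i, j) = (if i < n then X $$ (i + n, j) else - X $$ (i - n, j))"
proof -
  have "(symplectic_form n * X) $$ (i, j) = (\<Sum>l<2 * n. if l = (if i < n then i + n else i - n)
      then (if i < n then X $$ (l, j) else - X $$ (l, j)) else 0)"
    unfolding mat_mat_index_sum[OF symplectic_form_carrier assms] using assms
    by (intro sum.cong refl) (auto simp: symplectic_form_index)
  then show ?thesis using assms by (auto simp: sum.delta)
qed

lemma symplectic_form_square: "symplectic_form n * symplectic_form n = - 1\<^sub>m (2 * n)"
proof (rule eq_matI)
  fix i j assume "i < dim_row (- 1\<^sub>m (2 * n) :: 'a mat)" "j < dim_col (- 1\<^sub>m (2 * n) :: 'a mat)"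
  then have ij: "i < 2 * n" "j < 2 * n" by auto
  then show "(symplectic_form n * symplectic_form n) $$ (i, j) = (- 1\<^sub>m (2 * n) :: 'a mat) $$ (i, j)"
    unfolding symplectic_form_mult_index[OF symplectic_form_carrier ij]
    by (auto simp: symplectic_form_index)
qed simp_all

lemma uminus_mult_mat:
  fixes A B :: "'a::field mat"
  assumes "A \<in> carrier_mat n k" "B \<in> carrier_mat k m"
  shows "(- A) * B = - (A * B)" "A * (- B) = - (A * B)"
  using assms by (auto intro!: eq_matI)

text \<open>The hypothesis says that \<open>G P' (- G)\<close> is a right inverse of
  \<open>P\<close>. It is therefore also a left inverse, which is the transposed relation.\<close>

lemma symplectic_transpose:
  fixes P :: "'a::field mat"
  assumes P: "P \<in> carrier_mat (2 * n) (2 * n)" and e: "P * symplectic_form n * transpose_mat P = symplectic_form n"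
  shows "transpose_mat P * symplectic_form n * P = symplectic_form n \<and>
    (\<exists>Q. Q \<in> carrier_mat (2 * n) (2 * n) \<and> P * Q = 1\<^sub>m (2 * n) \<and> Q * P = 1\<^sub>m (2 * n))"
proof -
  let ?N = "2 * n" and ?G = "symplectic_form n :: 'a mat" and ?T = "transpose_mat P"
  note G = symplectic_form_carrier[of n, where 'a = 'a]
  have T: "?T \<in> carrier_mat ?N ?N" using P by simp
  have GG: "?G * ?G = - 1\<^sub>m ?N" by (rule symplectic_form_square)
  have mG: "- ?G \<in> carrier_mat ?N ?N" using G by simp
  have mGG: "(- ?G) * ?G = 1\<^sub>m ?N" "?G * (- ?G) = 1\<^sub>m ?N"
    using GG uminus_mult_mat[OF G G] by simp_all
  define Q where "Q = ?G * ?T * (- ?G)"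
  have Q: "Q \<in> carrier_mat ?N ?N" unfolding Q_def by (intro mult_carrier_square G T mG)
  have "P * Q = (P * ?G * ?T) * (- ?G)"
    unfolding Q_def by (simp only: assoc_mult_mat[of _ ?N ?N _ ?N _ ?N] mult_carrier_square P G T mG)
  then have PQ: "P * Q = 1\<^sub>m ?N" using e mGG by simp
  have QP: "Q * P = 1\<^sub>m ?N" by (rule mat_mult_left_right_inverse[OF P Q PQ])
  have "- ?G = (- ?G) * (Q * P)" using QP mG by simp
  also have "\<dots> = (- ?G) * (?G * (?T * ((- ?G) * P)))"
    unfolding Q_def by (simp only: assoc_mult_mat[of _ ?N ?N _ ?N _ ?N] mult_carrier_square P G T mG)
  also have "\<dots> = ?T * ((- ?G) * P)"
    by (rule mult_cancel_inverse[OF G mG _ mGG(1), where k = ?N]) (intro mult_carrier_square P T mG)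
  also have "\<dots> = - (?T * ?G * P)"
    using P G T by (simp add: uminus_mult_mat[OF G P] uminus_mult_mat[OF T mult_carrier_square[OF G P]] assoc_mult_mat[OF T G P])
  finally have "?T * ?G * P = ?G" by simp
  then show ?thesis using Q PQ QP by blast
qed

text \<open>In this form the columns of \<open>P\<close> are a symplectic basis, as suits matrices
  that act on column vectors.\<close>

lemma Sp_iff:
  fixes P :: "'a::field mat"
  shows "P \<in> Sp n \<longleftrightarrow> P \<in> carrier_mat (2 * n) (2 * n) \<and>
    transpose_mat P * symplectic_form n * P = symplectic_form n"
proof
  assume "P \<in> Sp n"
  then show "P \<in> carrier_mat (2 * n) (2 * n) \<and> transpose_mat P * symplectic_form n * P = symplectic_form n"
    using symplectic_transpose[of P n] unfolding Sp_def by blast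
next
  assume P: "P \<in> carrier_mat (2 * n) (2 * n) \<and> transpose_mat P * symplectic_form n * P = symplectic_form n"
  then have T: "transpose_mat P \<in> carrier_mat (2 * n) (2 * n)" by simp
  have e: "P * symplectic_form n * transpose_mat P = symplectic_form n"
    using symplectic_transpose[OF T] P by simp
  then have "invertible_mat P"
    using symplectic_transpose[of P n] P unfolding invertible_mat_def inverts_mat_def by auto
  then show "P \<in> Sp n" using P e unfolding Sp_def by blast
qed

lemma Sp_carrier: "P \<in> Sp n \<Longrightarrow> P \<in> carrier_mat (2 * n) (2 * n)"
  unfolding Sp_def by blast

lemma Sp_inverse:
  fixes P :: "'a::field mat"
  assumes "P \<in> Sp n"
  obtains Q where "Q \<in> carrier_mat (2 * n) (2 * n)" "P * Q = 1\<^sub>m (2 * n)" "Q * P = 1\<^sub>m (2 * n)"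
  using assms symplectic_transpose[of P n] unfolding Sp_def by blast

lemma Sp_mult:
  fixes P Q :: "'a::field mat"
  assumes "P \<in> Sp n" "Q \<in> Sp n"
  shows "P * Q \<in> Sp n"
proof -
  let ?N = "2 * n" and ?G = "symplectic_form n :: 'a mat"
  note G = symplectic_form_carrier[of n, where 'a = 'a]
  have c: "P \<in> carrier_mat ?N ?N" "Q \<in> carrier_mat ?N ?N"
    and e: "transpose_mat P * ?G * P = ?G" "transpose_mat Q * ?G * Q = ?G" using assms unfolding Sp_iff by auto
  have T: "transpose_mat P \<in> carrier_mat ?N ?N" "transpose_mat Q \<in> carrier_mat ?N ?N" using c by auto
  have "transpose_mat (P * Q) * ?G * (P * Q) = transpose_mat Q * (transpose_mat P * ?G * P) * Q"
    unfolding transpose_mult[OF c]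
    by (simp only: assoc_mult_mat[of _ ?N ?N _ ?N _ ?N] mult_carrier_square c G T)
  then show ?thesis using e c unfolding Sp_iff by simp
qed

lemma Sp_left_inverse:
  fixes P Q :: "'a::field mat"
  assumes P: "P \<in> Sp n" and Q: "Q \<in> carrier_mat (2 * n) (2 * n)" and QP: "Q * P = 1\<^sub>m (2 * n)"
  shows "Q \<in> Sp n"
proof -
  let ?N = "2 * n" and ?G = "symplectic_form n :: 'a mat"
  note G = symplectic_form_carrier[of n, where 'a = 'a]
  have c: "P \<in> carrier_mat ?N ?N" and e: "transpose_mat P * ?G * P = ?G" using P unfolding Sp_iff by auto
  have PQ: "P * Q = 1\<^sub>m ?N" by (rule mat_mult_left_right_inverse[OF Q c QP])
  have T: "transpose_mat P \<in> carrier_mat ?N ?N" "transpose_mat Q \<in> carrier_mat ?N ?N" using c Q by auto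
  have TT: "transpose_mat Q * transpose_mat P = 1\<^sub>m ?N"
    using transpose_mult[OF c Q] PQ by simp
  have "transpose_mat Q * ?G * Q = transpose_mat Q * (transpose_mat P * ?G * P) * Q" using e by simp
  also have "\<dots> = transpose_mat Q * (transpose_mat P * (?G * (P * Q)))"
    by (simp only: assoc_mult_mat[of _ ?N ?N _ ?N _ ?N] mult_carrier_square c Q G T)
  also have "\<dots> = ?G * (P * Q)"
    by (rule mult_cancel_inverse[OF T(1,2) _ TT, where k = ?N]) (intro mult_carrier_square c Q G)
  also have "\<dots> = ?G" unfolding PQ by (rule right_mult_one_mat[OF G])
  finally show ?thesis using Q unfolding Sp_iff by blast
qed

lemma Sp_one: "1\<^sub>m (2 * n) \<in> Sp n"
  unfolding Sp_iff by simp

definition sp_conj :: "nat \<Rightarrow> 'a::field mat \<Rightarrow> 'a mat \<Rightarrow> bool" where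
  "sp_conj n M N \<longleftrightarrow> (\<exists>P\<in>Sp n. \<exists>Q. similar_mat_wit M N P Q)"

lemma sp_conjI:
  fixes M N :: "'a::field mat"
  assumes "P \<in> Sp n" "Q \<in> carrier_mat (2 * n) (2 * n)" "Q * P = 1\<^sub>m (2 * n)" "N \<in> carrier_mat (2 * n) (2 * n)"
    and M: "M = P * N * Q"
  shows "sp_conj n M N"
proof -
  have P: "P \<in> carrier_mat (2 * n) (2 * n)" by (rule Sp_carrier[OF assms(1)])
  have "P * Q = 1\<^sub>m (2 * n)" by (rule mat_mult_left_right_inverse[OF assms(2) P assms(3)])
  then have "similar_mat_wit M N P Q"
    by (intro similar_mat_witI[of _ _ "2 * n"]) (use assms P in auto)
  then show ?thesis using assms(1) unfolding sp_conj_def by blast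
qed

lemma sp_conjE:
  fixes M N :: "'a::field mat"
  assumes "sp_conj n M N" "N \<in> carrier_mat (2 * n) (2 * n)"
  obtains P Q where "P \<in> Sp n" "Q \<in> Sp n" "P * Q = 1\<^sub>m (2 * n)" "Q * P = 1\<^sub>m (2 * n)" "M = P * N * Q"
    "M \<in> carrier_mat (2 * n) (2 * n)"
proof -
  obtain P Q where PQ: "P \<in> Sp n" "similar_mat_wit M N P Q" using assms unfolding sp_conj_def by blast
  have P: "P \<in> carrier_mat (2 * n) (2 * n)" by (rule Sp_carrier[OF PQ(1)])
  have d: "dim_row M = 2 * n" using PQ(2) P unfolding similar_mat_wit_def Let_def by auto
  note w = similar_mat_witD[OF d[symmetric] PQ(2)]
  show ?thesis using that[OF PQ(1) Sp_left_inverse[OF PQ(1) w(7,2)] w(1,2,3,4)] .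
qed

lemma sp_conj_sym:
  fixes M N :: "'a::field mat"
  assumes "sp_conj n M N" "N \<in> carrier_mat (2 * n) (2 * n)"
  shows "sp_conj n N M"
proof -
  let ?N = "2 * n"
  obtain P Q where PQ: "P \<in> Sp n" "Q \<in> Sp n" "P * Q = 1\<^sub>m (2 * n)" "Q * P = 1\<^sub>m (2 * n)" "M = P * N * Q"
    "M \<in> carrier_mat (2 * n) (2 * n)"
    using sp_conjE[OF assms] .
  note c = Sp_carrier[OF PQ(1)] Sp_carrier[OF PQ(2)]
  have "Q * M * P = (Q * P) * N * (Q * P)"
    unfolding PQ(5) by (simp only: assoc_mult_mat[of _ ?N ?N _ ?N _ ?N] mult_carrier_square c assms)
  then have "N = Q * M * P" using PQ(4) assms(2) by simp
  then show ?thesis by (intro sp_conjI[OF PQ(2) c(1) PQ(3,6)])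
qed

lemma sp_conj_trans:
  fixes M N R :: "'a::field mat"
  assumes "sp_conj n M N" "sp_conj n N R" "R \<in> carrier_mat (2 * n) (2 * n)"
  shows "sp_conj n M R"
proof -
  let ?N = "2 * n"
  obtain P Q where PQ: "P \<in> Sp n" "Q \<in> Sp n" "P * Q = 1\<^sub>m (2 * n)" "Q * P = 1\<^sub>m (2 * n)" "N = P * R * Q"
    "N \<in> carrier_mat (2 * n) (2 * n)"
    using sp_conjE[OF assms(2,3)] .
  obtain S T where ST: "S \<in> Sp n" "T \<in> Sp n" "S * T = 1\<^sub>m (2 * n)" "T * S = 1\<^sub>m (2 * n)" "M = S * N * T"
    "M \<in> carrier_mat (2 * n) (2 * n)"
    using sp_conjE[OF assms(1) PQ(6)] .
  note c = PQ(1,2)[THEN Sp_carrier] ST(1,2)[THEN Sp_carrier]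
  show ?thesis
  proof (rule sp_conjI[OF Sp_mult[OF ST(1) PQ(1)] _ _ assms(3)])
    show "Q * T \<in> carrier_mat ?N ?N" using c by simp
    have "Q * T * (S * P) = Q * (T * (S * P))"
      by (simp only: assoc_mult_mat[of _ ?N ?N _ ?N _ ?N] mult_carrier_square c)
    also have "T * (S * P) = P" by (rule mult_cancel_inverse[OF c(3,4,1) ST(4)])
    finally show "Q * T * (S * P) = 1\<^sub>m ?N" using PQ by simp
    show "M = S * P * R * (Q * T)"
      unfolding ST(5) PQ(5) by (simp only: assoc_mult_mat[of _ ?N ?N _ ?N _ ?N] mult_carrier_square c assms(3))
  qed
qed

lemma sp_conj_Sp:
  fixes M N :: "'a::field mat"
  assumes "sp_conj n M N" "N \<in> Sp n"
  shows "M \<in> Sp n"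
  using assms Sp_mult by (metis Sp_carrier sp_conjE)

section \<open>The symplectic form on vectors\<close>

definition omega :: "nat \<Rightarrow> 'a::field vec \<Rightarrow> 'a vec \<Rightarrow> 'a" where
  "omega n x y = x \<bullet> (symplectic_form n *\<^sub>v y)"

lemma omega_sum:
  assumes "x \<in> carrier_vec (2 * n)" "y \<in> carrier_vec (2 * n)"
  shows "omega n x y = (\<Sum>i<n. x $ i * y $ (i + n) - x $ (i + n) * y $ i)"
proof -
  have e: "(symplectic_form n *\<^sub>v y) $ i = (if i < n then y $ (i + n) else - y $ (i - n))" if "i < 2 * n" for i
  proof -
    have "(symplectic_form n *\<^sub>v y) $ i = (\<Sum>l<2 * n. if l = (if i < n then i + n else i - n)
        then (if i < n then y $ l else - y $ l) else 0)"
      unfolding mat_vec_index_sum[OF symplectic_form_carrier assms(2) that] using that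
      by (intro sum.cong refl) (auto simp: symplectic_form_index)
    then show ?thesis using that by (auto simp: sum.delta)
  qed
  have "omega n x y = (\<Sum>i<2 * n. x $ i * (if i < n then y $ (i + n) else - y $ (i - n)))"
    unfolding omega_def scalar_prod_def dim_mult_mat_vec symplectic_form_dim atLeast0LessThan
    by (intro sum.cong refl) (simp add: e del: index_mult_mat_vec)
  also have "{..<2 * n} = {..<n} \<union> {n..<2 * n}" by auto
  also have "(\<Sum>i\<in>{..<n} \<union> {n..<2 * n}. x $ i * (if i < n then y $ (i + n) else - y $ (i - n)))
    = (\<Sum>i<n. x $ i * y $ (i + n)) + (\<Sum>i\<in>{n..<2 * n}. - (x $ i * y $ (i - n)))"
    by (subst sum.union_disjoint) (auto intro!: arg_cong2[of _ _ _ _ "(+)"] sum.cong)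
  also have "(\<Sum>i\<in>{n..<2 * n}. - (x $ i * y $ (i - n))) = (\<Sum>i<n. - (x $ (i + n) * y $ i))"
    by (rule sum.reindex_bij_witness[of _ "\<lambda>i. i + n" "\<lambda>i. i - n"]) auto
  finally show ?thesis by (simp add: sum_negf sum_subtractf)
qed

lemma omega_add:
  assumes "x \<in> carrier_vec (2 * n)" "y \<in> carrier_vec (2 * n)" "z \<in> carrier_vec (2 * n)"
  shows "omega n (x + y) z = omega n x z + omega n y z" "omega n z (x + y) = omega n z x + omega n z y"
  using assms by (simp_all add: omega_sum algebra_simps sum.distrib sum_subtractf)

lemma omega_smult:
  assumes "x \<in> carrier_vec (2 * n)" "z \<in> carrier_vec (2 * n)"
  shows "omega n (a \<cdot>\<^sub>v x) z = a * omega n x z" "omega n z (a \<cdot>\<^sub>v x) = a * omega n z x"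
  using assms by (simp_all add: omega_sum sum_distrib_left algebra_simps)

lemma omega_uminus:
  assumes "x \<in> carrier_vec (2 * n)" "z \<in> carrier_vec (2 * n)"
  shows "omega n (- x) z = - omega n x z" "omega n z (- x) = - omega n z x"
  using assms by (simp_all add: omega_sum algebra_simps flip: sum_negf)

lemma omega_minus:
  assumes "x \<in> carrier_vec (2 * n)" "y \<in> carrier_vec (2 * n)" "z \<in> carrier_vec (2 * n)"
  shows "omega n (x - y) z = omega n x z - omega n y z" "omega n z (x - y) = omega n z x - omega n z y"
  using assms by (simp_all add: omega_sum algebra_simps sum.distrib sum_subtractf)

lemma omega_self: "x \<in> carrier_vec (2 * n) \<Longrightarrow> omega n x x = 0"
  by (simp add: omega_sum mult.commute)

lemma omega_swap:
  "x \<in> carrier_vec (2 * n) \<Longrightarrow> y \<in> carrier_vec (2 * n) \<Longrightarrow> omega n y x = - omega n x y"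
  by (simp add: omega_sum mult.commute flip: sum_negf)

lemma omega_zero [simp]:
  "x \<in> carrier_vec (2 * n) \<Longrightarrow> omega n x (0\<^sub>v (2 * n)) = 0"
  "x \<in> carrier_vec (2 * n) \<Longrightarrow> omega n (0\<^sub>v (2 * n)) x = 0"
  by (simp_all add: omega_sum)

lemma omega_nondegenerate:
  assumes x: "x \<in> carrier_vec (2 * n)" "x \<noteq> 0\<^sub>v (2 * n)"
  obtains y where "y \<in> carrier_vec (2 * n)" "omega n x y = 1"
proof -
  obtain i where i: "i < 2 * n" "x $ i \<noteq> 0" using x by (metis carrier_vecD eq_vecI index_zero_vec)
  define j where "j = (if i < n then i + n else i - n)"
  have j: "j < 2 * n" using i by (auto simp: j_def)
  have "omega n x (unit_vec (2 * n) j) \<noteq> 0"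
  proof (cases "i < n")
    case True
    have "omega n x (unit_vec (2 * n) j) = (\<Sum>k<n. if k = i then x $ i else 0)"
      unfolding omega_sum[OF x(1) unit_vec_carrier] using i True
      by (intro sum.cong refl) (auto simp: j_def unit_vec_def)
    then show ?thesis using i True by (simp add: sum.delta)
  next
    case False
    have "omega n x (unit_vec (2 * n) j) = (\<Sum>k<n. if k = i - n then - x $ i else 0)"
      unfolding omega_sum[OF x(1) unit_vec_carrier] using i False
      by (intro sum.cong refl) (auto simp: j_def unit_vec_def)
    then show ?thesis using i False by (simp add: sum.delta)
  qed
  then have "omega n x (inverse (omega n x (unit_vec (2 * n) j)) \<cdot>\<^sub>v unit_vec (2 * n) j) = 1"
    using omega_smult(2)[OF unit_vec_carrier x(1)] by simp
  then show ?thesis by (rule that[rotated]) simp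
qed

lemma omega_mult:
  fixes M :: "'a::field mat"
  assumes M: "M \<in> Sp n" and x: "x \<in> carrier_vec (2 * n)" and y: "y \<in> carrier_vec (2 * n)"
  shows "omega n (M *\<^sub>v x) (M *\<^sub>v y) = omega n x y"
proof -
  let ?N = "2 * n" and ?G = "symplectic_form n :: 'a mat"
  note G = symplectic_form_carrier[of n, where 'a = 'a]
  have c: "M \<in> carrier_mat ?N ?N" and e: "transpose_mat M * ?G * M = ?G" using M unfolding Sp_iff by auto
  have My: "?G *\<^sub>v (M *\<^sub>v y) \<in> carrier_vec ?N" "M *\<^sub>v y \<in> carrier_vec ?N" "M *\<^sub>v x \<in> carrier_vec ?N"
    using c y x mult_mat_vec_carrier[OF G mult_mat_vec_carrier[OF c y]] by auto
  have T: "transpose_mat M \<in> carrier_mat ?N ?N" using c by simp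
  have "omega n (M *\<^sub>v x) (M *\<^sub>v y) = (?G *\<^sub>v (M *\<^sub>v y)) \<bullet> (M *\<^sub>v x)"
    unfolding omega_def by (rule comm_scalar_prod[OF My(3,1)])
  also have "\<dots> = (transpose_mat M *\<^sub>v (?G *\<^sub>v (M *\<^sub>v y))) \<bullet> x"
    by (rule transpose_vec_mult_scalar[OF c x My(1), symmetric])
  also have "transpose_mat M *\<^sub>v (?G *\<^sub>v (M *\<^sub>v y)) = (transpose_mat M * ?G * M) *\<^sub>v y"
    using assoc_mult_mat_vec[OF mult_carrier_mat[OF T G] c y] assoc_mult_mat_vec[OF T G My(2)] by simp
  also have "\<dots> \<bullet> x = omega n x y"
    unfolding e omega_def by (rule comm_scalar_prod[OF mult_mat_vec_carrier[OF G y] x])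
  finally show ?thesis .
qed

lemma homogeneous_solution:
  fixes ls :: "'a::field vec list"
  assumes "set ls \<subseteq> carrier_vec N" "length ls < N"
  obtains x where "x \<in> carrier_vec N" "x \<noteq> 0\<^sub>v N" "\<And>l. l \<in> set ls \<Longrightarrow> l \<bullet> x = 0"
proof -
  define B where "B = mat\<^sub>r N N (\<lambda>r. if r = N - 1 then 0\<^sub>v N else if r < length ls then ls ! r else 0\<^sub>v N)"
  have B: "B \<in> carrier_mat N N" by (simp add: B_def)
  have "B = mat\<^sub>r N N (\<lambda>r. if r = N - 1 then 0\<^sub>v N else (\<lambda>r. if r < length ls then ls ! r else 0\<^sub>v N) r)"
    by (simp add: B_def)
  moreover have "(\<lambda>r. if r < length ls then ls ! r else 0\<^sub>v N) \<in> {0..<N} \<rightarrow> carrier_vec N"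
    using assms(1) by (auto simp: subset_iff)
  ultimately have "det B = 0" using det_row_0[of "N - 1" N] assms(2) by simp
  then obtain x where x: "x \<in> carrier_vec N" "x \<noteq> 0\<^sub>v N" "B *\<^sub>v x = 0\<^sub>v N"
    using det_0_iff_vec_prod_zero_field[OF B] by blast
  have "ls ! r \<bullet> x = 0" if "r < length ls" for r
  proof -
    have "row B r = ls ! r" using that assms unfolding B_def
      by (subst row_mat_of_row_fun) (auto simp: subset_iff)
    then have "(B *\<^sub>v x) $ r = ls ! r \<bullet> x" using that assms(2) B by simp
    then show ?thesis using x(3) that assms(2) by simp
  qed
  then show ?thesis using that[OF x(1,2)] by (metis in_set_conv_nth)
qed

lemma omega_orthogonal_exists:
  fixes gs :: "'a::field vec list"
  assumes "set gs \<subseteq> carrier_vec (2 * n)" "length gs < 2 * n"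
  obtains x where "x \<in> carrier_vec (2 * n)" "x \<noteq> 0\<^sub>v (2 * n)" "\<And>g. g \<in> set gs \<Longrightarrow> omega n g x = 0"
proof -
  let ?T = "transpose_mat (symplectic_form n) :: 'a mat"
  have T: "?T \<in> carrier_mat (2 * n) (2 * n)" by simp
  have "set (map ((*\<^sub>v) ?T) gs) \<subseteq> carrier_vec (2 * n)" using mult_mat_vec_carrier[OF T] assms(1) by auto
  then obtain x where x: "x \<in> carrier_vec (2 * n)" "x \<noteq> 0\<^sub>v (2 * n)"
    "\<And>l. l \<in> set (map ((*\<^sub>v) ?T) gs) \<Longrightarrow> l \<bullet> x = 0"
    using homogeneous_solution[of "map ((*\<^sub>v) ?T) gs" "2 * n"] assms(2) by (metis length_map)
  have "omega n g x = 0" if "g \<in> set gs" for g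
    using x(3)[of "?T *\<^sub>v g"] that transpose_vec_mult_scalar[OF symplectic_form_carrier x(1), of g] assms(1)
    by (auto simp: omega_def)
  then show ?thesis using that x by blast
qed

section \<open>Partial symplectic bases and their orthogonal complements\<close>

definition symplectic_basis :: "nat \<Rightarrow> nat \<Rightarrow> (nat \<Rightarrow> 'a::field vec) \<Rightarrow> (nat \<Rightarrow> 'a vec) \<Rightarrow> bool" where
  "symplectic_basis n k e f \<longleftrightarrow>
     (\<forall>i<k. e i \<in> carrier_vec (2 * n) \<and> f i \<in> carrier_vec (2 * n)) \<and>
     (\<forall>i<k. \<forall>j<k. omega n (e i) (e j) = 0 \<and> omega n (f i) (f j) = 0 \<and>
        omega n (e i) (f j) = (if i = j then 1 else 0))"

lemma symplectic_basisD:
  assumes "symplectic_basis n k e f"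
  shows "i < k \<Longrightarrow> e i \<in> carrier_vec (2 * n)" "i < k \<Longrightarrow> f i \<in> carrier_vec (2 * n)"
    "i < k \<Longrightarrow> j < k \<Longrightarrow> omega n (e i) (e j) = 0" "i < k \<Longrightarrow> j < k \<Longrightarrow> omega n (f i) (f j) = 0"
    "i < k \<Longrightarrow> j < k \<Longrightarrow> omega n (e i) (f j) = (if i = j then 1 else 0)"
    "i < k \<Longrightarrow> j < k \<Longrightarrow> omega n (f j) (e i) = (if i = j then - 1 else 0)"
  using assms omega_swap[of "e i" n "f j"] unfolding symplectic_basis_def by auto

lemma symplectic_basis_0: "symplectic_basis n 0 e f"
  by (simp add: symplectic_basis_def)

definition perp :: "nat \<Rightarrow> nat \<Rightarrow> (nat \<Rightarrow> 'a::field vec) \<Rightarrow> (nat \<Rightarrow> 'a vec) \<Rightarrow> 'a vec \<Rightarrow> bool" where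
  "perp n k e f x \<longleftrightarrow> x \<in> carrier_vec (2 * n) \<and> (\<forall>i<k. omega n (e i) x = 0 \<and> omega n (f i) x = 0)"

lemma symplectic_basis_Suc:
  assumes S: "symplectic_basis n k e f" and x: "perp n k e f x" and y: "perp n k e f y" and xy: "omega n x y = 1"
  shows "symplectic_basis n (Suc k) (e(k := x)) (f(k := y))"
proof -
  note D = symplectic_basisD[OF S]
  have c: "x \<in> carrier_vec (2 * n)" "y \<in> carrier_vec (2 * n)" using x y by (auto simp: perp_def)
  have "omega n x (e i) = 0" "omega n y (f i) = 0" "omega n x (f i) = 0" if "i < k" for i
    using omega_swap[OF D(1)[OF that] c(1)] omega_swap[OF D(2)[OF that] c(1)] omega_swap[OF D(2)[OF that] c(2)] that x y
    by (auto simp: perp_def)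
  then show ?thesis using D c x y xy omega_self[OF c(1)] omega_self[OF c(2)]
    unfolding symplectic_basis_def perp_def by (auto simp: less_Suc_eq)
qed

text \<open>The projection subtracts from \<open>x\<close> the sum of
  \<open>omega n x (f i) * e i - omega n x (e i) * f i\<close>. Later arguments see
  \<open>x'\<close> only through its products with other vectors, so these are what is
  exported.\<close>

lemma perp_projection_explicit:
  assumes S: "symplectic_basis n k e f" and x: "x \<in> carrier_vec (2 * n)"
  obtains x' where "perp n k e f x'"
    "\<And>z. z \<in> carrier_vec (2 * n) \<Longrightarrow> omega n z x' =
       omega n z x - (\<Sum>i<k. omega n x (f i) * omega n z (e i) - omega n x (e i) * omega n z (f i))"
proof -
  note D = symplectic_basisD[OF S]
  define x' where "x' = vec (2 * n) (\<lambda>l. x $ l - (\<Sum>i<k. omega n x (f i) * e i $ l - omega n x (e i) * f i $ l))"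
  have x'c: "x' \<in> carrier_vec (2 * n)" by (simp add: x'_def)
  have lin: "omega n z x' = omega n z x - (\<Sum>i<k. omega n x (f i) * omega n z (e i) - omega n x (e i) * omega n z (f i))"
    if z: "z \<in> carrier_vec (2 * n)" for z
  proof -
    have "omega n z x' = omega n z x - (\<Sum>l<n. \<Sum>i<k. omega n x (f i) * (z $ l * e i $ (l + n) - z $ (l + n) * e i $ l)
       - omega n x (e i) * (z $ l * f i $ (l + n) - z $ (l + n) * f i $ l))"
      unfolding omega_sum[OF z x'c] omega_sum[OF z x] sum_subtractf[symmetric]
      by (intro sum.cong refl) (auto simp: x'_def algebra_simps sum_distrib_left sum_subtractf sum.distrib)
    also have "(\<Sum>l<n. \<Sum>i<k. omega n x (f i) * (z $ l * e i $ (l + n) - z $ (l + n) * e i $ l)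
       - omega n x (e i) * (z $ l * f i $ (l + n) - z $ (l + n) * f i $ l)) =
      (\<Sum>i<k. omega n x (f i) * omega n z (e i) - omega n x (e i) * omega n z (f i))"
    proof (subst sum.swap, intro sum.cong refl)
      fix i assume "i \<in> {..<k}"
      then have i: "i < k" by simp
      show "(\<Sum>l<n. omega n x (f i) * (z $ l * e i $ (l + n) - z $ (l + n) * e i $ l)
         - omega n x (e i) * (z $ l * f i $ (l + n) - z $ (l + n) * f i $ l))
        = omega n x (f i) * omega n z (e i) - omega n x (e i) * omega n z (f i)"
        unfolding omega_sum[OF z D(1)[OF i]] omega_sum[OF z D(2)[OF i]]
        by (simp add: sum_distrib_left sum_subtractf right_diff_distrib)
    qed
    finally show ?thesis .
  qed
  have "perp n k e f x'"
    unfolding perp_def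
  proof (intro conjI allI impI x'c)
    fix j assume j: "j < k"
    have "(\<Sum>i<k. omega n x (f i) * omega n (e j) (e i) - omega n x (e i) * omega n (e j) (f i)) = (\<Sum>i<k. if i = j then - omega n x (e i) else 0)"
      using j D by (intro sum.cong refl) auto
    then show "omega n (e j) x' = 0"
      using lin[OF D(1)[OF j]] j omega_swap[OF x D(1)[OF j]] by (simp add: sum.delta)
    have "(\<Sum>i<k. omega n x (f i) * omega n (f j) (e i) - omega n x (e i) * omega n (f j) (f i)) = (\<Sum>i<k. if i = j then - omega n x (f i) else 0)"
      using j D by (intro sum.cong refl) auto
    then show "omega n (f j) x' = 0"
      using lin[OF D(2)[OF j]] j omega_swap[OF x D(2)[OF j]] by (simp add: sum.delta)
  qed
  then show ?thesis using that lin by blast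
qed

text \<open>The disjunction covers two situations in which the correction terms vanish:
  \<open>z\<close> is orthogonal to all pairs, or both \<open>z\<close> and \<open>x\<close> are
  orthogonal to the vectors \<open>e i\<close>.\<close>

lemma perp_projection:
  assumes S: "symplectic_basis n k e f" and x: "x \<in> carrier_vec (2 * n)"
  obtains x' where "perp n k e f x'"
    "\<And>z. z \<in> carrier_vec (2 * n) \<Longrightarrow> (\<And>i. i < k \<Longrightarrow> omega n z (e i) = 0) \<Longrightarrow>
       (\<And>i. i < k \<Longrightarrow> omega n x (e i) = 0 \<or> omega n z (f i) = 0) \<Longrightarrow> omega n z x' = omega n z x"
proof -
  obtain x' where x': "perp n k e f x'" and lin: "\<And>z. z \<in> carrier_vec (2 * n) \<Longrightarrow> omega n z x' =
       omega n z x - (\<Sum>i<k. omega n x (f i) * omega n z (e i) - omega n x (e i) * omega n z (f i))"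
    using perp_projection_explicit[OF assms] by blast
  have "omega n z x' = omega n z x" if z: "z \<in> carrier_vec (2 * n)" "\<And>i. i < k \<Longrightarrow> omega n z (e i) = 0"
    "\<And>i. i < k \<Longrightarrow> omega n x (e i) = 0 \<or> omega n z (f i) = 0" for z
  proof -
    have "(\<Sum>i<k. omega n x (f i) * omega n z (e i) - omega n x (e i) * omega n z (f i)) = 0"
      by (rule sum.neutral) (use z(2,3) in auto)
    then show ?thesis using lin[OF z(1)] by simp
  qed
  then show ?thesis using that x' by blast
qed

lemma perp_partner:
  assumes S: "symplectic_basis n k e f" and x: "perp n k e f x" "x \<noteq> 0\<^sub>v (2 * n)"
  obtains y where "perp n k e f y" "omega n x y = 1"
proof -
  note D = symplectic_basisD[OF S]
  have c: "x \<in> carrier_vec (2 * n)" using x by (simp add: perp_def)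
  obtain y0 where y0: "y0 \<in> carrier_vec (2 * n)" "omega n x y0 = 1" using omega_nondegenerate[OF c x(2)] .
  obtain y where y: "perp n k e f y" and eq: "\<And>z. z \<in> carrier_vec (2 * n) \<Longrightarrow> (\<And>i. i < k \<Longrightarrow> omega n z (e i) = 0) \<Longrightarrow>
       (\<And>i. i < k \<Longrightarrow> omega n y0 (e i) = 0 \<or> omega n z (f i) = 0) \<Longrightarrow> omega n z y = omega n z y0"
    using perp_projection[OF S y0(1)] by blast
  have "omega n x (e i) = 0" "omega n x (f i) = 0" if "i < k" for i
    using omega_swap[OF D(1)[OF that] c] omega_swap[OF D(2)[OF that] c] x(1) that by (auto simp: perp_def)
  then show ?thesis using that[OF y] eq[OF c] y0(2) by simp
qed

lemma perp_exists:
  fixes e f :: "nat \<Rightarrow> 'a::field vec"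
  assumes S: "symplectic_basis n k e f" and "k < n"
  obtains x where "perp n k e f x" "x \<noteq> 0\<^sub>v (2 * n)"
proof -
  note D = symplectic_basisD[OF S]
  let ?gs = "map e [0..<k] @ map f [0..<k]"
  have "set ?gs \<subseteq> carrier_vec (2 * n)" using D(1,2) by auto
  then obtain x where x: "x \<in> carrier_vec (2 * n)" "x \<noteq> 0\<^sub>v (2 * n)" "\<And>g. g \<in> set ?gs \<Longrightarrow> omega n g x = 0"
    using omega_orthogonal_exists[of ?gs n] assms(2) by auto
  then have "perp n k e f x" by (auto simp: perp_def)
  then show ?thesis using that x by blast
qed

lemma symplectic_basis_extend:
  fixes e f :: "nat \<Rightarrow> 'a::field vec"
  assumes "symplectic_basis n k e f" "k \<le> n"
  obtains e' f' where "symplectic_basis n n e' f'" "\<And>i. i < k \<Longrightarrow> e' i = e i \<and> f' i = f i"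
proof -
  have "\<exists>e' f'. symplectic_basis n n e' f' \<and> (\<forall>i<k. e' i = e i \<and> f' i = f i)"
    using assms
  proof (induction "n - k" arbitrary: k e f)
    case 0
    then show ?case by auto
  next
    case (Suc d)
    then have k: "k < n" by simp
    obtain x where x: "perp n k e f x" "x \<noteq> 0\<^sub>v (2 * n)" using perp_exists[OF Suc.prems(1) k] .
    obtain y where y: "perp n k e f y" "omega n x y = 1" using perp_partner[OF Suc.prems(1) x] .
    have "symplectic_basis n (Suc k) (e(k := x)) (f(k := y))"
      by (rule symplectic_basis_Suc[OF Suc.prems(1) x(1) y])
    moreover have "d = n - Suc k" "Suc k \<le> n" using Suc.hyps(2) k by auto
    ultimately obtain e' f' where "symplectic_basis n n e' f'"
      "\<forall>i<Suc k. e' i = (e(k := x)) i \<and> f' i = (f(k := y)) i" using Suc.hyps(1) by blast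
    then show ?case by (intro exI[of _ e'] exI[of _ f']) auto
  qed
  then show ?thesis using that by blast
qed

definition basis_mat :: "nat \<Rightarrow> (nat \<Rightarrow> 'a::field vec) \<Rightarrow> (nat \<Rightarrow> 'a vec) \<Rightarrow> 'a mat" where
  "basis_mat n e f = mat (2 * n) (2 * n) (\<lambda>(i, j). if j < n then e j $ i else f (j - n) $ i)"

lemma basis_mat_carrier [simp]: "basis_mat n e f \<in> carrier_mat (2 * n) (2 * n)"
  by (simp add: basis_mat_def)

lemma basis_mat_col:
  assumes "symplectic_basis n n e f" "j < 2 * n"
  shows "col (basis_mat n e f) j = (if j < n then e j else f (j - n))"
proof (cases "j < n")
  case True
  then show ?thesis using symplectic_basisD(1)[OF assms(1) True] assms(2)
    by (intro eq_vecI) (auto simp: basis_mat_def)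
next
  case False
  then have "j - n < n" using assms(2) by simp
  from symplectic_basisD(2)[OF assms(1) this] show ?thesis using False assms(2)
    by (intro eq_vecI) (auto simp: basis_mat_def)
qed

lemma form_index_omega:
  fixes P R :: "'a::field mat"
  assumes P: "P \<in> carrier_mat (2 * n) (2 * n)" and R: "R \<in> carrier_mat (2 * n) (2 * n)"
    and ij: "i < 2 * n" "j < 2 * n"
  shows "(transpose_mat P * (symplectic_form n * R)) $$ (i, j) = omega n (col P i) (col R j)"
proof -
  let ?G = "symplectic_form n :: 'a mat"
  have GR: "?G * R \<in> carrier_mat (2 * n) (2 * n)" using R by simp
  have "(transpose_mat P * (?G * R)) $$ (i, j) = row (transpose_mat P) i \<bullet> col (?G * R) j"
    using GR ij carrier_matD[OF P] carrier_matD[OF GR] by (subst index_mult_mat) auto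
  also have "row (transpose_mat P) i = col P i" using P ij by simp
  also have "col (?G * R) j = ?G *\<^sub>v col R j"
    by (rule col_mult2[OF symplectic_form_carrier R ij(2)])
  finally show ?thesis by (simp add: omega_def)
qed

lemma basis_mat_Sp:
  fixes e f :: "nat \<Rightarrow> 'a::field vec"
  assumes S: "symplectic_basis n n e f"
  shows "basis_mat n e f \<in> Sp n"
proof -
  let ?P = "basis_mat n e f" and ?G = "symplectic_form n :: 'a mat"
  note D = symplectic_basisD[OF S] and P = basis_mat_carrier[of n e f]
  have "transpose_mat ?P * (?G * ?P) = ?G"
  proof (rule eq_matI)
    fix i j assume "i < dim_row ?G" "j < dim_col ?G"
    then have ij: "i < 2 * n" "j < 2 * n" by auto
    show "(transpose_mat ?P * (?G * ?P)) $$ (i, j) = ?G $$ (i, j)"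
      unfolding form_index_omega[OF P P ij] basis_mat_col[OF S ij(1)] basis_mat_col[OF S ij(2)]
        symplectic_form_index[OF ij] using ij
      by (auto simp: D)
  qed (simp_all add: basis_mat_def)
  moreover have "transpose_mat ?P * ?G * ?P = transpose_mat ?P * (?G * ?P)"
    by (rule assoc_mult_mat[of _ "2 * n" "2 * n" _ "2 * n" _ "2 * n"]) simp_all
  ultimately show ?thesis unfolding Sp_iff using P by metis
qed

lemma perp_full_zero:
  fixes e f :: "nat \<Rightarrow> 'a::field vec"
  assumes S: "symplectic_basis n n e f" and x: "perp n n e f x"
  shows "x = 0\<^sub>v (2 * n)"
proof (rule ccontr)
  assume x0: "x \<noteq> 0\<^sub>v (2 * n)"
  let ?N = "2 * n" and ?P = "basis_mat n e f"
  have c: "x \<in> carrier_vec ?N" using x by (simp add: perp_def)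
  obtain y where y: "y \<in> carrier_vec ?N" "omega n x y = 1" using omega_nondegenerate[OF c x0] .
  obtain Q where Q: "Q \<in> carrier_mat ?N ?N" "?P * Q = 1\<^sub>m ?N" using Sp_inverse[OF basis_mat_Sp[OF S]] .
  define z where "z = Q *\<^sub>v y"
  have z: "z \<in> carrier_vec ?N" using Q y by (simp add: z_def)
  have Pz: "?P *\<^sub>v z = y"
    using assoc_mult_mat_vec[OF basis_mat_carrier Q(1) y(1), of e f] Q(2) y(1) by (simp add: z_def)
  let ?T = "transpose_mat (symplectic_form n) :: 'a mat"
  have T: "?T *\<^sub>v x \<in> carrier_vec ?N" using c by (intro mult_mat_vec_carrier[of _ _ ?N]) auto
  have om: "omega n x v = (?T *\<^sub>v x) \<bullet> v" if "v \<in> carrier_vec ?N" for v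
    unfolding omega_def by (rule transpose_vec_mult_scalar[OF symplectic_form_carrier that c, symmetric])
  have "omega n x y = (?T *\<^sub>v x) \<bullet> (?P *\<^sub>v z)" unfolding Pz by (rule om[OF y(1)])
  also have "\<dots> = (transpose_mat ?P *\<^sub>v (?T *\<^sub>v x)) \<bullet> z"
    by (rule transpose_vec_mult_scalar[OF basis_mat_carrier z T, symmetric])
  also have "transpose_mat ?P *\<^sub>v (?T *\<^sub>v x) = 0\<^sub>v ?N"
  proof (rule eq_vecI)
    fix j assume "j < dim_vec (0\<^sub>v ?N :: 'a vec)"
    then have j: "j < ?N" by simp
    have cj: "col ?P j \<in> carrier_vec ?N" by (rule col_carrier_vec[OF j basis_mat_carrier])
    have "(transpose_mat ?P *\<^sub>v (?T *\<^sub>v x)) $ j = col ?P j \<bullet> (?T *\<^sub>v x)"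
      using j by (simp add: basis_mat_def)
    also have "\<dots> = omega n x (col ?P j)"
      unfolding om[OF cj] by (rule comm_scalar_prod[OF cj T])
    also have "\<dots> = 0" unfolding basis_mat_col[OF S j]
      using x j omega_swap[OF symplectic_basisD(1)[OF S, of j] c] omega_swap[OF symplectic_basisD(2)[OF S, of "j - n"] c]
      by (auto simp: perp_def)
    finally show "(transpose_mat ?P *\<^sub>v (?T *\<^sub>v x)) $ j = 0\<^sub>v ?N $ j" using j by simp
  qed (simp add: basis_mat_def)
  finally show False using y(2) z by simp
qed

text \<open>Since \<open>x\<close> is orthogonal to the given \<open>e i\<close>, it differs from
  its projection \<open>x'\<close> by a combination of them. If \<open>x'\<close> is nonzero it
  becomes the next \<open>e\<close>, so that the whole Lagrangian subspace is orthogonal to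
  \<open>x'\<close> and hence to \<open>x\<close>; if it is zero, any extension will do.\<close>

lemma symplectic_basis_extend_perp:
  fixes e f :: "nat \<Rightarrow> 'a::field vec"
  assumes S: "symplectic_basis n k e f" and k: "k \<le> n" and x: "x \<in> carrier_vec (2 * n)"
    and xe: "\<And>i. i < k \<Longrightarrow> omega n x (e i) = 0"
  obtains e' f' where "symplectic_basis n n e' f'" "\<And>i. i < k \<Longrightarrow> e' i = e i \<and> f' i = f i"
    "\<And>i. i < n \<Longrightarrow> omega n x (e' i) = 0"
proof -
  obtain x' where x': "perp n k e f x'" and eq: "\<And>z. z \<in> carrier_vec (2 * n) \<Longrightarrow> (\<And>i. i < k \<Longrightarrow> omega n z (e i) = 0) \<Longrightarrow>
       (\<And>i. i < k \<Longrightarrow> omega n x (e i) = 0 \<or> omega n z (f i) = 0) \<Longrightarrow> omega n z x' = omega n z x"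
    using perp_projection[OF S x] by blast
  obtain e' f' where S': "symplectic_basis n n e' f'" and ext: "\<And>i. i < k \<Longrightarrow> e' i = e i \<and> f' i = f i"
    and x'e: "\<And>i. i < n \<Longrightarrow> omega n (e' i) x' = 0"
  proof (cases "x' = 0\<^sub>v (2 * n)")
    case True
    obtain e' f' where "symplectic_basis n n e' f'" "\<And>i. i < k \<Longrightarrow> e' i = e i \<and> f' i = f i"
      using symplectic_basis_extend[OF S k] by blast
    then show ?thesis using that[of e' f'] symplectic_basisD(1)[of n n e' f'] True by auto
  next
    case False
    have "k < n" using perp_full_zero[of n e f x'] S x' False k by (cases "k = n") auto
    obtain y where y: "perp n k e f y" "omega n x' y = 1" using perp_partner[OF S x' False] .
    have S1: "symplectic_basis n (Suc k) (e(k := x')) (f(k := y))"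
      by (rule symplectic_basis_Suc[OF S x' y])
    obtain e' f' where e': "symplectic_basis n n e' f'"
        "\<And>i. i < Suc k \<Longrightarrow> e' i = (e(k := x')) i \<and> f' i = (f(k := y)) i"
      using symplectic_basis_extend[OF S1] \<open>k < n\<close> by (metis Suc_leI)
    have "e' k = x'" using e'(2)[of k] by simp
    then have "omega n (e' i) x' = 0" if "i < n" for i
      using symplectic_basisD(3)[OF e'(1) that \<open>k < n\<close>] by simp
    then show ?thesis using that[OF e'(1)] e'(2) by (auto simp: less_Suc_eq)
  qed
  have "omega n x (e' i) = 0" if i: "i < n" for i
  proof -
    note c = symplectic_basisD(1)[OF S' i]
    have "omega n (e' i) x = 0"
      using eq[OF c] x'e[OF i] symplectic_basisD(3)[OF S' i] ext k xe
      by (metis less_le_trans)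
    then show ?thesis using omega_swap[OF c x] by simp
  qed
  then show ?thesis using that S' ext by blast
qed

text \<open>Coordinates are read off with the form: the coefficient of a vector \<open>y\<close> at
  \<open>f i\<close> is \<open>omega n (e i) y\<close>, and the one at \<open>e i\<close> is
  \<open>- omega n (f i) y\<close>.\<close>

lemma conjugate_by_basis:
  fixes M :: "'a::field mat"
  assumes M: "M \<in> Sp n" and S: "symplectic_basis n n e f"
  obtains N Q where "N \<in> Sp n" "sp_conj n M N"
    "\<And>i j. i < n \<Longrightarrow> j < n \<Longrightarrow> N $$ (i + n, j) = omega n (e i) (M *\<^sub>v e j)"
    "\<And>i j. i < n \<Longrightarrow> j < n \<Longrightarrow> N $$ (i, j) = - omega n (f i) (M *\<^sub>v e j)"
    "\<And>i j. i < n \<Longrightarrow> j < n \<Longrightarrow> N $$ (i, j + n) = - omega n (f i) (M *\<^sub>v f j)"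
    "Q \<in> carrier_mat (2 * n) (2 * n)" "Q * basis_mat n e f = 1\<^sub>m (2 * n)" "N = Q * M * basis_mat n e f"
proof -
  let ?N = "2 * n" and ?P = "basis_mat n e f" and ?G = "symplectic_form n :: 'a mat"
  note P = basis_mat_Sp[OF S] and Pc = basis_mat_carrier[of n e f]
  have Mc: "M \<in> carrier_mat ?N ?N" by (rule Sp_carrier[OF M])
  obtain Q where Q: "Q \<in> carrier_mat ?N ?N" "?P * Q = 1\<^sub>m ?N" "Q * ?P = 1\<^sub>m ?N" using Sp_inverse[OF P] .
  define N where "N = Q * M * ?P"
  note G = symplectic_form_carrier[of n, where 'a = 'a]
  have N: "N \<in> carrier_mat ?N ?N" using Q Mc Pc by (simp add: N_def)
  have "?P * N * Q = (?P * Q) * M * (?P * Q)"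
    unfolding N_def by (simp only: assoc_mult_mat[of _ ?N ?N _ ?N _ ?N] mult_carrier_square Pc Q(1) Mc)
  then have "M = ?P * N * Q" using Q(2) Mc by simp
  then have conj: "sp_conj n M N" by (rule sp_conjI[OF P Q(1,3) N])
  have NSp: "N \<in> Sp n" using sp_conj_Sp[OF sp_conj_sym[OF conj N] M] .
  have PN: "?P * N = M * ?P"
  proof -
    have "?P * N = (?P * Q) * (M * ?P)"
      unfolding N_def by (simp only: assoc_mult_mat[of _ ?N ?N _ ?N _ ?N] mult_carrier_square Pc Q(1) Mc)
    then show ?thesis using Q(2) Mc Pc left_mult_one_mat[of "M * ?P" ?N ?N] by simp
  qed
  have T: "transpose_mat ?P \<in> carrier_mat ?N ?N" using Pc by simp
  have "?G * N = transpose_mat ?P * ?G * ?P * N" using P unfolding Sp_iff by simp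
  also have "\<dots> = transpose_mat ?P * (?G * (?P * N))"
    by (simp only: assoc_mult_mat[of _ ?N ?N _ ?N _ ?N] mult_carrier_square Pc G N T)
  finally have GN: "?G * N = transpose_mat ?P * (?G * (M * ?P))" unfolding PN .
  have MP: "M * ?P \<in> carrier_mat ?N ?N" using Mc Pc by simp
  have key: "(?G * N) $$ (i, j) = omega n (col ?P i) (M *\<^sub>v col ?P j)" if "i < ?N" "j < ?N" for i j
    unfolding GN form_index_omega[OF Pc MP that] col_mult2[OF Mc Pc that(2)] ..
  show ?thesis
  proof (rule that[OF NSp conj])
    fix i j assume ij: "i < n" "j < n"
    then have l: "i < ?N" "j < ?N" "i + n < ?N" "j + n < ?N" by auto
    show "N $$ (i + n, j) = omega n (e i) (M *\<^sub>v e j)"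
      using key[OF l(1,2)] ij unfolding basis_mat_col[OF S l(1)] basis_mat_col[OF S l(2)] symplectic_form_mult_index[OF N l(1,2)] by simp
    show "N $$ (i, j) = - omega n (f i) (M *\<^sub>v e j)"
      using key[OF l(3,2)] ij unfolding basis_mat_col[OF S l(3)] basis_mat_col[OF S l(2)] symplectic_form_mult_index[OF N l(3,2)]
      by (simp add: minus_equation_iff[of "N $$ (i, j)"])
    show "N $$ (i, j + n) = - omega n (f i) (M *\<^sub>v f j)"
      using key[OF l(3,4)] ij unfolding basis_mat_col[OF S l(3)] basis_mat_col[OF S l(4)] symplectic_form_mult_index[OF N l(3,4)]
      by (simp add: minus_equation_iff[of "N $$ (i, j + n)"])
  qed (use Q N_def in auto)
qed

section \<open>Strictly hyperbolic elements\<close>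

lemma reciprocal_poly_props:
  fixes q :: "'a::field poly"
  assumes "lead_coeff q = 1" "coeff q 0 \<noteq> 0"
  shows "degree (reciprocal_poly q) = degree q" "lead_coeff (reciprocal_poly q) = 1"
    "coeff (reciprocal_poly q) 0 = inverse (coeff q 0)" "reciprocal_poly (reciprocal_poly q) = q"
    "reflect_poly q = Polynomial.smult (coeff q 0) (reciprocal_poly q)"
proof -
  let ?r = "reciprocal_poly q"
  have r: "?r = Polynomial.smult (inverse (coeff q 0)) (reflect_poly q)"
    by (simp add: reciprocal_poly_def poly_0_coeff_0)
  show d: "degree ?r = degree q" unfolding r using assms by (simp add: degree_reflect_poly_eq)
  show "lead_coeff ?r = 1" unfolding d unfolding r using assms by (simp add: coeff_reflect_poly)
  show c: "coeff ?r 0 = inverse (coeff q 0)" unfolding r using assms by simp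
  show "reflect_poly q = Polynomial.smult (coeff q 0) ?r" unfolding r using assms by simp
  show "reciprocal_poly ?r = q"
    unfolding reciprocal_poly_def[of ?r] poly_0_coeff_0 c
    unfolding r reflect_poly_smult using assms by (simp add: reflect_poly_reflect_poly)
qed

text \<open>For a symplectic matrix the adjoint with respect to the form is the inverse.\<close>

lemma omega_poly_adjoint:
  fixes N :: "'a::field mat"
  assumes N: "N \<in> Sp n" and B: "B \<in> carrier_mat (2 * n) (2 * n)" and NB: "N * B = 1\<^sub>m (2 * n)"
    and x: "x \<in> carrier_vec (2 * n)" and w: "w \<in> carrier_vec (2 * n)"
  shows "omega n (poly_mat p N *\<^sub>v x) w = omega n x (poly_mat p B *\<^sub>v w)"
  using w
proof (induction p arbitrary: w)
  case 0
  have "0\<^sub>m (2 * n) (2 * n) *\<^sub>v v = 0\<^sub>v (2 * n)" if "v \<in> carrier_vec (2 * n)" for v :: "'a vec"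
    using that by (intro eq_vecI) auto
  then show ?case using x 0 B Sp_carrier[OF N] by simp
next
  case (pCons a p)
  let ?N = "2 * n"
  note c = Sp_carrier[OF N]
  have split: "poly_mat (pCons a p) M *\<^sub>v v = a \<cdot>\<^sub>v v + M *\<^sub>v (poly_mat p M *\<^sub>v v)"
    if M: "M \<in> carrier_mat ?N ?N" and v: "v \<in> carrier_vec ?N" for M v
  proof -
    have "poly_mat (pCons a p) M *\<^sub>v v = (a \<cdot>\<^sub>m 1\<^sub>m ?N) *\<^sub>v v + (M * poly_mat p M) *\<^sub>v v"
      unfolding poly_mat_pCons[OF M] by (rule add_mult_distrib_mat_vec[of _ ?N ?N]) (use M v in auto)
    also have "(a \<cdot>\<^sub>m 1\<^sub>m ?N) *\<^sub>v v = a \<cdot>\<^sub>v v" using v by (intro eq_vecI) auto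
    also have "(M * poly_mat p M) *\<^sub>v v = M *\<^sub>v (poly_mat p M *\<^sub>v v)"
      by (rule assoc_mult_mat_vec[OF M poly_mat_carrier[OF M] v])
    finally show ?thesis .
  qed
  note Nx = mult_mat_vec_carrier[OF poly_mat_carrier[OF c, of p] x]
  note Bw = mult_mat_vec_carrier[OF B pCons.prems]
  note NNx = mult_mat_vec_carrier[OF c Nx] and Bpw = mult_mat_vec_carrier[OF poly_mat_carrier[OF B, of p] pCons.prems]
  have "N *\<^sub>v (B *\<^sub>v w) = w" using assoc_mult_mat_vec[OF c B pCons.prems] NB pCons.prems by simp
  then have "omega n (N *\<^sub>v (poly_mat p N *\<^sub>v x)) w = omega n (poly_mat p N *\<^sub>v x) (B *\<^sub>v w)"
    using omega_mult[OF N Nx Bw] by simp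
  also have "\<dots> = omega n x (poly_mat p B *\<^sub>v (B *\<^sub>v w))" by (rule pCons.IH[OF Bw])
  also have "poly_mat p B *\<^sub>v (B *\<^sub>v w) = B *\<^sub>v (poly_mat p B *\<^sub>v w)"
    using assoc_mult_mat_vec[OF poly_mat_carrier[OF B] B pCons.prems] assoc_mult_mat_vec[OF B poly_mat_carrier[OF B] pCons.prems]
      poly_mat_commute_self[OF B] by simp
  finally have *: "omega n (N *\<^sub>v (poly_mat p N *\<^sub>v x)) w = omega n x (B *\<^sub>v (poly_mat p B *\<^sub>v w))" .
  show ?case
    unfolding split[OF c x] split[OF B pCons.prems]
    using omega_add[OF smult_carrier_vec[THEN iffD2, OF x] NNx pCons.prems]
      omega_add[OF smult_carrier_vec[THEN iffD2, OF pCons.prems] mult_mat_vec_carrier[OF B Bpw] x]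
      omega_smult[OF x pCons.prems] omega_smult[OF pCons.prems x] *
    by simp
qed

text \<open>Up to a scalar and a power of \<open>N\<close>, \<open>q*(N)\<close> is the adjoint of
  \<open>q(N)\<close>, so its image is orthogonal to the kernel of \<open>q(N)\<close>. By Bezout
  the image contains this kernel.\<close>

lemma kernel_isotropic:
  fixes N :: "'a::field mat"
  assumes N: "N \<in> Sp n" and q: "lead_coeff q = 1" "coeff q 0 \<noteq> 0" and co: "comaximal q (reciprocal_poly q)"
    and x: "x \<in> carrier_vec (2 * n)" "poly_mat q N *\<^sub>v x = 0\<^sub>v (2 * n)"
    and y: "y \<in> carrier_vec (2 * n)" "poly_mat q N *\<^sub>v y = 0\<^sub>v (2 * n)"
  shows "omega n x y = 0"
proof -
  let ?N = "2 * n" and ?r = "reciprocal_poly q"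
  note c = Sp_carrier[OF N]
  obtain B where B: "B \<in> carrier_mat ?N ?N" "N * B = 1\<^sub>m ?N" "B * N = 1\<^sub>m ?N" using Sp_inverse[OF N] .
  have refl: "poly_mat (reflect_poly q) N = poly_mat q B * N ^\<^sub>m degree (reflect_poly q)"
    using poly_mat_reflect[OF c B(1,3), of "reflect_poly q"] q by (simp add: reflect_poly_reflect_poly)
  have z: "omega n x (poly_mat (reflect_poly q) N *\<^sub>v z) = 0" if z: "z \<in> carrier_vec ?N" for z
  proof -
    note p = pow_carrier_mat[OF c, of "degree (reflect_poly q)"]
    note Nz = mult_mat_vec_carrier[OF p z]
    have "poly_mat (reflect_poly q) N *\<^sub>v z = poly_mat q B *\<^sub>v (N ^\<^sub>m degree (reflect_poly q) *\<^sub>v z)"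
      unfolding refl by (rule assoc_mult_mat_vec[OF poly_mat_carrier[OF B(1)] p z])
    then have "omega n x (poly_mat (reflect_poly q) N *\<^sub>v z)
      = omega n (poly_mat q N *\<^sub>v x) (N ^\<^sub>m degree (reflect_poly q) *\<^sub>v z)"
      using omega_poly_adjoint[OF N B(1,2) x(1) Nz, of q] by simp
    then show ?thesis using x(2) Nz by simp
  qed
  obtain u v where "u * q + v * ?r = 1" using co unfolding comaximal_def by blast
  then have "y = poly_mat (u * q + ?r * v) N *\<^sub>v y" using act_1[OF c y(1)] by (simp add: mult.commute)
  also have "\<dots> = poly_mat u N *\<^sub>v (poly_mat q N *\<^sub>v y) + poly_mat ?r N *\<^sub>v (poly_mat v N *\<^sub>v y)"
    using y(1) by (simp add: act_add[OF c] act_mult[OF c])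
  also have "poly_mat u N *\<^sub>v (poly_mat q N *\<^sub>v y) = 0\<^sub>v ?N" unfolding y(2) by (rule act_zero[OF c])
  also have "0\<^sub>v ?N + poly_mat ?r N *\<^sub>v (poly_mat v N *\<^sub>v y) = poly_mat ?r N *\<^sub>v (poly_mat v N *\<^sub>v y)"
    by (rule left_zero_vec[OF act_carrier[OF c]])
  finally have y': "y = poly_mat ?r N *\<^sub>v (poly_mat v N *\<^sub>v y)" .
  let ?z = "poly_mat v N *\<^sub>v y"
  note zc = act_carrier[OF c, of v y]
  have "poly_mat (reflect_poly q) N *\<^sub>v ?z = coeff q 0 \<cdot>\<^sub>v (poly_mat ?r N *\<^sub>v ?z)"
    unfolding reciprocal_poly_props(5)[OF q] poly_mat_smult[OF c]
    using poly_mat_carrier[OF c, of ?r] zc by (intro eq_vecI) auto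
  then have "coeff q 0 * omega n x (poly_mat ?r N *\<^sub>v ?z) = 0"
    using z[OF zc] omega_smult(2)[OF act_carrier[OF c] x(1)] by simp
  then show ?thesis using q(2) y' by simp
qed

text \<open>The two isotropic kernels span the space, so the form puts them in duality; dual bases
  are built pair by pair.\<close>

lemma hyperbolic_basis:
  fixes N :: "'a::field mat"
  assumes N: "N \<in> Sp n" and co: "comaximal q q'" and ann: "poly_mat (q * q') N = 0\<^sub>m (2 * n) (2 * n)"
    and iso: "\<And>x y. x \<in> carrier_vec (2 * n) \<Longrightarrow> poly_mat q N *\<^sub>v x = 0\<^sub>v (2 * n) \<Longrightarrow>
        y \<in> carrier_vec (2 * n) \<Longrightarrow> poly_mat q N *\<^sub>v y = 0\<^sub>v (2 * n) \<Longrightarrow> omega n x y = 0"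
    and iso': "\<And>x y. x \<in> carrier_vec (2 * n) \<Longrightarrow> poly_mat q' N *\<^sub>v x = 0\<^sub>v (2 * n) \<Longrightarrow>
        y \<in> carrier_vec (2 * n) \<Longrightarrow> poly_mat q' N *\<^sub>v y = 0\<^sub>v (2 * n) \<Longrightarrow> omega n x y = 0"
  shows "\<exists>e f. symplectic_basis n n e f \<and>
    (\<forall>i<n. poly_mat q N *\<^sub>v e i = 0\<^sub>v (2 * n) \<and> poly_mat q' N *\<^sub>v f i = 0\<^sub>v (2 * n))"
proof -
  let ?N = "2 * n"
  note c = Sp_carrier[OF N]
  obtain u v where uv: "u * q + v * q' = 1" using co unfolding comaximal_def by blast
  have split: "\<exists>x1 x2. x1 \<in> carrier_vec ?N \<and> x2 \<in> carrier_vec ?N \<and> x = x1 + x2 \<and>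
      poly_mat q N *\<^sub>v x1 = 0\<^sub>v ?N \<and> poly_mat q' N *\<^sub>v x2 = 0\<^sub>v ?N" if x: "x \<in> carrier_vec ?N" for x
  proof (intro exI conjI)
    show "poly_mat (v * q') N *\<^sub>v x \<in> carrier_vec ?N" "poly_mat (u * q) N *\<^sub>v x \<in> carrier_vec ?N"
      by (rule act_carrier[OF c])+
    have "x = poly_mat (v * q' + u * q) N *\<^sub>v x" using act_1[OF c x] uv by (simp add: add.commute)
    then show "x = poly_mat (v * q') N *\<^sub>v x + poly_mat (u * q) N *\<^sub>v x" using act_add[OF c x] by simp
    have z: "0\<^sub>m ?N ?N *\<^sub>v x = 0\<^sub>v ?N" using x by (intro eq_vecI) auto
    have "poly_mat q N *\<^sub>v (poly_mat (v * q') N *\<^sub>v x) = poly_mat (v * (q * q')) N *\<^sub>v x"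
      using act_mult[OF c x] by (metis mult.left_commute)
    also have "\<dots> = 0\<^sub>v ?N" unfolding act_mult[OF c x] ann z by (rule act_zero[OF c])
    finally show "poly_mat q N *\<^sub>v (poly_mat (v * q') N *\<^sub>v x) = 0\<^sub>v ?N" .
    have "poly_mat q' N *\<^sub>v (poly_mat (u * q) N *\<^sub>v x) = poly_mat (u * (q * q')) N *\<^sub>v x"
      using act_mult[OF c x] by (metis mult.left_commute mult.commute)
    also have "\<dots> = 0\<^sub>v ?N" unfolding act_mult[OF c x] ann z by (rule act_zero[OF c])
    finally show "poly_mat q' N *\<^sub>v (poly_mat (u * q) N *\<^sub>v x) = 0\<^sub>v ?N" .
  qed
  have "\<exists>e f. symplectic_basis n k e f \<and>
    (\<forall>i<k. poly_mat q N *\<^sub>v e i = 0\<^sub>v ?N \<and> poly_mat q' N *\<^sub>v f i = 0\<^sub>v ?N)" if "k \<le> n" for k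
    using that
  proof (induction k)
    case 0
    then show ?case using symplectic_basis_0 by blast
  next
    case (Suc k)
    then obtain e f where S: "symplectic_basis n k e f"
      and ef: "\<And>i. i < k \<Longrightarrow> poly_mat q N *\<^sub>v e i = 0\<^sub>v ?N" "\<And>i. i < k \<Longrightarrow> poly_mat q' N *\<^sub>v f i = 0\<^sub>v ?N"
      by auto
    note D = symplectic_basisD[OF S]
    \<comment> \<open>Each chosen basis vector is orthogonal to the component lying in its own
      kernel, by isotropy, and to the other component by subtraction. So both components stay in the
      complement.\<close>
    have splitp: "\<exists>x1 x2. perp n k e f x1 \<and> perp n k e f x2 \<and> x = x1 + x2 \<and>
      poly_mat q N *\<^sub>v x1 = 0\<^sub>v ?N \<and> poly_mat q' N *\<^sub>v x2 = 0\<^sub>v ?N" if x: "perp n k e f x" for x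
    proof -
      have xc: "x \<in> carrier_vec ?N" using x by (simp add: perp_def)
      obtain x1 x2 where x12: "x1 \<in> carrier_vec ?N" "x2 \<in> carrier_vec ?N" "x = x1 + x2"
        "poly_mat q N *\<^sub>v x1 = 0\<^sub>v ?N" "poly_mat q' N *\<^sub>v x2 = 0\<^sub>v ?N" using split[OF xc] by blast
      have "omega n (e i) x1 = 0 \<and> omega n (f i) x2 = 0 \<and> omega n (e i) x2 = 0 \<and> omega n (f i) x1 = 0" if i: "i < k" for i
      proof -
        have 1: "omega n (e i) x1 = 0" by (rule iso[OF D(1)[OF i] ef(1)[OF i] x12(1,4)])
        have 2: "omega n (f i) x2 = 0" by (rule iso'[OF D(2)[OF i] ef(2)[OF i] x12(2,5)])
        show ?thesis using 1 2 x i omega_add(2)[OF x12(1,2) D(1)[OF i]] omega_add(2)[OF x12(1,2) D(2)[OF i]]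
          unfolding perp_def x12(3) by auto
      qed
      then have "perp n k e f x1" "perp n k e f x2" using x12 by (auto simp: perp_def)
      then show ?thesis using x12 by blast
    qed
    have "k < n" using Suc.prems by simp
    then obtain x where x: "perp n k e f x" "x \<noteq> 0\<^sub>v ?N" using perp_exists[OF S] by blast
    obtain x1 x2 where x12: "perp n k e f x1" "perp n k e f x2" "x = x1 + x2"
        "poly_mat q N *\<^sub>v x1 = 0\<^sub>v ?N" "poly_mat q' N *\<^sub>v x2 = 0\<^sub>v ?N" using splitp[OF x(1)] by blast
    have xc: "x1 \<in> carrier_vec ?N" "x2 \<in> carrier_vec ?N" using x12 by (auto simp: perp_def)
    have "\<exists>a b. perp n k e f a \<and> perp n k e f b \<and> omega n a b = 1 \<and> poly_mat q N *\<^sub>v a = 0\<^sub>v ?N \<and> poly_mat q' N *\<^sub>v b = 0\<^sub>v ?N"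
    proof (cases "x1 = 0\<^sub>v ?N")
      case False
      obtain y where y: "perp n k e f y" "omega n x1 y = 1" using perp_partner[OF S x12(1) False] .
      obtain y1 y2 where y12: "perp n k e f y1" "perp n k e f y2" "y = y1 + y2"
        "poly_mat q N *\<^sub>v y1 = 0\<^sub>v ?N" "poly_mat q' N *\<^sub>v y2 = 0\<^sub>v ?N" using splitp[OF y(1)] by blast
      have yc: "y1 \<in> carrier_vec ?N" "y2 \<in> carrier_vec ?N" using y12 by (auto simp: perp_def)
      have "omega n x1 y2 = 1" using y(2) omega_add(2)[OF yc xc(1)] iso[OF xc(1) x12(4) yc(1) y12(4)] unfolding y12(3) by simp
      then show ?thesis using x12 y12 by blast
    next
      case True
      then have "x2 \<noteq> 0\<^sub>v ?N" using x(2) x12(3) xc by auto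
      then obtain y where y: "perp n k e f y" "omega n x2 y = 1" using perp_partner[OF S x12(2)] by blast
      obtain y1 y2 where y12: "perp n k e f y1" "perp n k e f y2" "y = y1 + y2"
        "poly_mat q N *\<^sub>v y1 = 0\<^sub>v ?N" "poly_mat q' N *\<^sub>v y2 = 0\<^sub>v ?N" using splitp[OF y(1)] by blast
      have yc: "y1 \<in> carrier_vec ?N" "y2 \<in> carrier_vec ?N" using y12 by (auto simp: perp_def)
      have "omega n x2 y1 = 1" using y(2) omega_add(2)[OF yc xc(2)] iso'[OF xc(2) x12(5) yc(2) y12(5)] unfolding y12(3) by simp
      \<comment> \<open>The vector from the kernel of \<open>q(N)\<close> must come first in the
        pair; the exchange costs a sign.\<close>
      then have 1: "omega n (- y1) x2 = 1" using omega_uminus(1)[OF yc(1) xc(2)] omega_swap[OF xc(2) yc(1)] by simp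
      have "perp n k e f (- y1)" using y12(1) omega_uminus(2)[OF yc(1) D(1)] omega_uminus(2)[OF yc(1) D(2)] by (auto simp: perp_def)
      moreover have "poly_mat q N *\<^sub>v (- y1) = - (poly_mat q N *\<^sub>v y1)"
        using poly_mat_carrier[OF c, of q] yc(1) by (intro eq_vecI) auto
      then have "poly_mat q N *\<^sub>v (- y1) = 0\<^sub>v ?N" using y12(4) by simp
      ultimately show ?thesis using 1 x12 by blast
    qed
    then obtain a b where ab: "perp n k e f a" "perp n k e f b" "omega n a b = 1"
      "poly_mat q N *\<^sub>v a = 0\<^sub>v ?N" "poly_mat q' N *\<^sub>v b = 0\<^sub>v ?N" by blast
    show ?case
      by (intro exI[of _ "e(k := a)"] exI[of _ "f(k := b)"] conjI symplectic_basis_Suc[OF S ab(1-3)])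
        (use ab ef in \<open>auto simp: less_Suc_eq\<close>)
  qed
  then show ?thesis by blast
qed

lemma four_block_carrier_2:
  "A \<in> carrier_mat n n \<Longrightarrow> D \<in> carrier_mat n n \<Longrightarrow> four_block_mat A B C D \<in> carrier_mat (2 * n) (2 * n)"
  using four_block_carrier_mat[of A n n D n n B C] by (simp add: mult_2)

lemma four_block_eq_iff:
  assumes "A \<in> carrier_mat n n" "B \<in> carrier_mat n n" "C \<in> carrier_mat n n" "D \<in> carrier_mat n n"
    "A' \<in> carrier_mat n n" "B' \<in> carrier_mat n n" "C' \<in> carrier_mat n n" "D' \<in> carrier_mat n n"
  shows "four_block_mat A B C D = four_block_mat A' B' C' D' \<longleftrightarrow> A = A' \<and> B = B' \<and> C = C' \<and> D = D'"
proof
  assume e: "four_block_mat A B C D = four_block_mat A' B' C' D'"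
  have *: "four_block_mat A B C D $$ (i, j) = four_block_mat A' B' C' D' $$ (i, j)" for i j using e by simp
  show "A = A' \<and> B = B' \<and> C = C' \<and> D = D'"
  proof (intro conjI; rule eq_matI)
    fix i j
    show "A $$ (i, j) = A' $$ (i, j)" if "i < dim_row A'" "j < dim_col A'" using *[of i j] that assms by simp
    show "B $$ (i, j) = B' $$ (i, j)" if "i < dim_row B'" "j < dim_col B'" using *[of i "j + n"] that assms by simp
    show "C $$ (i, j) = C' $$ (i, j)" if "i < dim_row C'" "j < dim_col C'" using *[of "i + n" j] that assms by simp
    show "D $$ (i, j) = D' $$ (i, j)" if "i < dim_row D'" "j < dim_col D'" using *[of "i + n" "j + n"] that assms by simp
  qed (use assms in auto)
qed simp

lemma mat_four_blocks:
  assumes "M \<in> carrier_mat (2 * n) (2 * n)"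
  obtains A B C D where "A \<in> carrier_mat n n" "B \<in> carrier_mat n n" "C \<in> carrier_mat n n" "D \<in> carrier_mat n n"
    "M = four_block_mat A B C D"
proof (rule that)
  show "M = four_block_mat (mat n n (\<lambda>(i, j). M $$ (i, j))) (mat n n (\<lambda>(i, j). M $$ (i, j + n)))
     (mat n n (\<lambda>(i, j). M $$ (i + n, j))) (mat n n (\<lambda>(i, j). M $$ (i + n, j + n)))"
    using assms by (intro eq_matI) auto
qed auto

text \<open>Of the four block equations, the lower left one is minus the transpose of the upper
  right one.\<close>

lemma Sp_block_iff:
  fixes A B C D :: "'a::field mat"
  assumes c: "A \<in> carrier_mat n n" "B \<in> carrier_mat n n" "C \<in> carrier_mat n n" "D \<in> carrier_mat n n"
  shows "four_block_mat A B C D \<in> Sp n \<longleftrightarrow> transpose_mat A * C = transpose_mat C * A \<and>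
    transpose_mat B * D = transpose_mat D * B \<and> transpose_mat A * D = 1\<^sub>m n + transpose_mat C * B"
proof -
  let ?P = "four_block_mat A B C D" and ?G = "symplectic_form n :: 'a mat"
  have P: "?P \<in> carrier_mat (2 * n) (2 * n)" by (rule four_block_carrier_2[OF c(1,4)])
  have t: "transpose_mat A \<in> carrier_mat n n" "transpose_mat B \<in> carrier_mat n n"
    "transpose_mat C \<in> carrier_mat n n" "transpose_mat D \<in> carrier_mat n n" using c by auto
  have TP: "transpose_mat ?P = four_block_mat (transpose_mat A) (transpose_mat C) (transpose_mat B) (transpose_mat D)"
    by (rule transpose_four_block_mat[OF c])
  have GP: "?G * ?P = four_block_mat C D (- A) (- B)"
  proof -
    have "0\<^sub>m n n * A = 0\<^sub>m n n" "0\<^sub>m n n * B = 0\<^sub>m n n" "0\<^sub>m n n * C = 0\<^sub>m n n" "0\<^sub>m n n * D = 0\<^sub>m n n"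
      using c by auto
    then show ?thesis unfolding symplectic_form_def
      using c by (subst mult_four_block_mat[of _ n n _ n _ n _ _ n _ n]) (auto simp: uminus_mult_mat[of _ n n _ n])
  qed
  have TG: "transpose_mat ?P * ?G * ?P = transpose_mat ?P * (?G * ?P)"
    by (rule assoc_mult_mat[OF _ symplectic_form_carrier P]) (use P in simp)
  have m: "X * (- Y) = - (X * Y)" if "X \<in> carrier_mat n n" "Y \<in> carrier_mat n n" for X Y :: "'a mat"
    using uminus_mult_mat(2)[OF that] .
  have e: "transpose_mat ?P * ?G * ?P = four_block_mat (transpose_mat A * C + - (transpose_mat C * A))
     (transpose_mat A * D + - (transpose_mat C * B)) (transpose_mat B * C + - (transpose_mat D * A))
     (transpose_mat B * D + - (transpose_mat D * B))"
    unfolding TG unfolding GP TP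
    using c t by (subst mult_four_block_mat[of _ n n _ n _ n _ _ n _ n]) (auto simp: m)
  have prods: "transpose_mat A * C \<in> carrier_mat n n" "transpose_mat C * A \<in> carrier_mat n n"
    "transpose_mat A * D \<in> carrier_mat n n" "transpose_mat C * B \<in> carrier_mat n n"
    "transpose_mat B * C \<in> carrier_mat n n" "transpose_mat D * A \<in> carrier_mat n n"
    "transpose_mat B * D \<in> carrier_mat n n" "transpose_mat D * B \<in> carrier_mat n n" using c t by auto
  have eq0: "X + - Y = 0\<^sub>m n n \<longleftrightarrow> X = Y" and eq1: "X + - Y = 1\<^sub>m n \<longleftrightarrow> X = 1\<^sub>m n + Y"
    and eq2: "X + - Y = - 1\<^sub>m n \<longleftrightarrow> Y = 1\<^sub>m n + X"
    if "X \<in> carrier_mat n n" "Y \<in> carrier_mat n n" for X Y :: "'a mat"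
    using that by (auto simp: mat_eq_iff algebra_simps add_eq_0_iff eq_neg_iff_add_eq_0)+
  have third: "transpose_mat D * A = 1\<^sub>m n + transpose_mat B * C"
    if "transpose_mat A * D = 1\<^sub>m n + transpose_mat C * B"
  proof -
    have "transpose_mat D * A = transpose_mat (transpose_mat A * D)" using transpose_mult[OF t(1) c(4)] by simp
    also have "\<dots> = 1\<^sub>m n + transpose_mat (transpose_mat C * B)"
      unfolding that using transpose_add[OF one_carrier_mat prods(4)] by simp
    also have "transpose_mat (transpose_mat C * B) = transpose_mat B * C" using transpose_mult[OF t(3) c(2)] by simp
    finally show ?thesis .
  qed
  have "?P \<in> Sp n \<longleftrightarrow> four_block_mat (transpose_mat A * C + - (transpose_mat C * A))
     (transpose_mat A * D + - (transpose_mat C * B)) (transpose_mat B * C + - (transpose_mat D * A))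
     (transpose_mat B * D + - (transpose_mat D * B)) = four_block_mat (0\<^sub>m n n) (1\<^sub>m n) (- 1\<^sub>m n) (0\<^sub>m n n)"
    unfolding Sp_iff e using P by (simp add: symplectic_form_def)
  also have "\<dots> \<longleftrightarrow> transpose_mat A * C + - (transpose_mat C * A) = 0\<^sub>m n n \<and>
     transpose_mat A * D + - (transpose_mat C * B) = 1\<^sub>m n \<and> transpose_mat B * C + - (transpose_mat D * A) = - 1\<^sub>m n \<and>
     transpose_mat B * D + - (transpose_mat D * B) = 0\<^sub>m n n"
    by (rule four_block_eq_iff[of _ n]) (use prods in auto)
  also have "\<dots> \<longleftrightarrow> transpose_mat A * C = transpose_mat C * A \<and>
    transpose_mat B * D = transpose_mat D * B \<and> transpose_mat A * D = 1\<^sub>m n + transpose_mat C * B"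
    unfolding eq0[OF prods(1,2)] eq1[OF prods(3,4)] eq2[OF prods(5,6)] eq0[OF prods(7,8)] using third by blast
  finally show ?thesis .
qed

text \<open>Both kernels are invariant and isotropic, so in an adapted basis the off-diagonal blocks
  vanish, and the symplectic condition makes \<open>D\<close> the inverse transpose of
  \<open>A\<close>.\<close>

lemma hyperbolic_diagonal_form:
  fixes N :: "'a::field mat"
  assumes N: "N \<in> Sp n" and q: "lead_coeff q = 1" "degree q = n" "coeff q 0 \<noteq> 0"
    and co: "comaximal q (reciprocal_poly q)" and cyc: "cyclic_for (q * reciprocal_poly q) N"
  obtains A D where "A \<in> carrier_mat n n" "D \<in> carrier_mat n n" "cyclic_for q A" "transpose_mat A * D = 1\<^sub>m n"
    "sp_conj n N (four_block_mat A (0\<^sub>m n n) (0\<^sub>m n n) D)" "four_block_mat A (0\<^sub>m n n) (0\<^sub>m n n) D \<in> Sp n"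
proof -
  let ?N = "2 * n" and ?r = "reciprocal_poly q"
  note rp = reciprocal_poly_props[OF q(1,3)]
  note c = Sp_carrier[OF N]
  have r0: "?r \<noteq> 0" "q \<noteq> 0" using rp(2) q(1) by auto
  have deg: "degree (q * ?r) = ?N" using r0 q rp(1) by (simp add: degree_mult_eq)
  have r1: "coeff ?r 0 \<noteq> 0" using rp(3) q(3) by simp
  have co': "comaximal ?r (reciprocal_poly ?r)" unfolding rp(4) by (rule comaximal_sym[OF co])
  obtain e f where S: "symplectic_basis n n e f"
    and ef: "\<And>i. i < n \<Longrightarrow> poly_mat q N *\<^sub>v e i = 0\<^sub>v ?N" "\<And>i. i < n \<Longrightarrow> poly_mat ?r N *\<^sub>v f i = 0\<^sub>v ?N"
    using hyperbolic_basis[OF N co cyclic_forD(2)[OF cyc deg]] kernel_isotropic[OF N q(1,3) co]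
      kernel_isotropic[OF N rp(2) r1 co'] by blast
  note SD = symplectic_basisD[OF S]
  let ?P = "basis_mat n e f"
  obtain N' Q where N': "N' \<in> Sp n" and conj: "sp_conj n N N'"
    and ent: "\<And>i j. i < n \<Longrightarrow> j < n \<Longrightarrow> N' $$ (i + n, j) = omega n (e i) (N *\<^sub>v e j)"
      "\<And>i j. i < n \<Longrightarrow> j < n \<Longrightarrow> N' $$ (i, j + n) = - omega n (f i) (N *\<^sub>v f j)"
    and Q: "Q \<in> carrier_mat ?N ?N" "Q * ?P = 1\<^sub>m ?N" "N' = Q * N * ?P"
    using conjugate_by_basis[OF N S] by metis
  have PQ: "?P * Q = 1\<^sub>m ?N" by (rule mat_mult_left_right_inverse[OF Q(1) basis_mat_carrier Q(2)])
  have inv: "poly_mat p N *\<^sub>v (N *\<^sub>v x) = 0\<^sub>v ?N" if "x \<in> carrier_vec ?N" "poly_mat p N *\<^sub>v x = 0\<^sub>v ?N" for p x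
  proof -
    have "poly_mat p N *\<^sub>v (N *\<^sub>v x) = N *\<^sub>v (poly_mat p N *\<^sub>v x)"
      using assoc_mult_mat_vec[OF poly_mat_carrier[OF c] c that(1)] assoc_mult_mat_vec[OF c poly_mat_carrier[OF c] that(1)]
        poly_mat_commute_self[OF c] by simp
    then show ?thesis using that(2) c by (auto intro!: eq_vecI)
  qed
  have Nx: "N *\<^sub>v x \<in> carrier_vec ?N" if "x \<in> carrier_vec ?N" for x using mult_mat_vec_carrier[OF c that] .
  have z1: "N' $$ (i + n, j) = 0" if "i < n" "j < n" for i j
    unfolding ent(1)[OF that]
    by (rule kernel_isotropic[OF N q(1,3) co SD(1)[OF that(1)] ef(1)[OF that(1)] Nx[OF SD(1)[OF that(2)]] inv[OF SD(1)[OF that(2)] ef(1)[OF that(2)]]])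
  have z2: "N' $$ (i, j + n) = 0" if "i < n" "j < n" for i j
    using ent(2)[OF that]
      kernel_isotropic[OF N rp(2) r1 co' SD(2)[OF that(1)] ef(2)[OF that(1)] Nx[OF SD(2)[OF that(2)]] inv[OF SD(2)[OF that(2)] ef(2)[OF that(2)]]]
    by simp
  have N'c: "N' \<in> carrier_mat ?N ?N" by (rule Sp_carrier[OF N'])
  obtain A B C D where blk: "A \<in> carrier_mat n n" "B \<in> carrier_mat n n" "C \<in> carrier_mat n n" "D \<in> carrier_mat n n"
    "N' = four_block_mat A B C D" using mat_four_blocks[OF N'c] .
  have "B = 0\<^sub>m n n" using z2 blk by (intro eq_matI) auto
  moreover have "C = 0\<^sub>m n n" using z1 blk by (intro eq_matI) auto
  ultimately have N'b: "N' = four_block_mat A (0\<^sub>m n n) (0\<^sub>m n n) D" using blk by simp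
  have AD: "transpose_mat A * D = 1\<^sub>m n"
    using N' Sp_block_iff[OF blk(1) zero_carrier_mat zero_carrier_mat blk(4)] blk unfolding N'b by simp
  have cyc': "cyclic_for (q * ?r) N'" unfolding Q(3) by (rule cyclic_for_similar[OF cyc deg Q(1) basis_mat_carrier PQ])
  have pN': "poly_mat p N' = four_block_mat (poly_mat p A) (0\<^sub>m n n) (0\<^sub>m n n) (poly_mat p D)" for p
    unfolding N'b by (rule poly_mat_block_diag[OF blk(1,4)])
  have colz: "poly_mat p N' $$ (i, j) = 0" if ij: "i < ?N" "j < ?N" and x: "poly_mat p N *\<^sub>v col ?P j = 0\<^sub>v ?N" for p i j
  proof -
    have "poly_mat p N' = Q * poly_mat p N * ?P"
      unfolding Q(3) by (rule poly_mat_similar[OF c Q(1) basis_mat_carrier PQ])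
    also have "\<dots> = Q * (poly_mat p N * ?P)" by (rule assoc_mult_mat[OF Q(1) poly_mat_carrier[OF c] basis_mat_carrier])
    finally have e: "poly_mat p N' = Q * (poly_mat p N * ?P)" .
    have PP: "poly_mat p N * ?P \<in> carrier_mat ?N ?N" by (rule mult_carrier_square[OF poly_mat_carrier[OF c] basis_mat_carrier])
    have "col (poly_mat p N * ?P) j = 0\<^sub>v ?N"
      using col_mult2[OF poly_mat_carrier[OF c] basis_mat_carrier ij(2)] x by simp
    then have "row Q i \<bullet> col (poly_mat p N * ?P) j = 0"
      using row_carrier_vec[OF ij(1) Q(1)] by simp
    then show ?thesis unfolding e using ij Q(1) PP by (subst index_mult_mat) auto
  qed
  have qA: "poly_mat q A = 0\<^sub>m n n"
  proof (rule eq_matI)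
    fix i j assume "i < dim_row (0\<^sub>m n n :: 'a mat)" "j < dim_col (0\<^sub>m n n :: 'a mat)"
    then have ij: "i < n" "j < n" by auto
    have j2: "j < ?N" using ij by simp
    have "poly_mat q N' $$ (i, j) = 0" by (rule colz) (use ij ef(1) basis_mat_col[OF S j2] in auto)
    then show "poly_mat q A $$ (i, j) = 0\<^sub>m n n $$ (i, j)" using ij blk unfolding pN' by simp
  qed (use blk in auto)
  have rD: "poly_mat ?r D = 0\<^sub>m n n"
  proof (rule eq_matI)
    fix i j assume "i < dim_row (0\<^sub>m n n :: 'a mat)" "j < dim_col (0\<^sub>m n n :: 'a mat)"
    then have ij: "i < n" "j < n" by auto
    have j2: "j + n < ?N" using ij by simp
    have "poly_mat ?r N' $$ (i + n, j + n) = 0" by (rule colz) (use ij ef(2) basis_mat_col[OF S j2] in auto)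
    then show "poly_mat ?r D $$ (i, j) = 0\<^sub>m n n $$ (i, j)" using ij blk unfolding pN' by simp
  qed (use blk in auto)
  \<comment> \<open>If \<open>s(A) = 0\<close>, then \<open>s q*\<close> annihilates the whole
    matrix although its degree is below \<open>2 * n\<close>.\<close>
  have "s = 0" if s: "poly_mat s A = 0\<^sub>m n n" "degree s < n" for s
  proof -
    have "poly_mat (s * ?r) A = 0\<^sub>m n n" "poly_mat (s * ?r) D = 0\<^sub>m n n"
      using s(1) rD poly_mat_mult[OF blk(1)] poly_mat_mult[OF blk(4)]
        left_mult_zero_mat[OF poly_mat_carrier[OF blk(1)]] right_mult_zero_mat[OF poly_mat_carrier[OF blk(4)]] by auto
    then have "poly_mat (s * ?r) N' = 0\<^sub>m ?N ?N" unfolding pN' by (simp add: mult_2)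
    moreover have "degree (s * ?r) < ?N" using s(2) q(2) rp(1) degree_mult_le[of s ?r] by simp
    ultimately have "s * ?r = 0" using cyclic_forD(3)[OF cyc' deg] by blast
    then show ?thesis using r0 by simp
  qed
  then have "cyclic_for q A" unfolding cyclic_for_def q(2) using blk(1) qA by blast
  then show ?thesis using that[OF blk(1,4) _ AD] conj N' unfolding N'b by blast
qed

text \<open>By the diagonal form it is enough to conjugate the blocks \<open>A'\<close> and
  \<open>A\<close>, which are cyclic with the same polynomial. An invertible \<open>P\<close> doing
  this extends to the symplectic matrix diag(P, P^(-T)), which takes care of the other
  block.\<close>

theorem cyclic_hyperbolic_conjugate:
  fixes N N' :: "'a::field mat"
  assumes N: "N \<in> Sp n" "N' \<in> Sp n" and q: "lead_coeff q = 1" "degree q = n" "coeff q 0 \<noteq> 0" and n0: "n > 0"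
    and co: "comaximal q (reciprocal_poly q)"
    and cyc: "cyclic_for (q * reciprocal_poly q) N" "cyclic_for (q * reciprocal_poly q) N'"
  shows "sp_conj n N N'"
proof -
  obtain A D where A: "A \<in> carrier_mat n n" "D \<in> carrier_mat n n" "cyclic_for q A" "transpose_mat A * D = 1\<^sub>m n"
    "sp_conj n N (four_block_mat A (0\<^sub>m n n) (0\<^sub>m n n) D)" "four_block_mat A (0\<^sub>m n n) (0\<^sub>m n n) D \<in> Sp n"
    using hyperbolic_diagonal_form[OF N(1) q co cyc(1)] .
  obtain A' D' where A': "A' \<in> carrier_mat n n" "D' \<in> carrier_mat n n" "cyclic_for q A'" "transpose_mat A' * D' = 1\<^sub>m n"
    "sp_conj n N' (four_block_mat A' (0\<^sub>m n n) (0\<^sub>m n n) D')" "four_block_mat A' (0\<^sub>m n n) (0\<^sub>m n n) D' \<in> Sp n"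
    using hyperbolic_diagonal_form[OF N(2) q co cyc(2)] .
  obtain P Q where PQ: "P \<in> carrier_mat n n" "Q \<in> carrier_mat n n" "P * Q = 1\<^sub>m n" "Q * P = 1\<^sub>m n" "A = P * A' * Q"
    using cyclic_for_conjugate[OF A(3) A'(3) q(2) n0 q(1)] .
  let ?Z = "0\<^sub>m n n :: 'a mat"
  have t: "transpose_mat P \<in> carrier_mat n n" "transpose_mat Q \<in> carrier_mat n n" "transpose_mat A \<in> carrier_mat n n"
    "transpose_mat A' \<in> carrier_mat n n" using PQ A A' by auto
  have PTQT: "transpose_mat P * transpose_mat Q = 1\<^sub>m n" "transpose_mat Q * transpose_mat P = 1\<^sub>m n"
    using transpose_mult[OF PQ(2,1)] transpose_mult[OF PQ(1,2)] unfolding PQ(3,4) transpose_one by simp_all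
  define T where "T = four_block_mat P ?Z ?Z (transpose_mat Q)"
  define T' where "T' = four_block_mat Q ?Z ?Z (transpose_mat P)"
  have Tc: "T' \<in> carrier_mat (2 * n) (2 * n)" unfolding T'_def by (rule four_block_carrier_2[OF PQ(2) t(1)])
  have diag: "four_block_mat X ?Z ?Z Y * four_block_mat X' ?Z ?Z Y' = four_block_mat (X * X') ?Z ?Z (Y * Y')"
    if "X \<in> carrier_mat n n" "Y \<in> carrier_mat n n" "X' \<in> carrier_mat n n" "Y' \<in> carrier_mat n n" for X Y X' Y' :: "'a mat"
    using that by (simp add: mult_four_block_mat[of _ n n _ n _ n _ _ n _ n])
  have TSp: "T \<in> Sp n" unfolding T_def Sp_block_iff[OF PQ(1) zero_carrier_mat zero_carrier_mat t(2)]
    using PQ t PTQT by simp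
  have T'T: "T' * T = 1\<^sub>m (2 * n)"
    unfolding T_def T'_def diag[OF PQ(2) t(1) PQ(1) t(2)] PQ PTQT by (simp add: mult_2)
  have DD: "transpose_mat Q * D' * transpose_mat P = D"
  proof -
    have DT: "D * transpose_mat A = 1\<^sub>m n" by (rule mat_mult_left_right_inverse[OF t(3) A(2,4)])
    have TA: "transpose_mat A = transpose_mat Q * transpose_mat A' * transpose_mat P"
      unfolding PQ(5) transpose_mult[OF mult_carrier_square[OF PQ(1) A'(1)] PQ(2)] transpose_mult[OF PQ(1) A'(1)]
      by (rule assoc_mult_mat[OF t(2,4,1), symmetric])
    have c1: "transpose_mat P * (transpose_mat Q * X) = X" "transpose_mat A' * (D' * X) = X" if "X \<in> carrier_mat n n" for X
      using mult_cancel_inverse[OF t(2,1) that PTQT(1)] mult_cancel_inverse[OF A'(2) t(4) that A'(4)] by auto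
    have "transpose_mat A * (transpose_mat Q * D' * transpose_mat P) = 1\<^sub>m n"
      unfolding TA by (simp only: assoc_mult_mat[of _ n n _ n _ n] mult_carrier_square t A' c1 PTQT)
    then have "D * (transpose_mat A * (transpose_mat Q * D' * transpose_mat P)) = D" using A by simp
    moreover have "D * (transpose_mat A * (transpose_mat Q * D' * transpose_mat P)) = transpose_mat Q * D' * transpose_mat P"
      by (rule mult_cancel_inverse[OF t(3) A(2) _ DT, where k = n]) (use t A' in simp)
    ultimately show ?thesis by simp
  qed
  have "T * four_block_mat A' ?Z ?Z D' * T' = four_block_mat A ?Z ?Z D"
    unfolding T_def T'_def diag[OF PQ(1) t(2) A'(1,2)]
      diag[OF mult_carrier_square[OF PQ(1) A'(1)] mult_carrier_square[OF t(2) A'(2)] PQ(2) t(1)]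
    unfolding DD PQ(5) ..
  then have "sp_conj n (four_block_mat A ?Z ?Z D) (four_block_mat A' ?Z ?Z D')"
    by (intro sp_conjI[OF TSp Tc T'T Sp_carrier[OF A'(6)]]) simp
  then show ?thesis
    using sp_conj_trans sp_conj_sym[OF A'(5) Sp_carrier[OF A'(6)]] A(5) Sp_carrier[OF A'(6)] Sp_carrier[OF N(2)] by metis
qed

section \<open>Corners of symplectic matrices and products of classes\<close>

lemma cyclic_for_det:
  assumes "cyclic_for p X" "degree p = n" "n > 0" "lead_coeff p = 1"
  shows "det X = (- 1) ^ n * coeff p 0"
proof -
  obtain V W where V: "V \<in> carrier_mat n n" "W \<in> carrier_mat n n" "V * W = 1\<^sub>m n" "W * V = 1\<^sub>m n"
    "X = V * companion n (coeff p) * W"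
    using cyclic_for_similar_companion[OF assms] .
  have "similar_mat X (companion n (coeff p))"
    unfolding similar_mat_def using cyclic_forD(1)[OF assms(1,2)] V
    by (intro exI[of _ V] exI[of _ W] similar_mat_witI[of V W n]) auto
  then show ?thesis using det_similar det_companion[OF assms(3)] by metis
qed

text \<open>Reflection turns annihilators of \<open>X\<close> into annihilators of its inverse and
  conversely, without raising the degree; this gives both annihilation and minimality.\<close>

lemma cyclic_for_inverse:
  fixes X :: "'a::field mat"
  assumes X: "cyclic_for p X" and p: "degree p = n" "lead_coeff p = 1" "coeff p 0 \<noteq> 0"
    and Z: "Z \<in> carrier_mat n n" "Z * X = 1\<^sub>m n"
  shows "cyclic_for (reciprocal_poly p) Z"
proof -
  note c = cyclic_forD[OF X p(1)] and rp = reciprocal_poly_props[OF p(2,3)]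
  have XZ: "X * Z = 1\<^sub>m n" by (rule mat_mult_left_right_inverse[OF Z(1) c(1) Z(2)])
  have kill: "M = 0\<^sub>m n n" if "M * A ^\<^sub>m k = 0\<^sub>m n n" "M \<in> carrier_mat n n" "A \<in> carrier_mat n n" "B \<in> carrier_mat n n" "A * B = 1\<^sub>m n"
    for M A B :: "'a mat" and k
  proof -
    note pA = pow_carrier_mat[OF that(3), of k] and pB = pow_carrier_mat[OF that(4), of k]
    have "M = M * (A ^\<^sub>m k * B ^\<^sub>m k)" using pow_mat_inverse[OF that(4,3,5)] that(2) by simp
    also have "\<dots> = M * A ^\<^sub>m k * B ^\<^sub>m k" by (rule assoc_mult_mat[OF that(2) pA pB, symmetric])
    finally show ?thesis unfolding that(1) using left_mult_zero_mat[OF pB] by simp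
  qed
  have "poly_mat (reflect_poly p) Z * X ^\<^sub>m degree p = 0\<^sub>m n n"
    unfolding poly_mat_reflect[OF c(1) Z] by (rule c(2))
  then have "poly_mat (reflect_poly p) Z = 0\<^sub>m n n" by (rule kill[OF _ poly_mat_carrier[OF Z(1)] c(1) Z(1) XZ])
  then have "poly_mat (reciprocal_poly p) Z = 0\<^sub>m n n"
    unfolding reciprocal_poly_def poly_mat_smult[OF Z(1)] by simp
  moreover have "s = 0" if s: "poly_mat s Z = 0\<^sub>m n n" "degree s < n" for s
  proof -
    have "poly_mat (reflect_poly s) X * Z ^\<^sub>m degree s = 0\<^sub>m n n"
      unfolding poly_mat_reflect[OF Z(1) c(1) XZ] by (rule s(1))
    then have "poly_mat (reflect_poly s) X = 0\<^sub>m n n" by (rule kill[OF _ poly_mat_carrier[OF c(1)] Z(1) c(1) Z(2)])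
    moreover have "degree (reflect_poly s) < n" using degree_reflect_poly_le[of s] s(2) by simp
    ultimately show ?thesis using c(3)[of "reflect_poly s"] by simp
  qed
  ultimately show ?thesis unfolding cyclic_for_def rp(1) p(1) using Z(1) by blast
qed

text \<open>A polynomial that annihilates the block matrix annihilates both diagonal blocks, so it
  is divisible by \<open>p\<close> and by \<open>r\<close>, hence by their product.\<close>

lemma cyclic_for_block_lower:
  fixes X :: "'a::field mat"
  assumes X: "cyclic_for p X" "degree p = n" and W: "cyclic_for r W" "degree r = n" and n0: "n > 0"
    and Z: "Z \<in> carrier_mat n n" and co: "comaximal p r"
  shows "cyclic_for (p * r) (four_block_mat X (0\<^sub>m n n) Z W)"
proof -
  let ?L = "four_block_mat X (0\<^sub>m n n) Z W" and ?N = "2 * n"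
  note x = cyclic_forD[OF X] and w = cyclic_forD[OF W]
  have p0: "p \<noteq> 0" "r \<noteq> 0" using X(2) W(2) n0 by auto
  have deg: "degree (p * r) = ?N" using X(2) W(2) p0 by (simp add: degree_mult_eq)
  have L: "?L \<in> carrier_mat ?N ?N" by (rule four_block_carrier_2[OF x(1) w(1)])
  obtain V where V: "V \<in> carrier_mat n n" "poly_mat p ?L = four_block_mat (poly_mat p X) (0\<^sub>m n n) V (poly_mat p W)"
    using poly_mat_block_lower[OF x(1) Z w(1)] by blast
  obtain V' where V': "V' \<in> carrier_mat n n" "poly_mat r ?L = four_block_mat (poly_mat r X) (0\<^sub>m n n) V' (poly_mat r W)"
    using poly_mat_block_lower[OF x(1) Z w(1)] by blast
  have "poly_mat (p * r) ?L = poly_mat r ?L * poly_mat p ?L"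
    unfolding mult.commute[of p r] by (rule poly_mat_mult[OF L])
  also have "\<dots> = 0\<^sub>m ?N ?N"
    unfolding V(2) V'(2) x(2) w(2)
    using V(1) V'(1) poly_mat_carrier[OF x(1), of r] poly_mat_carrier[OF w(1), of p]
      right_mult_zero_mat[OF poly_mat_carrier[OF x(1), of r], of n] left_mult_zero_mat[OF poly_mat_carrier[OF w(1), of p], of n]
    by (subst mult_four_block_mat[of _ n n _ n _ n _ _ n _ n]) (auto simp: mult_2)
  finally have 1: "poly_mat (p * r) ?L = 0\<^sub>m ?N ?N" .
  have "s = 0" if s: "poly_mat s ?L = 0\<^sub>m ?N ?N" "degree s < ?N" for s
  proof -
    obtain U where U: "U \<in> carrier_mat n n" "poly_mat s ?L = four_block_mat (poly_mat s X) (0\<^sub>m n n) U (poly_mat s W)"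
      using poly_mat_block_lower[OF x(1) Z w(1)] by blast
    have "four_block_mat (poly_mat s X) (0\<^sub>m n n) U (poly_mat s W) = four_block_mat (0\<^sub>m n n) (0\<^sub>m n n) (0\<^sub>m n n) (0\<^sub>m n n)"
      using s(1) U(2) by (simp add: mult_2)
    then have "poly_mat s X = 0\<^sub>m n n" "poly_mat s W = 0\<^sub>m n n"
      using four_block_eq_iff[of "poly_mat s X" n "0\<^sub>m n n" U "poly_mat s W" "0\<^sub>m n n" "0\<^sub>m n n" "0\<^sub>m n n" "0\<^sub>m n n"]
        poly_mat_carrier[OF x(1), of s] poly_mat_carrier[OF w(1), of s] U(1) by auto
    then have "p dvd s" "r dvd s" using cyclic_for_dvd[OF X(1), of s] cyclic_for_dvd[OF W(1), of s] X(2) W(2) n0 by auto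
    then have "p * r dvd s" using comaximal_mult_dvd[OF co] by blast
    then show ?thesis using dvd_imp_degree_le[of "p * r" s] s(2) deg by fastforce
  qed
  then show ?thesis unfolding cyclic_for_def deg using L 1 by blast
qed

text \<open>Only the first block column of a conjugate of \<open>M\<close> is kept. It describes the
  action of \<open>M\<close> on a Lagrangian subspace, and both the factorization criterion and the
  changes of basis below depend on it alone.\<close>

definition has_corner :: "nat \<Rightarrow> 'a::field mat \<Rightarrow> 'a mat \<Rightarrow> 'a mat \<Rightarrow> bool" where
  "has_corner n M A C \<longleftrightarrow> A \<in> carrier_mat n n \<and> C \<in> carrier_mat n n \<and>
     (\<exists>B\<in>carrier_mat n n. \<exists>D\<in>carrier_mat n n.
        four_block_mat A B C D \<in> Sp n \<and> sp_conj n M (four_block_mat A B C D))"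

text \<open>With \<open>A = X * Y\<close>, the block factorization
  \<open>(A, B; C, D) = (X, 0; C Y\<inverse>, X\<^sup>-\<^sup>T) (Y, X\<inverse> B; 0, Y\<^sup>-\<^sup>T)\<close> has cyclic strictly hyperbolic factors.\<close>

theorem class_product_if_corner:
  fixes M :: "'a::field mat"
  assumes n0: "n > 0"
    and p: "lead_coeff p = 1" "degree p = n" "coeff p 0 \<noteq> 0" "comaximal p (reciprocal_poly p)"
    and q: "lead_coeff q = 1" "degree q = n" "coeff q 0 \<noteq> 0" "comaximal q (reciprocal_poly q)"
    and N: "N1 \<in> Sp n" "cyclic_for (p * reciprocal_poly p) N1" "N2 \<in> Sp n" "cyclic_for (q * reciprocal_poly q) N2"
    and corner: "has_corner n M A C" and XY: "cyclic_for p X" "cyclic_for q Y" "A = X * Y"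
  shows "M \<in> class_product (Sp_conj_class n N1) (Sp_conj_class n N2)"
proof -
  let ?N = "2 * n" and ?Z = "0\<^sub>m n n :: 'a mat"
  obtain B D where c: "A \<in> carrier_mat n n" "B \<in> carrier_mat n n" "C \<in> carrier_mat n n" "D \<in> carrier_mat n n"
    and S: "four_block_mat A B C D \<in> Sp n" and conj: "sp_conj n M (four_block_mat A B C D)"
    using corner unfolding has_corner_def by blast
  note rel = Sp_block_iff[OF c, THEN iffD1, OF S]
  have X: "X \<in> carrier_mat n n" and Y: "Y \<in> carrier_mat n n"
    using cyclic_forD(1)[OF XY(1) p(2)] cyclic_forD(1)[OF XY(2) q(2)] by auto
  have "det X \<noteq> 0" "det Y \<noteq> 0" using cyclic_for_det[OF XY(1) p(2) n0 p(1)] cyclic_for_det[OF XY(2) q(2) n0 q(1)] p q by auto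
  then obtain Xi Yi where Xi: "Xi \<in> carrier_mat n n" "X * Xi = 1\<^sub>m n" "Xi * X = 1\<^sub>m n"
    and Yi: "Yi \<in> carrier_mat n n" "Y * Yi = 1\<^sub>m n" "Yi * Y = 1\<^sub>m n"
    using det_nonzero_inverse[OF X] det_nonzero_inverse[OF Y] by metis
  let ?T = "transpose_mat :: 'a mat \<Rightarrow> 'a mat"
  have t: "?T X \<in> carrier_mat n n" "?T Y \<in> carrier_mat n n" "?T Xi \<in> carrier_mat n n" "?T Yi \<in> carrier_mat n n"
    "?T C \<in> carrier_mat n n" "?T A \<in> carrier_mat n n" using X Y Xi Yi c by auto
  have tinv: "?T X * ?T Xi = 1\<^sub>m n" "?T Xi * ?T X = 1\<^sub>m n" "?T Y * ?T Yi = 1\<^sub>m n" "?T Yi * ?T Y = 1\<^sub>m n"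
    using transpose_mult[OF Xi(1) X] transpose_mult[OF X Xi(1)] transpose_mult[OF Yi(1) Y] transpose_mult[OF Y Yi(1)]
    unfolding Xi Yi transpose_one by simp_all
  have cancel: "X * (Xi * U) = U" "Xi * (X * U) = U" "Y * (Yi * U) = U" "Yi * (Y * U) = U"
    "?T X * (?T Xi * U) = U" "?T Xi * (?T X * U) = U" "?T Y * (?T Yi * U) = U" "?T Yi * (?T Y * U) = U"
    if "U \<in> carrier_mat n n" for U
    using mult_cancel_inverse[OF _ _ that] X Y Xi Yi t tinv by blast+
  have TA: "?T A = ?T Y * ?T X" unfolding XY(3) by (rule transpose_mult[OF X Y])
  define W where "W = C * Yi"
  have W: "W \<in> carrier_mat n n" using c Yi by (simp add: W_def)
  define L where "L = four_block_mat X ?Z W (?T Xi)"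
  define U where "U = four_block_mat Y (Xi * B) ?Z (?T Yi)"
  have XB: "Xi * B \<in> carrier_mat n n" using Xi c by simp
  have AC: "?T Y * ?T X * C = ?T C * (X * Y)" using rel TA XY(3) by simp
  \<comment> \<open>This is the symmetry of \<open>A^T C\<close> for \<open>A = X Y\<close>,
    multiplied by \<open>Y^(-T)\<close> from the left and by \<open>Y^(-1)\<close> from the
    right.\<close>
  have "?T X * W = ?T W * X"
  proof -
    have "?T X * W = ?T Yi * (?T Y * ?T X * C) * Yi"
      unfolding W_def by (simp only: assoc_mult_mat[of _ n n _ n _ n] mult_carrier_square X Y Xi Yi(1) c t cancel)
    also have "\<dots> = ?T Yi * ?T C * X * (Y * Yi)"
      unfolding AC by (simp only: assoc_mult_mat[of _ n n _ n _ n] mult_carrier_square X Y Xi Yi(1) c t)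
    also have "\<dots> = ?T W * X"
      unfolding W_def transpose_mult[OF c(3) Yi(1)] Yi(2) using t X by simp
    finally show ?thesis .
  qed
  then have LSp: "L \<in> Sp n"
    unfolding L_def Sp_block_iff[OF X zero_carrier_mat W t(3)] using tinv W t by simp
  \<comment> \<open>\<open>D\<close> is determined by \<open>A^T D = 1 + C^T B\<close>, as
    \<open>A\<close> is invertible.\<close>
  have Dform: "D = W * (Xi * B) + ?T Xi * ?T Yi"
  proof -
    have WB: "W * (Xi * B) \<in> carrier_mat n n" "?T Xi * ?T Yi \<in> carrier_mat n n" "?T Y * ?T X \<in> carrier_mat n n"
      using W XB t by auto
    have "?T A * (W * (Xi * B) + ?T Xi * ?T Yi) = ?T A * (W * (Xi * B)) + ?T A * (?T Xi * ?T Yi)"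
      by (rule mult_add_distrib_mat[OF t(6) WB(1,2)])
    also have "?T A * (?T Xi * ?T Yi) = 1\<^sub>m n"
      unfolding TA by (simp only: assoc_mult_mat[of _ n n _ n _ n] mult_carrier_square t cancel tinv)
    also have "?T A * (W * (Xi * B)) = (?T Y * ?T X * C) * (Yi * (Xi * B))"
      unfolding TA W_def by (simp only: assoc_mult_mat[of _ n n _ n _ n] mult_carrier_square X Y Xi(1) Yi(1) c t)
    also have "\<dots> = ?T C * B"
      unfolding AC by (simp only: assoc_mult_mat[of _ n n _ n _ n] mult_carrier_square X Y Xi(1) Yi(1) c t cancel)
    also have "?T C * B + 1\<^sub>m n = ?T A * D" using rel t(5) c(2) by (simp add: comm_add_mat[of _ n n])
    finally have e: "?T A * (W * (Xi * B) + ?T Xi * ?T Yi) = ?T A * D" .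
    have inv: "(?T Xi * ?T Yi) * (?T A * V) = V" if V: "V \<in> carrier_mat n n" for V
      unfolding TA by (simp only: assoc_mult_mat[of _ n n _ n _ n] mult_carrier_square t cancel V)
    have "W * (Xi * B) + ?T Xi * ?T Yi = (?T Xi * ?T Yi) * (?T A * (W * (Xi * B) + ?T Xi * ?T Yi))"
      by (rule inv[symmetric]) (use WB in simp)
    also have "\<dots> = D" unfolding e by (rule inv[OF c(4)])
    finally show ?thesis by simp
  qed
  have LU: "L * U = four_block_mat A B C D"
  proof -
    have "L * U = four_block_mat (X * Y + ?Z * ?Z) (X * (Xi * B) + ?Z * ?T Yi) (W * Y + ?T Xi * ?Z) (W * (Xi * B) + ?T Xi * ?T Yi)"
      unfolding L_def U_def by (rule mult_four_block_mat[OF X zero_carrier_mat W t(3) Y XB zero_carrier_mat t(4)])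
    moreover have "X * Y + ?Z * ?Z = A" using XY(3) X Y by simp
    moreover have "X * (Xi * B) + ?Z * ?T Yi = B" using cancel(1)[OF c(2)] c(2) t by simp
    moreover have "W * Y + ?T Xi * ?Z = C"
    proof -
      have "W * Y = C * (Yi * Y)" unfolding W_def by (rule assoc_mult_mat[OF c(3) Yi(1) Y])
      then show ?thesis using Yi c t by simp
    qed
    ultimately show ?thesis using Dform by simp
  qed
  have Uc: "U \<in> carrier_mat ?N ?N" unfolding U_def by (rule four_block_carrier_2[OF Y t(4)])
  obtain Li where Li: "Li \<in> carrier_mat ?N ?N" "L * Li = 1\<^sub>m ?N" "Li * L = 1\<^sub>m ?N" using Sp_inverse[OF LSp] .
  have "Li * (L * U) = U" by (rule mult_cancel_inverse[OF Sp_carrier[OF LSp] Li(1) Uc Li(3)])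
  then have USp: "U \<in> Sp n" using Sp_mult[OF Sp_left_inverse[OF LSp Li(1,3)] S] LU by simp
  have cycXi: "cyclic_for (reciprocal_poly p) (?T Xi)"
    by (rule cyclic_for_transpose[OF cyclic_for_inverse[OF XY(1) p(2,1,3) Xi(1,3)]])
  have cycYi: "cyclic_for (reciprocal_poly q) Yi"
    by (rule cyclic_for_inverse[OF XY(2) q(2,1,3) Yi(1,3)])
  have degr: "degree (reciprocal_poly p) = n" "degree (reciprocal_poly q) = n"
    using reciprocal_poly_props(1) p q by metis+
  have cycL: "cyclic_for (p * reciprocal_poly p) L"
    unfolding L_def by (rule cyclic_for_block_lower[OF XY(1) p(2) cycXi degr(1) n0 W p(4)])
  \<comment> \<open>\<open>U\<close> is block upper triangular; its transpose has the shape treated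
    by \<open>cyclic_for_block_lower\<close>.\<close>
  have "cyclic_for (q * reciprocal_poly q) (four_block_mat (?T Y) ?Z (?T (Xi * B)) Yi)"
    by (rule cyclic_for_block_lower[OF cyclic_for_transpose[OF XY(2)] q(2) cycYi degr(2) n0 _ q(4)]) (use XB in simp)
  also have "four_block_mat (?T Y) ?Z (?T (Xi * B)) Yi = ?T U"
    unfolding U_def using transpose_four_block_mat[OF Y XB zero_carrier_mat t(4)] by simp
  finally have cycU: "cyclic_for (q * reciprocal_poly q) U" using cyclic_for_transpose by (metis transpose_transpose)
  have L1: "sp_conj n L N1" by (rule cyclic_hyperbolic_conjugate[OF LSp N(1) p(1,2,3) n0 p(4) cycL N(2)])
  have U2: "sp_conj n U N2" by (rule cyclic_hyperbolic_conjugate[OF USp N(3) q(1,2,3) n0 q(4) cycU N(4)])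
  note Lc = Sp_carrier[OF LSp] and Nc = Sp_carrier[OF N(1)] Sp_carrier[OF N(3)]
  obtain P Q where PQ: "P \<in> Sp n" "Q \<in> Sp n" "P * Q = 1\<^sub>m ?N" "Q * P = 1\<^sub>m ?N" "M = P * four_block_mat A B C D * Q"
    using sp_conjE[OF conj Sp_carrier[OF S]] by metis
  note Pc = Sp_carrier[OF PQ(1)] and Qc = Sp_carrier[OF PQ(2)]
  have canc: "Q * (P * V) = V" if "V \<in> carrier_mat ?N ?N" for V by (rule mult_cancel_inverse[OF Pc Qc that PQ(4)])
  have "M = (P * L * Q) * (P * U * Q)"
    unfolding PQ(5) LU[symmetric] by (simp only: assoc_mult_mat[of _ ?N ?N _ ?N _ ?N] mult_carrier_square Pc Qc Lc Uc canc)
  moreover have "P * L * Q \<in> Sp_conj_class n N1"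
    using sp_conj_trans[OF sp_conjI[OF PQ(1) Qc PQ(4) Lc refl] L1 Nc(1)] by (simp add: Sp_conj_class_def sp_conj_def)
  moreover have "P * U * Q \<in> Sp_conj_class n N2"
    using sp_conj_trans[OF sp_conjI[OF PQ(1) Qc PQ(4) Uc refl] U2 Nc(2)] by (simp add: Sp_conj_class_def sp_conj_def)
  ultimately show ?thesis unfolding class_product_def by blast
qed

section \<open>Moves that change a corner\<close>

lemma has_cornerI:
  "A \<in> carrier_mat n n \<Longrightarrow> B \<in> carrier_mat n n \<Longrightarrow> C \<in> carrier_mat n n \<Longrightarrow> D \<in> carrier_mat n n \<Longrightarrow>
    four_block_mat A B C D \<in> Sp n \<Longrightarrow> sp_conj n M (four_block_mat A B C D) \<Longrightarrow> has_corner n M A C"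
  unfolding has_corner_def by blast

lemma has_corner_symmetric:
  "has_corner n M A C \<Longrightarrow> transpose_mat A * C = transpose_mat C * A"
  unfolding has_corner_def using Sp_block_iff by blast

text \<open>The relation \<open>D^T A - B^T C = 1\<close> gives the first block column a left
  inverse.\<close>

lemma has_corner_injective:
  fixes M :: "'a::field mat"
  assumes "has_corner n M A C" and x: "x \<in> carrier_vec n" "A *\<^sub>v x = 0\<^sub>v n" "C *\<^sub>v x = 0\<^sub>v n"
  shows "x = 0\<^sub>v n"
proof -
  obtain B D where c: "A \<in> carrier_mat n n" "B \<in> carrier_mat n n" "C \<in> carrier_mat n n" "D \<in> carrier_mat n n"
    and S: "four_block_mat A B C D \<in> Sp n"
    using assms(1) unfolding has_corner_def by blast
  note rel = Sp_block_iff[OF c, THEN iffD1, OF S]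
  let ?T = "transpose_mat :: 'a mat \<Rightarrow> 'a mat"
  have t: "?T A \<in> carrier_mat n n" "?T B \<in> carrier_mat n n" "?T C \<in> carrier_mat n n" "?T D \<in> carrier_mat n n" using c by auto
  have "?T D * A = ?T (?T A * D)" using transpose_mult[OF t(1) c(4)] by simp
  also have "\<dots> = 1\<^sub>m n + ?T (?T C * B)"
    using rel transpose_add[OF one_carrier_mat mult_carrier_square[OF t(3) c(2)]] by simp
  also have "?T (?T C * B) = ?T B * C" using transpose_mult[OF t(3) c(2)] by simp
  finally have e: "?T D * A = 1\<^sub>m n + ?T B * C" .
  have z: "V *\<^sub>v 0\<^sub>v n = 0\<^sub>v n" if "V \<in> carrier_mat n n" for V :: "'a mat" using that by (intro eq_vecI) auto
  have "(?T D * A) *\<^sub>v x = 0\<^sub>v n" using assoc_mult_mat_vec[OF t(4) c(1) x(1)] x(2) z[OF t(4)] by simp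
  moreover have "(1\<^sub>m n + ?T B * C) *\<^sub>v x = x + ?T B *\<^sub>v (C *\<^sub>v x)"
    using add_mult_distrib_mat_vec[OF one_carrier_mat mult_carrier_square[OF t(2) c(3)] x(1)]
      assoc_mult_mat_vec[OF t(2) c(3) x(1)] x(1) by simp
  ultimately show ?thesis using e x z[OF t(2)] by simp
qed

text \<open>Conjugation by the block matrix (1, S; 0, 1), which is symplectic exactly for symmetric
  \<open>S\<close>.\<close>

lemma has_corner_shift:
  fixes M :: "'a::field mat"
  assumes "has_corner n M A C" and S: "S \<in> carrier_mat n n" "transpose_mat S = S"
  shows "has_corner n M (A + S * C) C"
proof -
  let ?N = "2 * n"
  obtain B D where c: "A \<in> carrier_mat n n" "B \<in> carrier_mat n n" "C \<in> carrier_mat n n" "D \<in> carrier_mat n n"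
    and Sp: "four_block_mat A B C D \<in> Sp n" and conj: "sp_conj n M (four_block_mat A B C D)"
    using assms(1) unfolding has_corner_def by blast
  let ?M = "four_block_mat A B C D" and ?Z = "0\<^sub>m n n :: 'a mat" and ?I = "1\<^sub>m n :: 'a mat"
  define P where "P = four_block_mat ?I S ?Z ?I"
  define Q where "Q = four_block_mat ?I (- S) ?Z ?I"
  have mS: "- S \<in> carrier_mat n n" using S by simp
  have PSp: "P \<in> Sp n" unfolding P_def Sp_block_iff[OF one_carrier_mat S(1) zero_carrier_mat one_carrier_mat]
    using S by simp
  note Pc = Sp_carrier[OF PSp]
  have Qc: "Q \<in> carrier_mat ?N ?N" unfolding Q_def by (rule four_block_carrier_2) auto
  have "P * Q = four_block_mat ?I ?Z ?Z ?I"
  proof -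
    have "- 0\<^sub>m n n + 1\<^sub>m n = (1\<^sub>m n :: 'a mat)" by (intro eq_matI) auto
    then show ?thesis
      unfolding P_def Q_def using S mS by (subst mult_four_block_mat[of _ n n _ n _ n _ _ n _ n]) (auto simp: uminus_l_inv_mat)
  qed
  then have PQ: "P * Q = 1\<^sub>m ?N" by (simp add: mult_2)
  have QP: "Q * P = 1\<^sub>m ?N" by (rule mat_mult_left_right_inverse[OF Pc Qc PQ])
  have SC: "S * C \<in> carrier_mat n n" "S * D \<in> carrier_mat n n" using S c by auto
  have e1: "P * ?M = four_block_mat (A + S * C) (B + S * D) C D"
    unfolding P_def using S c SC by (subst mult_four_block_mat[of _ n n _ n _ n _ _ n _ n]) auto
  have e: "P * ?M * Q = four_block_mat (A + S * C) ((A + S * C) * (- S) + (B + S * D)) C (C * (- S) + D)"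
    unfolding e1 Q_def using S c SC by (subst mult_four_block_mat[of _ n n _ n _ n _ _ n _ n]) auto
  have "sp_conj n (P * ?M * Q) ?M" by (rule sp_conjI[OF PSp Qc QP Sp_carrier[OF Sp] refl])
  then have r: "sp_conj n M (P * ?M * Q)" "P * ?M * Q \<in> Sp n"
    using sp_conj_trans[OF conj sp_conj_sym] sp_conj_Sp Sp Sp_carrier Pc Qc by (blast, metis)
  show ?thesis
    by (rule has_cornerI[OF _ _ _ _ r(2)[unfolded e] r(1)[unfolded e]]) (use c SC mS in auto)
qed

text \<open>Conjugation by diag(Q, P^T), a change of basis of the Lagrangian subspace:
  \<open>A\<close> transforms like an endomorphism and \<open>C\<close> like a bilinear
  form.\<close>

lemma has_corner_congruence:
  fixes M :: "'a::field mat"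
  assumes "has_corner n M A C" and P: "P \<in> carrier_mat n n" "Q \<in> carrier_mat n n" "Q * P = 1\<^sub>m n"
  shows "has_corner n M (Q * A * P) (transpose_mat P * C * P)"
proof -
  let ?N = "2 * n"
  obtain B D where c: "A \<in> carrier_mat n n" "B \<in> carrier_mat n n" "C \<in> carrier_mat n n" "D \<in> carrier_mat n n"
    and Sp: "four_block_mat A B C D \<in> Sp n" and conj: "sp_conj n M (four_block_mat A B C D)"
    using assms(1) unfolding has_corner_def by blast
  have PQ: "P * Q = 1\<^sub>m n" by (rule mat_mult_left_right_inverse[OF P(2,1,3)])
  let ?M = "four_block_mat A B C D" and ?Z = "0\<^sub>m n n :: 'a mat"
  let ?T = "transpose_mat :: 'a mat \<Rightarrow> 'a mat"
  have t: "?T P \<in> carrier_mat n n" "?T Q \<in> carrier_mat n n" using P by auto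
  have tinv: "?T P * ?T Q = 1\<^sub>m n" "?T Q * ?T P = 1\<^sub>m n"
    using transpose_mult[OF P(2,1)] transpose_mult[OF P(1,2)] unfolding P(3) PQ transpose_one by simp_all
  define V where "V = four_block_mat Q ?Z ?Z (?T P)"
  define W where "W = four_block_mat P ?Z ?Z (?T Q)"
  have VSp: "V \<in> Sp n" unfolding V_def Sp_block_iff[OF P(2) zero_carrier_mat zero_carrier_mat t(1)]
    using tinv t P by simp
  note Vc = Sp_carrier[OF VSp]
  have Wc: "W \<in> carrier_mat ?N ?N" unfolding W_def by (rule four_block_carrier_2) (use P t in auto)
  have "W * V = four_block_mat (1\<^sub>m n) ?Z ?Z (1\<^sub>m n)"
    unfolding V_def W_def using P PQ t tinv by (subst mult_four_block_mat[of _ n n _ n _ n _ _ n _ n]) auto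
  then have WV: "W * V = 1\<^sub>m ?N" by (simp add: mult_2)
  have e1: "V * ?M = four_block_mat (Q * A) (Q * B) (?T P * C) (?T P * D)"
    unfolding V_def using P t c by (subst mult_four_block_mat[of _ n n _ n _ n _ _ n _ n]) auto
  have e: "V * ?M * W = four_block_mat (Q * A * P) (Q * B * ?T Q) (?T P * C * P) (?T P * D * ?T Q)"
  proof -
    have q: "Q * A \<in> carrier_mat n n" "Q * B \<in> carrier_mat n n" "?T P * C \<in> carrier_mat n n" "?T P * D \<in> carrier_mat n n"
      using P t c by auto
    note m = mult_carrier_square[OF q(1) P(1)] mult_carrier_square[OF q(2) t(2)]
      mult_carrier_square[OF q(3) P(1)] mult_carrier_square[OF q(4) t(2)]
    show ?thesis
      unfolding e1 W_def mult_four_block_mat[OF q P(1) zero_carrier_mat zero_carrier_mat t(2)]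
        right_mult_zero_mat[OF q(1)] right_mult_zero_mat[OF q(2)] right_mult_zero_mat[OF q(3)] right_mult_zero_mat[OF q(4)]
        right_add_zero_mat[OF m(1)] left_add_zero_mat[OF m(2)] right_add_zero_mat[OF m(3)] left_add_zero_mat[OF m(4)] ..
  qed
  have "sp_conj n (V * ?M * W) ?M" by (rule sp_conjI[OF VSp Wc WV Sp_carrier[OF Sp] refl])
  then have r: "sp_conj n M (V * ?M * W)" "V * ?M * W \<in> Sp n"
    using sp_conj_trans[OF conj sp_conj_sym] sp_conj_Sp Sp Sp_carrier Vc Wc by (blast, metis)
  show ?thesis
    by (rule has_cornerI[OF _ _ _ _ r(2)[unfolded e] r(1)[unfolded e]]) (use c P t in auto)
qed

section \<open>Singular nonzero corners\<close>

definition coord_proj :: "nat \<Rightarrow> nat \<Rightarrow> 'a::field mat" where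
  "coord_proj n m = mat n n (\<lambda>(i, j). if i = j \<and> m \<le> i then 1 else 0)"

lemma coord_proj_carrier [simp]: "coord_proj n m \<in> carrier_mat n n"
  by (simp add: coord_proj_def)

text \<open>Elimination with the pivot moved to the last place. The kernel of the normal form is
  then spanned by the first \<open>m\<close> unit vectors, which matches
  \<open>upper_right_block n m\<close>.\<close>

lemma rank_normal_form:
  fixes C :: "'a::field mat"
  assumes "C \<in> carrier_mat n n"
  shows "\<exists>P Q m. P \<in> carrier_mat n n \<and> Q \<in> carrier_mat n n \<and> det P \<noteq> 0 \<and> det Q \<noteq> 0 \<and> m \<le> n \<and>
    P * C * Q = coord_proj n m"
  using assms
proof (induction n arbitrary: C)
  case 0
  then show ?case
    by (intro exI[of _ "1\<^sub>m 0"] exI[of _ 0]) (auto simp: coord_proj_def intro!: eq_matI)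
next
  case (Suc n)
  note C = Suc.prems
  let ?N = "Suc n"
  show ?case
  proof (cases "C = 0\<^sub>m ?N ?N")
    case True
    then show ?thesis
      by (intro exI[of _ "1\<^sub>m ?N"] exI[of _ ?N]) (auto simp: coord_proj_def intro!: eq_matI)
  next
    case False
    then obtain i j where ij: "i < ?N" "j < ?N" "C $$ (i, j) \<noteq> 0" using C by (auto simp: mat_eq_iff)
    let ?S = "swaprows_mat ?N i n :: 'a mat" and ?T = "swaprows_mat ?N j n :: 'a mat"
    have S: "?S \<in> carrier_mat ?N ?N" "?T \<in> carrier_mat ?N ?N" by auto
    have dS: "det ?S \<noteq> 0" "det ?T \<noteq> 0"
      using det_mult[OF S(1,1)] det_mult[OF S(2,2)] swaprows_mat_inv[of i ?N n, where 'a = 'a]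
        swaprows_mat_inv[of j ?N n, where 'a = 'a] ij by auto
    define C' where "C' = ?S * C * ?T"
    have C': "C' \<in> carrier_mat ?N ?N" unfolding C'_def by (intro mult_carrier_square S C)
    have SC: "?S * C \<in> carrier_mat ?N ?N" by (rule mult_carrier_square[OF S(1) C])
    have "C' $$ (n, n) = row (?S * C) n \<bullet> col ?T n"
      unfolding C'_def using S SC by (subst index_mult_mat) auto
    also have "col ?T n = unit_vec ?N j" using ij by (intro eq_vecI) auto
    also have "row (?S * C) n \<bullet> unit_vec ?N j = (?S * C) $$ (n, j)"
      using ij SC C by (subst scalar_prod_right_unit) (auto simp del: index_mult_mat(1))
    also have "\<dots> = row ?S n \<bullet> col C j" using ij C by simp
    also have "row ?S n = unit_vec ?N i" using ij by (intro eq_vecI) auto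
    also have "unit_vec ?N i \<bullet> col C j = C $$ (i, j)" using ij C by simp
    finally have piv: "C' $$ (n, n) \<noteq> 0" using ij by simp
    obtain C1 c r D where sp: "split_block C' n n = (C1, c, r, D)" by (cases "split_block C' n n")
    have cc: "C1 \<in> carrier_mat n n" "c \<in> carrier_mat n 1" "r \<in> carrier_mat 1 n" "D \<in> carrier_mat 1 1"
      and Cb: "C' = four_block_mat C1 c r D"
      using split_block[OF sp, of 1 1] C' by auto
    define d where "d = C' $$ (n, n)"
    have D: "D = d \<cdot>\<^sub>m 1\<^sub>m 1" using mat_1_1_eq[OF cc(4)] cc Cb by (simp add: d_def)
    have d0: "d \<noteq> 0" using piv by (simp add: d_def)
    define c' where "c' = - (inverse d \<cdot>\<^sub>m c)"
    define r' where "r' = inverse d \<cdot>\<^sub>m r"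
    have c'r': "c' \<in> carrier_mat n 1" "r' \<in> carrier_mat 1 n" "- r' \<in> carrier_mat 1 n" using cc by (auto simp: c'_def r'_def)
    define P0 where "P0 = four_block_mat (1\<^sub>m n) c' (0\<^sub>m 1 n) (inverse d \<cdot>\<^sub>m 1\<^sub>m 1)"
    define Q0 where "Q0 = four_block_mat (1\<^sub>m n) (0\<^sub>m n 1) (- r') (1\<^sub>m 1)"
    define B where "B = C1 + c' * r"
    have B: "B \<in> carrier_mat n n" using cc c'r' by (auto simp: B_def)
    have "P0 * C' = four_block_mat B (0\<^sub>m n 1) r' (1\<^sub>m 1)"
    proof -
      have 1: "c + c' * D = 0\<^sub>m n 1"
        using cc c'r' d0 by (intro eq_matI) (auto simp: D c'_def scalar_prod_def)
      have 2: "(inverse d \<cdot>\<^sub>m 1\<^sub>m 1) * r = r'" using cc by (simp add: r'_def mult_smult_assoc_mat[of _ 1 1 _ n])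
      have 3: "(inverse d \<cdot>\<^sub>m 1\<^sub>m 1) * D = 1\<^sub>m 1" using d0 by (intro eq_matI) (auto simp: D scalar_prod_def)
      show ?thesis
        unfolding P0_def Cb B_def using cc c'r' 1 2 3
        by (subst mult_four_block_mat[of _ n n _ 1 _ 1 _ _ n _ 1]) (auto simp: mult_carrier_mat[of _ n 1 _ n])
    qed
    moreover have "B + - 0\<^sub>m n n = B" using B by (intro eq_matI) auto
    ultimately have PCQ0: "P0 * C' * Q0 = four_block_mat B (0\<^sub>m n 1) (0\<^sub>m 1 n) (1\<^sub>m 1)"
      unfolding Q0_def using cc c'r' B
      by (simp add: mult_four_block_mat[of _ n n _ 1 _ 1 _ _ n _ 1] minus_r_inv_mat flip: minus_add_uminus_mat[OF c'r'(2,2)])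
    obtain P Q m where ih: "P \<in> carrier_mat n n" "Q \<in> carrier_mat n n" "det P \<noteq> 0" "det Q \<noteq> 0" "m \<le> n"
      "P * B * Q = coord_proj n m" using Suc.IH[OF B] by blast
    define P1 where "P1 = four_block_mat P (0\<^sub>m n 1) (0\<^sub>m 1 n) (1\<^sub>m 1)"
    define Q1 where "Q1 = four_block_mat Q (0\<^sub>m n 1) (0\<^sub>m 1 n) (1\<^sub>m 1)"
    have one: "(1\<^sub>m 1 :: 'a mat) \<in> carrier_mat 1 1" "inverse d \<cdot>\<^sub>m 1\<^sub>m 1 \<in> carrier_mat 1 1" by auto
    have car: "P0 \<in> carrier_mat ?N ?N" "Q0 \<in> carrier_mat ?N ?N" "P1 \<in> carrier_mat ?N ?N" "Q1 \<in> carrier_mat ?N ?N"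
      unfolding P0_def Q0_def P1_def Q1_def
      using four_block_carrier_mat[of "1\<^sub>m n" n n "inverse d \<cdot>\<^sub>m 1\<^sub>m 1" 1 1] four_block_carrier_mat[of "1\<^sub>m n" n n "1\<^sub>m 1" 1 1]
        four_block_carrier_mat[OF ih(1) one(1)] four_block_carrier_mat[OF ih(2) one(1)] by auto
    have dets: "det P0 \<noteq> 0" "det Q0 \<noteq> 0" "det P1 \<noteq> 0" "det Q1 \<noteq> 0"
      unfolding P0_def Q0_def P1_def Q1_def
      using det_four_block_mat_lower_left_zero[OF one_carrier_mat c'r'(1) refl one(2)]
        det_four_block_mat_upper_right_zero[OF one_carrier_mat refl c'r'(3) one(1)]
        det_four_block_mat_lower_left_zero[OF ih(1) zero_carrier_mat refl one(1)]
        det_four_block_mat_lower_left_zero[OF ih(2) zero_carrier_mat refl one(1)] ih d0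
      by (auto simp: det_single)
    have PB: "P * B \<in> carrier_mat n n" using ih B by simp
    have "P1 * (P0 * C' * Q0) * Q1 = four_block_mat (P * B * Q) (0\<^sub>m n 1) (0\<^sub>m 1 n) (1\<^sub>m 1)"
      unfolding P1_def Q1_def PCQ0 using ih B PB
      by (simp add: mult_four_block_mat[of _ n n _ 1 _ 1 _ _ n _ 1])
    also have "\<dots> = coord_proj ?N m"
      unfolding ih(6) using ih(5) by (intro eq_matI) (auto simp: coord_proj_def)
    finally have "P1 * P0 * ?S * C * (?T * Q0 * Q1) = coord_proj ?N m"
      unfolding C'_def
      by (simp only: assoc_mult_mat[of _ ?N ?N _ ?N _ ?N] mult_carrier_square S C car)
    moreover have "P1 * P0 * ?S \<in> carrier_mat ?N ?N" "?T * Q0 * Q1 \<in> carrier_mat ?N ?N"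
      by (simp_all only: mult_carrier_square S car)
    moreover have "det (P1 * P0 * ?S) \<noteq> 0" "det (?T * Q0 * Q1) \<noteq> 0"
      using det_mult[OF mult_carrier_square[OF car(3,1)] S(1)] det_mult[OF car(3,1)]
        det_mult[OF mult_carrier_square[OF S(2) car(2)] car(4)] det_mult[OF S(2) car(2)] dets dS by auto
    moreover have "m \<le> ?N" using ih(5) by simp
    ultimately show ?thesis by blast
  qed
qed

text \<open>With the generalized inverse \<open>J\<close> of \<open>C\<close>, the matrix
  \<open>S = B J + (B J)^T - J^T B^T C J\<close> satisfies \<open>S C = B\<close> as soon as
  \<open>B\<close> vanishes on the kernel of \<open>C\<close>. It is symmetric because
  \<open>C^T B\<close> is, so \<open>B\<close> can be added by a shift.\<close>

lemma has_corner_modify: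
  fixes M :: "'a::field mat"
  assumes corner: "has_corner n M A C" and J: "J \<in> carrier_mat n n" "J * C = E" "C * E = C"
    and B: "B \<in> carrier_mat n n" "B * E = B" "transpose_mat C * B = transpose_mat B * C"
  shows "has_corner n M (A + B) C"
proof -
  have c: "A \<in> carrier_mat n n" "C \<in> carrier_mat n n" using corner by (auto simp: has_corner_def)
  let ?T = "transpose_mat :: 'a mat \<Rightarrow> 'a mat"
  have E: "E \<in> carrier_mat n n" using J c by auto
  have t: "?T J \<in> carrier_mat n n" "?T B \<in> carrier_mat n n" "?T C \<in> carrier_mat n n" using J B c by auto
  define K where "K = ?T J * (?T B * C * J)"
  have K: "K \<in> carrier_mat n n" unfolding K_def by (intro mult_carrier_square t c J)
  have BJ: "B * J \<in> carrier_mat n n" "?T J * ?T B \<in> carrier_mat n n" "B * J + ?T J * ?T B \<in> carrier_mat n n" using B J t by auto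
  define S where "S = B * J + ?T J * ?T B - K"
  have S: "S \<in> carrier_mat n n" using BJ K by (auto simp: S_def)
  have KT: "?T K = K"
  proof -
    have "?T K = ?T (?T B * C * J) * J"
      unfolding K_def by (subst transpose_mult[OF t(1)]) (use t c J in auto)
    also have "?T (?T B * C * J) = ?T J * (?T C * B)"
      using transpose_mult[OF mult_carrier_square[OF t(2) c(2)] J(1)] transpose_mult[OF t(2) c(2)] by simp
    also have "?T J * (?T C * B) * J = K"
      unfolding K_def B(3) by (simp only: assoc_mult_mat[of _ n n _ n _ n] mult_carrier_square t c J)
    finally show ?thesis .
  qed
  have "?T S = ?T (B * J + ?T J * ?T B) - ?T K" unfolding S_def by (rule transpose_minus[OF BJ(3) K])
  also have "?T (B * J + ?T J * ?T B) = ?T (B * J) + ?T (?T J * ?T B)" by (rule transpose_add[OF BJ(1,2)])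
  also have "\<dots> = B * J + ?T J * ?T B"
    using transpose_mult[OF B(1) J(1)] transpose_mult[OF t(1,2)] BJ by (simp add: comm_add_mat[of _ n n])
  finally have ST: "?T S = S" unfolding KT S_def .
  have "S * C = (B * J + ?T J * ?T B) * C - K * C" unfolding S_def by (rule minus_mult_distrib_mat[OF BJ(3) K c(2)])
  also have "(B * J + ?T J * ?T B) * C = B * J * C + ?T J * ?T B * C" by (rule add_mult_distrib_mat[OF BJ(1,2) c(2)])
  also have "B * J * C = B" using assoc_mult_mat[OF B(1) J(1) c(2)] J(2) B(2) by simp
  also have "K * C = ?T J * (?T B * (C * (J * C)))"
    unfolding K_def by (simp only: assoc_mult_mat[of _ n n _ n _ n] mult_carrier_square t c J)
  also have "\<dots> = ?T J * ?T B * C" unfolding J(2,3) by (rule assoc_mult_mat[OF t(1,2) c(2), symmetric])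
  also have "B + ?T J * ?T B * C - ?T J * ?T B * C = B"
    using B(1) BJ c by (intro eq_matI) auto
  finally have "S * C = B" .
  then show ?thesis using has_corner_shift[OF corner S ST] by simp
qed

lemma det_scale_last:
  assumes "n > 0"
  shows "det (mat n n (\<lambda>(i, j). if i = j then if i = n - 1 then \<sigma> else 1 else 0)) = (\<sigma> :: 'a::field)"
proof -
  let ?D = "mat n n (\<lambda>(i, j). if i = j then if i = n - 1 then \<sigma> else 1 else 0)"
  have "det ?D = prod_list (diag_mat ?D)" by (rule det_upper_triangular[of _ n]) auto
  also have "diag_mat ?D = map (\<lambda>i. if i = n - 1 then \<sigma> else 1) [0..<n]" by (auto simp: diag_mat_def)
  also have "prod_list \<dots> = (\<Prod>i\<in>{0..<n}. if i = n - 1 then \<sigma> else 1)"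
    by (simp add: prod.list_conv_set_nth)
  also have "\<dots> = \<sigma>" using assms by (subst prod.remove[of _ "n - 1"]) (auto intro!: prod.neutral)
  finally show ?thesis .
qed

text \<open>On the kernel of \<open>C\<close>, spanned by the first \<open>m\<close> unit vectors,
  \<open>A\<close> is kept; elsewhere it is replaced so as to become invertible and compatible with
  \<open>C\<close>. Scaling one column corrects the determinant, and the factor \<open>1 + F\<close>
  is admissible because \<open>F\<close> maps into the kernel of \<open>C\<close>.\<close>

lemma factorization_if_normalized_corner:
  fixes M :: "'a::field mat"
  assumes corner: "has_corner n M A C" and m: "1 \<le> m" "m < n"
    and J: "J \<in> carrier_mat n n" "J * C = coord_proj n m" "C * coord_proj n m = C"
    and p: "lead_coeff p = 1" "degree p = n" "coeff p 0 \<noteq> 0" and q: "lead_coeff q = 1" "degree q = n" "coeff q 0 \<noteq> 0"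
  shows "\<exists>A' X Y. has_corner n M A' C \<and> cyclic_for p X \<and> cyclic_for q Y \<and> A' = X * Y"
proof -
  have c: "A \<in> carrier_mat n n" "C \<in> carrier_mat n n" using corner by (auto simp: has_corner_def)
  let ?T = "transpose_mat :: 'a mat \<Rightarrow> 'a mat"
  define E :: "'a mat" where "E = coord_proj n m"
  define E' :: "'a mat" where "E' = mat n n (\<lambda>(i, j). if i = j \<and> i < m then 1 else 0)"
  note JC = J(2)[folded E_def] and CE = J(3)[folded E_def]
  have E: "E \<in> carrier_mat n n" "E' \<in> carrier_mat n n" by (auto simp: E_def E'_def)
  have t: "?T J \<in> carrier_mat n n" "?T C \<in> carrier_mat n n" "?T A \<in> carrier_mat n n" "?T E \<in> carrier_mat n n" using J c E by auto
  have left: "(E * Z) $$ (i, j) = (if m \<le> i then Z $$ (i, j) else 0)" "(E' * Z) $$ (i, j) = (if i < m then Z $$ (i, j) else 0)"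
    if "Z \<in> carrier_mat n n" "i < n" "j < n" for Z i j
  proof -
    have "(E * Z) $$ (i, j) = (\<Sum>k<n. if k = i then (if m \<le> i then Z $$ (k, j) else 0) else 0)"
      unfolding mat_mat_index_sum[OF E(1) that] using that by (intro sum.cong refl) (auto simp: E_def coord_proj_def)
    then show "(E * Z) $$ (i, j) = (if m \<le> i then Z $$ (i, j) else 0)" using that by (simp add: sum.delta)
    have "(E' * Z) $$ (i, j) = (\<Sum>k<n. if k = i then (if i < m then Z $$ (k, j) else 0) else 0)"
      unfolding mat_mat_index_sum[OF E(2) that] using that by (intro sum.cong refl) (auto simp: E'_def)
    then show "(E' * Z) $$ (i, j) = (if i < m then Z $$ (i, j) else 0)" using that by (simp add: sum.delta)
  qed
  have right: "(Z * E) $$ (i, j) = (if m \<le> j then Z $$ (i, j) else 0)" if "Z \<in> carrier_mat n n" "i < n" "j < n" for Z i j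
  proof -
    have "(Z * E) $$ (i, j) = (\<Sum>k<n. if k = j then (if m \<le> j then Z $$ (i, k) else 0) else 0)"
      unfolding mat_mat_index_sum[OF that(1) E(1) that(2,3)] using that by (intro sum.cong refl) (auto simp: E_def coord_proj_def)
    then show "(Z * E) $$ (i, j) = (if m \<le> j then Z $$ (i, j) else 0)" using that by (simp add: sum.delta)
  qed
  have mm: "X * Y = Z" if "X \<in> carrier_mat n n" "Y \<in> carrier_mat n n" "Z \<in> carrier_mat n n"
    "\<And>i j. i < n \<Longrightarrow> j < n \<Longrightarrow> (X * Y) $$ (i, j) = Z $$ (i, j)" for X Y Z :: "'a mat"
    by (rule eq_matI) (use that in auto)
  have EE: "E * E = E" "E' * E = 0\<^sub>m n n" "?T E = E" "E' + E = 1\<^sub>m n"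
    subgoal by (rule mm[OF E(1,1,1)]) (simp only: left[OF E(1)], auto simp: E_def coord_proj_def)
    subgoal by (rule mm[OF E(2,1) zero_carrier_mat]) (simp only: left[OF E(1)], auto simp: E_def coord_proj_def)
    by (auto simp: E_def E'_def coord_proj_def intro!: eq_matI)
  have CE': "C * E' = 0\<^sub>m n n"
  proof -
    have EE': "E * E' = 0\<^sub>m n n" by (rule mm[OF E zero_carrier_mat]) (simp only: left[OF E(2)], auto simp: E'_def)
    have "C * E' = C * E * E'" unfolding CE ..
    also have "\<dots> = C * (E * E')" by (rule assoc_mult_mat[OF c(2) E])
    finally show ?thesis unfolding EE' using c by simp
  qed
  \<comment> \<open>The first term contributes nothing to \<open>C^T A0\<close>, because
    \<open>C^T A = A^T C\<close> and \<open>C E' = 0\<close>; the second makes \<open>C^T A0\<close>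
    equal to the symmetric matrix \<open>E\<close>.\<close>
  define A0 where "A0 = A * E' + ?T J * E"
  have AE: "A * E' \<in> carrier_mat n n" "?T J * E \<in> carrier_mat n n" "A * E \<in> carrier_mat n n" using c t E by auto
  have A0: "A0 \<in> carrier_mat n n" using AE by (simp add: A0_def)
  note sym = has_corner_symmetric[OF corner]
  have CJ: "?T C * ?T J = E" using transpose_mult[OF J(1) c(2)] JC EE(3) by simp
  have CA0: "?T C * A0 = E"
  proof -
    have "?T C * A0 = ?T C * (A * E') + ?T C * (?T J * E)" unfolding A0_def by (rule mult_add_distrib_mat[OF t(2) AE(1,2)])
    also have "?T C * (A * E') = ?T A * C * E'" using assoc_mult_mat[OF t(2) c(1) E(2)] sym by simp
    also have "\<dots> = 0\<^sub>m n n" using assoc_mult_mat[OF t(3) c(2) E(2)] CE' t by simp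
    also have "?T C * (?T J * E) = E" using assoc_mult_mat[OF t(2,1) E(1)] CJ EE(1) by simp
    finally show ?thesis using E by simp
  qed
  have "det A0 \<noteq> 0"
  proof (rule det_nonzero_if_injective[OF A0])
    fix x assume x: "x \<in> carrier_vec n" "A0 *\<^sub>v x = 0\<^sub>v n"
    have z: "V *\<^sub>v 0\<^sub>v n = 0\<^sub>v n" if "V \<in> carrier_mat n n" for V :: "'a mat" using that by (intro eq_vecI) auto
    have Ex: "E *\<^sub>v x = 0\<^sub>v n" using assoc_mult_mat_vec[OF t(2) A0 x(1)] x(2) z[OF t(2)] CA0 by simp
    have E'x: "E' *\<^sub>v x = x"
    proof -
      have "x = (E' + E) *\<^sub>v x" using EE(4) x by simp
      also have "\<dots> = E' *\<^sub>v x + E *\<^sub>v x" by (rule add_mult_distrib_mat_vec[OF E(2,1) x(1)])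
      finally show ?thesis using Ex mult_mat_vec_carrier[OF E(2) x(1)] by simp
    qed
    have "A0 *\<^sub>v x = (A * E') *\<^sub>v x + (?T J * E) *\<^sub>v x"
      unfolding A0_def by (rule add_mult_distrib_mat_vec[OF AE(1,2) x(1)])
    also have "(?T J * E) *\<^sub>v x = 0\<^sub>v n" using assoc_mult_mat_vec[OF t(1) E(1) x(1)] Ex z[OF t(1)] by simp
    also have "(A * E') *\<^sub>v x = A *\<^sub>v x" using assoc_mult_mat_vec[OF c(1) E(2) x(1)] E'x by simp
    finally have "A *\<^sub>v x = 0\<^sub>v n" using x(2) mult_mat_vec_carrier[OF c(1) x(1)] by simp
    moreover have "C *\<^sub>v x = 0\<^sub>v n" using assoc_mult_mat_vec[OF c(2) E(1) x(1)] CE Ex z[OF c(2)] by simp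
    ultimately show "x = 0\<^sub>v n" using has_corner_injective[OF corner x(1)] by blast
  qed
  \<comment> \<open>The last coordinate lies outside the kernel of \<open>C\<close>, as
    \<open>m < n\<close>, so the last column is free to be rescaled.\<close>
  define \<sigma> where "\<sigma> = coeff p 0 * coeff q 0 / det A0"
  define \<Delta> where "\<Delta> = mat n n (\<lambda>(i, j). if i = j then if i = n - 1 then \<sigma> else 1 else 0 :: 'a)"
  have \<Delta>: "\<Delta> \<in> carrier_mat n n" by (simp add: \<Delta>_def)
  have n0: "n > 0" using m by simp
  have "det \<Delta> = \<sigma>" unfolding \<Delta>_def by (rule det_scale_last[OF n0])
  then have "det (A0 * \<Delta>) = coeff p 0 * coeff q 0" using det_mult[OF A0 \<Delta>] \<open>det A0 \<noteq> 0\<close> by (simp add: \<sigma>_def)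
  then obtain F X Y where F: "upper_right_block n m F" and XY: "cyclic_for p X" "cyclic_for q Y"
    and eq: "A0 * \<Delta> * (1\<^sub>m n + F) = X * Y"
    using cyclic_factorization[OF mult_carrier_square[OF A0 \<Delta>] m p q] by blast
  have Fc: "F \<in> carrier_mat n n" and F0: "\<And>i j. i < n \<Longrightarrow> j < n \<Longrightarrow> \<not> (i < m \<and> m \<le> j) \<Longrightarrow> F $$ (i, j) = 0"
    using F by (auto simp: upper_right_block_def)
  have ED: "E * \<Delta> \<in> carrier_mat n n" using E \<Delta> by simp
  have dl: "(Z * \<Delta>) $$ (i, j) = (if j = n - 1 then \<sigma> * Z $$ (i, j) else Z $$ (i, j))" if "Z \<in> carrier_mat n n" "i < n" "j < n" for Z i j
  proof -
    have "(Z * \<Delta>) $$ (i, j) = (\<Sum>k<n. if k = j then (if j = n - 1 then \<sigma> * Z $$ (i, k) else Z $$ (i, k)) else 0)"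
      unfolding mat_mat_index_sum[OF that(1) \<Delta> that(2,3)] using that by (intro sum.cong refl) (auto simp: \<Delta>_def)
    then show ?thesis using that by (simp add: sum.delta)
  qed
  have dr: "(\<Delta> * Z) $$ (i, j) = (if i = n - 1 then \<sigma> * Z $$ (i, j) else Z $$ (i, j))" if "Z \<in> carrier_mat n n" "i < n" "j < n" for Z i j
  proof -
    have "(\<Delta> * Z) $$ (i, j) = (\<Sum>k<n. if k = i then (if i = n - 1 then \<sigma> * Z $$ (k, j) else Z $$ (k, j)) else 0)"
      unfolding mat_mat_index_sum[OF \<Delta> that] using that by (intro sum.cong refl) (auto simp: \<Delta>_def)
    then show ?thesis using that by (simp add: sum.delta)
  qed
  have Flast: "F $$ (n - 1, j) = 0" if "j < n" for j by (rule F0) (use m that in auto)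
  have id: "E' * \<Delta> = E'" "\<Delta> * F = F" "E' * F = F" "E * F = 0\<^sub>m n n" "F * E = F" "E * \<Delta> * E = E * \<Delta>" "?T (E * \<Delta>) = E * \<Delta>"
    subgoal by (rule mm[OF E(2) \<Delta> E(2)]) (simp only: dl[OF E(2)], use m in \<open>auto simp: E'_def\<close>)
    subgoal by (rule mm[OF \<Delta> Fc Fc]) (simp only: dr[OF Fc], use Flast in auto)
    subgoal by (rule mm[OF E(2) Fc Fc]) (simp only: left[OF Fc], use F0 in auto)
    subgoal by (rule mm[OF E(1) Fc zero_carrier_mat]) (simp only: left[OF Fc], use F0 in auto)
    subgoal by (rule mm[OF Fc E(1) Fc]) (simp only: right[OF Fc], use F0 in auto)
    subgoal by (rule mm[OF ED E(1) ED]) (simp only: right[OF ED] left[OF \<Delta>], auto simp: \<Delta>_def)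
    subgoal
    proof (rule eq_matI)
      fix i j assume "i < dim_row (E * \<Delta>)" "j < dim_col (E * \<Delta>)"
      then have ij: "i < n" "j < n" using ED by auto
      have "(E * \<Delta>) $$ (j, i) = (E * \<Delta>) $$ (i, j)"
        unfolding left[OF \<Delta> ij] left[OF \<Delta> ij(2,1)] using ij by (auto simp: \<Delta>_def)
      moreover have "?T (E * \<Delta>) $$ (i, j) = (E * \<Delta>) $$ (j, i)"
        by (rule index_transpose_mat(1)) (use ij carrier_matD[OF ED] in simp_all)
      ultimately show "?T (E * \<Delta>) $$ (i, j) = (E * \<Delta>) $$ (i, j)" by simp
    qed (use carrier_matD[OF ED] in simp_all)
    done
  have A'1: "A0 * \<Delta> = A * E' + ?T J * (E * \<Delta>)"
  proof -
    have "A0 * \<Delta> = A * E' * \<Delta> + ?T J * E * \<Delta>" unfolding A0_def by (rule add_mult_distrib_mat[OF AE(1,2) \<Delta>])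
    then show ?thesis using assoc_mult_mat[OF c(1) E(2) \<Delta>] assoc_mult_mat[OF t(1) E(1) \<Delta>] id(1) by simp
  qed
  have A'2: "A0 * \<Delta> * F = A * F"
  proof -
    have "A0 * \<Delta> * F = A0 * F" using assoc_mult_mat[OF A0 \<Delta> Fc] id(2) by simp
    also have "\<dots> = A * E' * F + ?T J * E * F" unfolding A0_def by (rule add_mult_distrib_mat[OF AE(1,2) Fc])
    also have "A * E' * F = A * F" using assoc_mult_mat[OF c(1) E(2) Fc] id(3) by simp
    also have "?T J * E * F = 0\<^sub>m n n" using assoc_mult_mat[OF t(1) E(1) Fc] id(4) t by simp
    finally show ?thesis using c Fc by simp
  qed
  \<comment> \<open>\<open>B\<close> is the desired corner \<open>A0 \<Delta> (1 + F)\<close> minus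
    \<open>A\<close>, written with \<open>A0 \<Delta> F = A F\<close>.\<close>
  define B where "B = ?T J * (E * \<Delta>) + A * F - A * E"
  have JED: "?T J * (E * \<Delta>) \<in> carrier_mat n n" "A * F \<in> carrier_mat n n" "?T J * (E * \<Delta>) + A * F \<in> carrier_mat n n" using t ED c Fc by auto
  have B: "B \<in> carrier_mat n n" unfolding B_def by (rule minus_carrier_mat[OF AE(3)])
  have A_split: "A = A * E' + A * E" using mult_add_distrib_mat[OF c(1) E(2,1)] EE(4) c by simp
  have cancel: "(R + S) + (V + W - S) = R + V + W"
    if "R \<in> carrier_mat n n" "S \<in> carrier_mat n n" "V \<in> carrier_mat n n" "W \<in> carrier_mat n n" for R S V W :: "'a mat"
    using that by (intro eq_matI) auto
  have AB: "A + B = A * E' + ?T J * (E * \<Delta>) + A * F"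
    using arg_cong[OF A_split, of "\<lambda>Z. Z + B"] cancel[OF AE(1,3) JED(1,2)] unfolding B_def by (rule trans)
  have "A0 * \<Delta> * (1\<^sub>m n + F) = A0 * \<Delta> * 1\<^sub>m n + A0 * \<Delta> * F"
    by (rule mult_add_distrib_mat[OF mult_carrier_square[OF A0 \<Delta>] one_carrier_mat Fc])
  also have "A0 * \<Delta> * 1\<^sub>m n = A0 * \<Delta>" by (rule right_mult_one_mat[OF mult_carrier_square[OF A0 \<Delta>]])
  finally have "X * Y = A0 * \<Delta> + A * F" unfolding A'2 eq .
  then have prod: "X * Y = A + B" unfolding AB A'1 .
  have "B * E = B"
  proof -
    have "B * E = (?T J * (E * \<Delta>) + A * F) * E - A * E * E" unfolding B_def by (rule minus_mult_distrib_mat[OF JED(3) AE(3) E(1)])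
    also have "(?T J * (E * \<Delta>) + A * F) * E = ?T J * (E * \<Delta>) * E + A * F * E" by (rule add_mult_distrib_mat[OF JED(1,2) E(1)])
    also have "?T J * (E * \<Delta>) * E = ?T J * (E * \<Delta>)" using assoc_mult_mat[OF t(1) ED E(1)] id(6) by simp
    also have "A * F * E = A * F" using assoc_mult_mat[OF c(1) Fc E(1)] id(5) by simp
    also have "A * E * E = A * E" using assoc_mult_mat[OF c(1) E(1,1)] EE(1) by simp
    finally show ?thesis unfolding B_def .
  qed
  \<comment> \<open>The term with \<open>F\<close> drops out, since
    \<open>C^T A F = A^T C F = 0\<close>, and what remains is symmetric.\<close>
  have CB: "?T C * B = E * \<Delta> - ?T A * C"
  proof -
    have "?T C * B = ?T C * (?T J * (E * \<Delta>) + A * F) - ?T C * (A * E)"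
      unfolding B_def by (rule mult_minus_distrib_mat[OF t(2) JED(3) AE(3)])
    also have "?T C * (?T J * (E * \<Delta>) + A * F) = ?T C * (?T J * (E * \<Delta>)) + ?T C * (A * F)"
      by (rule mult_add_distrib_mat[OF t(2) JED(1,2)])
    also have "?T C * (?T J * (E * \<Delta>)) = E * \<Delta>"
      using assoc_mult_mat[OF t(2,1) ED] CJ assoc_mult_mat[OF E(1,1) \<Delta>] EE(1) by simp
    also have "?T C * (A * F) = ?T A * (C * E * F)"
      unfolding CE using assoc_mult_mat[OF t(2) c(1) Fc] sym assoc_mult_mat[OF t(3) c(2) Fc] by simp
    also have "\<dots> = 0\<^sub>m n n" using assoc_mult_mat[OF c(2) E(1) Fc] id(4) c t by simp
    also have "?T C * (A * E) = ?T A * C"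
      using assoc_mult_mat[OF t(2) c(1) E(1)] sym assoc_mult_mat[OF t(3) c(2) E(1)] CE by simp
    finally show ?thesis using ED by simp
  qed
  have "?T C * B = ?T B * C"
  proof -
    have "?T B * C = ?T (?T C * B)" using transpose_mult[OF t(2) B] by simp
    also have "\<dots> = ?T (E * \<Delta>) - ?T (?T A * C)" unfolding CB by (rule transpose_minus[OF ED mult_carrier_square[OF t(3) c(2)]])
    also have "?T (?T A * C) = ?T A * C" using transpose_mult[OF t(3) c(2)] sym by simp
    finally show ?thesis unfolding CB id(7) by simp
  qed
  then have "has_corner n M (A + B) C"
    by (rule has_corner_modify[OF corner J(1) JC CE B \<open>B * E = B\<close>])
  then show ?thesis using XY prod by metis
qed

text \<open>If \<open>P C Q\<close> is the projection \<open>E\<close>, congruence by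
  \<open>Q\<close> replaces \<open>C\<close> by \<open>Q^T C Q\<close>, for which
  \<open>P Q^(-T)\<close> serves as generalized inverse; the kernel is that of \<open>E\<close>
  because \<open>C Q = P^(-1) E\<close>. The assumptions on \<open>C\<close> amount to 0 < m <
  n.\<close>

theorem factorization_if_singular_corner:
  fixes M :: "'a::field mat"
  assumes corner: "has_corner n M A C" and C: "C \<noteq> 0\<^sub>m n n" "det C = 0"
    and p: "lead_coeff p = 1" "degree p = n" "coeff p 0 \<noteq> 0" and q: "lead_coeff q = 1" "degree q = n" "coeff q 0 \<noteq> 0"
  shows "\<exists>A' C' X Y. has_corner n M A' C' \<and> cyclic_for p X \<and> cyclic_for q Y \<and> A' = X * Y"
proof -
  have c: "A \<in> carrier_mat n n" "C \<in> carrier_mat n n" using corner by (auto simp: has_corner_def)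
  let ?T = "transpose_mat :: 'a mat \<Rightarrow> 'a mat"
  obtain P Q m where PQ: "P \<in> carrier_mat n n" "Q \<in> carrier_mat n n" "det P \<noteq> 0" "det Q \<noteq> 0" "m \<le> n"
    and nf: "P * C * Q = coord_proj n m" using rank_normal_form[OF c(2)] by blast
  obtain Pi where Pi: "Pi \<in> carrier_mat n n" "Pi * P = 1\<^sub>m n" using det_nonzero_inverse[OF PQ(1,3)] by blast
  obtain Qi where Qi: "Qi \<in> carrier_mat n n" "Q * Qi = 1\<^sub>m n" "Qi * Q = 1\<^sub>m n" using det_nonzero_inverse[OF PQ(2,4)] by blast
  have PC: "P * C \<in> carrier_mat n n" using PQ c by simp
  have det0: "det (coord_proj n m :: 'a mat) = 0"
    using arg_cong[OF nf, of det] det_mult[OF PC PQ(2)] det_mult[OF PQ(1) c(2)] C by simp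
  have "m \<noteq> 0"
  proof
    assume "m = 0"
    then have "coord_proj n m = (1\<^sub>m n :: 'a mat)" by (auto simp: coord_proj_def intro!: eq_matI)
    then show False using det0 by simp
  qed
  have CQ: "C = Pi * coord_proj n m * Qi"
  proof -
    have "Pi * coord_proj n m * Qi = Pi * (P * (C * (Q * Qi)))"
      unfolding nf[symmetric] by (simp only: assoc_mult_mat[of _ n n _ n _ n] mult_carrier_square PQ Qi Pi c)
    also have "\<dots> = C * (Q * Qi)" by (rule mult_cancel_inverse[OF PQ(1) Pi(1) _ Pi(2), where k = n]) (use c PQ Qi in simp)
    also have "\<dots> = C" unfolding Qi using c by simp
    finally show ?thesis by simp
  qed
  have "m \<noteq> n"
  proof
    assume "m = n"
    then have "coord_proj n m = (0\<^sub>m n n :: 'a mat)" by (auto simp: coord_proj_def intro!: eq_matI)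
    then have "C = 0\<^sub>m n n" unfolding CQ using Pi Qi by simp
    then show False using C by simp
  qed
  let ?E = "coord_proj n m :: 'a mat" and ?C = "?T Q * C * Q"
  note Ec = coord_proj_carrier[of n m, where 'a = 'a]
  have t: "?T Q \<in> carrier_mat n n" "?T Qi \<in> carrier_mat n n" using PQ Qi by auto
  have tt: "?T Qi * ?T Q = 1\<^sub>m n" using transpose_mult[OF PQ(2) Qi(1)] Qi by simp
  have corner': "has_corner n M (Qi * A * Q) ?C" by (rule has_corner_congruence[OF corner PQ(2) Qi(1,3)])
  have J: "P * ?T Qi \<in> carrier_mat n n" using PQ t by simp
  have canc: "?T Qi * (?T Q * Z) = Z" if "Z \<in> carrier_mat n n" for Z by (rule mult_cancel_inverse[OF t that tt])
  have JC: "P * ?T Qi * ?C = ?E"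
    unfolding nf[symmetric] by (simp only: assoc_mult_mat[of _ n n _ n _ n] mult_carrier_square PQ(1,2) t c canc)
  have EE: "?E * ?E = ?E"
  proof (rule eq_matI)
    fix i j assume "i < dim_row ?E" "j < dim_col ?E"
    then have ij: "i < n" "j < n" by (auto simp: coord_proj_def)
    have "(?E * ?E) $$ (i, j) = (\<Sum>k<n. if k = i then ?E $$ (k, j) * (if m \<le> i then 1 else 0) else 0)"
      unfolding mat_mat_index_sum[OF Ec Ec ij] using ij by (intro sum.cong refl) (auto simp: coord_proj_def)
    then show "(?E * ?E) $$ (i, j) = ?E $$ (i, j)" using ij by (auto simp: sum.delta coord_proj_def)
  qed (auto simp: coord_proj_def)
  have CQ': "C * Q = Pi * ?E"
  proof -
    have "C * Q = Pi * (?E * (Qi * Q))"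
      by (subst CQ) (simp only: assoc_mult_mat[of _ n n _ n _ n] mult_carrier_square PQ(2) Qi(1) Pi(1) Ec)
    then show ?thesis unfolding Qi using Ec Pi by simp
  qed
  have CE: "?C * ?E = ?C"
  proof -
    have C': "?C = ?T Q * (Pi * ?E)" using assoc_mult_mat[OF t(1) c(2) PQ(2)] CQ' by simp
    show ?thesis unfolding C'
      by (simp only: assoc_mult_mat[of _ n n _ n _ n] mult_carrier_square t Pi(1) Ec EE)
  qed
  show ?thesis
    using factorization_if_normalized_corner[OF corner' _ _ J JC CE p q] \<open>m \<noteq> 0\<close> \<open>m \<noteq> n\<close> PQ(5) by fastforce
qed

text \<open>A diagonal \<open>S\<close> gives \<open>A = S C\<close> any prescribed diagonal. If its
  first entry differs from all others, \<open>A (1 + F)\<close> with \<open>F\<close> in the first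
  row is conjugate to \<open>A\<close> by some \<open>1 + H\<close>, so the factor
  \<open>1 + F\<close> can be absorbed although \<open>C\<close> has no kernel.\<close>

theorem factorization_if_triangular_corner:
  fixes M :: "'a::field mat"
  assumes corner: "has_corner n M (0\<^sub>m n n) C" and C: "upper_triangular C" "\<And>i. i < n \<Longrightarrow> C $$ (i, i) \<noteq> 0" and n: "2 \<le> n"
    and p: "lead_coeff p = 1" "degree p = n" "coeff p 0 \<noteq> 0" and q: "lead_coeff q = 1" "degree q = n" "coeff q 0 \<noteq> 0"
    and x: "x \<noteq> 0" "x \<noteq> coeff p 0 * coeff q 0" "x * x \<noteq> coeff p 0 * coeff q 0"
  shows "\<exists>A' C' X Y. has_corner n M A' C' \<and> cyclic_for p X \<and> cyclic_for q Y \<and> A' = X * Y"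
proof -
  define \<delta> where "\<delta> = coeff p 0 * coeff q 0"
  have \<delta>: "\<delta> \<noteq> 0" using p q by (simp add: \<delta>_def)
  \<comment> \<open>The product of these entries is \<open>\<delta>\<close>, and the assumptions on
    \<open>x\<close> say that \<open>\<delta> / x\<close> is neither \<open>x\<close> nor 1.\<close>
  define d where "d i = (if i = 0 then \<delta> / x else if i = 1 then x else 1)" for i :: nat
  have d_ne: "i \<noteq> 0 \<Longrightarrow> d i \<noteq> d 0" for i
    using x \<delta> unfolding d_def \<delta>_def[symmetric] by (auto simp: field_simps)
  have Cc: "C \<in> carrier_mat n n" using corner by (simp add: has_corner_def)
  define S where "S = mat n n (\<lambda>(i, j). if i = j then d i / C $$ (i, i) else 0)"
  have S: "S \<in> carrier_mat n n" "transpose_mat S = S" by (auto simp: S_def intro!: eq_matI)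
  define A where "A = S * C"
  have A: "A \<in> carrier_mat n n" using S Cc by (simp add: A_def)
  have Aij: "A $$ (i, j) = d i / C $$ (i, i) * C $$ (i, j)" if "i < n" "j < n" for i j
  proof -
    have "A $$ (i, j) = (\<Sum>k<n. if k = i then d i / C $$ (i, i) * C $$ (k, j) else 0)"
      unfolding A_def mat_mat_index_sum[OF S(1) Cc that] using that by (intro sum.cong refl) (auto simp: S_def)
    then show ?thesis using that by (simp add: sum.delta)
  qed
  have Aii: "A $$ (i, i) = d i" if "i < n" for i using Aij[OF that that] C(2)[OF that] by simp
  have Aut: "A $$ (i, j) = 0" if "j < i" "i < n" for i j
    using Aij[of i j] upper_triangularD[OF C(1) that(1)] Cc that by simp
  have corner': "has_corner n M A C"
    using has_corner_shift[OF corner S] A by (simp add: A_def)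
  have utA: "upper_triangular A" using Aut A by auto
  have "det A = prod_list (diag_mat A)" by (rule det_upper_triangular[OF utA A])
  also have "diag_mat A = map d [0..<n]" using A by (auto simp: diag_mat_def Aii)
  also have "prod_list \<dots> = (\<Prod>i\<in>{0..<n}. d i)" by (simp add: prod.list_conv_set_nth)
  also have "\<dots> = d 0 * (d 1 * (\<Prod>i\<in>{0..<n} - {0} - {1}. d i))"
    using n by (subst prod.remove[of _ 0], simp, simp, subst prod.remove[of _ 1]) auto
  also have "(\<Prod>i\<in>{0..<n} - {0} - {1}. d i) = 1" by (rule prod.neutral) (auto simp: d_def)
  finally have det: "det A = coeff p 0 * coeff q 0" using x by (simp add: d_def \<delta>_def)
  obtain F X Y where F: "upper_right_block n 1 F" and XY: "cyclic_for p X" "cyclic_for q Y" and eq: "A * (1\<^sub>m n + F) = X * Y"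
    using cyclic_factorization[OF A _ _ p q det, of 1] n by auto
  have urb: "A * U = d 0 \<cdot>\<^sub>m U \<and> U \<in> carrier_mat n n" if U: "upper_right_block n 1 U" for U
  proof -
    have Uc: "U \<in> carrier_mat n n" and U0: "\<And>i j. i < n \<Longrightarrow> j < n \<Longrightarrow> i \<noteq> 0 \<or> j = 0 \<Longrightarrow> U $$ (i, j) = 0"
      using U unfolding upper_right_block_def by auto
    have "(A * U) $$ (i, j) = (d 0 \<cdot>\<^sub>m U) $$ (i, j)" if ij: "i < n" "j < n" for i j
    proof -
      have "(A * U) $$ (i, j) = (\<Sum>k<n. if k = 0 then A $$ (i, 0) * U $$ (0, j) else 0)"
        unfolding mat_mat_index_sum[OF A Uc ij] using ij U0 by (intro sum.cong refl) auto
      also have "\<dots> = A $$ (i, 0) * U $$ (0, j)" using ij by (simp add: sum.delta)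
      finally show ?thesis using ij Uc Aii[of i] Aut[of 0 i] U0[of i j] by (cases "i = 0") auto
    qed
    then show ?thesis using A Uc by (auto intro!: eq_matI simp del: index_mult_mat(1))
  qed
  have Fc: "F \<in> carrier_mat n n" using urb[OF F] by blast
  define E where "E = mat n n (\<lambda>(i, j). if i = 0 \<and> j = 0 then 1 else 0 :: 'a)"
  have E: "E \<in> carrier_mat n n" by (simp add: E_def)
  \<comment> \<open>The conjugation requires \<open>H (A - d 0) = d 0 F\<close>, but
    \<open>A - d 0\<close> is singular. Adding \<open>E\<close> makes it invertible and does not
    affect the equation, because \<open>H E = 0\<close>.\<close>
  define A1 where "A1 = A + E - d 0 \<cdot>\<^sub>m 1\<^sub>m n"
  have A1: "A1 \<in> carrier_mat n n" unfolding A1_def by (rule minus_carrier_mat) simp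
  have utA1: "upper_triangular A1"
  proof
    fix i j assume "j < i" "i < dim_row A1"
    then show "A1 $$ (i, j) = 0" using Aut[of j i] A by (simp add: A1_def E_def)
  qed
  have "A1 $$ (i, i) \<noteq> 0" if "i < n" for i
    using that Aii[OF that] d_ne[of i] A by (cases "i = 0") (simp_all add: A1_def E_def)
  then have "det A1 \<noteq> 0" using upper_triangular_diag_nonzero[OF A1 utA1] by blast
  then obtain K where K: "K \<in> carrier_mat n n" "A1 * K = 1\<^sub>m n" "K * A1 = 1\<^sub>m n" using det_nonzero_inverse[OF A1] by blast
  have utK: "upper_triangular K" by (rule upper_triangular_inverse[OF A1 utA1 K(1,2)])
  define H where "H = d 0 \<cdot>\<^sub>m (F * K)"
  have FK: "F * K \<in> carrier_mat n n" using Fc K by simp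
  have Hc: "H \<in> carrier_mat n n" using FK by (simp add: H_def)
  have H0: "H $$ (i, j) = 0" if ij: "i < n" "j < n" "i \<noteq> 0 \<or> j = 0" for i j
  proof -
    have F0: "\<And>i j. i < n \<Longrightarrow> j < n \<Longrightarrow> i \<noteq> 0 \<or> j = 0 \<Longrightarrow> F $$ (i, j) = 0"
      using F unfolding upper_right_block_def by auto
    have "(F * K) $$ (i, j) = 0"
      unfolding mat_mat_index_sum[OF Fc K(1) ij(1,2)]
    proof (rule sum.neutral, rule ballI)
      fix k assume "k \<in> {..<n}"
      then show "F $$ (i, k) * K $$ (k, j) = 0"
        using F0[of i k] upper_triangularD[OF utK, of j k] ij K(1) by (cases "k = 0") auto
    qed
    moreover have "H $$ (i, j) = d 0 * (F * K) $$ (i, j)"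
      unfolding H_def by (rule index_smult_mat(1)) (use ij carrier_matD[OF FK] in simp_all)
    ultimately show ?thesis by simp
  qed
  then have Hb: "upper_right_block n 1 H" using Hc unfolding upper_right_block_def by auto
  have AH: "A * H = d 0 \<cdot>\<^sub>m H" using urb[OF Hb] by blast
  have HE: "H * E = 0\<^sub>m n n"
  proof (rule eq_matI)
    fix i j assume "i < dim_row (0\<^sub>m n n :: 'a mat)" "j < dim_col (0\<^sub>m n n :: 'a mat)"
    then have ij: "i < n" "j < n" by auto
    have "(H * E) $$ (i, j) = 0"
      unfolding mat_mat_index_sum[OF Hc E ij] by (rule sum.neutral) (use ij H0[of i 0] in \<open>auto simp: E_def\<close>)
    then show "(H * E) $$ (i, j) = 0\<^sub>m n n $$ (i, j)" using ij by simp
  qed (use Hc E in auto)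
  have HH: "H * H = 0\<^sub>m n n"
  proof (rule eq_matI)
    fix i j assume "i < dim_row (0\<^sub>m n n :: 'a mat)" "j < dim_col (0\<^sub>m n n :: 'a mat)"
    then have ij: "i < n" "j < n" by auto
    have "H $$ (i, k) * H $$ (k, j) = 0" if "k < n" for k using that ij H0[of i k] H0[of k j] by (cases "k = 0") auto
    then have "(H * H) $$ (i, j) = 0" unfolding mat_mat_index_sum[OF Hc Hc ij] by (intro sum.neutral) auto
    then show "(H * H) $$ (i, j) = 0\<^sub>m n n $$ (i, j)" using ij by simp
  qed (use Hc in auto)
  have "H * A1 = d 0 \<cdot>\<^sub>m F"
    unfolding H_def using mult_smult_assoc_mat[OF FK A1] assoc_mult_mat[OF Fc K(1) A1] K(3) Fc by simp
  moreover have "H * A1 = H * A - d 0 \<cdot>\<^sub>m H"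
  proof -
    have AE: "A + E \<in> carrier_mat n n" using A E by simp
    have "H * A1 = H * (A + E) - H * (d 0 \<cdot>\<^sub>m 1\<^sub>m n)" unfolding A1_def by (rule mult_minus_distrib_mat[OF Hc AE]) simp
    also have "H * (A + E) = H * A" using mult_add_distrib_mat[OF Hc A E] HE right_add_zero_mat[OF mult_carrier_square[OF Hc A]] by simp
    also have "H * (d 0 \<cdot>\<^sub>m 1\<^sub>m n) = d 0 \<cdot>\<^sub>m H" using mult_smult_distrib[OF Hc one_carrier_mat] Hc by simp
    finally show ?thesis .
  qed
  ultimately have HA: "H * A - d 0 \<cdot>\<^sub>m H = d 0 \<cdot>\<^sub>m F" by simp
  have HAc: "H * A \<in> carrier_mat n n" using Hc A by simp
  have oneH: "1\<^sub>m n + H \<in> carrier_mat n n" "1\<^sub>m n - H \<in> carrier_mat n n" using Hc by auto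
  have Q1: "(1\<^sub>m n + H) * A = A + H * A"
    using add_mult_distrib_mat[OF one_carrier_mat Hc A] A by simp
  \<comment> \<open>As \<open>A H = d 0 H\<close> and \<open>H H = 0\<close>, the conjugate is
    \<open>A + H A - d 0 H = A + d 0 F\<close>, and \<open>A F = d 0 F\<close>.\<close>
  have "(1\<^sub>m n + H) * A * (1\<^sub>m n - H) = (A + H * A) - (A + H * A) * H"
    unfolding Q1 using mult_minus_distrib_mat[of "A + H * A" n n "1\<^sub>m n" n H] HAc Hc A by simp
  also have "(A + H * A) * H = d 0 \<cdot>\<^sub>m H"
  proof -
    have "H * A * H = d 0 \<cdot>\<^sub>m (H * H)" using assoc_mult_mat[OF Hc A Hc] AH mult_smult_distrib[OF Hc Hc] by simp
    then have "H * A * H = 0\<^sub>m n n" unfolding HH by (simp add: smult_zero_mat)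
    then show ?thesis using add_mult_distrib_mat[OF A HAc Hc] AH Hc by simp
  qed
  also have "(A + H * A) - d 0 \<cdot>\<^sub>m H = A + (H * A - d 0 \<cdot>\<^sub>m H)"
    using HAc Hc A by (intro eq_matI) (auto simp del: index_mult_mat(1))
  also have "\<dots> = A * (1\<^sub>m n + F)"
    unfolding HA using mult_add_distrib_mat[OF A one_carrier_mat Fc] urb[OF F] A by simp
  finally have prod: "(1\<^sub>m n + H) * A * (1\<^sub>m n - H) = X * Y" unfolding eq .
  have "(1\<^sub>m n + H) * (1\<^sub>m n - H) = 1\<^sub>m n"
  proof -
    have "(1\<^sub>m n + H) * (1\<^sub>m n - H) = (1\<^sub>m n + H) * 1\<^sub>m n - (1\<^sub>m n + H) * H"
      by (rule mult_minus_distrib_mat[OF oneH(1) one_carrier_mat Hc])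
    also have "(1\<^sub>m n + H) * H = H" using add_mult_distrib_mat[OF one_carrier_mat Hc Hc] HH Hc by simp
    also have "(1\<^sub>m n + H) * 1\<^sub>m n = 1\<^sub>m n + H" by (rule right_mult_one_mat[OF oneH(1)])
    also have "1\<^sub>m n + H - H = 1\<^sub>m n" using Hc by (intro eq_matI) auto
    finally show ?thesis .
  qed
  from has_corner_congruence[OF corner' oneH(2,1) this] show ?thesis using prod XY by metis
qed

section \<open>Two by two corners\<close>

definition mat2 :: "'a \<Rightarrow> 'a \<Rightarrow> 'a \<Rightarrow> 'a \<Rightarrow> 'a mat" where
  "mat2 a b c d = mat 2 2 (\<lambda>(i, j). if i = 0 then if j = 0 then a else b else if j = 0 then c else d)"

lemma mat2_carrier [simp]: "mat2 a b c d \<in> carrier_mat 2 2"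
  by (simp add: mat2_def)

lemma mat2_index [simp]:
  "mat2 a b c d $$ (0, 0) = a" "mat2 a b c d $$ (0, Suc 0) = b"
  "mat2 a b c d $$ (Suc 0, 0) = c" "mat2 a b c d $$ (Suc 0, Suc 0) = d"
  by (simp_all add: mat2_def)

lemma mat_eq_2I:
  assumes "A \<in> carrier_mat 2 2" "B \<in> carrier_mat 2 2" "A $$ (0, 0) = B $$ (0, 0)" "A $$ (0, Suc 0) = B $$ (0, Suc 0)"
    "A $$ (Suc 0, 0) = B $$ (Suc 0, 0)" "A $$ (Suc 0, Suc 0) = B $$ (Suc 0, Suc 0)"
  shows "A = B"
proof (rule eq_matI)
  fix i j assume "i < dim_row B" "j < dim_col B"
  then have "i = 0 \<or> i = Suc 0" "j = 0 \<or> j = Suc 0" using assms(2) by auto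
  then show "A $$ (i, j) = B $$ (i, j)" using assms by auto
qed (use assms in auto)

lemma mat2_mult: "mat2 a b c d * mat2 a' b' c' d' =
    mat2 (a * a' + b * c') (a * b' + b * d') (c * a' + d * c') (c * b' + d * d' :: 'a::field)"
proof (rule mat_eq_2I)
  note s = mat_mat_index_sum[OF mat2_carrier mat2_carrier]
  have e: "{..<2} = {0, Suc 0}" by auto
  show "(mat2 a b c d * mat2 a' b' c' d') $$ (0, 0) = mat2 (a * a' + b * c') (a * b' + b * d') (c * a' + d * c') (c * b' + d * d') $$ (0, 0)"
    "(mat2 a b c d * mat2 a' b' c' d') $$ (0, Suc 0) = mat2 (a * a' + b * c') (a * b' + b * d') (c * a' + d * c') (c * b' + d * d') $$ (0, Suc 0)"
    "(mat2 a b c d * mat2 a' b' c' d') $$ (Suc 0, 0) = mat2 (a * a' + b * c') (a * b' + b * d') (c * a' + d * c') (c * b' + d * d') $$ (Suc 0, 0)"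
    "(mat2 a b c d * mat2 a' b' c' d') $$ (Suc 0, Suc 0) = mat2 (a * a' + b * c') (a * b' + b * d') (c * a' + d * c') (c * b' + d * d') $$ (Suc 0, Suc 0)"
    by (simp_all add: s e del: index_mult_mat(1))
qed (auto intro!: mult_carrier_square)

lemma mat2_transpose: "transpose_mat (mat2 a b c d) = mat2 a c b d"
  by (rule mat_eq_2I) (auto simp: mat2_def)

lemma mat2_zero_add: "0\<^sub>m 2 2 + mat2 a b c (d :: 'a::field) = mat2 a b c d"
  by simp

text \<open>A nonscalar 2 x 2 matrix is annihilated by no nonzero polynomial of degree below 2, and
  it satisfies the quadratic given by its trace and determinant.\<close>

lemma cyclic_for_mat2:
  fixes a b c d :: "'a::field"
  assumes ns: "\<not> (b = 0 \<and> c = 0 \<and> a = d)" and p: "p = [:a * d - b * c, - (a + d), 1:]"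
  shows "cyclic_for p (mat2 a b c d)"
proof -
  let ?X = "mat2 a b c d"
  have deg: "degree p = 2" by (simp add: p)
  note X = mat2_carrier[of a b c d]
  have id: "x \<cdot>\<^sub>m 1\<^sub>m 2 = mat2 x 0 0 x" for x :: 'a by (rule mat_eq_2I) auto
  have add: "mat2 x y z w + mat2 x' y' z' w' = mat2 (x + x') (y + y') (z + z') (w + w')" for x y z w x' y' z' w' :: 'a
    by (rule mat_eq_2I) (simp_all add: mat2_def)
  have "0\<^sub>m 2 2 = mat2 0 0 0 (0 :: 'a)" by (rule mat_eq_2I) auto
  note r = poly_mat_pCons[OF X] poly_mat_0[OF X] id add this mat2_mult
  have "poly_mat p ?X = 0\<^sub>m 2 2"
    unfolding p r by (rule mat_eq_2I) (simp_all add: algebra_simps)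
  moreover have "s = 0" if s: "poly_mat s ?X = 0\<^sub>m 2 2" "degree s < 2" for s
  proof -
    define x y where "x = coeff s 0" and "y = coeff s 1"
    have sxy: "s = [:x, y:]"
      by (rule poly_eqI) (use s(2) in \<open>auto simp: x_def y_def coeff_pCons coeff_eq_0 split: nat.splits\<close>)
    have "mat2 (x + a * y) (b * y) (c * y) (x + d * y) = mat2 0 0 0 0"
      using s(1) unfolding sxy r by simp
    then have "x + a * y = 0" "b * y = 0" "c * y = 0" "x + d * y = 0" by (metis mat2_index)+
    then have "y = 0" using ns by (metis add_left_cancel mult_cancel_right mult_eq_0_iff)
    with \<open>x + a * y = 0\<close> show "s = 0" by (simp add: sxy)
  qed
  ultimately show ?thesis unfolding cyclic_for_def deg using X by blast
qed

text \<open>For this alternating \<open>C\<close> the matrices \<open>S C\<close> are those of trace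
  0, so nonscalar \<open>X\<close> and \<open>Y\<close> with the given roots and tr(X Y) = 0 are
  wanted. For \<open>X\<close> lower and \<open>Y\<close> upper triangular with off-diagonal entries
  \<open>u\<close> and \<open>v\<close> the trace is \<open>s + u * v\<close>.\<close>

lemma alternating_corner_factorization_if_split:
  fixes M :: "'a::field mat"
  assumes corner: "has_corner 2 M (0\<^sub>m 2 2) (mat2 0 (- c) c 0)" and c: "c \<noteq> 0"
  shows "\<exists>A' C' X Y. has_corner 2 M A' C' \<and> cyclic_for [:a1 * b1, - (a1 + b1), 1:] X \<and>
    cyclic_for [:a2 * b2, - (a2 + b2), 1:] Y \<and> A' = X * Y"
proof -
  have shift: "has_corner 2 M (mat2 x y z w) (mat2 0 (- c) c 0)" if "x + w = 0" for x y z w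
  proof -
    let ?S = "mat2 (- y / c) (x / c) (x / c) (z / c)"
    have "w = - x" using that by (metis add_eq_0_iff)
    then have "?S * mat2 0 (- c) c 0 = mat2 x y z w" unfolding mat2_mult using c by simp
    then show ?thesis
      using has_corner_shift[OF corner, of ?S] by (simp add: mat2_transpose mat2_zero_add)
  qed
  define s where "s = a1 * a2 + b1 * b2"
  have lower: ?thesis if uv: "u * v = - s" "u \<noteq> 0 \<or> a1 \<noteq> b1" "v \<noteq> 0 \<or> a2 \<noteq> b2" for u v
  proof -
    have "cyclic_for [:a1 * b1, - (a1 + b1), 1:] (mat2 a1 0 u b1)" by (rule cyclic_for_mat2) (use uv in auto)
    moreover have "cyclic_for [:a2 * b2, - (a2 + b2), 1:] (mat2 a2 v 0 b2)" by (rule cyclic_for_mat2) (use uv in auto)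
    moreover have "has_corner 2 M (mat2 a1 0 u b1 * mat2 a2 v 0 b2) (mat2 0 (- c) c 0)"
      unfolding mat2_mult by (rule shift) (use uv in \<open>simp add: s_def\<close>)
    ultimately show ?thesis by metis
  qed
  \<comment> \<open>For \<open>s = 0\<close> one of \<open>u\<close>, \<open>v\<close> vanishes, and
    that matrix is nonscalar only if its roots differ. With two double roots both matrices are taken
    upper triangular, and the trace of the product is \<open>s\<close>.\<close>
  consider "s \<noteq> 0" | "s = 0" "a2 \<noteq> b2" | "s = 0" "a1 \<noteq> b1" | "s = 0" "a1 = b1" "a2 = b2" by blast
  then show ?thesis
  proof cases
    case 1
    then show ?thesis using lower[of 1 "- s"] by simp
  next
    case 2
    then show ?thesis using lower[of 1 0] by simp
  next
    case 3
    then show ?thesis using lower[of 0 1] by simp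
  next
    case 4
    have "cyclic_for [:a1 * b1, - (a1 + b1), 1:] (mat2 a1 1 0 b1)" by (rule cyclic_for_mat2) auto
    moreover have "cyclic_for [:a2 * b2, - (a2 + b2), 1:] (mat2 a2 1 0 b2)" by (rule cyclic_for_mat2) auto
    moreover have "has_corner 2 M (mat2 a1 1 0 b1 * mat2 a2 1 0 b2) (mat2 0 (- c) c 0)"
      unfolding mat2_mult by (rule shift) (use 4 in \<open>simp add: s_def\<close>)
    ultimately show ?thesis by metis
  qed
qed

lemma alternating_corner_factorization_if_char_3:
  fixes M :: "'a::field mat"
  assumes corner: "has_corner 2 M (0\<^sub>m 2 2) (mat2 0 (- c) c 0)" and c: "c \<noteq> 0"
    and three: "(3 :: 'a) = 0" and \<tau>: "\<tau> * \<tau> = 1"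
  shows "\<exists>A' C' X. has_corner 2 M A' C' \<and> cyclic_for [:- 1, - \<tau>, 1:] X \<and> A' = X * X"
proof -
  let ?X = "mat2 (- \<tau>) (- \<tau>) \<tau> (- \<tau>)"
  have two: "x + x = - x" for x :: 'a
  proof -
    have "x + x + x = 3 * x" by simp
    then show ?thesis using three by (simp add: eq_neg_iff_add_eq_0)
  qed
  have "\<tau> \<noteq> 0" using \<tau> by auto
  have X: "cyclic_for [:- 1, - \<tau>, 1:] ?X"
    by (rule cyclic_for_mat2) (use \<open>\<tau> \<noteq> 0\<close> two[of 1] two[of "- \<tau>"] in \<open>simp_all add: \<tau>\<close>)
  have "mat2 (1 / c) 0 0 (1 / c) * mat2 0 (- c) c 0 = mat2 0 (- 1) 1 0" unfolding mat2_mult using c by simp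
  then have "has_corner 2 M (mat2 0 (- 1) 1 0) (mat2 0 (- c) c 0)"
    using has_corner_shift[OF corner, of "mat2 (1 / c) 0 0 (1 / c)"] by (simp add: mat2_transpose mat2_zero_add)
  moreover have "- \<tau> * - \<tau> + - \<tau> * \<tau> = 0" "- \<tau> * - \<tau> + - \<tau> * - \<tau> = - 1" "\<tau> * - \<tau> + - \<tau> * \<tau> = 1" "\<tau> * - \<tau> + - \<tau> * - \<tau> = 0"
    unfolding mult_minus_left mult_minus_right minus_minus \<tau> two by simp_all
  then have "?X * ?X = mat2 0 (- 1) 1 0" by (simp only: mat2_mult add.commute)
  ultimately show ?thesis using X by metis
qed

text \<open>A diagonal \<open>S\<close> normalizes the corner to (1, \<rho>; 0, 1). The sign of
  \<open>\<tau>'\<close> is left to the explicit factors: changing it exchanges reciprocal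
  polynomials, which belong to the same class.\<close>

lemma triangular_corner_factorization_if_char_3:
  fixes M :: "'a::field mat"
  assumes corner: "has_corner 2 M (0\<^sub>m 2 2) (mat2 c1 c12 0 c2)" and c: "c1 \<noteq> 0" "c2 \<noteq> 0"
    and three: "(3 :: 'a) = 0" and sq: "\<And>x :: 'a. x = 0 \<or> x * x = 1" and \<tau>: "\<tau> \<noteq> 0"
  shows "\<exists>A' C' X Y \<tau>'. has_corner 2 M A' C' \<and> cyclic_for [:- 1, - \<tau>, 1:] X \<and>
    cyclic_for [:- 1, - \<tau>', 1:] Y \<and> A' = X * Y \<and> \<tau>' * \<tau>' = 1"
proof -
  have two: "x + x = - x" for x :: 'a
  proof -
    have "x + x + x = 3 * x" by simp
    then show ?thesis using three by (simp add: eq_neg_iff_add_eq_0)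
  qed
  have \<tau>1: "\<tau> * \<tau> = 1" using sq[of \<tau>] \<tau> by simp
  define \<rho> where "\<rho> = c12 / c1"
  have "mat2 (1 / c1) 0 0 (1 / c2) * mat2 c1 c12 0 c2 = mat2 1 \<rho> 0 1" unfolding mat2_mult using c by (simp add: \<rho>_def)
  then have corner': "has_corner 2 M (mat2 1 \<rho> 0 1) (mat2 c1 c12 0 c2)"
    using has_corner_shift[OF corner, of "mat2 (1 / c1) 0 0 (1 / c2)"] by (simp add: mat2_transpose mat2_zero_add)
  show ?thesis
  proof (cases "\<rho> = 0")
    case True
    have "cyclic_for [:- 1, - \<tau>, 1:] (mat2 0 1 1 \<tau>)" "cyclic_for [:- 1, - (- \<tau>), 1:] (mat2 (- \<tau>) 1 1 0)"
      by (rule cyclic_for_mat2; simp)+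
    moreover have "mat2 0 1 1 \<tau> * mat2 (- \<tau>) 1 1 0 = mat2 1 \<rho> 0 1" unfolding mat2_mult using True by simp
    moreover have "(- \<tau>) * (- \<tau>) = 1" using \<tau>1 by simp
    ultimately show ?thesis using corner' by metis
  next
    case False
    then have \<rho>: "\<rho> * \<rho> = 1" using sq by blast
    define \<sigma> where "\<sigma> = \<tau> * \<rho>"
    have \<sigma>: "\<sigma> * \<sigma> = 1" "\<sigma> \<noteq> 0" "\<sigma> * \<tau> = \<rho>"
      using \<rho> \<tau>1 \<tau> False unfolding \<sigma>_def by (auto simp: algebra_simps)
    have "cyclic_for [:- 1, - \<tau>, 1:] (mat2 0 (- \<sigma>) (- \<sigma>) \<tau>)"
      by (rule cyclic_for_mat2) (use \<sigma> in auto)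
    moreover have "cyclic_for [:- 1, - \<tau>, 1:] (mat2 (- \<tau>) \<sigma> (- \<sigma>) (- \<tau>))"
      by (rule cyclic_for_mat2) (use \<sigma> \<tau>1 two[of "- \<tau>"] two[of 1] in auto)
    moreover have "mat2 0 (- \<sigma>) (- \<sigma>) \<tau> * mat2 (- \<tau>) \<sigma> (- \<sigma>) (- \<tau>) = mat2 1 \<rho> 0 1"
    proof -
      have "\<tau> * \<sigma> = \<rho>" using \<sigma>(3) by (simp add: mult.commute)
      then have "0 * - \<tau> + - \<sigma> * - \<sigma> = 1" "0 * \<sigma> + - \<sigma> * - \<tau> = \<rho>" "- \<sigma> * - \<tau> + \<tau> * - \<sigma> = 0"
        "- \<sigma> * \<sigma> + \<tau> * - \<tau> = 1"
        unfolding mult_minus_left mult_minus_right minus_minus mult_zero_left \<sigma>(1,3) \<tau>1 two by simp_all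
      then show ?thesis by (simp only: mat2_mult)
    qed
    ultimately show ?thesis using corner' \<tau>1 by metis
  qed
qed

section \<open>Isotropic frames adapted to a symplectic matrix\<close>

lemma frame_corner:
  fixes M :: "'a::field mat"
  assumes M: "M \<in> Sp n" and S: "symplectic_basis n n e f"
  obtains A C where "has_corner n M A C" "\<And>i j. i < n \<Longrightarrow> j < n \<Longrightarrow> C $$ (i, j) = omega n (e i) (M *\<^sub>v e j)"
proof (rule conjugate_by_basis[OF M S])
  fix N Q
  assume N: "N \<in> Sp n" "sp_conj n M N"
    and idx: "\<And>i j. i < n \<Longrightarrow> j < n \<Longrightarrow> N $$ (i + n, j) = omega n (e i) (M *\<^sub>v e j)"
  obtain A B C D where c: "A \<in> carrier_mat n n" "B \<in> carrier_mat n n" "C \<in> carrier_mat n n" "D \<in> carrier_mat n n"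
    and eq: "N = four_block_mat A B C D" using mat_four_blocks[OF Sp_carrier[OF N(1)]] .
  have "C $$ (i, j) = omega n (e i) (M *\<^sub>v e j)" if "i < n" "j < n" for i j
    using idx[OF that] that c unfolding eq by simp
  then show ?thesis using that[OF has_cornerI[OF c N[unfolded eq]]] by blast
qed

text \<open>Symmetry of \<open>A^T C\<close> makes \<open>A C^(-1)\<close> symmetric, so the shift
  by its negative is available and clears \<open>A\<close>.\<close>

lemma has_corner_zero_if_invertible:
  fixes M :: "'a::field mat"
  assumes corner: "has_corner n M A C" and det: "det C \<noteq> 0"
  shows "has_corner n M (0\<^sub>m n n) C"
proof -
  have c: "A \<in> carrier_mat n n" "C \<in> carrier_mat n n" using corner by (auto simp: has_corner_def)
  obtain K where K: "K \<in> carrier_mat n n" "C * K = 1\<^sub>m n" "K * C = 1\<^sub>m n" using det_nonzero_inverse[OF c(2) det] .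
  let ?T = "transpose_mat :: 'a mat \<Rightarrow> 'a mat"
  have AK: "A * K \<in> carrier_mat n n" using c K by simp
  have t: "?T A \<in> carrier_mat n n" "?T C \<in> carrier_mat n n" "?T K \<in> carrier_mat n n" using c K by auto
  have KC: "?T K * ?T C = 1\<^sub>m n" using transpose_mult[OF c(2) K(1)] K(2) by simp
  have "?T (A * K) = ?T K * ?T A" by (rule transpose_mult[OF c(1) K(1)])
  also have "\<dots> = ?T K * (?T A * (C * K))" unfolding K(2) using t by simp
  also have "\<dots> = ?T K * (?T A * C * K)" using assoc_mult_mat[OF t(1) c(2) K(1)] by simp
  also have "?T A * C * K = ?T C * (A * K)"
    unfolding has_corner_symmetric[OF corner] by (rule assoc_mult_mat[OF t(2) c(1) K(1)])
  also have "?T K * \<dots> = A * K" by (rule mult_cancel_inverse[OF t(2,3) AK KC])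
  finally have sym: "?T (- (A * K)) = - (A * K)" using AK by (simp add: transpose_uminus)
  have "- (A * K) * C = - (A * K * C)" by (rule uminus_mult_mat(1)[OF AK c(2)])
  also have "A * K * C = A" using assoc_mult_mat[OF c(1) K(1) c(2)] K c by simp
  finally have "A + - (A * K) * C = 0\<^sub>m n n" using c(1) by (intro eq_matI) auto
  then show ?thesis using has_corner_shift[OF corner _ sym] AK by simp
qed

section \<open>Triangularizing the form omega(x, M y)\<close>

lemma perp_SucD:
  assumes "perp n (Suc k) (e(k := x)) (f(k := y)) z"
  shows "perp n k e f z" "omega n x z = 0" "omega n y z = 0"
proof -
  have z: "z \<in> carrier_vec (2 * n)"
    and 0: "\<And>i. i < Suc k \<Longrightarrow> omega n ((e(k := x)) i) z = 0 \<and> omega n ((f(k := y)) i) z = 0"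
    using assms unfolding perp_def by auto
  show "perp n k e f z" unfolding perp_def
  proof (intro conjI allI impI z)
    fix i assume "i < k"
    then show "omega n (e i) z = 0" "omega n (f i) z = 0" using 0[of i] by auto
  qed
  show "omega n x z = 0" "omega n y z = 0" using 0[of k] by auto
qed

lemma perpD:
  assumes "symplectic_basis n k e f" "perp n k e f z"
  shows "z \<in> carrier_vec (2 * n)" "i < k \<Longrightarrow> omega n z (e i) = 0" "i < k \<Longrightarrow> omega n z (f i) = 0"
    "i < k \<Longrightarrow> omega n (e i) z = 0" "i < k \<Longrightarrow> omega n (f i) z = 0"
proof -
  show z: "z \<in> carrier_vec (2 * n)" using assms(2) by (simp add: perp_def)
  show e: "i < k \<Longrightarrow> omega n (e i) z = 0" and f: "i < k \<Longrightarrow> omega n (f i) z = 0"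
    using assms(2) by (auto simp: perp_def)
  show "i < k \<Longrightarrow> omega n z (e i) = 0" using e omega_swap[OF symplectic_basisD(1)[OF assms(1)] z] by simp
  show "i < k \<Longrightarrow> omega n z (f i) = 0" using f omega_swap[OF symplectic_basisD(2)[OF assms(1)] z] by simp
qed

text \<open>The last condition anticipates the vectors still to be chosen: anything orthogonal to
  the first \<open>k\<close> pairs produces zeros below the diagonal in the first \<open>k\<close>
  columns of the Gram matrix.\<close>

definition triangular_frame :: "nat \<Rightarrow> 'a::field mat \<Rightarrow> nat \<Rightarrow> (nat \<Rightarrow> 'a vec) \<Rightarrow> (nat \<Rightarrow> 'a vec) \<Rightarrow> bool" where
  "triangular_frame n M k e f \<longleftrightarrow> symplectic_basis n k e f \<and>
     (\<forall>i<k. omega n (e i) (M *\<^sub>v e i) \<noteq> 0) \<and> (\<forall>i<k. \<forall>j<i. omega n (e i) (M *\<^sub>v e j) = 0) \<and>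
     (\<forall>i<k. \<forall>z. perp n k e f z \<longrightarrow> omega n z (M *\<^sub>v e i) = 0)"

lemma triangular_frame_0: "triangular_frame n M 0 e f"
  by (simp add: triangular_frame_def symplectic_basis_0)

text \<open>The partner of \<open>x\<close> is the normalized projection of \<open>M x\<close>, so
  orthogonality to the partner implies orthogonality to \<open>M x\<close>, which is the vanishing
  that the frame demands.\<close>

lemma triangular_frame_Suc:
  fixes M :: "'a::field mat"
  assumes M: "M \<in> Sp n" and T: "triangular_frame n M k e f" and x: "perp n k e f x"
    and nz: "omega n x (M *\<^sub>v x) \<noteq> 0"
  obtains y where "triangular_frame n M (Suc k) (e(k := x)) (f(k := y))"
proof -
  have S: "symplectic_basis n k e f" using T by (simp add: triangular_frame_def)
  note D = symplectic_basisD[OF S]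
  define c where "c = omega n x (M *\<^sub>v x)"
  have xc: "x \<in> carrier_vec (2 * n)" using x by (simp add: perp_def)
  have Mx: "M *\<^sub>v x \<in> carrier_vec (2 * n)" using Sp_carrier[OF M] xc by simp
  obtain y0 where y0: "perp n k e f y0" and proj: "\<And>z. z \<in> carrier_vec (2 * n) \<Longrightarrow> (\<And>i. i < k \<Longrightarrow> omega n z (e i) = 0) \<Longrightarrow>
       (\<And>i. i < k \<Longrightarrow> omega n (M *\<^sub>v x) (e i) = 0 \<or> omega n z (f i) = 0) \<Longrightarrow> omega n z y0 = omega n z (M *\<^sub>v x)"
    using perp_projection[OF S Mx] by blast
  have y0c: "y0 \<in> carrier_vec (2 * n)" using y0 by (simp add: perp_def)
  have proj': "omega n z y0 = omega n z (M *\<^sub>v x)" if "perp n k e f z" for z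
    using proj[OF perpD(1)[OF S that]] perpD[OF S that] by blast
  define y where "y = inverse c \<cdot>\<^sub>v y0"
  have yc: "y \<in> carrier_vec (2 * n)" using y0c by (simp add: y_def)
  have y: "perp n k e f y"
    using y0 D(1,2) y0c unfolding perp_def y_def by (auto simp: omega_smult(2)[OF y0c])
  have xy: "omega n x y = 1"
    using proj'[OF x] nz unfolding y_def omega_smult(2)[OF y0c xc] c_def by simp
  let ?e = "e(k := x)" and ?f = "f(k := y)"
  have S': "symplectic_basis n (Suc k) ?e ?f" by (rule symplectic_basis_Suc[OF S x y xy])
  have "omega n z (M *\<^sub>v ?e i) = 0" if z: "perp n (Suc k) ?e ?f z" and i: "i < Suc k" for z i
  proof (cases "i = k")
    case True
    note zc = perpD(1)[OF S' z]
    have "omega n z y = 0" using perp_SucD(3)[OF z] omega_swap[OF yc zc] by simp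
    then show ?thesis using True proj'[OF perp_SucD(1)[OF z]] nz
      unfolding y_def omega_smult(2)[OF y0c zc] by (simp add: c_def)
  next
    case False
    then show ?thesis using T i perp_SucD(1)[OF z] by (auto simp: triangular_frame_def)
  qed
  moreover have "omega n (?e i) (M *\<^sub>v ?e j) = 0" if "i < Suc k" "j < i" for i j
    using T x that by (cases "i = k") (auto simp: triangular_frame_def)
  moreover have "omega n (?e i) (M *\<^sub>v ?e i) \<noteq> 0" if "i < Suc k" for i
    using T nz that by (cases "i = k") (auto simp: triangular_frame_def)
  ultimately show ?thesis using that[of y] S' unfolding triangular_frame_def by blast
qed

lemma triangular_frame_extend:
  fixes M :: "'a::field mat"
  assumes M: "M \<in> Sp n" and "triangular_frame n M k e f" "k \<le> n"
    and "\<And>x. perp n k e f x \<Longrightarrow> x \<noteq> 0\<^sub>v (2 * n) \<Longrightarrow> omega n x (M *\<^sub>v x) \<noteq> 0"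
  shows "\<exists>e' f'. triangular_frame n M n e' f'"
  using assms(2-)
proof (induction "n - k" arbitrary: k e f)
  case 0
  then show ?case by auto
next
  case (Suc d)
  then have k: "k < n" by simp
  have S: "symplectic_basis n k e f" using Suc.prems(1) by (simp add: triangular_frame_def)
  obtain x where x: "perp n k e f x" "x \<noteq> 0\<^sub>v (2 * n)" using perp_exists[OF S k] .
  obtain y where y: "triangular_frame n M (Suc k) (e(k := x)) (f(k := y))"
    using triangular_frame_Suc[OF M Suc.prems(1) x(1) Suc.prems(3)[OF x]] .
  show ?case
  proof (rule Suc.hyps(1)[OF _ y])
    show "d = n - Suc k" "Suc k \<le> n" using Suc.hyps(2) k by auto
    show "omega n z (M *\<^sub>v z) \<noteq> 0" if "perp n (Suc k) (e(k := x)) (f(k := y)) z" "z \<noteq> 0\<^sub>v (2 * n)" for z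
      using Suc.prems(3)[OF perp_SucD(1)[OF that(1)] that(2)] .
  qed
qed

lemma triangular_frame_corner:
  fixes M :: "'a::field mat"
  assumes M: "M \<in> Sp n" and T: "triangular_frame n M n e f"
  obtains C where "has_corner n M (0\<^sub>m n n) C" "upper_triangular C" "\<And>i. i < n \<Longrightarrow> C $$ (i, i) \<noteq> 0"
proof -
  have S: "symplectic_basis n n e f" using T by (simp add: triangular_frame_def)
  obtain A C where corner: "has_corner n M A C"
    and C: "\<And>i j. i < n \<Longrightarrow> j < n \<Longrightarrow> C $$ (i, j) = omega n (e i) (M *\<^sub>v e j)" using frame_corner[OF M S] by blast
  have Cc: "C \<in> carrier_mat n n" using corner by (simp add: has_corner_def)
  have ut: "upper_triangular C"
  proof
    fix i j assume "j < i" "i < dim_row C"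
    then show "C $$ (i, j) = 0" using T C[of i j] Cc unfolding triangular_frame_def by simp
  qed
  have d: "C $$ (i, i) \<noteq> 0" if "i < n" for i using T C[OF that that] that unfolding triangular_frame_def by simp
  have "det C \<noteq> 0" using upper_triangular_diag_nonzero[OF Cc ut] d by blast
  then show ?thesis using that[OF has_corner_zero_if_invertible[OF corner] ut d] by blast
qed

lemma det_zero_if_kernel:
  fixes C :: "'a::field mat"
  assumes "C \<in> carrier_mat n n" "x \<in> carrier_vec n" "x \<noteq> 0\<^sub>v n" "\<And>i. i < n \<Longrightarrow> (\<Sum>k<n. C $$ (i, k) * x $ k) = 0"
  shows "det C = 0"
proof -
  have "C *\<^sub>v x = 0\<^sub>v n"
  proof (rule eq_vecI)
    fix i assume "i < dim_vec (0\<^sub>v n :: 'a vec)"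
    then have i: "i < n" by simp
    show "(C *\<^sub>v x) $ i = 0\<^sub>v n $ i" unfolding mat_vec_index_sum[OF assms(1,2) i] using assms(4)[OF i] i by simp
  qed (use assms in simp)
  then show ?thesis using det_0_iff_vec_prod_zero_field[OF assms(1)] assms(2,3) by blast
qed

text \<open>The frame is continued by \<open>w\<close> and completed orthogonally to the projection
  \<open>w'\<close> of \<open>M w\<close>. Columns 0 and 1 of the Gram matrix are then zero below
  row 0 and hence dependent, while the entry (0, 0) is nonzero.\<close>

lemma isotropic_frame_corner:
  fixes M :: "'a::field mat"
  assumes M: "M \<in> Sp n" and n: "2 \<le> n" and T: "triangular_frame n M 1 e f"
    and w: "perp n 1 e f w" "w \<noteq> 0\<^sub>v (2 * n)" "omega n w (M *\<^sub>v w) = 0"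
  obtains A C where "has_corner n M A C" "C \<noteq> 0\<^sub>m n n" "det C = 0"
proof -
  have S: "symplectic_basis n 1 e f" using T by (simp add: triangular_frame_def)
  note wp = perpD[OF S w(1)]
  have Mw: "M *\<^sub>v w \<in> carrier_vec (2 * n)" using Sp_carrier[OF M] wp(1) by simp
  obtain y where y: "perp n 1 e f y" "omega n w y = 1" using perp_partner[OF S w(1,2)] .
  define e2 f2 where "e2 = e(1 := w)" and "f2 = f(1 := y)"
  have S2: "symplectic_basis n 2 e2 f2"
    using symplectic_basis_Suc[OF S w(1) y] by (simp add: e2_def f2_def numeral_2_eq_2)
  obtain w' where w': "perp n 1 e f w'" and proj: "\<And>z. z \<in> carrier_vec (2 * n) \<Longrightarrow> (\<And>i. i < 1 \<Longrightarrow> omega n z (e i) = 0) \<Longrightarrow>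
       (\<And>i. i < 1 \<Longrightarrow> omega n (M *\<^sub>v w) (e i) = 0 \<or> omega n z (f i) = 0) \<Longrightarrow> omega n z w' = omega n z (M *\<^sub>v w)"
    using perp_projection[OF S Mw] by blast
  have proj': "omega n z w' = omega n z (M *\<^sub>v w)" if "perp n 1 e f z" for z
    using proj[OF perpD(1)[OF S that]] perpD[OF S that] by blast
  note w'p = perpD[OF S w']
  \<comment> \<open>Here the isotropy of \<open>w\<close> enters: \<open>w'\<close> is orthogonal to
    both \<open>e 0\<close> and \<open>w\<close>, so a completion orthogonal to it exists.\<close>
  have "omega n w' w = 0" using proj'[OF w(1)] w(3) omega_swap[OF wp(1) w'p(1)] by simp
  then have "omega n w' (e2 i) = 0" if "i < 2" for i using that w'p(2)[of 0] by (auto simp: e2_def less_2_cases_iff)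
  then obtain e' f' where S': "symplectic_basis n n e' f'" and ext: "\<And>i. i < 2 \<Longrightarrow> e' i = e2 i \<and> f' i = f2 i"
    and ort: "\<And>i. i < n \<Longrightarrow> omega n w' (e' i) = 0"
    using symplectic_basis_extend_perp[OF S2 n w'p(1)] by blast
  have e'01: "e' 0 = e 0" "f' 0 = f 0" "e' 1 = w" using ext[of 0] ext[of 1] by (auto simp: e2_def f2_def)
  note D' = symplectic_basisD[OF S']
  have p': "perp n 1 e f (e' i)" if "0 < i" "i < n" for i
    using D'(1)[of i] D'(3)[of 0 i] D'(6)[of i 0] that n unfolding perp_def by (auto simp: e'01[symmetric])
  have col0: "omega n (e' i) (M *\<^sub>v e 0) = 0" if "0 < i" "i < n" for i
    using T p'[OF that] by (simp add: triangular_frame_def)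
  have col1: "omega n (e' i) (M *\<^sub>v w) = 0" if "0 < i" "i < n" for i
    using proj'[OF p'[OF that]] ort[OF that(2)] omega_swap[OF D'(1)[OF that(2)] w'p(1)] by simp
  obtain A C where corner: "has_corner n M A C"
    and C: "\<And>i j. i < n \<Longrightarrow> j < n \<Longrightarrow> C $$ (i, j) = omega n (e' i) (M *\<^sub>v e' j)" using frame_corner[OF M S'] by blast
  have Cc: "C \<in> carrier_mat n n" using corner by (simp add: has_corner_def)
  have C00: "C $$ (0, 0) \<noteq> 0" using C[of 0 0] n T e'01 by (simp add: triangular_frame_def)
  define x where "x = vec n (\<lambda>i. if i = 0 then C $$ (0, 1) else if i = 1 then - C $$ (0, 0) else 0)"
  have "x $ 1 = - C $$ (0, 0)" using n by (simp add: x_def)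
  then have x0: "x \<noteq> 0\<^sub>v n" using C00 n by auto
  have "det C = 0"
  proof (rule det_zero_if_kernel[OF Cc _ x0])
    show "x \<in> carrier_vec n" by (simp add: x_def)
    fix i assume i: "i < n"
    have "(\<Sum>k<n. C $$ (i, k) * x $ k) = (\<Sum>k\<in>{0, 1}. C $$ (i, k) * x $ k)"
      by (rule sum.mono_neutral_right) (use n in \<open>auto simp: x_def\<close>)
    also have "\<dots> = C $$ (i, 0) * C $$ (0, 1) - C $$ (i, 1) * C $$ (0, 0)" using n by (simp add: x_def)
    also have "\<dots> = 0"
      using C[OF i, of 0] C[OF i, of 1] col0[of i] col1[of i] e'01 i n by (cases "i = 0") auto
    finally show "(\<Sum>k<n. C $$ (i, k) * x $ k) = 0" .
  qed
  moreover have "C \<noteq> 0\<^sub>m n n" using C00 n by auto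
  ultimately show ?thesis using that[OF corner] by blast
qed

section \<open>Isotropic vectors and the choice between singular and triangular corners\<close>

lemma mult_mat_vec_lin:
  fixes M :: "'a::field mat"
  assumes "M \<in> carrier_mat k k" "x \<in> carrier_vec k" "y \<in> carrier_vec k"
  shows "M *\<^sub>v (x + y) = M *\<^sub>v x + M *\<^sub>v y" "M *\<^sub>v (a \<cdot>\<^sub>v x) = a \<cdot>\<^sub>v (M *\<^sub>v x)"
  using mult_add_distrib_mat_vec[OF assms] mult_mat_vec[OF assms(1,2)] by auto

text \<open>If Q(x) = omega(x, M x) had no zero, values a, b on orthogonal vectors would have a + b
  nonzero, and (a - b)(a + b) = 0 would give a = b. Three mutually orthogonal vectors then share one
  value a, and since 2a and 3a are nonzero too, the same argument yields 2a = a. The third vector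
  obeys five linear conditions, which is possible because 2n \<ge> 6.\<close>

lemma isotropic_vector_if_small_field:
  fixes M :: "'a::field mat"
  assumes M: "M \<in> Sp n" and n: "3 \<le> n" and S: "symplectic_basis n 1 e f"
    and small: "\<And>x :: 'a. x = 0 \<or> x * x = 1"
  shows "\<exists>w. perp n 1 e f w \<and> w \<noteq> 0\<^sub>v (2 * n) \<and> omega n w (M *\<^sub>v w) = 0"
proof (rule ccontr)
  assume no: "\<not> ?thesis"
  have Mc: "M \<in> carrier_mat (2 * n) (2 * n)" by (rule Sp_carrier[OF M])
  obtain B where B: "B \<in> carrier_mat (2 * n) (2 * n)" "M * B = 1\<^sub>m (2 * n)" using Sp_inverse[OF M] .
  define Q where "Q x = omega n x (M *\<^sub>v x)" for x
  \<comment> \<open>\<open>omega n (h x) y\<close> is the polar form of \<open>Q\<close>, because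
    the inverse of \<open>M\<close> is its adjoint.\<close>
  define h where "h x = B *\<^sub>v x - M *\<^sub>v x" for x
  have aniso: "Q w \<noteq> 0" if "perp n 1 e f w" "w \<noteq> 0\<^sub>v (2 * n)" for w using no that unfolding Q_def by blast
  have hc: "h x \<in> carrier_vec (2 * n)" if "x \<in> carrier_vec (2 * n)" for x using that B Mc by (simp add: h_def)
  have Qadd: "Q (x + y) = Q x + Q y + omega n (h x) y" if xy: "x \<in> carrier_vec (2 * n)" "y \<in> carrier_vec (2 * n)" for x y
  proof -
    have c: "M *\<^sub>v x \<in> carrier_vec (2 * n)" "M *\<^sub>v y \<in> carrier_vec (2 * n)" "B *\<^sub>v x \<in> carrier_vec (2 * n)" using xy B Mc by auto
    have "M *\<^sub>v (B *\<^sub>v x) = x" using assoc_mult_mat_vec[OF Mc B(1) xy(1)] B(2) xy by simp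
    then have "omega n x (M *\<^sub>v y) = omega n (B *\<^sub>v x) y" using omega_mult[OF M c(3) xy(2)] by simp
    then have "omega n (h x) y = omega n x (M *\<^sub>v y) + omega n y (M *\<^sub>v x)"
      unfolding h_def omega_minus(1)[OF c(3,1) xy(2)] using omega_swap[OF xy(2) c(1)] by simp
    then show ?thesis
      unfolding Q_def mult_mat_vec_lin(1)[OF Mc xy] using xy c by (simp add: omega_add)
  qed
  have add: "Q x + Q w \<noteq> 0 \<and> Q (x + w) = Q x + Q w \<and> perp n 1 e f (x + w) \<and> omega n g (x + w) = omega n g x"
    if x: "perp n 1 e f x" and w: "perp n 1 e f w" and ort: "omega n (h x) w = 0"
      and g: "g \<in> carrier_vec (2 * n)" "omega n g x \<noteq> 0" "omega n g w = 0" for x w g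
  proof -
    note xc = perpD(1)[OF S x] and wc = perpD(1)[OF S w]
    have p: "perp n 1 e f (x + w)"
      using perpD[OF S x] perpD[OF S w] symplectic_basisD(1,2)[OF S] unfolding perp_def by (auto simp: omega_add)
    have gx: "omega n g (x + w) = omega n g x" using omega_add(2)[OF xc wc g(1)] g(3) by simp
    have "x + w \<noteq> 0\<^sub>v (2 * n)"
    proof
      assume "x + w = 0\<^sub>v (2 * n)"
      then show False using gx g(1,2) by simp
    qed
    moreover have "Q (x + w) = Q x + Q w" using Qadd[OF xc wc] ort by simp
    ultimately show ?thesis using aniso[OF p] p gx by simp
  qed
  have e0: "e 0 \<in> carrier_vec (2 * n)" "f 0 \<in> carrier_vec (2 * n)" using symplectic_basisD(1,2)[OF S] by auto
  obtain v where v: "perp n 1 e f v" "v \<noteq> 0\<^sub>v (2 * n)" using perp_exists[OF S] n by (metis less_le_trans one_less_numeral_iff semiring_norm(77))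
  note vc = perpD(1)[OF S v(1)]
  \<comment> \<open>\<open>g\<close> pairs nontrivially with \<open>v\<close> and trivially with
    \<open>w1\<close> and \<open>w2\<close>; it certifies that the sums formed below are
    nonzero.\<close>
  obtain g where g: "g \<in> carrier_vec (2 * n)" "omega n v g = 1" using omega_nondegenerate[OF vc v(2)] .
  have gv: "omega n g v \<noteq> 0" using omega_swap[OF vc g(1)] g(2) by simp
  obtain w1 where w1: "w1 \<in> carrier_vec (2 * n)" "w1 \<noteq> 0\<^sub>v (2 * n)"
    and o1: "\<And>t. t \<in> set [e 0, f 0, h v, g] \<Longrightarrow> omega n t w1 = 0"
    using omega_orthogonal_exists[of "[e 0, f 0, h v, g]" n] e0 hc[OF vc] g(1) n by auto
  have p1: "perp n 1 e f w1" using w1 o1 by (simp add: perp_def)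
  obtain w2 where w2: "w2 \<in> carrier_vec (2 * n)" "w2 \<noteq> 0\<^sub>v (2 * n)"
    and o2: "\<And>t. t \<in> set [e 0, f 0, h v, h (v + w1), g] \<Longrightarrow> omega n t w2 = 0"
    using omega_orthogonal_exists[of "[e 0, f 0, h v, h (v + w1), g]" n] e0 hc[OF vc] hc[of "v + w1"] vc w1(1) g(1) n by auto
  have p2: "perp n 1 e f w2" using w2 o2 by (simp add: perp_def)
  have 1: "Q v + Q w1 \<noteq> 0" "Q (v + w1) = Q v + Q w1" "perp n 1 e f (v + w1)" "omega n g (v + w1) \<noteq> 0"
    using add[OF v(1) p1 _ g(1) gv] o1 gv by auto
  have 2: "Q v + Q w2 \<noteq> 0" using add[OF v(1) p2 _ g(1) gv] o2 by auto
  have 3: "Q (v + w1) + Q w2 \<noteq> 0" using add[OF 1(3) p2 _ g(1) 1(4)] o2 by auto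
  have eq: "b = a" if "a \<noteq> 0" "b \<noteq> 0" "a + b \<noteq> 0" for a b :: 'a
  proof -
    have "(a - b) * (a + b) = 0" using small[of a] small[of b] that by (simp add: algebra_simps)
    then show ?thesis using that by simp
  qed
  have nz: "Q v \<noteq> 0" "Q w1 \<noteq> 0" "Q w2 \<noteq> 0" using aniso v w1 w2 p1 p2 by auto
  have "Q w1 = Q v" "Q w2 = Q v" using eq[OF nz(1,2) 1(1)] eq[OF nz(1,3) 2] by auto
  then have "Q v + Q v + Q v \<noteq> 0" "Q v + Q v \<noteq> 0" using 1 3 by auto
  then have "Q v = Q v + Q v" using eq[of "Q v + Q v" "Q v"] nz by (simp add: add.assoc)
  then show False using nz(1) by (metis add_cancel_left_right)
qed

text \<open>The frame starts with \<open>v\<close>. Either the complement of the first pair contains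
  an isotropic vector, or the frame can be completed greedily; in the latter case, for
  \<open>n \<ge> 3\<close>, the previous lemma rules out that all nonzero elements have square
  1.\<close>

lemma nonalternating_corner:
  fixes M :: "'a::field mat"
  assumes M: "M \<in> Sp n" and n: "2 \<le> n" and v: "v \<in> carrier_vec (2 * n)" "omega n v (M *\<^sub>v v) \<noteq> 0"
  shows "(\<exists>A C. has_corner n M A C \<and> C \<noteq> 0\<^sub>m n n \<and> det C = 0) \<or>
    (\<exists>C. has_corner n M (0\<^sub>m n n) C \<and> upper_triangular C \<and> (\<forall>i<n. C $$ (i, i) \<noteq> 0)) \<and>
      (3 \<le> n \<longrightarrow> (\<exists>x :: 'a. x \<noteq> 0 \<and> x * x \<noteq> 1))"
proof -
  have "perp n 0 (\<lambda>_. v) (\<lambda>_. v) v" using v by (simp add: perp_def)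
  from triangular_frame_Suc[OF M triangular_frame_0 this v(2)]
  obtain e f where T: "triangular_frame n M 1 e f" by (metis One_nat_def)
  have S: "symplectic_basis n 1 e f" using T by (simp add: triangular_frame_def)
  show ?thesis
  proof (cases "\<exists>w. perp n 1 e f w \<and> w \<noteq> 0\<^sub>v (2 * n) \<and> omega n w (M *\<^sub>v w) = 0")
    case True
    then show ?thesis using isotropic_frame_corner[OF M n T] by metis
  next
    case False
    then obtain e' f' where T': "triangular_frame n M n e' f'" using triangular_frame_extend[OF M T] n by auto
    show ?thesis using triangular_frame_corner[OF M T'] isotropic_vector_if_small_field[OF M _ S] False by metis
  qed
qed

section \<open>Alternating forms omega(x, M y)\<close>

lemma nonscalar_vector:
  fixes M :: "'a::field mat"
  assumes M: "M \<in> carrier_mat N N" and ns: "\<not> scalar_mat N M"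
  obtains v where "v \<in> carrier_vec N" "\<And>a. M *\<^sub>v v \<noteq> a \<cdot>\<^sub>v v"
proof (rule ccontr)
  assume no: "\<not> thesis"
  have ex: "\<exists>a. M *\<^sub>v v = a \<cdot>\<^sub>v v" if "v \<in> carrier_vec N" for v
  proof (rule ccontr)
    assume "\<nexists>a. M *\<^sub>v v = a \<cdot>\<^sub>v v"
    then show False using no \<open>v \<in> carrier_vec N\<close> \<open>\<And>v. \<lbrakk>v \<in> carrier_vec N; \<And>a. M *\<^sub>v v \<noteq> a \<cdot>\<^sub>v v\<rbrakk> \<Longrightarrow> thesis\<close> by blast
  qed
  then have "\<forall>i. \<exists>a. M *\<^sub>v unit_vec N i = a \<cdot>\<^sub>v unit_vec N i" by simp
  then obtain c where c: "\<And>i. M *\<^sub>v unit_vec N i = c i \<cdot>\<^sub>v unit_vec N i" by metis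
  have entry: "M $$ (j, i) = (if j = i then c i else 0)" if "i < N" "j < N" for i j
  proof -
    have "col M i $ j = (c i \<cdot>\<^sub>v unit_vec N i) $ j" using c[of i] mat_mult_unit_vec[OF M that(1)] by simp
    then show ?thesis using that M by (auto simp: unit_vec_def)
  qed
  have cc: "c i = c 0" if i: "i < N" for i
  proof (cases "i = 0")
    case False
    let ?v = "unit_vec N i + unit_vec N 0"
    obtain a where a: "M *\<^sub>v ?v = a \<cdot>\<^sub>v ?v" using ex[of ?v] by auto
    have "M *\<^sub>v ?v = c i \<cdot>\<^sub>v unit_vec N i + c 0 \<cdot>\<^sub>v unit_vec N 0"
      using mult_mat_vec_lin(1)[OF M, of "unit_vec N i" "unit_vec N 0"] by (simp add: c)
    then have e: "(c i \<cdot>\<^sub>v unit_vec N i + c 0 \<cdot>\<^sub>v unit_vec N 0) $ l = (a \<cdot>\<^sub>v ?v) $ l" for l using a by simp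
    have "c i = a" using e[of i] i False by (auto simp: unit_vec_def)
    moreover have "c 0 = a" using e[of 0] i False by (auto simp: unit_vec_def)
    ultimately show ?thesis by simp
  qed simp
  have "M $$ (j, i) = (c 0 \<cdot>\<^sub>m 1\<^sub>m N) $$ (j, i)" if "i < N" "j < N" for i j
    using entry[OF that] cc[OF that(1)] that by simp
  then have "M = c 0 \<cdot>\<^sub>m 1\<^sub>m N" using M by (intro eq_matI) auto
  then show False using ns unfolding scalar_mat_def by blast
qed

lemma separating_vector_1:
  fixes v w :: "'a::field vec"
  assumes v: "v \<in> carrier_vec (2 * n)" and w: "w \<in> carrier_vec (2 * n)" and ind: "\<And>a. w \<noteq> a \<cdot>\<^sub>v v"
  obtains z where "z \<in> carrier_vec (2 * n)" "omega n z v = 0" "omega n z w = 1"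
proof -
  have left: "\<exists>z. z \<in> carrier_vec (2 * n) \<and> omega n z x = 1" if x: "x \<in> carrier_vec (2 * n)" "x \<noteq> 0\<^sub>v (2 * n)" for x :: "'a vec"
  proof -
    obtain y where y: "y \<in> carrier_vec (2 * n)" "omega n x y = 1" using omega_nondegenerate[OF x] .
    then show ?thesis using omega_swap[OF x(1) y(1)] omega_uminus(1)[OF y(1) x(1)] by (intro exI[of _ "- y"]) simp
  qed
  show ?thesis
  proof (cases "v = 0\<^sub>v (2 * n)")
    case True
    have "0 \<cdot>\<^sub>v v = 0\<^sub>v (2 * n)" using v by (intro eq_vecI) auto
    then have "w \<noteq> 0\<^sub>v (2 * n)" using ind[of 0] by simp
    then show ?thesis using left[OF w] that True by auto
  next
    case False
    obtain a where a: "a \<in> carrier_vec (2 * n)" "omega n a v = 1" using left[OF v False] by blast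
    define w1 where "w1 = w - omega n a w \<cdot>\<^sub>v v"
    have w1: "w1 \<in> carrier_vec (2 * n)" using w v by (simp add: w1_def)
    have om: "omega n t w1 = omega n t w - omega n a w * omega n t v" if "t \<in> carrier_vec (2 * n)" for t
      unfolding w1_def using w v that by (simp add: omega_minus omega_smult)
    have "w1 \<noteq> 0\<^sub>v (2 * n)"
    proof
      assume e: "w1 = 0\<^sub>v (2 * n)"
      have "w = omega n a w \<cdot>\<^sub>v v"
      proof (rule eq_vecI)
        fix i assume "i < dim_vec (omega n a w \<cdot>\<^sub>v v)"
        then have i: "i < 2 * n" using v by simp
        then show "w $ i = (omega n a w \<cdot>\<^sub>v v) $ i" using arg_cong[OF e, of "\<lambda>x. x $ i"] w v by (simp add: w1_def)
      qed (use w v in simp)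
      then show False using ind by blast
    qed
    then obtain c where c: "c \<in> carrier_vec (2 * n)" "omega n c w1 = 1" using left[OF w1] by blast
    define z where "z = c - omega n c v \<cdot>\<^sub>v a"
    have z: "z \<in> carrier_vec (2 * n)" using c a by (simp add: z_def)
    have oz: "omega n z x = omega n c x - omega n c v * omega n a x" if "x \<in> carrier_vec (2 * n)" for x
      unfolding z_def using c a that by (simp add: omega_minus omega_smult)
    have zv: "omega n z v = 0" using oz[OF v] a by simp
    have "omega n z w = omega n z w1" using om[OF z] zv by simp
    also have "\<dots> = 1" using oz[OF w1] om[OF a(1)] a c by simp
    finally show ?thesis using that[OF z zv] by blast
  qed
qed

text \<open>The vectors \<open>a\<close>, \<open>b\<close> are dual to \<open>u\<close>,
  \<open>v\<close>. They strip \<open>w\<close> of its components along \<open>u\<close> and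
  \<open>v\<close>, and then correct a partner of the remainder so that it becomes orthogonal to
  \<open>u\<close> and \<open>v\<close>.\<close>

lemma separating_vector_2:
  fixes u v w :: "'a::field vec"
  assumes u: "u \<in> carrier_vec (2 * n)" and v: "v \<in> carrier_vec (2 * n)" and w: "w \<in> carrier_vec (2 * n)"
    and ind: "\<And>a. u \<noteq> a \<cdot>\<^sub>v v" "\<And>a. v \<noteq> a \<cdot>\<^sub>v u" "\<And>a b. w \<noteq> a \<cdot>\<^sub>v u + b \<cdot>\<^sub>v v"
  obtains z where "z \<in> carrier_vec (2 * n)" "omega n z u = 0" "omega n z v = 0" "omega n z w = 1"
proof -
  obtain a where a: "a \<in> carrier_vec (2 * n)" "omega n a v = 0" "omega n a u = 1" using separating_vector_1[OF v u ind(1)] .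
  obtain b where b: "b \<in> carrier_vec (2 * n)" "omega n b u = 0" "omega n b v = 1" using separating_vector_1[OF u v ind(2)] .
  define w1 where "w1 = w - (omega n a w \<cdot>\<^sub>v u + omega n b w \<cdot>\<^sub>v v)"
  have c1: "omega n a w \<cdot>\<^sub>v u \<in> carrier_vec (2 * n)" "omega n b w \<cdot>\<^sub>v v \<in> carrier_vec (2 * n)"
    "omega n a w \<cdot>\<^sub>v u + omega n b w \<cdot>\<^sub>v v \<in> carrier_vec (2 * n)" using u v by auto
  have w1: "w1 \<in> carrier_vec (2 * n)" using w c1 by (simp add: w1_def)
  have om: "omega n t w1 = omega n t w - (omega n a w * omega n t u + omega n b w * omega n t v)" if "t \<in> carrier_vec (2 * n)" for t
    unfolding w1_def omega_minus(2)[OF w c1(3) that] omega_add(2)[OF c1(1,2) that] omega_smult(2)[OF u that] omega_smult(2)[OF v that] ..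
  have "w1 \<noteq> 0\<^sub>v (2 * n)"
  proof
    assume e: "w1 = 0\<^sub>v (2 * n)"
    have "w = omega n a w \<cdot>\<^sub>v u + omega n b w \<cdot>\<^sub>v v"
    proof (rule eq_vecI)
      fix i assume "i < dim_vec (omega n a w \<cdot>\<^sub>v u + omega n b w \<cdot>\<^sub>v v)"
      then have i: "i < 2 * n" using v by simp
      then show "w $ i = (omega n a w \<cdot>\<^sub>v u + omega n b w \<cdot>\<^sub>v v) $ i"
        using arg_cong[OF e, of "\<lambda>x. x $ i"] w u v by (simp add: w1_def)
    qed (use w v in simp)
    then show False using ind(3) by blast
  qed
  then obtain y where y: "y \<in> carrier_vec (2 * n)" "omega n w1 y = 1" using omega_nondegenerate[OF w1] by blast
  define z where "z = - y - (- omega n y u \<cdot>\<^sub>v a + - omega n y v \<cdot>\<^sub>v b)"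
  have c2: "- y \<in> carrier_vec (2 * n)" "- omega n y u \<cdot>\<^sub>v a \<in> carrier_vec (2 * n)" "- omega n y v \<cdot>\<^sub>v b \<in> carrier_vec (2 * n)"
    "- omega n y u \<cdot>\<^sub>v a + - omega n y v \<cdot>\<^sub>v b \<in> carrier_vec (2 * n)" using y a b by auto
  have z: "z \<in> carrier_vec (2 * n)" using c2 by (simp add: z_def)
  have oz: "omega n z x = - omega n y x + (omega n y u * omega n a x + omega n y v * omega n b x)" if "x \<in> carrier_vec (2 * n)" for x
    unfolding z_def omega_minus(1)[OF c2(1,4) that] omega_add(1)[OF c2(2,3) that] omega_smult(1)[OF a(1) that] omega_smult(1)[OF b(1) that]
      omega_uminus(1)[OF y(1) that] by simp
  have zu: "omega n z u = 0" "omega n z v = 0" using oz[OF u] oz[OF v] a b by auto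
  have "omega n z w = omega n z w1" using om[OF z] zu by simp
  also have "\<dots> = - omega n y w1" using oz[OF w1] om[OF a(1)] om[OF b(1)] a b by simp
  also have "\<dots> = 1" using omega_swap[OF w1 y(1)] y(2) by simp
  finally show ?thesis using that[OF z zu] by blast
qed

text \<open>Alternation makes \<open>M\<close> self-adjoint for the form, whereas the adjoint of a
  symplectic matrix is its inverse.\<close>

lemma alternating_involution:
  fixes M :: "'a::field mat"
  assumes M: "M \<in> Sp n" and alt: "\<And>x. x \<in> carrier_vec (2 * n) \<Longrightarrow> omega n x (M *\<^sub>v x) = 0"
    and x: "x \<in> carrier_vec (2 * n)"
  shows "y \<in> carrier_vec (2 * n) \<Longrightarrow> omega n x (M *\<^sub>v y) = - omega n y (M *\<^sub>v x)" "M *\<^sub>v (M *\<^sub>v x) = x"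
proof -
  have Mc: "M \<in> carrier_mat (2 * n) (2 * n)" by (rule Sp_carrier[OF M])
  have Mv: "M *\<^sub>v y \<in> carrier_vec (2 * n)" if "y \<in> carrier_vec (2 * n)" for y using Mc that by simp
  have polar: "omega n x (M *\<^sub>v y) = - omega n y (M *\<^sub>v x)"
    if "x \<in> carrier_vec (2 * n)" "y \<in> carrier_vec (2 * n)" for x y
  proof -
    have "omega n (x + y) (M *\<^sub>v (x + y)) = 0" using that by (intro alt) simp
    then have "omega n x (M *\<^sub>v y) + omega n y (M *\<^sub>v x) = 0"
      unfolding mult_mat_vec_lin(1)[OF Mc that] using that Mv alt by (simp add: omega_add add.commute)
    then show ?thesis by (rule iffD2[OF eq_neg_iff_add_eq_0])
  qed
  then show "y \<in> carrier_vec (2 * n) \<Longrightarrow> omega n x (M *\<^sub>v y) = - omega n y (M *\<^sub>v x)" using x by blast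
  let ?d = "M *\<^sub>v (M *\<^sub>v x) - x"
  have d: "?d \<in> carrier_vec (2 * n)" using x Mv by simp
  have "?d = 0\<^sub>v (2 * n)"
  proof (rule ccontr)
    assume "?d \<noteq> 0\<^sub>v (2 * n)"
    then obtain y where y: "y \<in> carrier_vec (2 * n)" "omega n ?d y = 1" using omega_nondegenerate[OF d] by blast
    have "omega n (M *\<^sub>v (M *\<^sub>v x)) y = - omega n y (M *\<^sub>v (M *\<^sub>v x))"
      by (rule omega_swap[OF y(1) Mv[OF Mv[OF x]]])
    also have "\<dots> = omega n (M *\<^sub>v x) (M *\<^sub>v y)" using polar[OF y(1) Mv[OF x]] by simp
    also have "\<dots> = omega n x y" by (rule omega_mult[OF M x y(1)])
    finally show False using y omega_minus(1)[OF Mv[OF Mv[OF x]] x y(1)] by simp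
  qed
  then have "?d $ i = 0" if "i < 2 * n" for i using that by simp
  moreover have "?d $ i = (M *\<^sub>v (M *\<^sub>v x)) $ i - x $ i" if "i < 2 * n" for i
    by (rule index_minus_vec(1)) (use that x in simp)
  ultimately have "(M *\<^sub>v (M *\<^sub>v x)) $ i = x $ i" if "i < 2 * n" for i using that by simp
  then show "M *\<^sub>v (M *\<^sub>v x) = x" using x Mc by (intro eq_vecI) (auto simp del: index_mult_mat_vec)
qed

text \<open>For an involution \<open>z + M z\<close> is fixed, and if it vanishes then
  \<open>z\<close> has eigenvalue -1. The span of \<open>v\<close> and \<open>M v\<close> meets the
  two eigenspaces in the multiples of \<open>v + M v\<close> and \<open>v - M v\<close>, which
  \<open>g\<close> and \<open>g'\<close> detect.\<close>

lemma alternating_eigenvector: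
  fixes M :: "'a::field mat"
  assumes M: "M \<in> Sp n" and n: "3 \<le> n" and alt: "\<And>x. x \<in> carrier_vec (2 * n) \<Longrightarrow> omega n x (M *\<^sub>v x) = 0"
    and v: "v \<in> carrier_vec (2 * n)" "\<And>a. M *\<^sub>v v \<noteq> a \<cdot>\<^sub>v v"
  obtains u \<epsilon> where "u \<in> carrier_vec (2 * n)" "M *\<^sub>v u = \<epsilon> \<cdot>\<^sub>v u" "omega n v u = 0"
    "\<And>a b. u \<noteq> a \<cdot>\<^sub>v v + b \<cdot>\<^sub>v (M *\<^sub>v v)"
proof -
  have Mc: "M \<in> carrier_mat (2 * n) (2 * n)" by (rule Sp_carrier[OF M])
  have Mv: "M *\<^sub>v y \<in> carrier_vec (2 * n)" if "y \<in> carrier_vec (2 * n)" for y using Mc that by simp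
  have polar: "omega n x (M *\<^sub>v y) = - omega n y (M *\<^sub>v x)" if "x \<in> carrier_vec (2 * n)" "y \<in> carrier_vec (2 * n)" for x y
    by (rule alternating_involution(1)[OF M _ that]) (rule alt)
  have inv: "M *\<^sub>v (M *\<^sub>v x) = x" if "x \<in> carrier_vec (2 * n)" for x
    by (rule alternating_involution(2)[OF M _ that]) (rule alt)
  have dims: "dim_vec v = 2 * n" "dim_vec (M *\<^sub>v v) = 2 * n" using v(1) Mc by auto
  \<comment> \<open>As \<open>v\<close> is not an eigenvector, \<open>v - s (M v)\<close> is
    nonzero, so a scalar multiple of it vanishes only for the scalar 0.\<close>
  have nonprop: "(a - s * b) = 0" if "\<And>i. i < 2 * n \<Longrightarrow> (a - s * b) * (v $ i - s * (M *\<^sub>v v) $ i) = 0" "s * s = 1" for a b s :: 'a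
  proof (rule ccontr)
    assume ne: "a - s * b \<noteq> 0"
    have "M *\<^sub>v v = s \<cdot>\<^sub>v v"
    proof (rule eq_vecI)
      fix i assume "i < dim_vec (s \<cdot>\<^sub>v v)"
      then have i: "i < 2 * n" using dims by simp
      have "v $ i = s * (M *\<^sub>v v) $ i" using that(1)[OF i] ne by simp
      then have "s * v $ i = (s * s) * (M *\<^sub>v v) $ i" by (simp add: mult.assoc)
      then show "(M *\<^sub>v v) $ i = (s \<cdot>\<^sub>v v) $ i" using i dims that(2) by simp
    qed (use dims in simp)
    then show False using v(2) by blast
  qed
  have ne: "v + s \<cdot>\<^sub>v (M *\<^sub>v v) \<noteq> 0\<^sub>v (2 * n)" if "s * s = 1" for s
  proof
    assume e: "v + s \<cdot>\<^sub>v (M *\<^sub>v v) = 0\<^sub>v (2 * n)"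
    have "v $ i - (- s) * (M *\<^sub>v v) $ i = 0" if "i < 2 * n" for i
      using arg_cong[OF e, of "\<lambda>x. x $ i"] dims that by (simp del: index_mult_mat_vec)
    then have "1 - (- s) * 0 = (0 :: 'a)" by (intro nonprop) (use that in auto)
    then show False by simp
  qed
  have plus: "v + s \<cdot>\<^sub>v (M *\<^sub>v v) \<in> carrier_vec (2 * n)" for s using v(1) Mv by simp
  obtain g where g: "g \<in> carrier_vec (2 * n)" "omega n (v + 1 \<cdot>\<^sub>v (M *\<^sub>v v)) g = 1"
    using omega_nondegenerate[OF plus[of 1] ne] by auto
  obtain g' where g': "g' \<in> carrier_vec (2 * n)" "omega n (v + (- 1) \<cdot>\<^sub>v (M *\<^sub>v v)) g' = 1"
    using omega_nondegenerate[OF plus[of "- 1"] ne] by auto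
  \<comment> \<open>The first two conditions serve the case \<open>u = z\<close>, the last two, by
    self-adjointness, the case \<open>u = z + M z\<close>. Four conditions leave a nonzero
    \<open>z\<close> since \<open>n \<ge> 3\<close>.\<close>
  let ?gs = "[v, g', v + 1 \<cdot>\<^sub>v (M *\<^sub>v v), g + M *\<^sub>v g]"
  have "set ?gs \<subseteq> carrier_vec (2 * n)" using v(1) g(1) g'(1) plus[of 1] Mv by simp
  then obtain z where z: "z \<in> carrier_vec (2 * n)" "z \<noteq> 0\<^sub>v (2 * n)" and o: "\<And>t. t \<in> set ?gs \<Longrightarrow> omega n t z = 0"
    using omega_orthogonal_exists[of ?gs n] n by auto
  have Mz: "M *\<^sub>v z \<in> carrier_vec (2 * n)" using Mv z by blast
  have swapM: "omega n t (M *\<^sub>v z) = omega n (M *\<^sub>v t) z" if "t \<in> carrier_vec (2 * n)" for t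
    using polar[OF that z(1)] omega_swap[OF z(1) Mv[OF that]] by simp
  have sum0: "omega n t (z + M *\<^sub>v z) = omega n (t + M *\<^sub>v t) z" if "t \<in> carrier_vec (2 * n)" for t
    using omega_add(2)[OF z(1) Mz that] omega_add(1)[OF that Mv[OF that] z(1)] swapM[OF that] by simp
  have M2: "M *\<^sub>v (a \<cdot>\<^sub>v v + b \<cdot>\<^sub>v (M *\<^sub>v v)) = a \<cdot>\<^sub>v (M *\<^sub>v v) + b \<cdot>\<^sub>v v" for a b
    using mult_mat_vec_lin(1)[OF Mc, of "a \<cdot>\<^sub>v v" "b \<cdot>\<^sub>v (M *\<^sub>v v)"] v(1) Mv[OF v(1)] inv[OF v(1)]
    by (simp add: mult_mat_vec_lin(2)[OF Mc])
  have outside: "u \<noteq> a \<cdot>\<^sub>v v + b \<cdot>\<^sub>v (M *\<^sub>v v)"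
    if u: "M *\<^sub>v u = s \<cdot>\<^sub>v u" "s * s = 1" "u \<noteq> 0\<^sub>v (2 * n)"
      and t: "t \<in> carrier_vec (2 * n)" "omega n (v + s \<cdot>\<^sub>v (M *\<^sub>v v)) t = 1" "omega n t u = 0" for u s t a b
  proof
    assume e: "u = a \<cdot>\<^sub>v v + b \<cdot>\<^sub>v (M *\<^sub>v v)"
    have "a - s * b = 0"
    proof (rule nonprop)
      fix i assume i: "i < 2 * n"
      have "a * (M *\<^sub>v v) $ i + b * v $ i = s * (a * v $ i + b * (M *\<^sub>v v) $ i)"
        using arg_cong[OF u(1)[unfolded e M2], of "\<lambda>x. x $ i"] i dims by (simp del: index_mult_mat_vec)
      then have "s * (a * (M *\<^sub>v v) $ i + b * v $ i) = (s * s) * (a * v $ i + b * (M *\<^sub>v v) $ i)" by (simp add: mult.assoc)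
      then show "(a - s * b) * (v $ i - s * (M *\<^sub>v v) $ i) = 0"
        using u(2) by (simp add: algebra_simps del: index_mult_mat_vec)
    qed (rule u(2))
    then have ab: "a = s * b" "b = s * a" using u(2) by (auto simp flip: mult.assoc)
    have eu: "u = a \<cdot>\<^sub>v (v + s \<cdot>\<^sub>v (M *\<^sub>v v))"
      unfolding e using dims ab(2) by (intro eq_vecI) (auto simp: algebra_simps simp del: index_mult_mat_vec)
    have "omega n u t = a" unfolding eu omega_smult(1)[OF plus t(1)] t(2) by simp
    moreover have uc: "u \<in> carrier_vec (2 * n)" unfolding eu using plus by simp
    ultimately have a0: "a = 0" using omega_swap[OF t(1) uc] t(3) by simp
    have "0 \<cdot>\<^sub>v x = 0\<^sub>v (2 * n)" if "x \<in> carrier_vec (2 * n)" for x :: "'a vec" using that by (intro eq_vecI) auto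
    then have "u = 0\<^sub>v (2 * n)" unfolding eu a0 using plus by blast
    then show False using u(3) by simp
  qed
  show ?thesis
  proof (cases "z + M *\<^sub>v z = 0\<^sub>v (2 * n)")
    case False
    let ?u = "z + M *\<^sub>v z"
    have u: "?u \<in> carrier_vec (2 * n)" using z Mz by simp
    have Mu: "M *\<^sub>v ?u = 1 \<cdot>\<^sub>v ?u"
      unfolding mult_mat_vec_lin(1)[OF Mc z(1) Mz] inv[OF z(1)] using z Mz by (simp add: comm_add_vec)
    have "omega n g ?u = 0" using sum0[OF g(1)] o by simp
    moreover have "omega n v ?u = 0" using sum0[OF v(1)] o[of "v + 1 \<cdot>\<^sub>v (M *\<^sub>v v)"] by simp
    ultimately show ?thesis using that[OF u Mu] outside[OF Mu _ False g] by simp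
  next
    case True
    have Mz': "M *\<^sub>v z = (- 1) \<cdot>\<^sub>v z"
    proof (rule eq_vecI)
      fix i assume "i < dim_vec ((- 1) \<cdot>\<^sub>v z)"
      then have i: "i < 2 * n" using z by simp
      have "z $ i + (M *\<^sub>v z) $ i = 0" using arg_cong[OF True, of "\<lambda>x. x $ i"] i z(1) Mc by (simp del: index_mult_mat_vec)
      then show "(M *\<^sub>v z) $ i = ((- 1) \<cdot>\<^sub>v z) $ i" using i z(1) by (simp add: eq_neg_iff_add_eq_0 add.commute del: index_mult_mat_vec)
    qed (use z Mc in simp)
    show ?thesis using that[OF z(1) Mz'] outside[OF Mz' _ z(2) g'] o by simp
  qed
qed

text \<open>An eigenvector \<open>u\<close> inside the Lagrangian subspace gives a zero column of
  the Gram matrix. Two further basis vectors \<open>v'\<close> and \<open>z'\<close> with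
  \<open>omega n z' (M v')\<close> nonzero keep the matrix from vanishing, so three basis vectors
  are required.\<close>

lemma alternating_corner:
  fixes M :: "'a::field mat"
  assumes M: "M \<in> Sp n" and n: "3 \<le> n" and alt: "\<And>x. x \<in> carrier_vec (2 * n) \<Longrightarrow> omega n x (M *\<^sub>v x) = 0"
    and ns: "\<not> scalar_mat (2 * n) M"
  obtains A C where "has_corner n M A C" "C \<noteq> 0\<^sub>m n n" "det C = 0"
proof -
  have Mc: "M \<in> carrier_mat (2 * n) (2 * n)" by (rule Sp_carrier[OF M])
  have Mv: "M *\<^sub>v y \<in> carrier_vec (2 * n)" if "y \<in> carrier_vec (2 * n)" for y using Mc that by simp
  have polar: "omega n x (M *\<^sub>v y) = - omega n y (M *\<^sub>v x)" if "x \<in> carrier_vec (2 * n)" "y \<in> carrier_vec (2 * n)" for x y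
    by (rule alternating_involution(1)[OF M _ that]) (rule alt)
  obtain v where v: "v \<in> carrier_vec (2 * n)" "\<And>a. M *\<^sub>v v \<noteq> a \<cdot>\<^sub>v v" using nonscalar_vector[OF Mc ns] by blast
  obtain u \<epsilon> where u: "u \<in> carrier_vec (2 * n)" "M *\<^sub>v u = \<epsilon> \<cdot>\<^sub>v u" "omega n v u = 0"
    and out: "\<And>a b. u \<noteq> a \<cdot>\<^sub>v v + b \<cdot>\<^sub>v (M *\<^sub>v v)"
    using alternating_eigenvector[OF M n alt v] by blast
  have zero: "0 \<cdot>\<^sub>v x = 0\<^sub>v (2 * n)" if "x \<in> carrier_vec (2 * n)" for x :: "'a vec" using that by (intro eq_vecI) auto
  have u0: "u \<noteq> 0\<^sub>v (2 * n)" using out[of 0 0] zero v(1) Mv by simp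
  have ind1: "u \<noteq> a \<cdot>\<^sub>v v" for a using out[of a 0] zero[OF Mv[OF v(1)]] v(1) by simp
  have ind2: "v \<noteq> a \<cdot>\<^sub>v u" for a
  proof
    assume e: "v = a \<cdot>\<^sub>v u"
    have "M *\<^sub>v v = (a * \<epsilon>) \<cdot>\<^sub>v u" using mult_mat_vec_lin(2)[OF Mc u(1) u(1)] u(2) e by (simp add: smult_smult_assoc)
    also have "\<dots> = \<epsilon> \<cdot>\<^sub>v v" unfolding e by (simp add: smult_smult_assoc mult.commute)
    finally show False using v(2) by blast
  qed
  have ind3: "M *\<^sub>v v \<noteq> a \<cdot>\<^sub>v u + b \<cdot>\<^sub>v v" for a b
  proof
    assume e: "M *\<^sub>v v = a \<cdot>\<^sub>v u + b \<cdot>\<^sub>v v"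
    have comp: "(M *\<^sub>v v) $ i = a * u $ i + b * v $ i" if "i < 2 * n" for i unfolding e using that u(1) v(1) by simp
    show False
    proof (cases "a = 0")
      case True
      then show False using e zero[OF u(1)] v(1) v(2)[of b] by simp
    next
      case False
      have "u = (- b / a) \<cdot>\<^sub>v v + (1 / a) \<cdot>\<^sub>v (M *\<^sub>v v)"
        by (rule eq_vecI) (use False comp u(1) v(1) Mc in \<open>auto simp: field_simps simp del: index_mult_mat_vec\<close>)
      then show False using out by blast
    qed
  qed
  obtain z where z: "z \<in> carrier_vec (2 * n)" "omega n z u = 0" "omega n z v = 0" "omega n z (M *\<^sub>v v) = 1"
    using separating_vector_2[OF u(1) v(1) Mv[OF v(1)] ind1 ind2 ind3] .
  define e :: "nat \<Rightarrow> 'a vec" where "e = (\<lambda>_. 0\<^sub>v (2 * n))"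
  have S0: "symplectic_basis n 0 e e" by (rule symplectic_basis_0)
  have pu: "perp n 0 e e u" using u(1) by (simp add: perp_def)
  obtain y where y: "perp n 0 e e y" "omega n u y = 1" using perp_partner[OF S0 pu u0] .
  have S1: "symplectic_basis n 1 (e(0 := u)) (e(0 := y))" using symplectic_basis_Suc[OF S0 pu y] by simp
  obtain v' where v': "perp n 1 (e(0 := u)) (e(0 := y)) v'" and pv: "\<And>t. t \<in> carrier_vec (2 * n) \<Longrightarrow> omega n t v' =
       omega n t v - (\<Sum>i<1. omega n v ((e(0 := y)) i) * omega n t ((e(0 := u)) i) - omega n v ((e(0 := u)) i) * omega n t ((e(0 := y)) i))"
    using perp_projection_explicit[OF S1 v(1)] by blast
  \<comment> \<open>As \<open>v\<close> is orthogonal to \<open>u\<close>, the projection changes it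
    only by a multiple of \<open>u\<close>; since \<open>z\<close> is orthogonal to the eigenvector
    \<open>u\<close>, its products with \<open>v\<close> and \<open>M v\<close> survive.\<close>
  have pv': "omega n t v' = omega n t v - omega n v y * omega n t u" if "t \<in> carrier_vec (2 * n)" for t
    using pv[OF that] u(3) by simp
  have v'c: "v' \<in> carrier_vec (2 * n)" "omega n v' u = 0" using perpD(1)[OF S1 v'] perpD(2)[OF S1 v', of 0] by auto
  have eps: "omega n t (M *\<^sub>v u) = \<epsilon> * omega n t u" if "t \<in> carrier_vec (2 * n)" for t
    unfolding u(2) by (rule omega_smult(2)[OF u(1) that])
  have zv': "omega n z v' = 0" using pv'[OF z(1)] z by simp
  have zMv': "omega n z (M *\<^sub>v v') = 1"
  proof -
    have sw: "omega n z (M *\<^sub>v t) = omega n (M *\<^sub>v z) t" if t: "t \<in> carrier_vec (2 * n)" for t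
      using polar[OF z(1) t] omega_swap[OF t Mv[OF z(1)]] by simp
    show ?thesis
      unfolding sw[OF v'c(1)] pv'[OF Mv[OF z(1)]] sw[OF v(1), symmetric] sw[OF u(1), symmetric] eps[OF z(1)] z by simp
  qed
  have "v' \<noteq> 0\<^sub>v (2 * n)"
  proof
    assume "v' = 0\<^sub>v (2 * n)"
    then have "M *\<^sub>v v' = 0\<^sub>v (2 * n)" using Mc by (intro eq_vecI) auto
    then show False using zMv' z(1) by simp
  qed
  from perp_partner[OF S1 v' this] obtain y1 where y1: "perp n 1 (e(0 := u)) (e(0 := y)) y1" "omega n v' y1 = 1" .
  define e2 f2 where "e2 = e(0 := u, 1 := v')" and "f2 = e(0 := y, 1 := y1)"
  have S2: "symplectic_basis n 2 e2 f2"
    using symplectic_basis_Suc[OF S1 v' y1] by (simp add: e2_def f2_def numeral_2_eq_2)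
  have e2: "e2 0 = u" "e2 1 = v'" "e2 (Suc 0) = v'" by (simp_all add: e2_def)
  obtain z' where z': "perp n 2 e2 f2 z'" and pz: "\<And>t. t \<in> carrier_vec (2 * n) \<Longrightarrow> omega n t z' =
       omega n t z - (\<Sum>i<2. omega n z (f2 i) * omega n t (e2 i) - omega n z (e2 i) * omega n t (f2 i))"
    using perp_projection_explicit[OF S2 z(1)] by blast
  have z'c: "z' \<in> carrier_vec (2 * n)" using z' by (simp add: perp_def)
  have nz: "omega n z' (M *\<^sub>v v') \<noteq> 0"
  proof -
    have "omega n (M *\<^sub>v v') u = 0"
      using omega_swap[OF u(1) Mv[OF v'c(1)]] polar[OF u(1) v'c(1)] eps[OF v'c(1)] v'c(2) by simp
    moreover have "omega n (M *\<^sub>v v') v' = 0" using omega_swap[OF v'c(1) Mv[OF v'c(1)]] alt[OF v'c(1)] by simp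
    moreover have "{..<2} = {0, 1 :: nat}" by auto
    ultimately have "omega n (M *\<^sub>v v') z' = omega n (M *\<^sub>v v') z"
      using pz[OF Mv[OF v'c(1)]] z(2) zv' by (simp add: e2)
    then show ?thesis
      using omega_swap[OF z'c Mv[OF v'c(1)]] omega_swap[OF z(1) Mv[OF v'c(1)]] zMv' by auto
  qed
  then have "z' \<noteq> 0\<^sub>v (2 * n)" using Mv[OF v'c(1)] by auto
  from perp_partner[OF S2 z' this] obtain y2 where y2: "perp n 2 e2 f2 y2" "omega n z' y2 = 1" .
  have S3: "symplectic_basis n 3 (e2(2 := z')) (f2(2 := y2))"
    using symplectic_basis_Suc[OF S2 z' y2] by (simp add: numeral_3_eq_3 numeral_2_eq_2)
  obtain e' f' where S': "symplectic_basis n n e' f'" and ext: "\<And>i. i < 3 \<Longrightarrow> e' i = (e2(2 := z')) i \<and> f' i = (f2(2 := y2)) i"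
    using symplectic_basis_extend[OF S3 n] by blast
  have e': "e' 0 = u" "e' 1 = v'" "e' 2 = z'" using ext[of 0] ext[of 1] ext[of 2] e2 by auto
  obtain A C where corner: "has_corner n M A C"
    and C: "\<And>i j. i < n \<Longrightarrow> j < n \<Longrightarrow> C $$ (i, j) = omega n (e' i) (M *\<^sub>v e' j)" using frame_corner[OF M S'] by blast
  have Cc: "C \<in> carrier_mat n n" using corner by (simp add: has_corner_def)
  have C21: "C $$ (2, 1) \<noteq> 0" using C[of 2 1] n nz e' by simp
  have col: "C $$ (i, 0) = 0" if "i < n" for i
    using C[OF that, of 0] eps[OF symplectic_basisD(1)[OF S' that]] symplectic_basisD(3)[OF S' that, of 0] n e' by simp
  have "unit_vec n 0 \<noteq> (0\<^sub>v n :: 'a vec)" using n by (metis index_unit_vec(2) index_zero_vec(1) less_le_trans zero_less_numeral zero_neq_one)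
  then have "det C = 0"
    by (intro det_zero_if_kernel[OF Cc unit_vec_carrier]) (auto simp: unit_vec_def col intro!: sum.neutral)
  moreover have "C \<noteq> 0\<^sub>m n n" using C21 n by auto
  ultimately show ?thesis using that[OF corner] by blast
qed

text \<open>In dimension 4 the plane of \<open>v\<close> and a suitable \<open>z'\<close> is
  Lagrangian. Its Gram matrix is alternating with off-diagonal entry normalized to 1, hence
  invertible, so \<open>A\<close> can be cleared.\<close>

lemma alternating_corner_2:
  fixes M :: "'a::field mat"
  assumes M: "M \<in> Sp 2" and alt: "\<And>x. x \<in> carrier_vec 4 \<Longrightarrow> omega 2 x (M *\<^sub>v x) = 0"
    and ns: "\<not> scalar_mat 4 M"
  shows "has_corner 2 M (0\<^sub>m 2 2) (mat2 0 (- 1) 1 0)"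
proof -
  have alt': "\<And>x. x \<in> carrier_vec (2 * 2) \<Longrightarrow> omega 2 x (M *\<^sub>v x) = 0" using alt by simp
  have Mc: "M \<in> carrier_mat (2 * 2) (2 * 2)" by (rule Sp_carrier[OF M])
  have Mv: "M *\<^sub>v y \<in> carrier_vec (2 * 2)" if "y \<in> carrier_vec (2 * 2)" for y using Mc that by simp
  have polar: "omega 2 x (M *\<^sub>v y) = - omega 2 y (M *\<^sub>v x)" if "x \<in> carrier_vec (2 * 2)" "y \<in> carrier_vec (2 * 2)" for x y
    by (rule alternating_involution(1)[OF M _ that]) (rule alt')
  have ns': "\<not> scalar_mat (2 * 2) M" using ns by simp
  obtain v where v: "v \<in> carrier_vec (2 * 2)" "\<And>a. M *\<^sub>v v \<noteq> a \<cdot>\<^sub>v v" using nonscalar_vector[OF Mc ns'] by blast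
  have v0: "v \<noteq> 0\<^sub>v (2 * 2)"
  proof
    assume "v = 0\<^sub>v (2 * 2)"
    then have "M *\<^sub>v v = 0 \<cdot>\<^sub>v v" using Mc by (intro eq_vecI) auto
    then show False using v(2) by blast
  qed
  obtain z where z: "z \<in> carrier_vec (2 * 2)" "omega 2 z v = 0" "omega 2 z (M *\<^sub>v v) = 1"
    using separating_vector_1[OF v(1) Mv[OF v(1)] v(2)] by blast
  define e :: "nat \<Rightarrow> 'a vec" where "e = (\<lambda>_. 0\<^sub>v (2 * 2))"
  have S0: "symplectic_basis 2 0 e e" by (rule symplectic_basis_0)
  have pv: "perp 2 0 e e v" using v(1) by (simp add: perp_def)
  obtain y where y: "perp 2 0 e e y" "omega 2 v y = 1" using perp_partner[OF S0 pv v0] .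
  have S1: "symplectic_basis 2 1 (e(0 := v)) (e(0 := y))" using symplectic_basis_Suc[OF S0 pv y] by simp
  obtain z' where z': "perp 2 1 (e(0 := v)) (e(0 := y)) z'" and pz: "\<And>t. t \<in> carrier_vec (2 * 2) \<Longrightarrow> omega 2 t z' =
       omega 2 t z - (\<Sum>i<1. omega 2 z ((e(0 := y)) i) * omega 2 t ((e(0 := v)) i) - omega 2 z ((e(0 := v)) i) * omega 2 t ((e(0 := y)) i))"
    using perp_projection_explicit[OF S1 z(1)] by blast
  have z'c: "z' \<in> carrier_vec (2 * 2)" using z' by (simp add: perp_def)
  have "omega 2 (M *\<^sub>v v) v = 0" using omega_swap[OF v(1) Mv[OF v(1)]] alt'[OF v(1)] by simp
  then have "omega 2 (M *\<^sub>v v) z' = omega 2 (M *\<^sub>v v) z" using pz[OF Mv[OF v(1)]] z(2) by simp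
  then have z'M: "omega 2 z' (M *\<^sub>v v) = 1"
    using omega_swap[OF z'c Mv[OF v(1)]] omega_swap[OF z(1) Mv[OF v(1)]] z(3) by simp
  then have "z' \<noteq> 0\<^sub>v (2 * 2)" using Mv[OF v(1)] omega_zero(2)[OF Mv[OF v(1)]] by auto
  from perp_partner[OF S1 z' this] obtain y1 where y1: "perp 2 1 (e(0 := v)) (e(0 := y)) y1" "omega 2 z' y1 = 1" .
  define e2 f2 where "e2 = e(0 := v, 1 := z')" and "f2 = e(0 := y, 1 := y1)"
  have S2: "symplectic_basis 2 2 e2 f2"
    using symplectic_basis_Suc[OF S1 z' y1] by (simp add: e2_def f2_def numeral_2_eq_2)
  have e2: "e2 0 = v" "e2 (Suc 0) = z'" by (simp_all add: e2_def)
  obtain A C where corner: "has_corner 2 M A C"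
    and C: "\<And>i j. i < 2 \<Longrightarrow> j < 2 \<Longrightarrow> C $$ (i, j) = omega 2 (e2 i) (M *\<^sub>v e2 j)" using frame_corner[OF M S2] by blast
  have Cc: "C \<in> carrier_mat 2 2" using corner by (simp add: has_corner_def)
  have Ceq: "C = mat2 0 (- 1) 1 0"
    using C[of 0 0] C[of 0 1] C[of 1 0] C[of 1 1] alt'[OF v(1)] alt'[OF z'c] polar[OF v(1) z'c] z'M
    by (intro mat_eq_2I[OF Cc mat2_carrier]) (simp_all add: e2)
  have "1\<^sub>m 2 = mat2 0 (- 1) 1 0 * mat2 0 1 (- 1) (0 :: 'a)" unfolding mat2_mult by (rule mat_eq_2I) auto
  then have "det (mat2 0 (- 1) 1 0) * det (mat2 0 1 (- 1) (0 :: 'a)) = 1"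
    by (metis det_mult[OF mat2_carrier mat2_carrier] det_one)
  then have "det C \<noteq> 0" unfolding Ceq by auto
  then show ?thesis using has_corner_zero_if_invertible[OF corner] unfolding Ceq by blast
qed

section \<open>Products of strictly hyperbolic classes\<close>

definition hyperbolic_for :: "nat \<Rightarrow> 'a::field poly \<Rightarrow> 'a mat \<Rightarrow> bool" where
  "hyperbolic_for n q N \<longleftrightarrow> N \<in> Sp n \<and> lead_coeff q = 1 \<and> degree q = n \<and> coeff q 0 \<noteq> 0 \<and>
     comaximal q (reciprocal_poly q) \<and> cyclic_for (q * reciprocal_poly q) N"

lemma hyperbolic_forD:
  assumes "hyperbolic_for n q N"
  shows "N \<in> Sp n" "lead_coeff q = 1" "degree q = n" "coeff q 0 \<noteq> 0" "comaximal q (reciprocal_poly q)"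
    "cyclic_for (q * reciprocal_poly q) N"
  using assms unfolding hyperbolic_for_def by auto

text \<open>The product of \<open>q\<close> and its reciprocal does not tell the two apart; over
  GF(3) this freedom absorbs a sign.\<close>

lemma hyperbolic_for_reciprocal:
  assumes "hyperbolic_for n q N"
  shows "hyperbolic_for n (reciprocal_poly q) N"
proof -
  note h = hyperbolic_forD[OF assms] and r = reciprocal_poly_props[OF hyperbolic_forD(2,4)[OF assms]]
  show ?thesis
    using h r comaximal_sym[OF h(5)] unfolding hyperbolic_for_def by (simp add: mult.commute)
qed

lemma class_product_if_factorization:
  fixes M :: "'a::field mat"
  assumes n0: "n > 0" and N1: "hyperbolic_for n p N1" and N2: "hyperbolic_for n q N2"
    and ex: "\<exists>A C X Y. has_corner n M A C \<and> cyclic_for p X \<and> cyclic_for q Y \<and> A = X * Y"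
  shows "M \<in> class_product (Sp_conj_class n N1) (Sp_conj_class n N2)"
proof -
  obtain A C X Y where c: "has_corner n M A C" "cyclic_for p X" "cyclic_for q Y" "A = X * Y"
    using ex by (elim exE conjE)
  note h1 = hyperbolic_forD[OF N1] and h2 = hyperbolic_forD[OF N2]
  show ?thesis
    by (rule class_product_if_corner[OF n0 h1(2,3,4,5) h2(2,3,4,5) h1(1,6) h2(1,6) c])
qed

text \<open>A diagonal entry of the triangular form is a root of \<open>q\<close> or of its
  reciprocal; in the second case its inverse is a root of \<open>q\<close>.\<close>

lemma root_if_triangularizable:
  fixes N :: "'a::field mat"
  assumes h: "hyperbolic_for n q N" and T: "upper_triangular T \<or> upper_triangular (transpose_mat T)" "similar_mat N T"
    and char: "char_poly N = q * reciprocal_poly q" and n0: "n > 0"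
  shows "\<exists>a. poly q a = 0"
proof -
  note Nc = Sp_carrier[OF hyperbolic_forD(1)[OF h]]
  obtain m P Q where "{N, T, P, Q} \<subseteq> carrier_mat m m" using similar_matD[OF T(2)] by blast
  then have Tc: "T \<in> carrier_mat (2 * n) (2 * n)" using Nc by auto
  obtain U where U: "U \<in> carrier_mat (2 * n) (2 * n)" "upper_triangular U" "char_poly U = char_poly T"
    using T(1) Tc char_poly_transpose_mat[OF Tc] transpose_carrier_mat[of T "2 * n" "2 * n"] by blast
  have cp: "q * reciprocal_poly q = (\<Prod>a\<leftarrow>diag_mat U. [:- a, 1:])"
    using char char_poly_similar[OF T(2)] U(3) char_poly_upper_triangular[OF U(1,2)] by simp
  define a where "a = U $$ (0, 0)"
  have "a \<in> set (diag_mat U)" using U(1) n0 by (auto simp: diag_mat_def a_def)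
  then have "poly (\<Prod>a\<leftarrow>diag_mat U. [:- a, 1:]) a = 0" by (auto simp: poly_prod_list prod_list_zero_iff)
  then have "poly q a * poly (reciprocal_poly q) a = 0" unfolding cp[symmetric] by simp
  then consider "poly q a = 0" | "poly (reciprocal_poly q) a = 0" by auto
  then show ?thesis
  proof cases
    case 2
    note r = reciprocal_poly_props[OF hyperbolic_forD(2,4)[OF h]]
    have "a \<noteq> 0" using 2 r(3) hyperbolic_forD(4)[OF h] by (auto simp: poly_0_coeff_0)
    moreover have "poly (reflect_poly q) a = 0" unfolding r(5) using 2 by simp
    ultimately have "poly q (inverse a) = 0" by (simp add: poly_reflect_poly_nz)
    then show ?thesis by blast
  qed blast
qed

lemma hyperbolic_class:
  fixes \<Omega> :: "'a::field mat set"
  assumes "is_Sp_conj_class n \<Omega>" and "cyclic_class \<Omega>" and "strictly_hyperbolic_class \<Omega>" and n0: "n > 0"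
  obtains N q where "\<Omega> = Sp_conj_class n N" "hyperbolic_for n q N" "triangularizable_class \<Omega> \<Longrightarrow> \<exists>a. poly q a = 0"
proof -
  obtain N where N: "N \<in> Sp n" "\<Omega> = Sp_conj_class n N" using assms(1) unfolding is_Sp_conj_class_def by blast
  note Nc = Sp_carrier[OF N(1)]
  have "similar_mat_wit N N (1\<^sub>m (2 * n)) (1\<^sub>m (2 * n))"
    by (intro similar_mat_witI[of _ _ "2 * n"]) (use Nc in auto)
  then have mem: "N \<in> \<Omega>" unfolding N(2) Sp_conj_class_def using Sp_one by blast
  obtain q where q: "lead_coeff q = 1" "poly q 0 \<noteq> 0" "coprime q (reciprocal_poly q)"
    and mp: "min_poly N = q * reciprocal_poly q" using assms(3) mem unfolding strictly_hyperbolic_class_def by blast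
  have c0: "coeff q 0 \<noteq> 0" using q(2) by (simp add: poly_0_coeff_0)
  note r = reciprocal_poly_props[OF q(1) c0]
  have nz: "q \<noteq> 0" "reciprocal_poly q \<noteq> 0" using q(1) r(2) by auto
  have cp: "char_poly N = q * reciprocal_poly q" using assms(2) mem mp unfolding cyclic_class_def cyclic_mat_def by simp
  then have "degree (q * reciprocal_poly q) = 2 * n" using degree_monic_char_poly[OF Nc] by simp
  then have deg: "degree q = n" using r(1) nz by (simp add: degree_mult_eq)
  have deg2: "degree (q * reciprocal_poly q) = 2 * n" using deg r(1) nz by (simp add: degree_mult_eq)
  have min: "is_min_poly N (q * reciprocal_poly q)" using is_min_poly_min_poly[of N] mp by simp
  have "cyclic_for (q * reciprocal_poly q) N"
    unfolding cyclic_for_def deg2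
  proof (intro conjI allI impI)
    show "N \<in> carrier_mat (2 * n) (2 * n)" by (rule Nc)
    show "poly_mat (q * reciprocal_poly q) N = 0\<^sub>m (2 * n) (2 * n)"
      using min Nc unfolding is_min_poly_def by simp
    fix s assume s: "poly_mat s N = 0\<^sub>m (2 * n) (2 * n)" "degree s < 2 * n"
    then show "s = 0" using min Nc unfolding is_min_poly_def deg2 by force
  qed
  then have h: "hyperbolic_for n q N"
    unfolding hyperbolic_for_def using N(1) q(1) deg c0 coprime_comaximal[OF q(3) nz(2)] by blast
  have "\<exists>a. poly q a = 0" if tri: "triangularizable_class \<Omega>"
  proof -
    obtain T where T: "upper_triangular T \<or> upper_triangular (transpose_mat T)" "similar_mat N T"
      using tri mem unfolding triangularizable_class_def by blast
    show ?thesis by (rule root_if_triangularizable[OF h T cp n0])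
  qed
  then show ?thesis by (rule that[OF N(2) h])
qed

lemma quadratic_form:
  assumes "lead_coeff q = 1" "degree q = 2"
  shows "q = [:coeff q 0, coeff q 1, 1:]"
  by (rule poly_eqI) (use assms in \<open>auto simp: coeff_pCons coeff_eq_0 numeral_2_eq_2 split: nat.splits\<close>)

lemma quadratic_splits_if_root:
  fixes q :: "'a::field poly"
  assumes q: "lead_coeff q = 1" "degree q = 2" and a: "poly q a = 0"
  obtains b where "q = [:a * b, - (a + b), 1:]"
proof -
  define b where "b = - coeff q 1 - a"
  have "poly [:coeff q 0, coeff q 1, 1:] a = 0" using a quadratic_form[OF q(1,2)] by simp
  then have "coeff q 0 + a * (coeff q 1 + a) = 0" by simp
  then have "coeff q 0 = - (a * (coeff q 1 + a))" by (rule iffD2[OF eq_neg_iff_add_eq_0])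
  also have "\<dots> = a * b" by (simp add: b_def algebra_simps)
  finally have ab: "coeff q 0 = a * b" .
  have "coeff q 1 = - (a + b)" by (simp add: b_def)
  then show ?thesis using that[of b] ab quadratic_form[OF q(1,2)] by simp
qed

text \<open>As c^(-1) = c, the reciprocal of x^2 + b x + c is x^2 + b c x + c. Since the two are
  comaximal, b \<noteq> 0 and c \<noteq> 1, so c = -1 and 2 \<noteq> 0. Then 4 = 1, and the
  characteristic is 3.\<close>

lemma small_field_quadratic:
  fixes q :: "'a::field poly"
  assumes small: "\<And>x :: 'a. x = 0 \<or> x * x = 1" and h: "hyperbolic_for 2 q N"
  obtains \<tau> where "q = [:- 1, - \<tau>, 1:]" "reciprocal_poly q = [:- 1, \<tau>, 1:]" "\<tau> * \<tau> = 1" "(3 :: 'a) = 0"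
proof -
  note H = hyperbolic_forD[OF h]
  define c b where "c = coeff q 0" and "b = coeff q 1"
  have q: "q = [:c, b, 1:]" using quadratic_form[OF H(2,3)] by (simp add: c_def b_def)
  have c: "c * c = 1" using small[of c] H(4) by (simp add: c_def)
  have "reciprocal_poly q = [:c, b * c, 1:]"
  proof -
    note r = reciprocal_poly_props[OF H(2,4)]
    have ic: "inverse c = c" using c by (metis inverse_unique)
    have "coeff (reciprocal_poly q) 1 = inverse c * coeff (reflect_poly q) 1"
      unfolding reciprocal_poly_def by (simp add: poly_0_coeff_0 c_def)
    also have "coeff (reflect_poly q) 1 = b" using H(3) by (simp add: coeff_reflect_poly b_def)
    finally show ?thesis using quadratic_form[of "reciprocal_poly q"] r H(3) ic by (simp add: c_def mult.commute)
  qed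
  moreover have "q \<noteq> reciprocal_poly q"
  proof
    assume "q = reciprocal_poly q"
    then have "comaximal q q" using H(5) by simp
    then have "q dvd 1" unfolding comaximal_def by (metis dvd_add dvd_triv_right)
    then show False using H(3) by (auto simp: poly_dvd_1)
  qed
  ultimately have r: "reciprocal_poly q = [:c, b * c, 1:]" and bc: "b \<noteq> b * c" unfolding q by auto
  have "c \<noteq> 1" "b \<noteq> 0" using bc by auto
  have "(c - 1) * (c + 1) = 0" using c by (simp add: algebra_simps)
  then have c1: "c = - 1" using \<open>c \<noteq> 1\<close> by (simp add: eq_neg_iff_add_eq_0)
  have "(2 :: 'a) \<noteq> 0" using \<open>c \<noteq> 1\<close> unfolding c1 by (metis add_eq_0_iff one_add_one)
  then have "(2 :: 'a) * 2 = 1" using small[of 2] by blast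
  then have three: "(3 :: 'a) = 0"
  proof -
    have "(3 :: 'a) + 1 = 2 * 2" by simp
    then have "(3 :: 'a) + 1 = 1" unfolding \<open>(2 :: 'a) * 2 = 1\<close> .
    then show ?thesis by (metis add_cancel_left_left)
  qed
  show ?thesis
    by (rule that[of "- b"]) (use q r c1 small[of b] \<open>b \<noteq> 0\<close> three in auto)
qed

lemma class_product_if_singular_corner:
  fixes M :: "'a::field mat"
  assumes "n > 0" and N1: "hyperbolic_for n p N1" and N2: "hyperbolic_for n q N2"
    and "has_corner n M A C" "C \<noteq> 0\<^sub>m n n" "det C = 0"
  shows "M \<in> class_product (Sp_conj_class n N1) (Sp_conj_class n N2)"
  using class_product_if_factorization[OF assms(1-3)] factorization_if_singular_corner[OF assms(4-6)]
    hyperbolic_forD(2-4)[OF N1] hyperbolic_forD(2-4)[OF N2] by blast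

lemma class_product_if_nonalternating:
  fixes M :: "'a::field mat"
  assumes M: "M \<in> Sp n" and n: "2 \<le> n" and v: "v \<in> carrier_vec (2 * n)" "omega n v (M *\<^sub>v v) \<noteq> 0"
    and N1: "hyperbolic_for n p N1" and N2: "hyperbolic_for n q N2"
  shows "M \<in> class_product (Sp_conj_class n N1) (Sp_conj_class n N2)"
proof -
  have n0: "n > 0" using n by simp
  note h1 = hyperbolic_forD[OF N1] and h2 = hyperbolic_forD[OF N2]
  define \<delta> where "\<delta> = coeff p 0 * coeff q 0"
  consider A C where "has_corner n M A C" "C \<noteq> 0\<^sub>m n n" "det C = 0"
    | C where "has_corner n M (0\<^sub>m n n) C" "upper_triangular C" "\<And>i. i < n \<Longrightarrow> C $$ (i, i) \<noteq> 0"
        "3 \<le> n \<longrightarrow> (\<exists>x :: 'a. x \<noteq> 0 \<and> x * x \<noteq> 1)"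
    using nonalternating_corner[OF M n v] by blast
  then show ?thesis
  proof cases
    case 1
    then show ?thesis by (rule class_product_if_singular_corner[OF n0 N1 N2])
  next
    case 2
    show ?thesis
    proof (cases "\<exists>x. x \<noteq> 0 \<and> x \<noteq> \<delta> \<and> x * x \<noteq> \<delta>")
      case True
      then obtain x where x: "x \<noteq> 0" "x \<noteq> coeff p 0 * coeff q 0" "x * x \<noteq> coeff p 0 * coeff q 0"
        unfolding \<delta>_def by blast
      show ?thesis
        by (rule class_product_if_factorization[OF n0 N1 N2])
          (rule factorization_if_triangular_corner[OF 2(1,2) _ n h1(2-4) h2(2-4) x], rule 2(3))
    next
      case False
      \<comment> \<open>Testing \<open>x = 1\<close> gives \<open>\<delta> = 1\<close>. Every
        nonzero \<open>x\<close> then has square 1, which \<open>2(4)\<close> excludes for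
        \<open>n \<ge> 3\<close>.\<close>
      then have "\<delta> = 1" by (metis mult_1 zero_neq_one)
      then have small: "x = 0 \<or> x * x = 1" for x :: 'a using False by (metis mult_1)
      then have "n = 2" using 2(4) n by fastforce
      note N1 = N1[unfolded \<open>n = 2\<close>] and N2 = N2[unfolded \<open>n = 2\<close>] and 2 = 2[unfolded \<open>n = 2\<close>]
      obtain \<tau> where \<tau>: "p = [:- 1, - \<tau>, 1:]" "\<tau> * \<tau> = 1" and three: "(3 :: 'a) = 0"
        using small_field_quadratic[OF small N1] by blast
      obtain \<sigma> where \<sigma>: "q = [:- 1, - \<sigma>, 1:]" "reciprocal_poly q = [:- 1, \<sigma>, 1:]" "\<sigma> * \<sigma> = 1"
        using small_field_quadratic[OF small N2] by blast
      have Cc: "C \<in> carrier_mat 2 2" using 2(1) by (simp add: has_corner_def)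
      have "C $$ (1, 0) = 0" using upper_triangularD[OF 2(2), of 0 1] Cc by simp
      then have C: "C = mat2 (C $$ (0, 0)) (C $$ (0, 1)) 0 (C $$ (1, 1))"
        by (intro mat_eq_2I[OF Cc]) simp_all
      have corner: "has_corner 2 M (0\<^sub>m 2 2) (mat2 (C $$ (0, 0)) (C $$ (0, 1)) 0 (C $$ (1, 1)))" using 2(1) C by simp
      have "\<tau> \<noteq> 0" using \<tau> by auto
      have d: "C $$ (0, 0) \<noteq> 0" "C $$ (1, 1) \<noteq> 0" using 2(3)[of 0] 2(3)[of 1] by auto
      have "\<exists>A' C' X Y \<tau>'. has_corner 2 M A' C' \<and> cyclic_for p X \<and>
          cyclic_for [:- 1, - \<tau>', 1:] Y \<and> A' = X * Y \<and> \<tau>' * \<tau>' = 1"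
        unfolding \<tau>(1) by (rule triangular_corner_factorization_if_char_3[OF corner d three small \<open>\<tau> \<noteq> 0\<close>])
      then obtain A' C' X Y \<tau>' where c: "has_corner 2 M A' C'" "cyclic_for p X"
        "cyclic_for [:- 1, - \<tau>', 1:] Y" "A' = X * Y" "\<tau>' * \<tau>' = 1"
        by (elim exE conjE) (rule that)
      \<comment> \<open>Elements of square 1 agree up to sign, and a change of sign means passing
        from \<open>q\<close> to its reciprocal.\<close>
      have "(\<tau>' - \<sigma>) * (\<tau>' + \<sigma>) = 0" using c(5) \<sigma>(3) by (simp add: algebra_simps)
      then have "\<tau>' = \<sigma> \<or> \<tau>' = - \<sigma>" by (auto simp: eq_neg_iff_add_eq_0)
      then show ?thesis
      proof
        assume "\<tau>' = \<sigma>"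
        then show ?thesis unfolding \<open>n = 2\<close> using c \<sigma>(1) by (intro class_product_if_factorization[OF _ N1 N2]) auto
      next
        assume "\<tau>' = - \<sigma>"
        then show ?thesis unfolding \<open>n = 2\<close> using c \<sigma>(2)
          by (intro class_product_if_factorization[OF _ N1 hyperbolic_for_reciprocal[OF N2]]) auto
      qed
    qed
  qed
qed

text \<open>The last hypothesis lists the two situations in which factors with a product of trace 0
  are written down explicitly.\<close>

lemma class_product_if_alternating_2:
  fixes M :: "'a::field mat"
  assumes M: "M \<in> Sp 2" and alt: "\<And>x. x \<in> carrier_vec 4 \<Longrightarrow> omega 2 x (M *\<^sub>v x) = 0" and ns: "\<not> scalar_mat 4 M"
    and N1: "hyperbolic_for 2 p N1" and N2: "hyperbolic_for 2 q N2"
    and "(\<forall>x :: 'a. x = 0 \<or> x * x = 1) \<or> (\<exists>a b. poly p a = 0 \<and> poly q b = 0)"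
  shows "M \<in> class_product (Sp_conj_class 2 N1) (Sp_conj_class 2 N2)"
proof -
  have corner: "has_corner 2 M (0\<^sub>m 2 2) (mat2 0 (- 1) 1 0)" by (rule alternating_corner_2[OF M _ ns]) (rule alt)
  note h1 = hyperbolic_forD[OF N1] and h2 = hyperbolic_forD[OF N2]
  from assms(6) show ?thesis
  proof
    assume "\<forall>x :: 'a. x = 0 \<or> x * x = 1"
    then have small: "x = 0 \<or> x * x = 1" for x :: 'a by blast
    obtain \<tau> where \<tau>: "p = [:- 1, - \<tau>, 1:]" "\<tau> * \<tau> = 1" and three: "(3 :: 'a) = 0"
      using small_field_quadratic[OF small N1] by blast
    obtain \<sigma> where \<sigma>: "q = [:- 1, - \<sigma>, 1:]" "reciprocal_poly q = [:- 1, \<sigma>, 1:]" "\<sigma> * \<sigma> = 1"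
      using small_field_quadratic[OF small N2] by blast
    have ex: "\<exists>A C X Y. has_corner 2 M A C \<and> cyclic_for p X \<and> cyclic_for p Y \<and> A = X * Y"
      using alternating_corner_factorization_if_char_3[OF corner one_neq_zero three \<tau>(2)] unfolding \<tau>(1) by blast
    have "(\<tau> - \<sigma>) * (\<tau> + \<sigma>) = 0" using \<tau>(2) \<sigma>(3) by (simp add: algebra_simps)
    then have "\<tau> = \<sigma> \<or> \<tau> = - \<sigma>" by (auto simp: eq_neg_iff_add_eq_0)
    then show ?thesis
    proof
      assume "\<tau> = \<sigma>"
      then have "q = p" using \<tau>(1) \<sigma>(1) by simp
      then show ?thesis using ex by (intro class_product_if_factorization[OF _ N1 N2]) auto
    next
      assume "\<tau> = - \<sigma>"
      then have "reciprocal_poly q = p" unfolding \<tau>(1) \<sigma>(2) by simp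
      then show ?thesis using ex by (intro class_product_if_factorization[OF _ N1 hyperbolic_for_reciprocal[OF N2]]) auto
    qed
  next
    assume "\<exists>a b. poly p a = 0 \<and> poly q b = 0"
    then obtain a1 a2 where a: "poly p a1 = 0" "poly q a2 = 0" by blast
    obtain b1 where b1: "p = [:a1 * b1, - (a1 + b1), 1:]" using quadratic_splits_if_root[OF h1(2,3) a(1)] .
    obtain b2 where b2: "q = [:a2 * b2, - (a2 + b2), 1:]" using quadratic_splits_if_root[OF h2(2,3) a(2)] .
    show ?thesis
      by (rule class_product_if_factorization[OF _ N1 N2])
        (simp, unfold b1 b2, rule alternating_corner_factorization_if_split[OF corner one_neq_zero])
  qed
qed

theorem theorem1p1:
  fixes n :: nat and \<Omega>\<^sub>1 \<Omega>\<^sub>2 :: "'a::field mat set"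
  assumes "2 * n \<ge> 4"
    and "is_Sp_conj_class n \<Omega>\<^sub>1" and "is_Sp_conj_class n \<Omega>\<^sub>2"
    and "cyclic_class \<Omega>\<^sub>1" and "cyclic_class \<Omega>\<^sub>2"
    and "strictly_hyperbolic_class \<Omega>\<^sub>1" and "strictly_hyperbolic_class \<Omega>\<^sub>2"
  shows "(card (UNIV :: 'a set) = 3 \<or> 2 * n \<ge> 6 \<or>
            (triangularizable_class \<Omega>\<^sub>1 \<and> triangularizable_class \<Omega>\<^sub>2) \<longrightarrow>
          {M \<in> Sp n. \<not> scalar_mat (2 * n) M} \<subseteq> class_product \<Omega>\<^sub>1 \<Omega>\<^sub>2) \<and>
         (2 * n = 4 \<longrightarrow>
          {M \<in> Sp n. M ^\<^sub>m 2 \<noteq> 1\<^sub>m 4} \<subseteq> class_product \<Omega>\<^sub>1 \<Omega>\<^sub>2)"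
proof -
  have n: "2 \<le> n" "n > 0" using assms(1) by auto
  obtain N1 p where N1: "\<Omega>\<^sub>1 = Sp_conj_class n N1" "hyperbolic_for n p N1"
    "triangularizable_class \<Omega>\<^sub>1 \<Longrightarrow> \<exists>a. poly p a = 0"
    using hyperbolic_class[OF assms(2,4,6) n(2)] by blast
  obtain N2 q where N2: "\<Omega>\<^sub>2 = Sp_conj_class n N2" "hyperbolic_for n q N2"
    "triangularizable_class \<Omega>\<^sub>2 \<Longrightarrow> \<exists>a. poly q a = 0"
    using hyperbolic_class[OF assms(3,5,7) n(2)] by blast
  have nonalt: "M \<in> class_product \<Omega>\<^sub>1 \<Omega>\<^sub>2"
    if "M \<in> Sp n" "v \<in> carrier_vec (2 * n)" "omega n v (M *\<^sub>v v) \<noteq> 0" for M v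
    unfolding N1(1) N2(1) by (rule class_product_if_nonalternating[OF that(1) n(1) that(2,3) N1(2) N2(2)])
  show ?thesis
  proof (intro conjI impI subsetI; elim CollectE conjE)
    fix M :: "'a mat"
    assume hyp: "card (UNIV :: 'a set) = 3 \<or> 2 * n \<ge> 6 \<or> (triangularizable_class \<Omega>\<^sub>1 \<and> triangularizable_class \<Omega>\<^sub>2)"
      and M: "M \<in> Sp n" and ns: "\<not> scalar_mat (2 * n) M"
    show "M \<in> class_product \<Omega>\<^sub>1 \<Omega>\<^sub>2"
    proof (cases "\<exists>v \<in> carrier_vec (2 * n). omega n v (M *\<^sub>v v) \<noteq> 0")
      case True
      then show ?thesis using nonalt[OF M] by blast
    next
      case False
      then have alt: "omega n x (M *\<^sub>v x) = 0" if "x \<in> carrier_vec (2 * n)" for x using that by blast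
      show ?thesis
      proof (cases "3 \<le> n")
        case True
        obtain A C where "has_corner n M A C" "C \<noteq> 0\<^sub>m n n" "det C = 0"
          using alternating_corner[OF M True _ ns] alt by blast
        then show ?thesis unfolding N1(1) N2(1) by (rule class_product_if_singular_corner[OF n(2) N1(2) N2(2)])
      next
        case False
        then have n2: "n = 2" using n by simp
        have cases: "(\<forall>x :: 'a. x = 0 \<or> x * x = 1) \<or> (\<exists>a b. poly p a = 0 \<and> poly q b = 0)"
        proof (cases "card (UNIV :: 'a set) = 3")
          case True
          have "x * x = 1" if "x \<noteq> 0" for x :: 'a
          proof (cases "x = 1")
            case False
            have fin: "finite (UNIV :: 'a set)" using True by (metis card.infinite zero_neq_numeral)
            \<comment> \<open>The field is \<open>{0, 1, x}\<close>, and \<open>x * x\<close> is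
              neither 0 nor \<open>x\<close>, hence 1.\<close>
            have "card {0, 1, x} = 3" using that False by simp
            then have "{0, 1, x} = UNIV" using True fin by (intro card_subset_eq) auto
            then have "x * x \<in> {0, 1, x}" by blast
            then show ?thesis using that False by auto
          qed simp
          then show ?thesis by blast
        next
          case False
          then show ?thesis using hyp n2 N1(3) N2(3) by auto
        qed
        show ?thesis unfolding N1(1) N2(1) n2
          by (rule class_product_if_alternating_2[OF _ _ _ N1(2)[unfolded n2] N2(2)[unfolded n2] cases])
            (use M alt ns n2 in auto)
      qed
    qed
  next
    fix M :: "'a mat"
    assume n4: "2 * n = 4" and M: "M \<in> Sp n" and sq: "M ^\<^sub>m 2 \<noteq> 1\<^sub>m 4"
    have Mc: "M \<in> carrier_mat (2 * n) (2 * n)" by (rule Sp_carrier[OF M])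
    \<comment> \<open>If the form were alternating, \<open>M\<close> would be an involution,
      contrary to \<open>sq\<close>.\<close>
    have "\<exists>v \<in> carrier_vec (2 * n). omega n v (M *\<^sub>v v) \<noteq> 0"
    proof (rule ccontr)
      assume "\<not> ?thesis"
      then have inv: "M *\<^sub>v (M *\<^sub>v x) = x" if "x \<in> carrier_vec (2 * n)" for x
        by (intro alternating_involution(2)[OF M _ that]) blast
      have MM: "M * M \<in> carrier_mat (2 * n) (2 * n)" using Mc by simp
      have "col (M * M) j = unit_vec (2 * n) j" if "j < 2 * n" for j
        using mat_mult_unit_vec[OF MM that] assoc_mult_mat_vec[OF Mc Mc unit_vec_carrier, of j] inv[OF unit_vec_carrier] by simp
      then have "(M * M) $$ (i, j) = 1\<^sub>m (2 * n) $$ (i, j)" if "i < 2 * n" "j < 2 * n" for i j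
        using that Mc index_col[of i "M * M" j] by (auto simp del: index_mult_mat(1) simp: unit_vec_def)
      then have "M * M = 1\<^sub>m (2 * n)" using Mc by (intro eq_matI) (auto simp del: index_mult_mat(1))
      then show False using sq n4 Mc by (simp add: numeral_2_eq_2)
    qed
    then show "M \<in> class_product \<Omega>\<^sub>1 \<Omega>\<^sub>2" using nonalt[OF M] by blast
  qed
qed

end
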